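(* Assume that $\nu_0$ is non-lattice a.s. If $\mathbb{E}|\mu_0|^\varepsilon<\infty$ for some $\varepsilon>0$, $\mathbb{E}\sigma_0^2\in(0,\infty)$, and $$\mathbb{E}\frac{N}{m_0}(\log^+N)^\beta<\infty$$ for some $\beta>\frac32$, then for all $h>0$, $$\sup_{x\in\mathbb{R}}\left|b_n\frac{Z_n(x,x+h)}{Z_n(\mathbb{R})}-h\,p\!\left(\frac{x-a_n}{b_n}\right)\right|\to0\quad\text{a.s. on }\{Z_n(\mathbb{R})\to\infty\},$$ where $a_n=\sum_{i=0}^{n-1}\mu_i$, $b_n=\left(\sum_{i=0}^{n-1}\sigma_i^2\right)^{1/2}$, and $p(x)=\frac1{\sqrt{2\pi}}e^{-x^2/2}$ is the standard normal density.
   Context: Branching random walk in a random environment in time. Let $\xi=(\xi_n)_{n\ge 0}$ be a stationary and ergodic sequence of random variables with values in a measurable space $\Theta$; each realization of $\xi_n$ determines a probability distribution $\eta_n=\eta(\xi_n)$ on $\mathbb{N}\times\mathbb{R}\times\mathbb{R}\times\cdots$. Given $\xi$ (quenched law $\mathbb{P}_\xi$, expectation $\mathbb{E}_\xi$), let $X(u)=(N(u),L_1(u),L_2(u),\dots)$, indexed by finite sequences $u\in\{\emptyset\}\cup\bigcup_{n\ge1}\mathbb{N}^n$, be independent random vectors, $X(u)$ having law $\eta_n$ when the length $|u|$ equals $n$ (values $L_i(u)$ with $i>N(u)$ play no role). The initial particle $\emptyset$ is at $S_\emptyset=0$; each particle $u$ of generation $n$, located at $S_u$, is replaced by $N(u)$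 particles $ui$ of generation $n+1$ located at $S_{ui}=S_u+L_i(u)$, $1\le i\le N(u)$. Let $\mathbb{T}_n$ be the set of particles of generation $n$ and $Z_n=\sum_{u\in\mathbb{T}_n}\delta_{S_u}$ their counting measure; $Z_n(x,x+h)$ is the number of particles of generation $n$ in the interval $(x,x+h)$. The annealed law $\mathbb{P}$ (expectation $\mathbb{E}$) is $\mathbb{P}_\xi$ integrated against the law of $\xi$; "a.s." refers to $\mathbb{P}$. Write $N=N(\emptyset)$ and $m_n=\mathbb{E}_\xi N(u)$ for $|u|=n$. Standing assumption: $\mathbb{E}\log m_0\in(0,\infty)$ and $\mathbb{E}\frac{N}{m_0}\log^+N<\infty$. Notation: for $|u|=n$, $\nu_n(A)=\frac1{m_n}\mathbb{E}_\xi\sum_{i=1}^{N(u)}\mathbf{1}_{\{L_i(u)\in A\}}$ (a probability measure on $\mathbb{R}$ depending on $\xi_n$), $\mu_n=\int x\,\nu_n(dx)$ and $\sigma_n^2=\int(x-\mu_n)^2\nu_n(dx)$. A probability measure on $\mathbb{R}$ is non-lattice if it is not concentrated on any set $c+d\mathbb{Z}$, $c,d\in\mathbb{R}$. *)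

theory Defs
  imports "HOL-Probability.Probability"
begin

section \<open>Stationary and ergodic sequences\<close>

abbreviation seq_space :: "'e measure \<Rightarrow> (nat \<Rightarrow> 'e) measure" where
  "seq_space \<Theta> \<equiv> Pi\<^sub>M UNIV (\<lambda>_. \<Theta>)"

definition stationary_sequence :: "'w measure \<Rightarrow> 'e measure \<Rightarrow> (nat \<Rightarrow> 'w \<Rightarrow> 'e) \<Rightarrow> bool" where
  "stationary_sequence M \<Theta> \<xi> \<longleftrightarrow>
     distr M (seq_space \<Theta>) (\<lambda>\<omega> n. \<xi> (Suc n) \<omega>) = distr M (seq_space \<Theta>) (\<lambda>\<omega> n. \<xi> n \<omega>)"

definition ergodic_sequence :: "'w measure \<Rightarrow> 'e measure \<Rightarrow> (nat \<Rightarrow> 'w \<Rightarrow> 'e) \<Rightarrow> bool" where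
  "ergodic_sequence M \<Theta> \<xi> \<longleftrightarrow>
     (\<forall>A\<in>sets (seq_space \<Theta>).
        (\<lambda>e n. e (Suc n)) -` A \<inter> space (seq_space \<Theta>) = A \<longrightarrow>
        measure M {\<omega>\<in>space M. (\<lambda>n. \<xi> n \<omega>) \<in> A} \<in> {0, 1})"


section \<open>Offspring vectors and their law given the environment\<close>

text \<open>
  A vector \<open>(N, L\<^sub>1, L\<^sub>2, \<dots>)\<close> is encoded as a pair \<open>(N, L)\<close>. Children are numbered
  from 0, so \<open>L i\<close> is the displacement of the child number \<open>i + 1\<close> of the usual notation and the
  children of \<open>u\<close> are the lists \<open>u @ [i]\<close> with \<open>i < N\<close>.
\<close>

type_synonym offspring = "nat \<times> (nat \<Rightarrow> real)"

abbreviation offspring_space :: "offspring measure" where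
  "offspring_space \<equiv> count_space UNIV \<Otimes>\<^sub>M Pi\<^sub>M UNIV (\<lambda>_. borel)"

abbreviation marked_tree_space :: "(nat list \<Rightarrow> offspring) measure" where
  "marked_tree_space \<equiv> Pi\<^sub>M UNIV (\<lambda>_. offspring_space)"

definition quenched_law ::
    "('e \<Rightarrow> offspring measure) \<Rightarrow> (nat \<Rightarrow> 'e) \<Rightarrow> (nat list \<Rightarrow> offspring) measure" where
  "quenched_law \<eta> e = Pi\<^sub>M UNIV (\<lambda>u. \<eta> (e (length u)))"

lemma distr_quenched_law:
  assumes "\<eta> \<in> \<Theta> \<rightarrow>\<^sub>M prob_algebra offspring_space" "\<And>n. e n \<in> space \<Theta>"
  shows "distr (quenched_law \<eta> e) offspring_space (\<lambda>x. x u) = \<eta> (e (length u))"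
proof -
  have *: "\<eta> (e n) \<in> space (prob_algebra offspring_space)" for n
    using assms by (meson measurable_space)
  then have p: "prob_space (\<eta> (e n))" and s: "sets (\<eta> (e n)) = sets offspring_space" for n
    by (auto simp: space_prob_algebra)
  interpret product_prob_space "\<lambda>u::nat list. \<eta> (e (length u))" UNIV
    by (intro product_prob_spaceI p)
  have "distr (quenched_law \<eta> e) offspring_space (\<lambda>x. x u)
      = distr (quenched_law \<eta> e) (\<eta> (e (length u))) (\<lambda>x. x u)"
    by (rule distr_cong) (simp_all add: s)
  also have "\<dots> = \<eta> (e (length u))"
    unfolding quenched_law_def by (rule PiM_component) simp
  finally show ?thesis .
qed

text \<open>
  Only the measurable space underlying \<open>\<Theta>\<close> is used, not its measure.
  The annealed law is the quenched law integrated against the law of \<open>\<xi>\<close>: \<open>annealed\<close> states that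
  \<open>quenched_law \<eta> \<xi>\<close> is the conditional law of \<open>X\<close> given \<open>\<xi>\<close>, i.e. given \<open>\<xi>\<close> the \<open>X u\<close> are
  independent and \<open>X u\<close> has law \<open>\<eta> (\<xi> (length u))\<close>.
\<close>

locale branching_random_walk_random_environment = prob_space M
  for M :: "'w measure" +
  fixes \<Theta> :: "'e measure" and \<eta> :: "'e \<Rightarrow> offspring measure"
    and \<xi> :: "nat \<Rightarrow> 'w \<Rightarrow> 'e" and X :: "nat list \<Rightarrow> 'w \<Rightarrow> offspring"
  assumes kernel: "\<eta> \<in> \<Theta> \<rightarrow>\<^sub>M prob_algebra offspring_space"
    and random_variable_environment: "\<And>n. \<xi> n \<in> M \<rightarrow>\<^sub>M \<Theta>"
    and random_variable_offspring: "\<And>u. X u \<in> M \<rightarrow>\<^sub>M offspring_space"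
    and stationary: "stationary_sequence M \<Theta> \<xi>"
    and ergodic: "ergodic_sequence M \<Theta> \<xi>"
    and annealed: "\<And>A B. A \<in> sets (seq_space \<Theta>) \<Longrightarrow> B \<in> sets marked_tree_space \<Longrightarrow>
      emeasure M {\<omega>\<in>space M. (\<lambda>n. \<xi> n \<omega>) \<in> A \<and> (\<lambda>u. X u \<omega>) \<in> B} =
      (\<integral>\<^sup>+\<omega>. indicator A (\<lambda>n. \<xi> n \<omega>) * emeasure (quenched_law \<eta> (\<lambda>n. \<xi> n \<omega>)) B \<partial>M)"


section \<open>The branching random walk built from a realization of the offspring vectors\<close>

primrec particles :: "(nat list \<Rightarrow> offspring) \<Rightarrow> nat \<Rightarrow> nat list set" where
  "particles x 0 = {[]}"
| "particles x (Suc n) = {u @ [i] | u i. u \<in> particles x n \<and> i < fst (x u)}"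

definition position :: "(nat list \<Rightarrow> offspring) \<Rightarrow> nat list \<Rightarrow> real" where
  "position x u = (\<Sum>k<length u. snd (x (take k u)) (u ! k))"

lemma position_root: "position x [] = 0"
  by (simp add: position_def)

lemma position_child: "position x (u @ [i]) = position x u + snd (x u) i"
  by (simp add: position_def nth_append)

definition num_particles :: "(nat list \<Rightarrow> offspring) \<Rightarrow> nat \<Rightarrow> real set \<Rightarrow> nat" where
  "num_particles x n A = card {u\<in>particles x n. position x u \<in> A}"

lemma finite_particles: "finite (particles x n)"
proof (induction n)
  case (Suc n)
  have "particles x (Suc n) = (\<Union>u\<in>particles x n. (\<lambda>i. u @ [i]) ` {..<fst (x u)})"
    by auto
  with Suc show ?case by simp
qed simp


section \<open>Quantities attached to an offspring law\<close>

text \<open>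
  Since \<open>X u\<close> has quenched law \<open>\<eta> (\<xi> n)\<close> for \<open>length u = n\<close>, quenched expectations of functions of
  \<open>X u\<close> are integrals with respect to \<open>P = \<eta> (\<xi> n)\<close>. The mean \<open>m\<close> and the variance \<open>\<sigma>\<^sup>2\<close> are
  \<open>ennreal\<close>-valued, so that infinite values are not confused with 0.
\<close>

definition mean_offspring :: "offspring measure \<Rightarrow> ennreal" where
  "mean_offspring P = (\<integral>\<^sup>+y. of_nat (fst y) \<partial>P)"

definition displacement_law :: "offspring measure \<Rightarrow> real measure" where
  "displacement_law P = measure_of UNIV (sets borel)
     (\<lambda>A. (\<integral>\<^sup>+y. (\<Sum>i<fst y. indicator A (snd y i)) \<partial>P) / mean_offspring P)"

lemma sets_displacement_law: "sets (displacement_law P) = sets borel"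
  using sets.sigma_sets_eq[of "borel :: real measure"] by (simp add: displacement_law_def)

lemma emeasure_displacement_law:
  assumes P: "sets P = sets offspring_space" and A: "A \<in> sets borel"
  shows "emeasure (displacement_law P) A =
    (\<integral>\<^sup>+y. (\<Sum>i<fst y. indicator A (snd y i)) \<partial>P) / mean_offspring P"
  unfolding displacement_law_def
proof (rule emeasure_measure_of_sigma)
  show "sigma_algebra UNIV (sets (borel :: real measure))"
    using sets.sigma_algebra_axioms[of "borel :: real measure"] by simp
  let ?g = "\<lambda>A y. \<Sum>i<fst y. indicator A (snd y i) :: ennreal"
  have meas: "?g A \<in> borel_measurable P" if A: "A \<in> sets borel" for A
  proof -
    have *: "(\<lambda>y. \<Sum>i<n. indicator A (snd y i) :: ennreal) \<in> borel_measurable offspring_space" for n :: nat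
      using A by measurable
    have "?g A \<in> borel_measurable offspring_space"
      by (rule measurable_compose_countable[OF *]) simp
    then show ?thesis
      using P by (simp cong: measurable_cong_sets)
  qed
  show "positive (sets borel) (\<lambda>A. (\<integral>\<^sup>+y. ?g A y \<partial>P) / mean_offspring P)"
    by (simp add: positive_def)
  show "countably_additive (sets borel) (\<lambda>A. (\<integral>\<^sup>+y. ?g A y \<partial>P) / mean_offspring P)"
  proof (rule countably_additiveI)
    fix F :: "nat \<Rightarrow> real set"
    assume F: "range F \<subseteq> sets borel" "disjoint_family F"
    have "(\<Sum>k. ?g (F k) y) = ?g (\<Union>k. F k) y" for y :: offspring
      by (subst suminf_sum) (simp_all add: suminf_indicator[OF F(2)])
    then have "(\<Sum>k. \<integral>\<^sup>+y. ?g (F k) y \<partial>P) = (\<integral>\<^sup>+y. ?g (\<Union>k. F k) y \<partial>P)"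
      using F(1) by (subst nn_integral_suminf[symmetric]) (auto intro!: meas)
    then show "(\<Sum>k. (\<integral>\<^sup>+y. ?g (F k) y \<partial>P) / mean_offspring P) =
        (\<integral>\<^sup>+y. ?g (\<Union>k. F k) y \<partial>P) / mean_offspring P"
      by (simp add: divide_ennreal_def)
  qed
qed (rule A)

lemma prob_space_displacement_law:
  assumes P: "sets P = sets offspring_space" and m: "mean_offspring P \<noteq> 0" "mean_offspring P \<noteq> \<infinity>"
  shows "prob_space (displacement_law P)"
proof
  have "space (displacement_law P) = UNIV"
    by (simp add: displacement_law_def)
  then show "emeasure (displacement_law P) (space (displacement_law P)) = 1"
    using m by (simp add: emeasure_displacement_law[OF P] ennreal_divide_self less_top
        flip: mean_offspring_def)
qed

text \<open>
  If \<open>displacement_variance P\<close> is finite (and the displacement law is a probability measure), then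
  the displacement law has a finite first moment, so the Bochner integral is the true mean.
\<close>

definition displacement_mean :: "offspring measure \<Rightarrow> real" where
  "displacement_mean P = (\<integral>x. x \<partial>displacement_law P)"

definition displacement_variance :: "offspring measure \<Rightarrow> ennreal" where
  "displacement_variance P =
     (\<integral>\<^sup>+x. ennreal ((x - displacement_mean P)\<^sup>2) \<partial>displacement_law P)"

definition non_lattice :: "real measure \<Rightarrow> bool" where
  "non_lattice \<nu> \<longleftrightarrow> \<not> (\<exists>c d. AE x in \<nu>. x \<in> range (\<lambda>k::int. c + d * of_int k))"

definition log_plus :: "real \<Rightarrow> real" where
  "log_plus x = (if x \<le> 1 then 0 else ln x)"

definition centering :: "('e \<Rightarrow> offspring measure) \<Rightarrow> (nat \<Rightarrow> 'e) \<Rightarrow> nat \<Rightarrow> real" where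
  "centering \<eta> e n = (\<Sum>i<n. displacement_mean (\<eta> (e i)))"

definition scaling :: "('e \<Rightarrow> offspring measure) \<Rightarrow> (nat \<Rightarrow> 'e) \<Rightarrow> nat \<Rightarrow> real" where
  "scaling \<eta> e n = sqrt (\<Sum>i<n. enn2real (displacement_variance (\<eta> (e i))))"

end

theory Submission
  imports Defs
begin

text \<open>
  Fix the environment. Divided by the quenched mean population, the empirical characteristic function
  \<open>Zt\<^sub>n(t)\<close> of the positions satisfies \<open>Zt\<^sub>j\<^sub>+\<^sub>1(t) = \<phi>\<^sub>j(t) Zt\<^sub>j(t) + martingale difference\<close>, where \<open>\<phi>\<^sub>j\<close> is the
  characteristic function of \<open>\<nu>\<^sub>j\<close>. After truncation of the offspring numbers at \<open>exp (d j)\<close> the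
  difference splits into a part with exponentially small second moment and a remainder \<open>R\<^sub>j\<close> with
  \<open>\<Sum>j. j powr (\<beta> - 1) * R\<^sub>j < \<infinity>\<close>. Telescoping from a generation \<open>k\<close> that grows like a small power of
  \<open>n\<close>, with the products of the \<open>\<phi>\<^sub>i\<close> bounded by \<open>exp (- c n t\<^sup>2)\<close> (non-lattice assumption and ergodic
  theorem), shows that \<open>b\<^sub>n\<close> times the \<open>L\<^sup>1\<close> distance on \<open>[-K, K]\<close> between the characteristic function of
  \<open>Z\<^sub>n / Z\<^sub>n(\<real>)\<close> and that of the normal law with mean \<open>a\<^sub>n\<close> and variance \<open>b\<^sub>n\<^sup>2\<close> tends to 0;
  \<open>\<beta> > 3/2\<close> makes the sum of the late \<open>R\<^sub>j\<close>, those with \<open>j\<close> of order \<open>n\<close>, negligible against \<open>1 / \<surd>n\<close>. The division by the martingale limit is harmless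
  because that limit is positive on survival. Sandwiching the indicator of an interval between functions with
  compactly supported Fourier transform turns the statement on characteristic functions into the
  local limit theorem.
\<close>

section \<open>Birkhoff sums over an ergodic shift\<close>

text \<open>The martingale differences need not have a second moment. Truncating at
  \<open>exp (d * real j)\<close> while the population grows at least like
  \<open>exp (2 * d * real j)\<close> makes the truncated part exponentially small; the price is the
  remainder \<open>R\<close>, which is controlled only polynomially. Its cost depends on when it
  occurs. If at least a third of the generations up to \<open>n\<close> follow, the product of
  characteristic functions is at most \<open>exp (- c * real n * t\<^sup>2)\<close>, whose integral
  over \<open>t\<close> is of order \<open>1 / sqrt n\<close> and cancels the factor
  \<open>b n\<close>; summability of \<open>R\<close> then suffices. A late remainder meets no such
  damping, hence the weight \<open>j powr (\<beta> - 1)\<close> with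
  \<open>\<beta> - 1 > 1 / 2\<close>. The starting generation is about the eighth root of
  \<open>n\<close>: its spread is small against \<open>sqrt n\<close>, while exponentially small
  terms from there on still beat \<open>sqrt n\<close>. Positivity of the martingale limit comes
  from restarting the truncation at generations from which the environment behaves well. Such
  generations recur by ergodicity, and a large population there concentrates by a second moment
  estimate.\<close>

definition shift_seq :: "(nat \<Rightarrow> 'e) \<Rightarrow> nat \<Rightarrow> 'e" where
  "shift_seq e n = e (Suc n)"

lemma shift_seq_funpow: "(shift_seq ^^ k) e = (\<lambda>n. e (n + k))"
  by (induction k) (auto simp: shift_seq_def)

lemma measurable_shift_seq [measurable]: "shift_seq \<in> seq_space \<Theta> \<rightarrow>\<^sub>M seq_space \<Theta>"
  unfolding shift_seq_def by (rule measurable_PiM_single') (auto simp: space_PiM)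

text \<open>The maximum of the Birkhoff sums of lengths \<open>0\<close> to \<open>n\<close>.
  Splitting off the first term rather than the last exhibits the shift, on which invariance of the
  measure acts.\<close>

primrec max_birkhoff :: "((nat \<Rightarrow> 'e) \<Rightarrow> real) \<Rightarrow> nat \<Rightarrow> (nat \<Rightarrow> 'e) \<Rightarrow> real" where
  "max_birkhoff f 0 e = 0"
| "max_birkhoff f (Suc n) e = max 0 (f e + max_birkhoff f n (shift_seq e))"

lemma max_birkhoff_nonneg: "0 \<le> max_birkhoff f n e"
  by (cases n) auto

lemma max_birkhoff_mono: "max_birkhoff f n e \<le> max_birkhoff f (Suc n) e"
proof (induction n arbitrary: e)
  case (Suc n)
  from Suc[of "shift_seq e"] show ?case by (simp add: max_def)
qed (simp add: max_birkhoff_nonneg)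

lemma sum_le_max_birkhoff: "(\<Sum>k<n. f ((shift_seq ^^ k) e)) \<le> max_birkhoff f n e"
proof (induction n arbitrary: e)
  case (Suc n)
  have "(\<Sum>k<Suc n. f ((shift_seq ^^ k) e)) = f e + (\<Sum>k<n. f ((shift_seq ^^ k) (shift_seq e)))"
    by (subst sum.lessThan_Suc_shift) (simp add: funpow_swap1 del: funpow.simps(2) sum.lessThan_Suc add: funpow_Suc_right)
  also have "\<dots> \<le> max_birkhoff f (Suc n) e"
    using Suc[of "shift_seq e"] by simp
  finally show ?case .
qed simp

locale ergodic_shift = prob_space Q
  for Q :: "(nat \<Rightarrow> 'e) measure" and \<Theta> :: "'e measure" +
  assumes sets_Q [measurable_cong]: "sets Q = sets (seq_space \<Theta>)"
    and invariant: "distr Q (seq_space \<Theta>) shift_seq = Q"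
    and trivial: "\<And>A. A \<in> sets Q \<Longrightarrow> shift_seq -` A \<inter> space Q = A \<Longrightarrow> prob A \<in> {0, 1}"
begin

lemma space_Q: "space Q = space (seq_space \<Theta>)"
  using sets_Q by (rule sets_eq_imp_space_eq)

lemma shift_in_space: "e \<in> space Q \<Longrightarrow> shift_seq e \<in> space Q"
  unfolding space_Q space_PiM by (simp add: shift_seq_def PiE_iff)

lemma integrable_shift:
  fixes g :: "(nat \<Rightarrow> 'e) \<Rightarrow> real"
  assumes g: "integrable Q g"
  shows "integrable Q (\<lambda>e. g (shift_seq e))"
proof -
  have "integrable (distr Q (seq_space \<Theta>) shift_seq) g"
    using g by (simp add: invariant)
  then show ?thesis by (rule integrable_distr[rotated]) measurable
qed

lemma integral_shift:
  fixes g :: "(nat \<Rightarrow> 'e) \<Rightarrow> real"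
  assumes [measurable]: "g \<in> borel_measurable Q"
  shows "(\<integral>e. g (shift_seq e) \<partial>Q) = (\<integral>e. g e \<partial>Q)"
proof -
  have "(\<integral>e. g e \<partial>distr Q (seq_space \<Theta>) shift_seq) = (\<integral>e. g (shift_seq e) \<partial>Q)"
    by (rule integral_distr) measurable
  then show ?thesis by (simp add: invariant)
qed

lemma nn_integral_shift:
  assumes [measurable]: "g \<in> borel_measurable Q"
  shows "(\<integral>\<^sup>+e. g (shift_seq e) \<partial>Q) = (\<integral>\<^sup>+e. g e \<partial>Q)"
proof -
  have "(\<integral>\<^sup>+e. g e \<partial>distr Q (seq_space \<Theta>) shift_seq) = (\<integral>\<^sup>+e. g (shift_seq e) \<partial>Q)"
    by (rule nn_integral_distr) measurable
  then show ?thesis by (simp add: invariant)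
qed

lemma nn_integral_shift_funpow:
  assumes [measurable]: "g \<in> borel_measurable Q"
  shows "(\<integral>\<^sup>+e. g ((shift_seq ^^ k) e) \<partial>Q) = (\<integral>\<^sup>+e. g e \<partial>Q)"
proof (induction k)
  case (Suc k)
  have "(\<integral>\<^sup>+e. g ((shift_seq ^^ Suc k) e) \<partial>Q) = (\<integral>\<^sup>+e. g ((shift_seq ^^ k) (shift_seq e)) \<partial>Q)"
    by (simp add: funpow_swap1)
  also have "\<dots> = (\<integral>\<^sup>+e. g ((shift_seq ^^ k) e) \<partial>Q)"
    by (rule nn_integral_shift[of "\<lambda>e. g ((shift_seq ^^ k) e)"]) measurable
  finally show ?case using Suc by simp
qed simp

lemma integrable_max_birkhoff: "integrable Q f \<Longrightarrow> integrable Q (max_birkhoff f n)"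
proof (induction n)
  case (Suc n)
  then have "integrable Q (\<lambda>e. max 0 (f e + max_birkhoff f n (shift_seq e)))"
    by (intro integrable_max Bochner_Integration.integrable_add
        integrable_shift[of "max_birkhoff f n"]) auto
  then show ?case by (simp cong: Bochner_Integration.integrable_cong)
qed (simp cong: Bochner_Integration.integrable_cong)

text \<open>
  On the invariant set where the maxima \<open>M\<^sub>n\<close> of the Birkhoff sums are unbounded,
  \<open>M\<^sub>n\<^sub>+\<^sub>1 - M\<^sub>n \<circ> T = max (- M\<^sub>n \<circ> T) f\<close> decreases to \<open>f\<close> while its integral stays nonnegative.
\<close>
lemma AE_birkhoff_bounded:
  fixes f :: "(nat \<Rightarrow> 'e) \<Rightarrow> real"
  assumes f: "integrable Q f" and neg: "(\<integral>e. f e \<partial>Q) < 0"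
  shows "AE e in Q. \<exists>C. \<forall>n. (\<Sum>k<n. f ((shift_seq ^^ k) e)) \<le> C"
proof -
  let ?m = "max_birkhoff f"
  have fm [measurable]: "f \<in> borel_measurable Q" using f by auto
  have mm [measurable]: "?m n \<in> borel_measurable Q" for n
    using integrable_max_birkhoff[OF f] by auto
  define A where "A = {e\<in>space Q. \<forall>C::nat. \<exists>n. real C < ?m n e}"
  have A [measurable]: "A \<in> sets Q" unfolding A_def by measurable
  have inv: "shift_seq e \<in> A \<longleftrightarrow> e \<in> A" if "e \<in> space Q" for e
  proof
    assume a: "shift_seq e \<in> A"
    have "\<exists>n. real C < ?m n e" for C :: nat
    proof -
      obtain n where "real (C + nat \<lceil>\<bar>f e\<bar>\<rceil>) < ?m n (shift_seq e)"
        using a unfolding A_def by blast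
      then have "real C < ?m (Suc n) e" by simp linarith
      then show ?thesis by blast
    qed
    with that show "e \<in> A" by (simp add: A_def)
  next
    assume a: "e \<in> A"
    have "\<exists>n. real C < ?m n (shift_seq e)" for C :: nat
    proof -
      obtain n where n: "real (C + nat \<lceil>\<bar>f e\<bar>\<rceil>) < ?m n e"
        using a unfolding A_def by blast
      moreover have "n \<noteq> 0"
      proof
        assume "n = 0"
        with n show False by simp linarith
      qed
      ultimately obtain n' where "n = Suc n'" by (cases n) auto
      with n have "real C < ?m n' (shift_seq e)"
        by (simp add: max_def split: if_splits; linarith)
      then show ?thesis by blast
    qed
    with that show "shift_seq e \<in> A" by (simp add: A_def shift_in_space)
  qed
  have "shift_seq -` A \<inter> space Q = A"
    using inv by (auto simp: A_def)
  then have "prob A \<in> {0, 1}" by (intro trivial A)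
  moreover have "prob A \<noteq> 1"
  proof
    assume "prob A = 1"
    then have aeA: "AE e in Q. e \<in> A" by (rule AE_prob_1)
    have pos: "0 \<le> (\<integral>e. max (- ?m n (shift_seq e)) (f e) \<partial>Q)" for n
    proof -
      have "(\<integral>e. max (- ?m n (shift_seq e)) (f e) \<partial>Q) = (\<integral>e. ?m (Suc n) e - ?m n (shift_seq e) \<partial>Q)"
        by (rule Bochner_Integration.integral_cong) (auto simp: max_def)
      also have "\<dots> = (\<integral>e. ?m (Suc n) e \<partial>Q) - (\<integral>e. ?m n (shift_seq e) \<partial>Q)"
        by (intro Bochner_Integration.integral_diff integrable_shift[of "?m n"]
            integrable_max_birkhoff f)
      also have "(\<integral>e. ?m n (shift_seq e) \<partial>Q) = (\<integral>e. ?m n e \<partial>Q)"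
        by (rule integral_shift) measurable
      finally have "(\<integral>e. max (- ?m n (shift_seq e)) (f e) \<partial>Q) = (\<integral>e. ?m (Suc n) e \<partial>Q) - (\<integral>e. ?m n e \<partial>Q)" .
      moreover have "(\<integral>e. ?m n e \<partial>Q) \<le> (\<integral>e. ?m (Suc n) e \<partial>Q)"
        by (intro integral_mono integrable_max_birkhoff f max_birkhoff_mono)
      ultimately show ?thesis by simp
    qed
    have "(\<lambda>n. \<integral>e. max (- ?m n (shift_seq e)) (f e) \<partial>Q) \<longlonglongrightarrow> (\<integral>e. f e \<partial>Q)"
    proof (rule integral_dominated_convergence[where w = "\<lambda>e. \<bar>f e\<bar>"])
      show "AE e in Q. (\<lambda>n. max (- ?m n (shift_seq e)) (f e)) \<longlonglongrightarrow> f e"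
        using aeA AE_space
      proof eventually_elim
        case (elim e)
        then have "shift_seq e \<in> A" using inv by simp
        then obtain n where n: "real (nat \<lceil>\<bar>f e\<bar>\<rceil>) < ?m n (shift_seq e)"
          unfolding A_def by blast
        have "max (- ?m k (shift_seq e)) (f e) = f e" if "k \<ge> n" for k
        proof -
          have "?m n (shift_seq e) \<le> ?m k (shift_seq e)"
            using that by (rule lift_Suc_mono_le[of "\<lambda>n. ?m n (shift_seq e)", OF max_birkhoff_mono])
          then show ?thesis using n by (simp add: max_def) linarith
        qed
        then show ?case
          by (intro tendsto_eventually) (auto simp: eventually_sequentially)
      qed
      show "AE e in Q. norm (max (- ?m n (shift_seq e)) (f e)) \<le> \<bar>f e\<bar>" for n
      proof (rule AE_I2)
        fix e
        have "norm (max (- a) b) \<le> \<bar>b\<bar>" if "0 \<le> a" for a b :: real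
          using that by (auto simp: max_def abs_if)
        then show "norm (max (- ?m n (shift_seq e)) (f e)) \<le> \<bar>f e\<bar>"
          by (simp add: max_birkhoff_nonneg)
      qed
    qed (use f in \<open>auto\<close>)
    then have "0 \<le> (\<integral>e. f e \<partial>Q)" by (rule LIMSEQ_le_const) (use pos in auto)
    with neg show False by simp
  qed
  ultimately have "prob A = 0" by simp
  then have "AE e in Q. e \<notin> A"
    using A by (subst (asm) prob_eq_0) auto
  with AE_space show ?thesis
  proof eventually_elim
    case (elim e)
    then obtain C :: nat where C: "\<And>n. ?m n e \<le> real C" by (auto simp: A_def not_less)
    show ?case
      by (rule exI[of _ "real C"]) (intro allI order_trans[OF sum_le_max_birkhoff C])
  qed
qed

text \<open>All later arguments use linear bounds with a slope strictly off the mean, valid for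
  every \<open>n\<close> up to a random constant. They follow from
  \<open>AE_birkhoff_bounded\<close> for \<open>f - c\<close>, whose mean is negative; no limit of
  averages is formed.\<close>

lemma AE_birkhoff_le:
  fixes f :: "(nat \<Rightarrow> 'e) \<Rightarrow> real"
  assumes f: "integrable Q f" and c: "(\<integral>e. f e \<partial>Q) < c"
  shows "AE e in Q. \<exists>C. \<forall>n. (\<Sum>k<n. f ((shift_seq ^^ k) e)) \<le> C + c * real n"
proof -
  have "AE e in Q. \<exists>C. \<forall>n. (\<Sum>k<n. f ((shift_seq ^^ k) e) - c) \<le> C"
    using f c by (intro AE_birkhoff_bounded) (auto simp: prob_space)
  then show ?thesis
    by eventually_elim (auto simp: sum_subtractf algebra_simps)
qed

lemma AE_birkhoff_ge:
  fixes f :: "(nat \<Rightarrow> 'e) \<Rightarrow> real"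
  assumes f: "integrable Q f" and c: "c < (\<integral>e. f e \<partial>Q)"
  shows "AE e in Q. \<exists>C. \<forall>n. c * real n - C \<le> (\<Sum>k<n. f ((shift_seq ^^ k) e))"
proof -
  have "AE e in Q. \<exists>C. \<forall>n. (\<Sum>k<n. - f ((shift_seq ^^ k) e)) \<le> C + (- c) * real n"
    using f c by (intro AE_birkhoff_le) auto
  then show ?thesis
  proof eventually_elim
    case (elim e)
    then obtain C where "\<And>n. (\<Sum>k<n. - f ((shift_seq ^^ k) e)) \<le> C + (- c) * real n" by blast
    then show ?case by (intro exI[of _ C] allI) (simp add: sum_negf algebra_simps)
  qed
qed

text \<open>The number of visits to \<open>G\<close> before time \<open>n\<close> grows at least at
  half the rate \<open>prob G\<close>, which finitely many visits cannot sustain. This later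
  supplies infinitely many good generations in almost every environment.\<close>

lemma AE_infinitely_often:
  assumes [measurable]: "G \<in> sets Q" and pos: "0 < prob G"
  shows "AE e in Q. infinite {k. (shift_seq ^^ k) e \<in> G}"
proof -
  have "AE e in Q. \<exists>C. \<forall>n. prob G / 2 * real n - C \<le> (\<Sum>k<n. indicator G ((shift_seq ^^ k) e))"
    using pos by (intro AE_birkhoff_ge) (auto simp: less_top[symmetric])
  then show ?thesis
  proof eventually_elim
    case (elim e)
    then obtain C where C: "\<And>n. prob G / 2 * real n - C \<le> (\<Sum>k<n. indicator G ((shift_seq ^^ k) e) :: real)"
      by blast
    show ?case
    proof
      assume fin: "finite {k. (shift_seq ^^ k) e \<in> G}" (is "finite ?K")
      have "prob G / 2 * real n \<le> card ?K + C" for n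
      proof -
        have "(\<Sum>k<n. indicator G ((shift_seq ^^ k) e) :: real) = (\<Sum>k\<in>{..<n} \<inter> ?K. 1)"
          by (rule sum.mono_neutral_cong_right) (auto simp: indicator_def)
        also have "\<dots> \<le> card ?K" using fin by (auto intro: card_mono)
        finally show ?thesis using C[of n] by linarith
      qed
      moreover obtain n :: nat where "(card ?K + C) / (prob G / 2) < real n"
        using reals_Archimedean2 by blast
      then have "card ?K + C < prob G / 2 * real n"
        using pos by (simp add: field_simps)
      ultimately show False using not_less by blast
    qed
  qed
qed

end


section \<open>Resampling one coordinate of a product measure\<close>

text \<open>Putting an independent copy in place of one coordinate preserves a product measure.
  Independence enters the moment estimates on the tree in this form, which takes the place of
  filtrations and conditional expectations.\<close>

lemma nn_integral_PiM_resample: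
  assumes P: "\<And>i. prob_space (Mi i)" and f [measurable]: "f \<in> borel_measurable (PiM UNIV Mi)"
  shows "(\<integral>\<^sup>+x. f x \<partial>PiM UNIV Mi) = (\<integral>\<^sup>+x. \<integral>\<^sup>+y. f (x(u := y)) \<partial>Mi u \<partial>PiM UNIV Mi)"
proof -
  interpret U: prob_space "Mi u" by (rule P)
  interpret pair_sigma_finite "Mi u" "PiM UNIV Mi"
    by (intro pair_sigma_finite.intro U.sigma_finite_measure_axioms
        prob_space_imp_sigma_finite prob_space_PiM P)
  have [measurable]: "(\<lambda>(y, x). x(u := y)) \<in> Mi u \<Otimes>\<^sub>M PiM UNIV Mi \<rightarrow>\<^sub>M PiM UNIV Mi"
    unfolding split_beta' by (rule measurable_fun_upd[where J = UNIV]) auto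
  have "(\<integral>\<^sup>+x. f x \<partial>PiM UNIV Mi) =
      (\<integral>\<^sup>+x. f x \<partial>distr (Mi u \<Otimes>\<^sub>M PiM UNIV Mi) (PiM UNIV Mi) (\<lambda>(y, x). x(u := y)))"
    using distr_pair_PiM_eq_PiM[of UNIV Mi u] P by simp
  also have "\<dots> = (\<integral>\<^sup>+z. f ((snd z)(u := fst z)) \<partial>(Mi u \<Otimes>\<^sub>M PiM UNIV Mi))"
    by (subst nn_integral_distr) (auto simp: split_beta')
  also have "\<dots> = (\<integral>\<^sup>+x. \<integral>\<^sup>+y. f (x(u := y)) \<partial>Mi u \<partial>PiM UNIV Mi)"
    by (subst nn_integral_snd[symmetric]) (auto simp: split_beta')
  finally show ?thesis .
qed


text \<open>The cross term is twice the real part of \<open>cnj A * c * Y y\<close> and has mean 0;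
  the bound on \<open>Y\<close> serves integrability.\<close>

lemma nn_integral_cmod_add_sq:
  fixes Y :: "'a \<Rightarrow> complex"
  assumes P: "prob_space P" and Y [measurable]: "Y \<in> borel_measurable P"
    and mean: "(\<integral>y. Y y \<partial>P) = 0" and bound: "\<And>y. cmod (Y y) \<le> B"
  shows "(\<integral>\<^sup>+y. ennreal ((cmod (A + c * Y y))\<^sup>2) \<partial>P) =
    ennreal ((cmod A)\<^sup>2) + ennreal ((cmod c)\<^sup>2) * (\<integral>\<^sup>+y. ennreal ((cmod (Y y))\<^sup>2) \<partial>P)"
proof -
  interpret prob_space P by (rule P)
  have iY: "integrable P Y"
    by (rule integrable_const_bound[where B = B]) (auto simp: bound)
  have iY2: "integrable P (\<lambda>y. (cmod (Y y))\<^sup>2)"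
    by (rule integrable_const_bound[where B = "B\<^sup>2"]) (auto simp: bound power_mono)
  have eq: "(cmod (A + c * Y y))\<^sup>2 = (cmod A)\<^sup>2 + 2 * Re (cnj A * c * Y y) + (cmod c)\<^sup>2 * (cmod (Y y))\<^sup>2" for y
    unfolding cmod_power2 by (simp add: power2_eq_square algebra_simps)
  have iR: "integrable P (\<lambda>y. Re (cnj A * c * Y y))"
    using iY by (intro integrable_Re integrable_mult_right)
  have "(\<integral>y. Re (cnj A * c * Y y) \<partial>P) = Re (\<integral>y. cnj A * c * Y y \<partial>P)"
    using iY by (intro integral_Re integrable_mult_right)
  then have R0: "(\<integral>y. Re (cnj A * c * Y y) \<partial>P) = 0"
    by (simp add: mean)
  have "integrable P (\<lambda>y. (cmod (A + c * Y y))\<^sup>2)"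
    unfolding eq by (intro Bochner_Integration.integrable_add integrable_mult_right iR iY2) simp
  then have "(\<integral>\<^sup>+y. ennreal ((cmod (A + c * Y y))\<^sup>2) \<partial>P) = ennreal (\<integral>y. (cmod (A + c * Y y))\<^sup>2 \<partial>P)"
    by (rule nn_integral_eq_integral) simp
  also have "(\<integral>y. (cmod (A + c * Y y))\<^sup>2 \<partial>P) = (cmod A)\<^sup>2 + (cmod c)\<^sup>2 * (\<integral>y. (cmod (Y y))\<^sup>2 \<partial>P)"
  proof -
    have "(\<integral>y. (cmod (A + c * Y y))\<^sup>2 \<partial>P) = (\<integral>y. (cmod A)\<^sup>2 \<partial>P) + (\<integral>y. 2 * Re (cnj A * c * Y y) \<partial>P)
        + (\<integral>y. (cmod c)\<^sup>2 * (cmod (Y y))\<^sup>2 \<partial>P)"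
      unfolding eq
      by (subst Bochner_Integration.integral_add Bochner_Integration.integral_add,
          (intro Bochner_Integration.integrable_add integrable_mult_right iR iY2 integrable_const)+)+ simp
    then show ?thesis
      unfolding integral_mult_right_zero R0 by (simp add: prob_space)
  qed
  also have "ennreal \<dots> = ennreal ((cmod A)\<^sup>2) + ennreal ((cmod c)\<^sup>2) * ennreal (\<integral>y. (cmod (Y y))\<^sup>2 \<partial>P)"
    by (simp add: ennreal_plus ennreal_mult)
  also have "ennreal (\<integral>y. (cmod (Y y))\<^sup>2 \<partial>P) = (\<integral>\<^sup>+y. ennreal ((cmod (Y y))\<^sup>2) \<partial>P)"
    by (rule nn_integral_eq_integral[symmetric]) (auto simp: iY2)
  finally show ?thesis .
qed


section \<open>Sums over a generation\<close>

lemma particles_iff: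
  "u \<in> particles x n \<longleftrightarrow> length u = n \<and> (\<forall>k<n. u ! k < fst (x (take k u)))"
proof (induction n arbitrary: u)
  case (Suc n)
  show ?case
  proof (cases u rule: rev_cases)
    case (snoc v i)
    have "(\<forall>k<Suc n. (v @ [i]) ! k < fst (x (take k (v @ [i])))) \<longleftrightarrow>
        (\<forall>k<n. v ! k < fst (x (take k v))) \<and> i < fst (x v)" if "length v = n"
      using that by (auto simp: less_Suc_eq nth_append)
    then show ?thesis using Suc[of v] by (auto simp: snoc)
  qed (use Suc in auto)
qed auto

lemma length_particles: "u \<in> particles x n \<Longrightarrow> length u = n"
  by (simp add: particles_iff)

text \<open>Membership in generation \<open>n\<close> is decided by the vectors at proper prefixes,
  whose lengths are below \<open>n\<close>, so a change at a word of length at least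
  \<open>n\<close> is invisible.\<close>

lemma particles_upd: "n \<le> length u \<Longrightarrow> particles (x(u := y)) n = particles x n"
proof (rule set_eqI)
  fix v assume n: "n \<le> length u"
  have "take k v \<noteq> u" if "length v = n" "k < n" for k
    using n that by (metis length_take min.strict_coboundedI2 min_def not_less)
  then show "v \<in> particles (x(u := y)) n \<longleftrightarrow> v \<in> particles x n"
    unfolding particles_iff by (metis fun_upd_other)
qed

lemma position_upd: "length v \<le> length u \<Longrightarrow> position (x(u := y)) v = position x v"
  unfolding position_def
proof (intro sum.cong refl)
  fix k assume "length v \<le> length u" "k \<in> {..<length v}"
  then have "take k v \<noteq> u" by (metis length_take lessThan_iff min.strict_coboundedI2 min_def not_less)
  then show "snd ((x(u := y)) (take k v)) (v ! k) = snd (x (take k v)) (v ! k)" by simp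
qed

lemma sum_particles_Suc:
  "(\<Sum>v\<in>particles x (Suc n). f v) = (\<Sum>u\<in>particles x n. \<Sum>i<fst (x u). f (u @ [i]))"
proof -
  have "(\<Sum>u\<in>particles x n. \<Sum>i<fst (x u). f (u @ [i])) =
      (\<Sum>p\<in>(SIGMA u:particles x n. {..<fst (x u)}). f (fst p @ [snd p]))"
    by (simp add: sum.Sigma finite_particles split_beta')
  also have "\<dots> = (\<Sum>v\<in>particles x (Suc n). f v)"
    by (rule sum.reindex_bij_witness[where i = "\<lambda>v. (butlast v, last v)" and j = "\<lambda>p. fst p @ [snd p]"])
       auto
  finally show ?thesis by simp
qed

lemma pred_particles [measurable]:
  assumes [measurable]: "X \<in> N \<rightarrow>\<^sub>M marked_tree_space"
  shows "Measurable.pred N (\<lambda>z. u \<in> particles (X z) n)"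
proof -
  have [measurable]: "(\<lambda>z. fst (X z v)) \<in> N \<rightarrow>\<^sub>M count_space UNIV" for v
    by measurable
  show ?thesis unfolding particles_iff by measurable
qed

lemma measurable_position [measurable]:
  assumes [measurable]: "X \<in> N \<rightarrow>\<^sub>M marked_tree_space"
  shows "(\<lambda>z. position (X z) u) \<in> borel_measurable N"
  unfolding position_def by measurable

text \<open>A generation takes values in the countable set of finite sets of words, so singletons
  suffice. Sums over this random index set then reduce to sums over fixed finite sets.\<close>

lemma measurable_particles:
  assumes [measurable]: "X \<in> N \<rightarrow>\<^sub>M marked_tree_space"
  shows "(\<lambda>z. particles (X z) n) \<in> N \<rightarrow>\<^sub>M count_space {S. finite S}"
  unfolding measurable_count_space_eq_countable[OF countable_Collect_finite]
proof -
  show "(\<lambda>z. particles (X z) n) \<in> space N \<rightarrow> {S. finite S} \<and>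
      (\<forall>S\<in>{S. finite S}. (\<lambda>z. particles (X z) n) -` {S} \<inter> space N \<in> sets N)"
  proof (intro conjI ballI)
    fix S :: "nat list set"
    have "(\<lambda>z. particles (X z) n) -` {S} \<inter> space N =
        {z\<in>space N. \<forall>u. u \<in> particles (X z) n \<longleftrightarrow> u \<in> S}" by auto
    also have "\<dots> \<in> sets N" by measurable
    finally show "(\<lambda>z. particles (X z) n) -` {S} \<inter> space N \<in> sets N" .
  qed (auto simp: finite_particles)
qed

lemma measurable_sum_particles:
  fixes f :: "'z \<Rightarrow> nat list \<Rightarrow> 'b :: {second_countable_topology, topological_comm_monoid_add}"
  assumes X: "X \<in> N \<rightarrow>\<^sub>M marked_tree_space" and f: "\<And>u. (\<lambda>z. f z u) \<in> borel_measurable N"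
  shows "(\<lambda>z. \<Sum>u\<in>particles (X z) n. f z u) \<in> borel_measurable N"
proof (rule measurable_compose_countable'[OF _ measurable_particles[OF X]])
  show "countable {S :: nat list set. finite S}"
    using countable_Collect_finite by blast
  show "(\<lambda>z. sum (f z) S) \<in> borel_measurable N" for S
    using f by (rule borel_measurable_sum)
qed

lemma measurable_sum_children:
  fixes f :: "'z \<Rightarrow> nat \<Rightarrow> 'b :: {second_countable_topology, topological_comm_monoid_add}"
  assumes X: "X \<in> N \<rightarrow>\<^sub>M count_space UNIV" and f: "\<And>i. (\<lambda>z. f z i) \<in> borel_measurable N"
  shows "(\<lambda>z. \<Sum>i<X z. f z i) \<in> borel_measurable N"
proof (rule measurable_compose_countable[OF _ X])
  show "(\<lambda>z. sum (f z) {..<n}) \<in> borel_measurable N" for n :: nat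
    using f by (rule borel_measurable_sum)
qed

lemma measurable_card_particles [measurable]:
  assumes [measurable]: "X \<in> N \<rightarrow>\<^sub>M marked_tree_space"
  shows "(\<lambda>z. card (particles (X z) n)) \<in> N \<rightarrow>\<^sub>M count_space UNIV"
  by (rule measurable_compose[OF measurable_particles[OF assms]]) simp


section \<open>The tree in a fixed environment\<close>

locale quenched_tree =
  fixes \<Lambda> :: "nat \<Rightarrow> offspring measure"
  assumes prob_\<Lambda>: "\<And>n. prob_space (\<Lambda> n)"
    and sets_\<Lambda> [measurable_cong]: "\<And>n. sets (\<Lambda> n) = sets offspring_space"
begin

definition tree_law :: "(nat list \<Rightarrow> offspring) measure" where
  "tree_law = PiM UNIV (\<lambda>u. \<Lambda> (length u))"

lemma sets_tree_law [measurable_cong]: "sets tree_law = sets marked_tree_space"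
  unfolding tree_law_def by (intro sets_PiM_cong refl sets_\<Lambda>)

lemma prob_tree_law: "prob_space tree_law"
  unfolding tree_law_def by (intro prob_space_PiM prob_\<Lambda>)

lemma space_tree_law [simp]: "space tree_law = UNIV"
  using sets_eq_imp_space_eq[OF sets_tree_law] by (simp add: space_PiM space_pair_measure)

lemma space_\<Lambda> [simp]: "space (\<Lambda> n) = UNIV"
  using sets_eq_imp_space_eq[OF sets_\<Lambda>[of n]] by (simp add: space_PiM space_pair_measure)

lemma measurable_tree_update [measurable (raw)]:
  assumes [measurable]: "f \<in> N \<rightarrow>\<^sub>M marked_tree_space" "g \<in> N \<rightarrow>\<^sub>M offspring_space"
  shows "(\<lambda>z. (f z)(u := g z)) \<in> N \<rightarrow>\<^sub>M marked_tree_space"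
  by (rule measurable_PiM_single') (auto simp: space_PiM space_pair_measure fun_upd_def)

lemma measurable_tree_section: "(\<lambda>y. x(u := y)) \<in> \<Lambda> n \<rightarrow>\<^sub>M tree_law"
proof -
  have "(\<lambda>y. x(u := y)) \<in> offspring_space \<rightarrow>\<^sub>M marked_tree_space"
  proof (rule measurable_PiM_single')
    show "(\<lambda>y. (x(u := y)) i) \<in> offspring_space \<rightarrow>\<^sub>M offspring_space" for i
      by (cases "i = u") (auto simp: space_PiM space_pair_measure)
  qed (auto simp: space_PiM space_pair_measure)
  then show ?thesis
    by (simp cong: measurable_cong_sets add: sets_\<Lambda> sets_tree_law)
qed

lemma nn_integral_resample:
  assumes [measurable]: "f \<in> borel_measurable tree_law"
  shows "(\<integral>\<^sup>+x. f x \<partial>tree_law) = (\<integral>\<^sup>+x. \<integral>\<^sup>+y. f (x(u := y)) \<partial>\<Lambda> (length u) \<partial>tree_law)"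
  using assms unfolding tree_law_def
  by (intro nn_integral_PiM_resample prob_\<Lambda>) auto

text \<open>The random index set is traded for an indicator under the counting measure on all words,
  so that Tonelli applies and each word can be resampled separately.\<close>

lemma nn_integral_sum_particles:
  assumes H [measurable]: "\<And>u. (\<lambda>x. H x u) \<in> borel_measurable tree_law"
  shows "(\<integral>\<^sup>+x. (\<Sum>u\<in>particles x n. H x u) \<partial>tree_law) =
    (\<integral>\<^sup>+u. \<integral>\<^sup>+x. H x u * indicator (particles x n) u \<partial>tree_law \<partial>count_space UNIV)"
proof -
  have "(\<Sum>u\<in>particles x n. H x u) = (\<integral>\<^sup>+u. H x u * indicator (particles x n) u \<partial>count_space UNIV)" for x
    by (simp add: nn_integral_count_space_indicator[symmetric] nn_integral_count_space_finite finite_particles)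
  then show ?thesis
    by (simp add: nn_integral_count_space_nn_integral[symmetric] sets_eq_imp_space_eq[OF sets_tree_law])
qed

text \<open>Whether \<open>u\<close> lies in generation \<open>n\<close> does not depend on the
  vector at \<open>u\<close>. Resampling there averages \<open>H\<close> over that vector while the
  index set stays fixed.\<close>

lemma first_moment:
  assumes H [measurable]: "\<And>u. (\<lambda>x. H x u) \<in> borel_measurable tree_law"
  shows "(\<integral>\<^sup>+x. (\<Sum>u\<in>particles x n. H x u) \<partial>tree_law) =
    (\<integral>\<^sup>+x. (\<Sum>u\<in>particles x n. \<integral>\<^sup>+y. H (x(u := y)) u \<partial>\<Lambda> n) \<partial>tree_law)"
proof -
  interpret L: prob_space "\<Lambda> n" for n by (rule prob_\<Lambda>)
  have [measurable]: "(\<lambda>x. \<integral>\<^sup>+y. H (x(u := y)) u \<partial>\<Lambda> n) \<in> borel_measurable tree_law" for u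
    by measurable
  have *: "(\<integral>\<^sup>+x. H x u * indicator (particles x n) u \<partial>tree_law) =
      (\<integral>\<^sup>+x. (\<integral>\<^sup>+y. H (x(u := y)) u \<partial>\<Lambda> n) * indicator (particles x n) u \<partial>tree_law)" for u
  proof (cases "length u = n")
    case True
    have "(\<integral>\<^sup>+x. H x u * indicator (particles x n) u \<partial>tree_law) =
        (\<integral>\<^sup>+x. \<integral>\<^sup>+y. H (x(u := y)) u * indicator (particles (x(u := y)) n) u \<partial>\<Lambda> (length u) \<partial>tree_law)"
      by (rule nn_integral_resample) measurable
    also have "\<dots> = (\<integral>\<^sup>+x. (\<integral>\<^sup>+y. H (x(u := y)) u \<partial>\<Lambda> n) * indicator (particles x n) u \<partial>tree_law)"
    proof (rule nn_integral_cong)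
      fix x
      have [measurable]: "(\<lambda>y. H (x(u := y)) u) \<in> borel_measurable (\<Lambda> n)"
        by (rule measurable_compose[OF measurable_tree_section H])
      show "(\<integral>\<^sup>+y. H (x(u := y)) u * indicator (particles (x(u := y)) n) u \<partial>\<Lambda> (length u)) =
          (\<integral>\<^sup>+y. H (x(u := y)) u \<partial>\<Lambda> n) * indicator (particles x n) u"
        using True by (simp add: particles_upd nn_integral_multc)
    qed
    finally show ?thesis .
  next
    case False
    then have "indicator (particles x n) u = (0 :: ennreal)" for x
      using length_particles by (auto simp: indicator_def)
    then show ?thesis by simp
  qed
  have "(\<integral>\<^sup>+x. (\<Sum>u\<in>particles x n. H x u) \<partial>tree_law) =
      (\<integral>\<^sup>+u. \<integral>\<^sup>+x. H x u * indicator (particles x n) u \<partial>tree_law \<partial>count_space UNIV)"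
    by (rule nn_integral_sum_particles) (rule H)
  also have "\<dots> = (\<integral>\<^sup>+u. \<integral>\<^sup>+x. (\<integral>\<^sup>+y. H (x(u := y)) u \<partial>\<Lambda> n) * indicator (particles x n) u \<partial>tree_law \<partial>count_space UNIV)"
    by (rule nn_integral_cong) (rule *)
  also have "\<dots> = (\<integral>\<^sup>+x. (\<Sum>u\<in>particles x n. \<integral>\<^sup>+y. H (x(u := y)) u \<partial>\<Lambda> n) \<partial>tree_law)"
    by (rule nn_integral_sum_particles[symmetric]) measurable
  finally show "(\<integral>\<^sup>+x. (\<Sum>u\<in>particles x n. H x u) \<partial>tree_law) = (\<integral>\<^sup>+x. (\<Sum>u\<in>particles x n. \<integral>\<^sup>+y. H (x(u := y)) u \<partial>\<Lambda> n) \<partial>tree_law)" .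
qed

text \<open>Orthogonality, by induction on \<open>S\<close>. Resampling at the new word leaves the
  other summands unchanged, since their coefficients and their memberships in the generation do not
  look at vectors of generation \<open>n\<close>; the centred \<open>Y\<close> kills the cross
  term.\<close>

lemma second_moment_finite:
  fixes a :: "(nat list \<Rightarrow> offspring) \<Rightarrow> nat list \<Rightarrow> complex"
  assumes a [measurable]: "\<And>u. (\<lambda>x. a x u) \<in> borel_measurable tree_law"
    and a_upd: "\<And>x u v y. length u = n \<Longrightarrow> length v = n \<Longrightarrow> a (x(v := y)) u = a x u"
    and Y [measurable]: "Y \<in> borel_measurable (\<Lambda> n)"
    and bound: "\<And>y. cmod (Y y) \<le> B" and mean: "(\<integral>y. Y y \<partial>\<Lambda> n) = 0"
    and S: "finite S" "\<And>u. u \<in> S \<Longrightarrow> length u = n"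
  shows "(\<integral>\<^sup>+x. ennreal ((cmod (\<Sum>u\<in>S. a x u * of_bool (u \<in> particles x n) * Y (x u)))\<^sup>2) \<partial>tree_law) =
    (\<Sum>u\<in>S. \<integral>\<^sup>+x. ennreal ((cmod (a x u))\<^sup>2) * indicator (particles x n) u \<partial>tree_law)
      * (\<integral>\<^sup>+y. ennreal ((cmod (Y y))\<^sup>2) \<partial>\<Lambda> n)"
  using S
proof (induction S rule: finite_induct)
  case (insert u S)
  define c where "c x u = a x u * of_bool (u \<in> particles x n)" for x u
  have [measurable]: "Y \<in> borel_measurable offspring_space"
    using Y by (simp cong: measurable_cong_sets add: sets_\<Lambda>)
  have [measurable]: "(\<lambda>x. c x u) \<in> borel_measurable tree_law" for u
    unfolding c_def by measurable
  have len: "length w = n" if "w \<in> Set.insert u S" for w using insert.prems that by blast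
  have c_upd: "c (x(u := y)) w = c x w" if "w \<in> Set.insert u S" for x w y
    using len[of u] len[of w] that by (auto simp: c_def a_upd particles_upd)
  let ?A = "\<lambda>x. \<Sum>w\<in>S. c x w * Y (x w)"
  have A: "?A (x(u := y)) = ?A x" for x y
    using insert.hyps by (intro sum.cong) (auto simp: c_upd)
  have upd: "(\<Sum>w\<in>Set.insert u S. c (x(u := y)) w * Y ((x(u := y)) w)) = ?A x + c x u * Y y" for x y
    using insert.hyps A[of x y] c_upd[of u x y] by simp
  have c2: "ennreal ((cmod (c x u))\<^sup>2) = ennreal ((cmod (a x u))\<^sup>2) * indicator (particles x n) u" for x u
    by (simp add: c_def indicator_def)
  have "(\<integral>\<^sup>+x. ennreal ((cmod (\<Sum>w\<in>Set.insert u S. c x w * Y (x w)))\<^sup>2) \<partial>tree_law) =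
      (\<integral>\<^sup>+x. \<integral>\<^sup>+y. ennreal ((cmod (\<Sum>w\<in>Set.insert u S. c (x(u := y)) w * Y ((x(u := y)) w)))\<^sup>2)
        \<partial>\<Lambda> (length u) \<partial>tree_law)"
    by (rule nn_integral_resample) measurable
  also have "\<dots> = (\<integral>\<^sup>+x. \<integral>\<^sup>+y. ennreal ((cmod (?A x + c x u * Y y))\<^sup>2) \<partial>\<Lambda> n \<partial>tree_law)"
    using len[of u] by (simp only: upd) simp
  also have "\<dots> = (\<integral>\<^sup>+x. ennreal ((cmod (?A x))\<^sup>2) +
      ennreal ((cmod (c x u))\<^sup>2) * (\<integral>\<^sup>+y. ennreal ((cmod (Y y))\<^sup>2) \<partial>\<Lambda> n) \<partial>tree_law)"
    by (rule nn_integral_cong) (rule nn_integral_cmod_add_sq[OF prob_\<Lambda> Y mean bound])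
  also have "\<dots> = (\<integral>\<^sup>+x. ennreal ((cmod (?A x))\<^sup>2) \<partial>tree_law) +
      (\<integral>\<^sup>+x. ennreal ((cmod (c x u))\<^sup>2) \<partial>tree_law) * (\<integral>\<^sup>+y. ennreal ((cmod (Y y))\<^sup>2) \<partial>\<Lambda> n)"
    by (subst nn_integral_add) (auto simp: nn_integral_multc)
  also have "(\<integral>\<^sup>+x. ennreal ((cmod (?A x))\<^sup>2) \<partial>tree_law) =
      (\<Sum>u\<in>S. \<integral>\<^sup>+x. ennreal ((cmod (a x u))\<^sup>2) * indicator (particles x n) u \<partial>tree_law)
        * (\<integral>\<^sup>+y. ennreal ((cmod (Y y))\<^sup>2) \<partial>\<Lambda> n)"
    using insert by (simp add: c_def)
  finally show ?case
    using insert.hyps by (simp add: c2 distrib_right add.commute) (simp add: c_def mult.assoc)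
qed simp

text \<open>Finite sets of words of length \<open>n\<close> exhaust the generation along an
  enumeration, and Fatou passes to the limit, whence the inequality.\<close>

lemma second_moment:
  fixes a :: "(nat list \<Rightarrow> offspring) \<Rightarrow> nat list \<Rightarrow> complex"
  assumes a [measurable]: "\<And>u. (\<lambda>x. a x u) \<in> borel_measurable tree_law"
    and a_upd: "\<And>x u v y. length u = n \<Longrightarrow> length v = n \<Longrightarrow> a (x(v := y)) u = a x u"
    and Y [measurable]: "Y \<in> borel_measurable (\<Lambda> n)"
    and bound: "\<And>y. cmod (Y y) \<le> B" and mean: "(\<integral>y. Y y \<partial>\<Lambda> n) = 0"
  shows "(\<integral>\<^sup>+x. ennreal ((cmod (\<Sum>u\<in>particles x n. a x u * Y (x u)))\<^sup>2) \<partial>tree_law) \<le>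
    (\<integral>\<^sup>+x. (\<Sum>u\<in>particles x n. ennreal ((cmod (a x u))\<^sup>2)) \<partial>tree_law)
      * (\<integral>\<^sup>+y. ennreal ((cmod (Y y))\<^sup>2) \<partial>\<Lambda> n)"
proof -
  define S where "S k = {u :: nat list. to_nat u < k \<and> length u = n}" for k :: nat
  let ?v = "\<integral>\<^sup>+y. ennreal ((cmod (Y y))\<^sup>2) \<partial>\<Lambda> n"
  let ?f = "\<lambda>k x. ennreal ((cmod (\<Sum>u\<in>S k. a x u * of_bool (u \<in> particles x n) * Y (x u)))\<^sup>2)"
  have [measurable]: "Y \<in> borel_measurable offspring_space"
    using Y by (simp cong: measurable_cong_sets add: sets_\<Lambda>)
  have fin: "finite (S k)" for k
  proof -
    have "finite (to_nat -` {..<k} :: nat list set)" by (intro finite_vimageI) auto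
    then show ?thesis by (rule rev_finite_subset) (auto simp: S_def)
  qed
  have lim: "ennreal ((cmod (\<Sum>u\<in>particles x n. a x u * Y (x u)))\<^sup>2) = liminf (\<lambda>k. ?f k x)" for x
  proof -
    define K where "K = Suc (Max (insert 0 (to_nat ` particles x n)))"
    have "particles x n \<subseteq> S k" if "k \<ge> K" for k
    proof
      fix u assume u: "u \<in> particles x n"
      then have "to_nat u \<le> Max (insert 0 (to_nat ` particles x n))"
        by (intro Max_ge) (auto simp: finite_particles)
      with u that show "u \<in> S k" by (simp add: S_def K_def length_particles)
    qed
    then have "(\<Sum>u\<in>S k. a x u * of_bool (u \<in> particles x n) * Y (x u)) = (\<Sum>u\<in>particles x n. a x u * Y (x u))"
      if "k \<ge> K" for k
      using that by (intro sum.mono_neutral_cong_right fin) auto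
    then have "(\<lambda>k. ?f k x) \<longlonglongrightarrow> ennreal ((cmod (\<Sum>u\<in>particles x n. a x u * Y (x u)))\<^sup>2)"
      by (intro tendsto_eventually) (auto simp: eventually_sequentially intro!: exI[of _ K])
    then have "liminf (\<lambda>k. ?f k x) = ennreal ((cmod (\<Sum>u\<in>particles x n. a x u * Y (x u)))\<^sup>2)"
      by (rule lim_imp_Liminf[OF sequentially_bot])
    then show ?thesis by (rule sym)
  qed
  have le: "(\<integral>\<^sup>+x. ?f k x \<partial>tree_law) \<le> (\<integral>\<^sup>+x. (\<Sum>u\<in>particles x n. ennreal ((cmod (a x u))\<^sup>2)) \<partial>tree_law) * ?v" for k
  proof -
    have "(\<integral>\<^sup>+x. ?f k x \<partial>tree_law) =
        (\<Sum>u\<in>S k. \<integral>\<^sup>+x. ennreal ((cmod (a x u))\<^sup>2) * indicator (particles x n) u \<partial>tree_law) * ?v"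
      by (rule second_moment_finite[OF a a_upd Y bound mean fin]) (auto simp: S_def)
    also have "\<dots> = (\<integral>\<^sup>+x. (\<Sum>u\<in>S k. ennreal ((cmod (a x u))\<^sup>2) * indicator (particles x n) u) \<partial>tree_law) * ?v"
      by (subst nn_integral_sum) auto
    also have "\<dots> \<le> (\<integral>\<^sup>+x. (\<Sum>u\<in>particles x n. ennreal ((cmod (a x u))\<^sup>2)) \<partial>tree_law) * ?v"
    proof (intro mult_right_mono nn_integral_mono)
      fix x
      have "(\<Sum>u\<in>S k. ennreal ((cmod (a x u))\<^sup>2) * indicator (particles x n) u) =
          (\<Sum>u\<in>S k \<inter> particles x n. ennreal ((cmod (a x u))\<^sup>2))"
        by (rule sum.mono_neutral_cong_right) (auto simp: fin)
      also have "\<dots> \<le> (\<Sum>u\<in>particles x n. ennreal ((cmod (a x u))\<^sup>2))"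
        by (rule sum_mono2) (auto simp: finite_particles)
      finally show "(\<Sum>u\<in>S k. ennreal ((cmod (a x u))\<^sup>2) * indicator (particles x n) u) \<le>
          (\<Sum>u\<in>particles x n. ennreal ((cmod (a x u))\<^sup>2))" .
    qed auto
    finally show ?thesis .
  qed
  have "(\<integral>\<^sup>+x. liminf (\<lambda>k. ?f k x) \<partial>tree_law) \<le> liminf (\<lambda>k. \<integral>\<^sup>+x. ?f k x \<partial>tree_law)"
    by (rule nn_integral_liminf) measurable
  also have "\<dots> \<le> limsup (\<lambda>k. \<integral>\<^sup>+x. ?f k x \<partial>tree_law)"
    by (rule Liminf_le_Limsup) simp
  also have "\<dots> \<le> (\<integral>\<^sup>+x. (\<Sum>u\<in>particles x n. ennreal ((cmod (a x u))\<^sup>2)) \<partial>tree_law) * ?v"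
    by (rule Limsup_bounded, rule always_eventually, rule allI, rule le)
  finally show ?thesis by (simp add: lim)
qed

end


section \<open>Integrals with respect to the displacement law\<close>

lemma nn_integral_displacement_law:
  assumes P: "sets P = sets offspring_space" and f: "f \<in> borel_measurable borel"
  shows "(\<integral>\<^sup>+x. f x \<partial>displacement_law P) =
    (\<integral>\<^sup>+y. (\<Sum>i<fst y. f (snd y i)) \<partial>P) / mean_offspring P"
proof -
  note P [measurable_cong] and sets_displacement_law [measurable_cong]
  have meas [measurable]: "(\<lambda>y. \<Sum>i<fst y. g (snd y i)) \<in> borel_measurable P"
    if [measurable]: "g \<in> borel_measurable borel" for g :: "real \<Rightarrow> ennreal"
    by (rule measurable_sum_children) measurable
  show ?thesis
    using f
  proof (induction f rule: borel_measurable_induct)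
    case (cong f g)
    then have "f = g" by (intro ext) (auto simp: space_borel)
    with cong show ?case by simp
  next
    case (set A)
    then show ?case
      using emeasure_displacement_law[OF P, of A] by (simp add: nn_integral_indicator sets_displacement_law)
  next
    case (mult u c)
    then show ?case
      by (simp add: nn_integral_cmult sum_distrib_left[symmetric] divide_ennreal_def mult.assoc)
  next
    case (add u v)
    then show ?case
      by (simp add: nn_integral_add sum.distrib divide_ennreal_def distrib_right)
  next
    case (seq U)
    have [measurable]: "U k \<in> borel_measurable borel" for k by (rule seq)
    have incU: "incseq (\<lambda>k. U k z)" for z
      using seq(3) by (auto simp: incseq_def le_fun_def)
    have "(\<integral>\<^sup>+x. (SUP k. U k) x \<partial>displacement_law P) = (SUP k. \<integral>\<^sup>+x. U k x \<partial>displacement_law P)"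
      unfolding SUP_apply by (rule nn_integral_monotone_convergence_SUP) (use seq(3) in auto)
    also have "\<dots> = (SUP k. (\<integral>\<^sup>+y. (\<Sum>i<fst y. U k (snd y i)) \<partial>P)) / mean_offspring P"
      unfolding seq.IH by (rule SUP_divide_ennreal[symmetric])
    also have "(SUP k. (\<integral>\<^sup>+y. (\<Sum>i<fst y. U k (snd y i)) \<partial>P)) =
        (\<integral>\<^sup>+y. (SUP k. \<Sum>i<fst y. U k (snd y i)) \<partial>P)"
      by (rule nn_integral_monotone_convergence_SUP[symmetric])
        (use seq(3) in \<open>auto simp: incseq_def le_fun_def intro!: sum_mono\<close>)
    also have "(\<lambda>y. SUP k. \<Sum>i<fst y. U k (snd y i)) = (\<lambda>y :: offspring. \<Sum>i<fst y. (SUP k. U k) (snd y i))"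
      by (rule ext) (simp add: ennreal_SUP_sum incU image_comp)
    finally show ?case .
  qed
qed

locale offspring_law = prob_space P for P :: "offspring measure" +
  assumes sets_P [measurable_cong]: "sets P = sets offspring_space"
    and mean_pos: "0 < mean_offspring P" and mean_finite: "mean_offspring P < \<infinity>"
begin

definition mean :: real where "mean = enn2real (mean_offspring P)"

lemma mean_gt_0: "0 < mean"
  unfolding mean_def using mean_pos mean_finite by (simp add: enn2real_positive_iff)

lemma ennreal_mean: "ennreal mean = mean_offspring P"
  unfolding mean_def using mean_finite by simp

lemma integrable_offspring: "integrable P (\<lambda>y. real (fst y))"
  using mean_finite unfolding mean_offspring_def
  by (intro integrableI_bounded) (auto simp: ennreal_of_nat_eq_real_of_nat)

lemma integral_offspring: "(\<integral>y. real (fst y) \<partial>P) = mean"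
  unfolding mean_def mean_offspring_def
  by (subst integral_eq_nn_integral) (auto simp: ennreal_of_nat_eq_real_of_nat)

lemma measurable_children_sum:
  fixes f :: "real \<Rightarrow> 'b :: {second_countable_topology, topological_comm_monoid_add}"
  assumes [measurable]: "f \<in> borel_measurable borel"
  shows "(\<lambda>y. \<Sum>i<fst y. f (snd y i)) \<in> borel_measurable P"
  by (rule measurable_sum_children) measurable

lemma integrable_children_sum:
  fixes f :: "real \<Rightarrow> 'b :: {banach, second_countable_topology}"
  assumes f [measurable]: "f \<in> borel_measurable borel" and B: "\<And>x. norm (f x) \<le> B"
  shows "integrable P (\<lambda>y. \<Sum>i<fst y. f (snd y i))"
proof (rule Bochner_Integration.integrable_bound[of _ "\<lambda>y. B * real (fst y)"])
  show "integrable P (\<lambda>y. B * real (fst y))"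
    by (intro integrable_mult_right integrable_offspring)
  show "AE y in P. norm (\<Sum>i<fst y. f (snd y i)) \<le> norm (B * real (fst y))"
  proof (rule AE_I2)
    fix y :: offspring
    have "norm (\<Sum>i<fst y. f (snd y i)) \<le> (\<Sum>i<fst y. B)"
      by (rule sum_norm_le) (rule B)
    also have "\<dots> \<le> norm (B * real (fst y))"
      using abs_ge_self[of "B * real (fst y)"] by (simp add: mult.commute)
    finally show "norm (\<Sum>i<fst y. f (snd y i)) \<le> norm (B * real (fst y))" .
  qed
qed (rule measurable_children_sum[OF f])

lemma prob_displacement_law: "prob_space (displacement_law P)"
  using mean_pos mean_finite by (intro prob_space_displacement_law sets_P) auto

lemma real_distribution_displacement_law: "real_distribution (displacement_law P)"
  by (intro real_distribution.intro prob_displacement_law real_distribution_axioms.intro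
      sets_displacement_law)

text \<open>Adding \<open>B\<close> makes the integrand nonnegative, where the formula for
  nonnegative integrals applies. Summed over the children the constant contributes
  \<open>mean * B\<close>, which is removed at the end.\<close>

lemma integral_displacement_law_real:
  fixes f :: "real \<Rightarrow> real"
  assumes f [measurable]: "f \<in> borel_measurable borel" and B: "\<And>x. \<bar>f x\<bar> \<le> B"
  shows "(\<integral>x. f x \<partial>displacement_law P) = (\<integral>y. (\<Sum>i<fst y. f (snd y i)) \<partial>P) / mean"
proof -
  interpret D: prob_space "displacement_law P" by (rule prob_displacement_law)
  note sets_displacement_law [measurable_cong]
  have pos: "0 \<le> f x + B" for x using B[of x] by linarith
  have 1: "integrable (displacement_law P) f"
    by (rule D.integrable_const_bound[of _ B]) (auto simp: B)
  have "(\<integral>x. f x + B \<partial>displacement_law P) = enn2real (\<integral>\<^sup>+x. ennreal (f x + B) \<partial>displacement_law P)"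
    by (rule integral_eq_nn_integral) (auto simp: pos)
  also have "(\<integral>\<^sup>+x. ennreal (f x + B) \<partial>displacement_law P) =
      (\<integral>\<^sup>+y. ennreal (\<Sum>i<fst y. f (snd y i) + B) \<partial>P) / mean_offspring P"
    using nn_integral_displacement_law[OF sets_P, of "\<lambda>x. ennreal (f x + B)"] by (simp add: pos)
  also have "enn2real \<dots> = (\<integral>y. (\<Sum>i<fst y. f (snd y i) + B) \<partial>P) / mean"
  proof -
    have bnd: "norm (f x + B) \<le> 2 * B" for x
      using B[of x] by simp
    have "integrable P (\<lambda>y. \<Sum>i<fst y. f (snd y i) + B)"
      by (rule integrable_children_sum[of "\<lambda>x. f x + B" "2 * B"]) (use bnd in auto)
    then have "(\<integral>\<^sup>+y. ennreal (\<Sum>i<fst y. f (snd y i) + B) \<partial>P) = ennreal (\<integral>y. (\<Sum>i<fst y. f (snd y i) + B) \<partial>P)"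
      by (rule nn_integral_eq_integral) (auto simp: pos sum_nonneg)
    moreover have "0 \<le> (\<integral>y. (\<Sum>i<fst y. f (snd y i) + B) \<partial>P)"
      by (intro integral_nonneg_AE AE_I2 sum_nonneg pos)
    ultimately show ?thesis
      using mean_gt_0 by (simp add: ennreal_mean[symmetric] divide_ennreal)
  qed
  also have "(\<integral>y. (\<Sum>i<fst y. f (snd y i) + B) \<partial>P) = (\<integral>y. (\<Sum>i<fst y. f (snd y i)) \<partial>P) + mean * B"
  proof -
    have "(\<integral>y. (\<Sum>i<fst y. f (snd y i) + B) \<partial>P) = (\<integral>y. (\<Sum>i<fst y. f (snd y i)) + real (fst y) * B \<partial>P)"
      by (simp add: sum.distrib)
    also have "\<dots> = (\<integral>y. (\<Sum>i<fst y. f (snd y i)) \<partial>P) + (\<integral>y. real (fst y) * B \<partial>P)"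
      using B by (intro Bochner_Integration.integral_add integrable_children_sum[of f B]
          integrable_mult_left integrable_offspring) auto
    also have "(\<integral>y. real (fst y) * B \<partial>P) = mean * B"
      by (simp add: integral_offspring)
    finally show ?thesis .
  qed
  finally show ?thesis
    using 1 mean_gt_0 by (simp add: D.prob_space add_divide_distrib)
qed

lemma integral_displacement_law_complex:
  fixes f :: "real \<Rightarrow> complex"
  assumes f [measurable]: "f \<in> borel_measurable borel" and B: "\<And>x. cmod (f x) \<le> B"
  shows "(\<integral>x. f x \<partial>displacement_law P) = (\<integral>y. (\<Sum>i<fst y. f (snd y i)) \<partial>P) / of_real mean"
proof -
  interpret D: prob_space "displacement_law P" by (rule prob_displacement_law)
  note sets_displacement_law [measurable_cong]
  have 1: "integrable (displacement_law P) f"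
    by (rule D.integrable_const_bound[of _ B]) (auto simp: B)
  have 2: "integrable P (\<lambda>y. \<Sum>i<fst y. f (snd y i))"
    by (rule integrable_children_sum[OF f B])
  have "\<bar>Re (f x)\<bar> \<le> B" "\<bar>Im (f x)\<bar> \<le> B" for x
    using B[of x] abs_Re_le_cmod[of "f x"] abs_Im_le_cmod[of "f x"] by linarith+
  then have "(\<integral>x. Re (f x) \<partial>displacement_law P) = (\<integral>y. (\<Sum>i<fst y. Re (f (snd y i))) \<partial>P) / mean"
    and "(\<integral>x. Im (f x) \<partial>displacement_law P) = (\<integral>y. (\<Sum>i<fst y. Im (f (snd y i))) \<partial>P) / mean"
    by (intro integral_displacement_law_real[where B = B]; auto)+
  then show ?thesis
    using integral_Re[OF 1] integral_Im[OF 1] integral_Re[OF 2] integral_Im[OF 2]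
    by (intro complex_eqI) simp_all
qed

lemma char_displacement_law:
  "char (displacement_law P) t = (\<integral>y. (\<Sum>i<fst y. iexp (t * snd y i)) \<partial>P) / of_real mean"
  unfolding char_def by (rule integral_displacement_law_complex[where B = 1]) auto

end


section \<open>Truncated martingale differences\<close>

declare particles.simps(2) [simp del]

text \<open>Dependence on the generations before \<open>k\<close> only, expressed as insensitivity
  to changes of the vectors at words of length at least \<open>k\<close>. This is the form in which
  resampling uses it, and no sigma-algebra has to be named.\<close>

definition predictable :: "nat \<Rightarrow> ((nat list \<Rightarrow> offspring) \<Rightarrow> 'a) \<Rightarrow> bool" where
  "predictable k g \<longleftrightarrow> (\<forall>x u y. k \<le> length u \<longrightarrow> g (x(u := y)) = g x)"

lemma predictableD: "predictable k g \<Longrightarrow> k \<le> length u \<Longrightarrow> g (x(u := y)) = g x"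
  unfolding predictable_def by blast

lemma predictable_mono: "predictable k g \<Longrightarrow> k \<le> n \<Longrightarrow> predictable n g"
  by (auto simp: predictable_def)

lemma card_particles_Suc: "card (particles x (Suc n)) = (\<Sum>u\<in>particles x n. fst (x u))"
  using sum_particles_Suc[of "\<lambda>_. 1 :: nat" x n] by simp

locale quenched_env = quenched_tree +
  assumes mean_pos: "\<And>n. 0 < mean_offspring (\<Lambda> n)"
    and mean_finite: "\<And>n. mean_offspring (\<Lambda> n) < \<infinity>"
begin

sublocale L: offspring_law "\<Lambda> n" for n
  by (intro offspring_law.intro offspring_law_axioms.intro prob_\<Lambda> sets_\<Lambda> mean_pos mean_finite)

lemma measure_\<Lambda>_UNIV [simp]: "measure (\<Lambda> n) UNIV = 1"
  using L.prob_space[of n] by simp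

definition pop_mean :: "nat \<Rightarrow> real" where
  "pop_mean n = (\<Prod>i<n. L.mean i)"

lemma pop_mean_gt_0: "0 < pop_mean n"
  unfolding pop_mean_def by (intro prod_pos ballI L.mean_gt_0)

lemma pop_mean_Suc: "pop_mean (Suc n) = pop_mean n * L.mean n"
  by (simp add: pop_mean_def)

definition W :: "nat \<Rightarrow> (nat list \<Rightarrow> offspring) \<Rightarrow> real" where
  "W n x = real (card (particles x n)) / pop_mean n"

lemma W_nonneg: "0 \<le> W n x"
  using pop_mean_gt_0[of n] by (simp add: W_def)

lemma measurable_W [measurable]: "W n \<in> borel_measurable tree_law"
  unfolding W_def by measurable

lemma W_0: "W 0 x = 1"
  by (simp add: W_def pop_mean_def)

abbreviation \<phi> :: "nat \<Rightarrow> real \<Rightarrow> complex" where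
  "\<phi> n \<equiv> char (displacement_law (\<Lambda> n))"

definition Zt :: "nat \<Rightarrow> real \<Rightarrow> (nat list \<Rightarrow> offspring) \<Rightarrow> complex" where
  "Zt n t x = (\<Sum>u\<in>particles x n. iexp (t * position x u)) / of_real (pop_mean n)"

lemma Zt_0: "Zt n 0 x = of_real (W n x)"
  by (simp add: Zt_def W_def)

lemma cmod_Zt_le: "cmod (Zt n t x) \<le> W n x"
proof -
  have "cmod (\<Sum>u\<in>particles x n. iexp (t * position x u)) \<le> (\<Sum>u\<in>particles x n. 1)"
    by (rule sum_norm_le) simp
  then show ?thesis
    using pop_mean_gt_0[of n] by (simp add: Zt_def W_def norm_divide divide_right_mono)
qed

definition Ysum :: "nat \<Rightarrow> real \<Rightarrow> offspring \<Rightarrow> complex" where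
  "Ysum n t y = (\<Sum>i<fst y. iexp (t * snd y i)) / of_real (L.mean n)"

definition Y1 :: "real \<Rightarrow> nat \<Rightarrow> real \<Rightarrow> offspring \<Rightarrow> complex" where
  "Y1 \<tau> n t y = (if real (fst y) \<le> \<tau> then Ysum n t y else 0)"

definition Y1_mean :: "real \<Rightarrow> nat \<Rightarrow> real \<Rightarrow> complex" where
  "Y1_mean \<tau> n t = (\<integral>y. Y1 \<tau> n t y \<partial>\<Lambda> n)"

definition large :: "real \<Rightarrow> nat \<Rightarrow> offspring \<Rightarrow> real" where
  "large \<tau> n y = (if real (fst y) \<le> \<tau> then 0 else real (fst y) / L.mean n)"

definition large_mean :: "real \<Rightarrow> nat \<Rightarrow> real" where
  "large_mean \<tau> n = (\<integral>y. large \<tau> n y \<partial>\<Lambda> n)"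

text \<open>Centring at the mean of the truncated variable instead of at \<open>\<phi> n t\<close>
  keeps the summands orthogonal after truncation.\<close>

definition Mtr :: "real \<Rightarrow> nat \<Rightarrow> real \<Rightarrow> (nat list \<Rightarrow> offspring) \<Rightarrow> complex" where
  "Mtr \<tau> n t x = (\<Sum>u\<in>particles x n. iexp (t * position x u) / of_real (pop_mean n)
     * (Y1 \<tau> n t (x u) - Y1_mean \<tau> n t))"

text \<open>A bound, uniform in \<open>t\<close>, for what the truncation discards:
  \<open>large\<close> stands for the removed values and \<open>large_mean\<close> for the resulting
  displacement of the mean.\<close>

definition R :: "real \<Rightarrow> nat \<Rightarrow> (nat list \<Rightarrow> offspring) \<Rightarrow> real" where
  "R \<tau> n x = (\<Sum>u\<in>particles x n. (large \<tau> n (x u) + large_mean \<tau> n) / pop_mean n)"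

text \<open>Joint measurability in the frequency and the vector is what later allows the expectation
  to be exchanged with the integral over \<open>t\<close>.\<close>

lemma measurable_Ysum_joint [measurable]:
  "(\<lambda>p. Ysum n (fst p) (snd p)) \<in> borel_measurable (borel \<Otimes>\<^sub>M offspring_space)"
proof -
  have "(\<lambda>p. \<Sum>i<fst (snd p). iexp (fst p * snd (snd p) i)) \<in>
      borel_measurable (borel \<Otimes>\<^sub>M offspring_space)"
    by (rule measurable_sum_children) measurable
  then show ?thesis unfolding Ysum_def by measurable
qed

lemma measurable_Y1_joint [measurable]:
  "(\<lambda>p. Y1 \<tau> n (fst p) (snd p)) \<in> borel_measurable (borel \<Otimes>\<^sub>M offspring_space)"
  unfolding Y1_def by measurable

lemma measurable_Y1 [measurable]: "Y1 \<tau> n t \<in> borel_measurable offspring_space"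
  using measurable_compose[OF _ measurable_Y1_joint[of \<tau> n], of "\<lambda>y. (t, y)" offspring_space]
  by simp

lemma measurable_Y1_mean [measurable]: "Y1_mean \<tau> n \<in> borel_measurable borel"
proof -
  have "(\<lambda>p. Y1 \<tau> n (fst p) (snd p)) \<in> borel_measurable (borel \<Otimes>\<^sub>M \<Lambda> n)"
    using measurable_Y1_joint by (simp cong: measurable_cong_sets sets_pair_measure_cong add: sets_\<Lambda>)
  then show ?thesis
    unfolding Y1_mean_def
    by (intro L.borel_measurable_lebesgue_integral) (simp add: split_beta')
qed

lemma measurable_large [measurable]: "large \<tau> n \<in> borel_measurable offspring_space"
  unfolding large_def by measurable

lemma measurable_Mtr_joint [measurable]:
  "(\<lambda>p. Mtr \<tau> n (fst p) (snd p)) \<in> borel_measurable (borel \<Otimes>\<^sub>M tree_law)"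
  unfolding Mtr_def
proof (rule measurable_sum_particles)
  show "snd \<in> borel \<Otimes>\<^sub>M tree_law \<rightarrow>\<^sub>M marked_tree_space" by measurable
  fix u
  have "(\<lambda>p. Y1 \<tau> n (fst p) (snd p u)) \<in> borel_measurable (borel \<Otimes>\<^sub>M tree_law)"
    using measurable_compose[OF _ measurable_Y1_joint[of \<tau> n], of "\<lambda>p. (fst p, snd p u)" "borel \<Otimes>\<^sub>M tree_law"]
    by simp
  then show "(\<lambda>p. iexp (fst p * position (snd p) u) / complex_of_real (pop_mean n) *
      (Y1 \<tau> n (fst p) (snd p u) - Y1_mean \<tau> n (fst p))) \<in> borel_measurable (borel \<Otimes>\<^sub>M tree_law)"
    by measurable
qed

lemma measurable_Mtr [measurable]: "Mtr \<tau> n t \<in> borel_measurable tree_law"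
  using measurable_compose[OF _ measurable_Mtr_joint[of \<tau> n], of "\<lambda>x. (t, x)" tree_law] by simp

lemma measurable_R [measurable]: "R \<tau> n \<in> borel_measurable tree_law"
  unfolding R_def by (rule measurable_sum_particles) measurable

lemma cmod_Ysum_le: "cmod (Ysum n t y) \<le> real (fst y) / L.mean n"
proof -
  have "cmod (\<Sum>i<fst y. iexp (t * snd y i)) \<le> (\<Sum>i<fst y. 1)"
    by (rule sum_norm_le) simp
  then show ?thesis
    using L.mean_gt_0[of n] by (simp add: Ysum_def norm_divide divide_right_mono)
qed

lemma integrable_Ysum: "integrable (\<Lambda> n) (Ysum n t)"
  unfolding Ysum_def by (intro integrable_divide L.integrable_children_sum[where B = 1]) auto

lemma integral_Ysum: "(\<integral>y. Ysum n t y \<partial>\<Lambda> n) = \<phi> n t"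
  unfolding L.char_displacement_law Ysum_def by (rule integral_divide_zero)

lemma integrable_Y1: "integrable (\<Lambda> n) (Y1 \<tau> n t)"
  by (rule Bochner_Integration.integrable_bound[OF integrable_Ysum[of n t]]) (auto simp: Y1_def)

lemma large_nonneg: "0 \<le> large \<tau> n y"
  using L.mean_gt_0[of n] by (simp add: large_def)

lemma integrable_large: "integrable (\<Lambda> n) (large \<tau> n)"
proof (rule Bochner_Integration.integrable_bound)
  show "integrable (\<Lambda> n) (\<lambda>y. real (fst y) / L.mean n)"
    by (intro integrable_divide L.integrable_offspring)
qed (auto simp: large_def)

lemma large_mean_nonneg: "0 \<le> large_mean \<tau> n"
  unfolding large_mean_def by (intro integral_nonneg_AE AE_I2 large_nonneg)

lemma R_nonneg: "0 \<le> R \<tau> n x"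
  unfolding R_def using pop_mean_gt_0[of n]
  by (intro sum_nonneg divide_nonneg_pos add_nonneg_nonneg large_nonneg large_mean_nonneg) auto

lemma cmod_Ysum_diff_le:
  "cmod ((Ysum n t y - \<phi> n t) - (Y1 \<tau> n t y - Y1_mean \<tau> n t)) \<le> large \<tau> n y + large_mean \<tau> n"
proof -
  have 1: "cmod (Ysum n t y - Y1 \<tau> n t y) \<le> large \<tau> n y" for y
    using cmod_Ysum_le[of n t y] by (simp add: Y1_def large_def)
  have "\<phi> n t - Y1_mean \<tau> n t = (\<integral>y. Ysum n t y - Y1 \<tau> n t y \<partial>\<Lambda> n)"
    unfolding Y1_mean_def integral_Ysum[symmetric]
    by (rule Bochner_Integration.integral_diff[symmetric] integrable_Ysum integrable_Y1)+
  also have "cmod \<dots> \<le> (\<integral>y. cmod (Ysum n t y - Y1 \<tau> n t y) \<partial>\<Lambda> n)"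
    by (rule integral_norm_bound)
  also have "\<dots> \<le> large_mean \<tau> n"
    unfolding large_mean_def
    by (intro integral_mono 1 integrable_large integrable_norm Bochner_Integration.integrable_diff
        integrable_Ysum integrable_Y1)
  finally have 2: "cmod (\<phi> n t - Y1_mean \<tau> n t) \<le> large_mean \<tau> n" .
  have "cmod ((Ysum n t y - Y1 \<tau> n t y) - (\<phi> n t - Y1_mean \<tau> n t)) \<le> large \<tau> n y + large_mean \<tau> n"
    by (rule order_trans[OF norm_triangle_ineq4]) (intro add_mono 1 2)
  then show ?thesis by (simp add: algebra_simps)
qed

lemma Zt_Suc: "Zt (Suc n) t x = (\<Sum>u\<in>particles x n. iexp (t * position x u) / of_real (pop_mean n) * Ysum n t (x u))"
proof -
  have "(\<Sum>u\<in>particles x (Suc n). iexp (t * position x u)) =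
      (\<Sum>u\<in>particles x n. \<Sum>i<fst (x u). iexp (t * position x u) * iexp (t * snd (x u) i))"
    unfolding sum_particles_Suc
    by (intro sum.cong refl) (simp add: position_child distrib_left exp_add)
  then have "Zt (Suc n) t x = (\<Sum>u\<in>particles x n. iexp (t * position x u) * (\<Sum>i<fst (x u). iexp (t * snd (x u) i)))
      / of_real (pop_mean n * L.mean n)"
    by (simp only: Zt_def pop_mean_Suc sum_distrib_left)
  also have "\<dots> = (\<Sum>u\<in>particles x n. iexp (t * position x u) / of_real (pop_mean n) * Ysum n t (x u))"
    unfolding sum_divide_distrib[of _ "particles x n"] Ysum_def by (intro sum.cong refl) simp
  finally show ?thesis .
qed

lemma martingale_difference_le:
  "cmod (Zt (Suc n) t x - \<phi> n t * Zt n t x) \<le> cmod (Mtr \<tau> n t x) + R \<tau> n x"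
proof -
  have "Zt (Suc n) t x - \<phi> n t * Zt n t x =
      (\<Sum>u\<in>particles x n. iexp (t * position x u) / of_real (pop_mean n) * (Ysum n t (x u) - \<phi> n t))"
    unfolding Zt_Suc Zt_def[of n]
    by (simp add: right_diff_distrib sum_subtractf sum_divide_distrib sum_distrib_left mult.commute
        diff_divide_distrib)
  then have "Zt (Suc n) t x - \<phi> n t * Zt n t x - Mtr \<tau> n t x =
      (\<Sum>u\<in>particles x n. iexp (t * position x u) / of_real (pop_mean n) *
        ((Ysum n t (x u) - \<phi> n t) - (Y1 \<tau> n t (x u) - Y1_mean \<tau> n t)))"
    unfolding Mtr_def by (simp add: sum_subtractf[symmetric] right_diff_distrib)
  also have "cmod \<dots> \<le> R \<tau> n x"
    unfolding R_def
  proof (rule sum_norm_le)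
    fix u
    show "cmod (iexp (t * position x u) / of_real (pop_mean n) *
        ((Ysum n t (x u) - \<phi> n t) - (Y1 \<tau> n t (x u) - Y1_mean \<tau> n t))) \<le>
        (large \<tau> n (x u) + large_mean \<tau> n) / pop_mean n"
      using cmod_Ysum_diff_le[of n t "x u" \<tau>] pop_mean_gt_0[of n]
      by (simp add: norm_mult norm_divide divide_right_mono)
  qed
  finally show ?thesis
    using norm_triangle_sub[of "Zt (Suc n) t x - \<phi> n t * Zt n t x" "Mtr \<tau> n t x"] by simp
qed

lemma nn_integral_children:
  fixes g :: "(nat list \<Rightarrow> offspring) \<Rightarrow> ennreal"
  assumes [measurable]: "g \<in> borel_measurable tree_law" and g: "predictable n g"
    and [measurable]: "\<psi> \<in> borel_measurable offspring_space"
  shows "(\<integral>\<^sup>+x. g x * (\<Sum>u\<in>particles x n. \<psi> (x u)) \<partial>tree_law) =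
    (\<integral>\<^sup>+x. g x * of_nat (card (particles x n)) \<partial>tree_law) * (\<integral>\<^sup>+y. \<psi> y \<partial>\<Lambda> n)"
proof -
  have "(\<integral>\<^sup>+x. g x * (\<Sum>u\<in>particles x n. \<psi> (x u)) \<partial>tree_law) =
      (\<integral>\<^sup>+x. (\<Sum>u\<in>particles x n. g x * \<psi> (x u)) \<partial>tree_law)"
    by (simp add: sum_distrib_left)
  also have "\<dots> = (\<integral>\<^sup>+x. (\<Sum>u\<in>particles x n. \<integral>\<^sup>+y. g (x(u := y)) * \<psi> ((x(u := y)) u) \<partial>\<Lambda> n) \<partial>tree_law)"
    by (rule first_moment) measurable
  also have "\<dots> = (\<integral>\<^sup>+x. (g x * of_nat (card (particles x n))) * (\<integral>\<^sup>+y. \<psi> y \<partial>\<Lambda> n) \<partial>tree_law)"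
  proof (rule nn_integral_cong)
    fix x
    have "(\<Sum>u\<in>particles x n. \<integral>\<^sup>+y. g (x(u := y)) * \<psi> ((x(u := y)) u) \<partial>\<Lambda> n) =
        (\<Sum>u\<in>particles x n. g x * (\<integral>\<^sup>+y. \<psi> y \<partial>\<Lambda> n))"
      by (intro sum.cong refl) (simp add: predictableD[OF g] length_particles nn_integral_cmult)
    then show "(\<Sum>u\<in>particles x n. \<integral>\<^sup>+y. g (x(u := y)) * \<psi> ((x(u := y)) u) \<partial>\<Lambda> n) =
        (g x * of_nat (card (particles x n))) * (\<integral>\<^sup>+y. \<psi> y \<partial>\<Lambda> n)"
      by (simp add: ac_simps)
  qed
  also have "\<dots> = (\<integral>\<^sup>+x. g x * of_nat (card (particles x n)) \<partial>tree_law) * (\<integral>\<^sup>+y. \<psi> y \<partial>\<Lambda> n)"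
    by (rule nn_integral_multc) measurable
  finally show ?thesis .
qed

lemma ennreal_W: "ennreal (W n x) = of_nat (card (particles x n)) * ennreal (1 / pop_mean n)"
  using pop_mean_gt_0[of n]
  by (simp add: W_def ennreal_of_nat_eq_real_of_nat flip: ennreal_mult)

text \<open>The martingale property of \<open>W\<close>, tested against nonnegative weights that are
  determined before generation \<open>n\<close> reproduces.\<close>

lemma nn_integral_W_Suc:
  fixes g :: "(nat list \<Rightarrow> offspring) \<Rightarrow> ennreal"
  assumes [measurable]: "g \<in> borel_measurable tree_law" and g: "predictable n g"
  shows "(\<integral>\<^sup>+x. g x * ennreal (W (Suc n) x) \<partial>tree_law) = (\<integral>\<^sup>+x. g x * ennreal (W n x) \<partial>tree_law)"
proof -
  let ?c = "\<lambda>n. ennreal (1 / pop_mean n)"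
  have "(\<integral>\<^sup>+x. g x * ennreal (W (Suc n) x) \<partial>tree_law) =
      (\<integral>\<^sup>+x. g x * (\<Sum>u\<in>particles x n. of_nat (fst (x u))) * ?c (Suc n) \<partial>tree_law)"
    by (simp add: ennreal_W card_particles_Suc mult.assoc)
  also have "\<dots> = (\<integral>\<^sup>+x. g x * (\<Sum>u\<in>particles x n. of_nat (fst (x u))) \<partial>tree_law) * ?c (Suc n)"
    by (rule nn_integral_multc) (intro borel_measurable_times_ennreal measurable_sum_particles; measurable)
  also have "(\<integral>\<^sup>+x. g x * (\<Sum>u\<in>particles x n. of_nat (fst (x u))) \<partial>tree_law) =
      (\<integral>\<^sup>+x. g x * of_nat (card (particles x n)) \<partial>tree_law) * (\<integral>\<^sup>+y. of_nat (fst y) \<partial>\<Lambda> n)"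
    by (rule nn_integral_children[OF _ g]) measurable
  also have "(\<integral>\<^sup>+y. of_nat (fst y) \<partial>\<Lambda> n) = ennreal (L.mean n)"
    by (simp add: L.ennreal_mean mean_offspring_def)
  also have "(\<integral>\<^sup>+x. g x * of_nat (card (particles x n)) \<partial>tree_law) * ennreal (L.mean n) * ?c (Suc n) =
      (\<integral>\<^sup>+x. g x * of_nat (card (particles x n)) \<partial>tree_law) * ?c n"
    using pop_mean_gt_0[of n] L.mean_gt_0[of n]
    by (simp add: mult.assoc pop_mean_Suc flip: ennreal_mult)
  also have "\<dots> = (\<integral>\<^sup>+x. g x * of_nat (card (particles x n)) * ?c n \<partial>tree_law)"
    by (rule nn_integral_multc[symmetric]) measurable
  also have "\<dots> = (\<integral>\<^sup>+x. g x * ennreal (W n x) \<partial>tree_law)"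
    by (simp add: ennreal_W mult.assoc)
  finally show ?thesis .
qed

lemma nn_integral_W:
  fixes g :: "(nat list \<Rightarrow> offspring) \<Rightarrow> ennreal"
  assumes gm: "g \<in> borel_measurable tree_law" and g: "predictable k g" and "k \<le> n"
  shows "(\<integral>\<^sup>+x. g x * ennreal (W n x) \<partial>tree_law) = (\<integral>\<^sup>+x. g x * ennreal (W k x) \<partial>tree_law)"
  using \<open>k \<le> n\<close>
proof (induction n rule: dec_induct)
  case (step n)
  then show ?case
    using nn_integral_W_Suc[OF gm predictable_mono[OF g, of n]] by simp
qed simp

lemma nn_integral_R:
  fixes g :: "(nat list \<Rightarrow> offspring) \<Rightarrow> ennreal"
  assumes gm [measurable]: "g \<in> borel_measurable tree_law" and g: "predictable k g" and k: "k \<le> n"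
  shows "(\<integral>\<^sup>+x. g x * ennreal (R \<tau> n x) \<partial>tree_law) =
    (\<integral>\<^sup>+x. g x * ennreal (W k x) \<partial>tree_law) * ennreal (2 * large_mean \<tau> n)"
proof -
  let ?\<psi> = "\<lambda>y. ennreal ((large \<tau> n y + large_mean \<tau> n) / pop_mean n)"
  have P: "0 < pop_mean n" by (rule pop_mean_gt_0)
  have "(\<integral>\<^sup>+x. g x * ennreal (R \<tau> n x) \<partial>tree_law) = (\<integral>\<^sup>+x. g x * (\<Sum>u\<in>particles x n. ?\<psi> (x u)) \<partial>tree_law)"
    unfolding R_def using P
    by (simp add: sum_ennreal large_nonneg large_mean_nonneg)
  also have "\<dots> = (\<integral>\<^sup>+x. g x * of_nat (card (particles x n)) \<partial>tree_law) * (\<integral>\<^sup>+y. ?\<psi> y \<partial>\<Lambda> n)"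
    by (rule nn_integral_children[OF _ predictable_mono[OF g k]]) measurable
  also have "(\<integral>\<^sup>+y. ?\<psi> y \<partial>\<Lambda> n) = ennreal (\<integral>y. (large \<tau> n y + large_mean \<tau> n) / pop_mean n \<partial>\<Lambda> n)"
    using P by (intro nn_integral_eq_integral integrable_divide Bochner_Integration.integrable_add integrable_large)
      (auto simp: large_nonneg large_mean_nonneg)
  also have "(\<integral>y. (large \<tau> n y + large_mean \<tau> n) / pop_mean n \<partial>\<Lambda> n) = 1 / pop_mean n * (2 * large_mean \<tau> n)"
    by (simp add: Bochner_Integration.integral_add integrable_large flip: large_mean_def)
  also have "(\<integral>\<^sup>+x. g x * of_nat (card (particles x n)) \<partial>tree_law) * ennreal (1 / pop_mean n * (2 * large_mean \<tau> n)) =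
      (\<integral>\<^sup>+x. g x * of_nat (card (particles x n)) \<partial>tree_law) * ennreal (1 / pop_mean n) * ennreal (2 * large_mean \<tau> n)"
    using P large_mean_nonneg[of \<tau> n] by (simp add: mult.assoc flip: ennreal_mult)
  also have "(\<integral>\<^sup>+x. g x * of_nat (card (particles x n)) \<partial>tree_law) * ennreal (1 / pop_mean n) =
      (\<integral>\<^sup>+x. g x * of_nat (card (particles x n)) * ennreal (1 / pop_mean n) \<partial>tree_law)"
    by (rule nn_integral_multc[symmetric]) measurable
  also have "\<dots> = (\<integral>\<^sup>+x. g x * ennreal (W n x) \<partial>tree_law)"
    by (simp add: ennreal_W mult.assoc)
  also have "\<dots> = (\<integral>\<^sup>+x. g x * ennreal (W k x) \<partial>tree_law)"
    by (rule nn_integral_W[OF gm g k])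
  finally show ?thesis .
qed

text \<open>A variance is at most the second moment, and in the square of
  \<open>cmod (Y1 \<tau> n t y)\<close> truncation bounds one factor by
  \<open>\<tau> / L.mean n\<close>, while the other is at most the normalised offspring number,
  whose mean is 1. A first moment of the offspring number thus suffices.\<close>

lemma nn_integral_Y1_centered:
  assumes \<tau>: "0 \<le> \<tau>"
  shows "(\<integral>\<^sup>+y. ennreal ((cmod (Y1 \<tau> n t y - Y1_mean \<tau> n t))\<^sup>2) \<partial>\<Lambda> n) \<le> ennreal (\<tau> / L.mean n)"
proof -
  have m: "0 < L.mean n" by (rule L.mean_gt_0)
  have Y1_le: "cmod (Y1 \<tau> n t y) \<le> \<tau> / L.mean n" for y
  proof (cases "real (fst y) \<le> \<tau>")
    case True
    then have "real (fst y) / L.mean n \<le> \<tau> / L.mean n"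
      using m by (intro divide_right_mono) auto
    then show ?thesis
      using cmod_Ysum_le[of n t y] True by (simp add: Y1_def)
  qed (use m \<tau> in \<open>simp add: Y1_def\<close>)
  have Ym: "(\<lambda>y. Y1 \<tau> n t y - Y1_mean \<tau> n t) \<in> borel_measurable (\<Lambda> n)" by measurable
  have mean0: "(\<integral>y. Y1 \<tau> n t y - Y1_mean \<tau> n t \<partial>\<Lambda> n) = 0"
    by (simp add: integrable_Y1 flip: Y1_mean_def)
  have bnd: "cmod (Y1 \<tau> n t y - Y1_mean \<tau> n t) \<le> \<tau> / L.mean n + cmod (Y1_mean \<tau> n t)" for y
    by (rule order_trans[OF norm_triangle_ineq4]) (simp add: Y1_le)
  have "(\<integral>\<^sup>+y. ennreal ((cmod (Y1 \<tau> n t y - Y1_mean \<tau> n t))\<^sup>2) \<partial>\<Lambda> n) \<le>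
      ennreal ((cmod (Y1_mean \<tau> n t))\<^sup>2) + ennreal ((cmod 1)\<^sup>2) * (\<integral>\<^sup>+y. ennreal ((cmod (Y1 \<tau> n t y - Y1_mean \<tau> n t))\<^sup>2) \<partial>\<Lambda> n)"
    by simp
  also have "\<dots> = (\<integral>\<^sup>+y. ennreal ((cmod (Y1_mean \<tau> n t + 1 * (Y1 \<tau> n t y - Y1_mean \<tau> n t)))\<^sup>2) \<partial>\<Lambda> n)"
    by (rule nn_integral_cmod_add_sq[OF prob_\<Lambda> Ym mean0 bnd, symmetric])
  also have "\<dots> = (\<integral>\<^sup>+y. ennreal ((cmod (Y1 \<tau> n t y))\<^sup>2) \<partial>\<Lambda> n)"
    by simp
  also have "\<dots> \<le> (\<integral>\<^sup>+y. ennreal (\<tau> / (L.mean n)\<^sup>2 * real (fst y)) \<partial>\<Lambda> n)"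
  proof (intro nn_integral_mono ennreal_leI)
    fix y
    show "(cmod (Y1 \<tau> n t y))\<^sup>2 \<le> \<tau> / (L.mean n)\<^sup>2 * real (fst y)"
    proof (cases "real (fst y) \<le> \<tau>")
      case True
      have "(cmod (Y1 \<tau> n t y))\<^sup>2 \<le> (\<tau> / L.mean n) * (real (fst y) / L.mean n)"
        unfolding power2_eq_square
        using True Y1_le[of y] cmod_Ysum_le[of n t y] m \<tau> by (intro mult_mono) (auto simp: Y1_def)
      then show ?thesis by (simp add: power2_eq_square)
    qed (use m \<tau> in \<open>simp add: Y1_def\<close>)
  qed
  also have "\<dots> = ennreal (\<integral>y. \<tau> / (L.mean n)\<^sup>2 * real (fst y) \<partial>\<Lambda> n)"
    using \<tau> by (intro nn_integral_eq_integral integrable_mult_right L.integrable_offspring) auto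
  also have "(\<integral>y. \<tau> / (L.mean n)\<^sup>2 * real (fst y) \<partial>\<Lambda> n) = \<tau> / L.mean n"
    using m by (simp add: L.integral_offspring power2_eq_square)
  finally show ?thesis .
qed

text \<open>An instance of \<open>second_moment\<close> whose squared coefficients add up to
  \<open>(g x)\<^sup>2 * W n x / pop_mean n\<close>; the martingale property then moves
  \<open>W n\<close> back to \<open>W k\<close>. The weight \<open>g\<close> is carried along so
  that fluctuations can later be measured relative to \<open>W k\<close>.\<close>

lemma nn_integral_Mtr:
  fixes g :: "(nat list \<Rightarrow> offspring) \<Rightarrow> real"
  assumes gm [measurable]: "g \<in> borel_measurable tree_law" and g: "predictable k g" and k: "k \<le> n"
    and \<tau>: "0 \<le> \<tau>"
  shows "(\<integral>\<^sup>+x. ennreal ((g x * cmod (Mtr \<tau> n t x))\<^sup>2) \<partial>tree_law) \<le>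
    (\<integral>\<^sup>+x. ennreal ((g x)\<^sup>2) * ennreal (W k x) \<partial>tree_law) * ennreal (\<tau> / pop_mean (Suc n))"
proof -
  have P: "0 < pop_mean n" by (rule pop_mean_gt_0)
  have m: "0 < L.mean n" by (rule L.mean_gt_0)
  let ?a = "\<lambda>x u. of_real (g x) * (iexp (t * position x u) / of_real (pop_mean n))"
  let ?Y = "\<lambda>y. Y1 \<tau> n t y - Y1_mean \<tau> n t"
  have Y1_le: "cmod (Y1 \<tau> n t y) \<le> \<tau> / L.mean n" for y
  proof (cases "real (fst y) \<le> \<tau>")
    case True
    then have "real (fst y) / L.mean n \<le> \<tau> / L.mean n"
      using m by (intro divide_right_mono) auto
    then show ?thesis
      using cmod_Ysum_le[of n t y] True by (simp add: Y1_def)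
  qed (use m \<tau> in \<open>simp add: Y1_def\<close>)
  have bnd: "cmod (?Y y) \<le> \<tau> / L.mean n + cmod (Y1_mean \<tau> n t)" for y
    by (rule order_trans[OF norm_triangle_ineq4]) (simp add: Y1_le)
  have "(\<integral>\<^sup>+x. ennreal ((g x * cmod (Mtr \<tau> n t x))\<^sup>2) \<partial>tree_law) =
      (\<integral>\<^sup>+x. ennreal ((cmod (\<Sum>u\<in>particles x n. ?a x u * ?Y (x u)))\<^sup>2) \<partial>tree_law)"
  proof (rule nn_integral_cong)
    fix x
    have "(\<Sum>u\<in>particles x n. ?a x u * ?Y (x u)) = of_real (g x) * Mtr \<tau> n t x"
      by (simp add: Mtr_def sum_distrib_left mult.assoc)
    then show "ennreal ((g x * cmod (Mtr \<tau> n t x))\<^sup>2) = ennreal ((cmod (\<Sum>u\<in>particles x n. ?a x u * ?Y (x u)))\<^sup>2)"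
      by (simp add: norm_mult power_mult_distrib)
  qed
  also have "\<dots> \<le> (\<integral>\<^sup>+x. (\<Sum>u\<in>particles x n. ennreal ((cmod (?a x u))\<^sup>2)) \<partial>tree_law)
      * (\<integral>\<^sup>+y. ennreal ((cmod (?Y y))\<^sup>2) \<partial>\<Lambda> n)"
  proof (rule second_moment[OF _ _ _ bnd])
    show "?a (x(v := y)) u = ?a x u" if "length u = n" "length v = n" for x u v y
      using that k by (simp add: position_upd predictableD[OF g])
    show "(\<integral>y. ?Y y \<partial>\<Lambda> n) = 0"
      by (simp add: integrable_Y1 flip: Y1_mean_def)
  qed measurable
  also have "\<dots> \<le> (\<integral>\<^sup>+x. (\<Sum>u\<in>particles x n. ennreal ((cmod (?a x u))\<^sup>2)) \<partial>tree_law) * ennreal (\<tau> / L.mean n)"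
    by (intro mult_left_mono nn_integral_Y1_centered \<tau>) simp
  also have "(\<integral>\<^sup>+x. (\<Sum>u\<in>particles x n. ennreal ((cmod (?a x u))\<^sup>2)) \<partial>tree_law) =
      (\<integral>\<^sup>+x. ennreal ((g x)\<^sup>2) * ennreal (W n x) * ennreal (1 / pop_mean n) \<partial>tree_law)"
  proof (rule nn_integral_cong)
    fix x
    have "(cmod (?a x u))\<^sup>2 = (g x)\<^sup>2 * (1 / pop_mean n)\<^sup>2" for u
      using P by (simp add: norm_mult norm_divide power_mult_distrib power_divide)
    then have "(\<Sum>u\<in>particles x n. ennreal ((cmod (?a x u))\<^sup>2)) =
        ennreal (real (card (particles x n)) * ((g x)\<^sup>2 * (1 / pop_mean n)\<^sup>2))"
      by (simp only: sum_constant ennreal_mult zero_le_power2 mult_nonneg_nonneg of_nat_0_le_iff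
          ennreal_of_nat_eq_real_of_nat)
    also have "real (card (particles x n)) * ((g x)\<^sup>2 * (1 / pop_mean n)\<^sup>2) = (g x)\<^sup>2 * W n x * (1 / pop_mean n)"
      by (simp add: W_def power2_eq_square)
    also have "ennreal \<dots> = ennreal ((g x)\<^sup>2) * ennreal (W n x) * ennreal (1 / pop_mean n)"
      using P W_nonneg[of n x] ennreal_mult[of "(g x)\<^sup>2 * W n x" "1 / pop_mean n"]
        ennreal_mult[of "(g x)\<^sup>2" "W n x"] by simp
    finally show "(\<Sum>u\<in>particles x n. ennreal ((cmod (?a x u))\<^sup>2)) =
        ennreal ((g x)\<^sup>2) * ennreal (W n x) * ennreal (1 / pop_mean n)" .
  qed
  also have "\<dots> = (\<integral>\<^sup>+x. ennreal ((g x)\<^sup>2) * ennreal (W n x) \<partial>tree_law) * ennreal (1 / pop_mean n)"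
    by (rule nn_integral_multc) measurable
  also have "(\<integral>\<^sup>+x. ennreal ((g x)\<^sup>2) * ennreal (W n x) \<partial>tree_law) = (\<integral>\<^sup>+x. ennreal ((g x)\<^sup>2) * ennreal (W k x) \<partial>tree_law)"
    using g by (intro nn_integral_W k) (auto simp: predictable_def)
  also have "\<dots> * ennreal (1 / pop_mean n) * ennreal (\<tau> / L.mean n) = \<dots> * ennreal (\<tau> / pop_mean (Suc n))"
    using P m \<tau> by (simp add: mult.assoc pop_mean_Suc flip: ennreal_mult)
  finally show ?thesis .
qed

end


section \<open>Almost sure bounds\<close>

lemma abs_le_1_plus_square: "\<bar>z\<bar> \<le> 1 + z\<^sup>2" for z :: real
proof -
  have "0 \<le> (\<bar>z\<bar> - 1)\<^sup>2" by simp
  then have "2 * \<bar>z\<bar> \<le> 1 + z\<^sup>2" by (simp add: power2_eq_square algebra_simps flip: abs_mult)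
  then show ?thesis using zero_le_power2[of z] by linarith
qed

lemma ennreal_divide_eqD: "a / b = c \<Longrightarrow> 0 < b \<Longrightarrow> b < \<infinity> \<Longrightarrow> a = c * (b :: ennreal)"
  using ennreal_divide_times by force

lemma AE_suminf_finite:
  assumes [measurable]: "\<And>j. f j \<in> borel_measurable M" and "(\<Sum>j. \<integral>\<^sup>+x. f j x \<partial>M) < \<infinity>"
  shows "AE x in M. (\<Sum>j. f j x) < (\<infinity> :: ennreal)"
proof -
  have "(\<integral>\<^sup>+x. (\<Sum>j. f j x) \<partial>M) < \<infinity>"
    using assms(2) by (subst nn_integral_suminf) auto
  then have "AE x in M. (\<Sum>j. f j x) \<noteq> \<infinity>"
    by (intro nn_integral_PInf_AE borel_measurable_suminf_order) auto
  then show ?thesis by eventually_elim (simp add: less_top)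
qed

lemma suminf_ennreal_finite:
  assumes "\<And>j. 0 \<le> a j" "summable a"
  shows "(\<Sum>j. ennreal (a j)) < \<infinity>"
  using assms by (simp add: suminf_ennreal2 less_top)

lemma AE_summable:
  assumes [measurable]: "\<And>j. f j \<in> borel_measurable M" and nonneg: "\<And>j x. 0 \<le> f j x"
    and le: "\<And>j. (\<integral>\<^sup>+x. ennreal (f j x) \<partial>M) \<le> ennreal (a j)"
    and a: "\<And>j. 0 \<le> a j" "summable a"
  shows "AE x in M. summable (\<lambda>j. f j x :: real)"
proof -
  have "(\<Sum>j. \<integral>\<^sup>+x. ennreal (f j x) \<partial>M) \<le> (\<Sum>j. ennreal (a j))"
    by (intro suminf_le le) auto
  also have "\<dots> < \<infinity>" by (rule suminf_ennreal_finite[OF a])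
  finally have "AE x in M. (\<Sum>j. ennreal (f j x)) < \<infinity>"
    by (intro AE_suminf_finite) auto
  then show ?thesis
    by eventually_elim (auto intro!: summable_suminf_not_top nonneg simp: less_top)
qed

text \<open>The Cauchy-Schwarz inequality on \<open>A\<close> in disguise: integrate the pointwise
  bound \<open>f x \<le> l / 2 + (f x)\<^sup>2 / (2 * l)\<close>.\<close>

lemma nn_integral_le_sqrt_second_moment:
  fixes f :: "'a \<Rightarrow> real"
  assumes [measurable]: "f \<in> borel_measurable M" "A \<in> sets M"
    and nonneg: "\<And>x. 0 \<le> f x" and supp: "\<And>x. x \<notin> A \<Longrightarrow> f x = 0"
    and l: "0 < l" and le: "(\<integral>\<^sup>+x. ennreal ((f x)\<^sup>2) \<partial>M) \<le> ennreal (l\<^sup>2) * emeasure M A"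
  shows "(\<integral>\<^sup>+x. ennreal (f x) \<partial>M) \<le> ennreal l * emeasure M A"
proof -
  have "f x \<le> l / 2 * indicator A x + 1 / (2 * l) * (f x)\<^sup>2" for x
  proof (cases "x \<in> A")
    case True
    have "0 \<le> (f x - l)\<^sup>2" by simp
    then show ?thesis using l True
      by (simp add: power2_eq_square field_simps)
  qed (simp add: supp)
  then have "(\<integral>\<^sup>+x. ennreal (f x) \<partial>M) \<le>
      (\<integral>\<^sup>+x. ennreal (l / 2) * indicator A x + ennreal (1 / (2 * l)) * ennreal ((f x)\<^sup>2) \<partial>M)"
    using l by (intro nn_integral_mono)
      (simp add: ennreal_indicator[symmetric] ennreal_mult[symmetric] ennreal_plus[symmetric] del: ennreal_plus)
  also have "\<dots> = ennreal (l / 2) * emeasure M A + ennreal (1 / (2 * l)) * (\<integral>\<^sup>+x. ennreal ((f x)\<^sup>2) \<partial>M)"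
    by (subst nn_integral_add) (auto simp: nn_integral_cmult)
  also have "\<dots> \<le> ennreal (l / 2) * emeasure M A + ennreal (1 / (2 * l)) * (ennreal (l\<^sup>2) * emeasure M A)"
    by (intro add_left_mono mult_left_mono le) simp
  also have "\<dots> = ennreal (l / 2) * emeasure M A + (ennreal (1 / (2 * l)) * ennreal (l\<^sup>2)) * emeasure M A"
    by (simp only: mult.assoc)
  also have "ennreal (1 / (2 * l)) * ennreal (l\<^sup>2) = ennreal (l / 2)"
    using l by (simp add: power2_eq_square flip: ennreal_mult)
  also have "ennreal (l / 2) * emeasure M A + ennreal (l / 2) * emeasure M A = ennreal l * emeasure M A"
    using l by (simp flip: distrib_right ennreal_plus)
  finally show ?thesis .
qed

context quenched_env
begin

lemma nn_integral_cmod_Mtr: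
  assumes \<tau>: "0 < \<tau>"
  shows "(\<integral>\<^sup>+x. ennreal (cmod (Mtr \<tau> n t x)) \<partial>tree_law) \<le> ennreal (sqrt (\<tau> / pop_mean (Suc n)))"
proof -
  interpret T: prob_space tree_law by (rule prob_tree_law)
  have P: "0 < \<tau> / pop_mean (Suc n)" using \<tau> pop_mean_gt_0[of "Suc n"] by simp
  have one: "emeasure tree_law UNIV = 1" using T.emeasure_space_1 by simp
  have "(\<integral>\<^sup>+x. ennreal ((1 * cmod (Mtr \<tau> n t x))\<^sup>2) \<partial>tree_law) \<le>
      (\<integral>\<^sup>+x. ennreal (1\<^sup>2) * ennreal (W 0 x) \<partial>tree_law) * ennreal (\<tau> / pop_mean (Suc n))"
    using \<tau> by (intro nn_integral_Mtr) (simp_all add: predictable_def)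
  also have "\<dots> = ennreal ((sqrt (\<tau> / pop_mean (Suc n)))\<^sup>2) * emeasure tree_law UNIV"
    using P by (simp add: W_0 one)
  finally have "(\<integral>\<^sup>+x. ennreal ((cmod (Mtr \<tau> n t x))\<^sup>2) \<partial>tree_law) \<le>
      ennreal ((sqrt (\<tau> / pop_mean (Suc n)))\<^sup>2) * emeasure tree_law UNIV" by simp
  then have "(\<integral>\<^sup>+x. ennreal (cmod (Mtr \<tau> n t x)) \<partial>tree_law) \<le>
      ennreal (sqrt (\<tau> / pop_mean (Suc n))) * emeasure tree_law UNIV"
    using P sets.top[of tree_law]
    by (intro nn_integral_le_sqrt_second_moment[where A = UNIV and l = "sqrt (\<tau> / pop_mean (Suc n))"
          and f = "\<lambda>x. cmod (Mtr \<tau> n t x)"]) simp_all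
  then show ?thesis by (simp add: one)
qed

section \<open>Drift and spread of the positions\<close>

definition drift :: "nat \<Rightarrow> real" where
  "drift n = (\<Sum>i<n. displacement_mean (\<Lambda> i))"

definition var :: "nat \<Rightarrow> real" where
  "var n = enn2real (displacement_variance (\<Lambda> n))"

definition spread :: "nat \<Rightarrow> (nat list \<Rightarrow> offspring) \<Rightarrow> real" where
  "spread n x = (\<Sum>u\<in>particles x n. \<bar>position x u - drift n\<bar>) / pop_mean n"

lemma measurable_spread [measurable]: "spread n \<in> borel_measurable tree_law"
  unfolding spread_def by (intro borel_measurable_divide measurable_sum_particles) measurable

lemma spread_nonneg: "0 \<le> spread n x"
  using pop_mean_gt_0[of n] by (simp add: spread_def sum_nonneg)

lemma cmod_Zt_centered: "cmod (Zt n t x * iexp (- t * drift n) - of_real (W n x)) \<le> \<bar>t\<bar> * spread n x"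
proof -
  have e: "iexp (t * position x u) * iexp (- t * drift n) = iexp (t * (position x u - drift n))" for u
    unfolding exp_add[symmetric] by (rule arg_cong[where f = exp]) (simp add: algebra_simps)
  have "Zt n t x * iexp (- t * drift n) = (\<Sum>u\<in>particles x n. iexp (t * (position x u - drift n))) / of_real (pop_mean n)"
    unfolding Zt_def times_divide_eq_left sum_distrib_right e ..
  then have "Zt n t x * iexp (- t * drift n) - of_real (W n x) =
      (\<Sum>u\<in>particles x n. iexp (t * (position x u - drift n)) - 1) / of_real (pop_mean n)"
    by (simp only: W_def of_real_divide of_real_of_nat_eq sum_subtractf diff_divide_distrib sum_constant mult_1_right)
  also have "cmod \<dots> \<le> (\<Sum>u\<in>particles x n. \<bar>t\<bar> * \<bar>position x u - drift n\<bar>) / pop_mean n"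
  proof -
    have "cmod (\<Sum>u\<in>particles x n. iexp (t * (position x u - drift n)) - 1) \<le>
        (\<Sum>u\<in>particles x n. \<bar>t\<bar> * \<bar>position x u - drift n\<bar>)"
    proof (rule sum_norm_le)
      fix u
      show "cmod (iexp (t * (position x u - drift n)) - 1) \<le> \<bar>t\<bar> * \<bar>position x u - drift n\<bar>"
        using iexp_approx1[of "t * (position x u - drift n)" 0] by (simp add: abs_mult)
    qed
    then show ?thesis
      using pop_mean_gt_0[of n] by (simp add: norm_divide divide_right_mono)
  qed
  finally show ?thesis by (simp add: spread_def sum_distrib_left)
qed

end

locale quenched_env_var = quenched_env +
  assumes var_finite: "\<And>n. displacement_variance (\<Lambda> n) < \<infinity>"
begin

lemma ennreal_var: "ennreal (var n) = displacement_variance (\<Lambda> n)"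
  unfolding var_def using var_finite[of n] by simp

lemma var_nonneg: "0 \<le> var n"
  by (simp add: var_def)

lemma displacement_square_integrable:
  "integrable (displacement_law (\<Lambda> n)) (\<lambda>x. (x - displacement_mean (\<Lambda> n))\<^sup>2)"
proof (rule integrableI_bounded)
  show "(\<integral>\<^sup>+x. ennreal (norm ((x - displacement_mean (\<Lambda> n))\<^sup>2)) \<partial>displacement_law (\<Lambda> n)) < \<infinity>"
    using var_finite[of n] by (simp add: displacement_variance_def)
qed (simp cong: measurable_cong_sets add: sets_displacement_law)

lemma displacement_integrable: "integrable (displacement_law (\<Lambda> n)) (\<lambda>x. x)"
proof -
  interpret D: real_distribution "displacement_law (\<Lambda> n)" by (rule L.real_distribution_displacement_law)
  let ?\<mu> = "displacement_mean (\<Lambda> n)"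
  have "integrable (displacement_law (\<Lambda> n)) (\<lambda>x. x - ?\<mu>)"
  proof (rule Bochner_Integration.integrable_bound)
    show "integrable (displacement_law (\<Lambda> n)) (\<lambda>x. 1 + (x - ?\<mu>)\<^sup>2)"
      using displacement_square_integrable by simp
    show "AE x in displacement_law (\<Lambda> n). norm (x - ?\<mu>) \<le> norm (1 + (x - ?\<mu>)\<^sup>2)"
    proof (rule AE_I2)
      fix x
      show "norm (x - ?\<mu>) \<le> norm (1 + (x - ?\<mu>)\<^sup>2)"
        using abs_le_1_plus_square[of "x - ?\<mu>"] by simp
    qed
  qed simp
  then have "integrable (displacement_law (\<Lambda> n)) (\<lambda>x. (x - ?\<mu>) + ?\<mu>)"
    by (intro Bochner_Integration.integrable_add) auto
  then show ?thesis by simp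
qed

lemma nn_integral_displacement_shift:
  "(\<integral>\<^sup>+x. ennreal ((s + (x - displacement_mean (\<Lambda> n)))\<^sup>2) \<partial>displacement_law (\<Lambda> n)) =
    ennreal (s\<^sup>2 + var n)"
proof -
  interpret D: real_distribution "displacement_law (\<Lambda> n)" by (rule L.real_distribution_displacement_law)
  let ?\<mu> = "displacement_mean (\<Lambda> n)"
  have eq: "(s + (x - ?\<mu>))\<^sup>2 = s\<^sup>2 - 2 * s * ?\<mu> + 2 * s * x + (x - ?\<mu>)\<^sup>2" for x
    by (simp add: power2_eq_square algebra_simps)
  have int: "integrable (displacement_law (\<Lambda> n)) (\<lambda>x. (s + (x - ?\<mu>))\<^sup>2)"
    unfolding eq using displacement_integrable displacement_square_integrable by simp
  have v: "(\<integral>x. (x - ?\<mu>)\<^sup>2 \<partial>displacement_law (\<Lambda> n)) = var n"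
    unfolding var_def displacement_variance_def by (rule integral_eq_nn_integral) auto
  have mu: "(\<integral>x. x \<partial>displacement_law (\<Lambda> n)) = ?\<mu>" by (simp add: displacement_mean_def)
  have "(\<integral>\<^sup>+x. ennreal ((s + (x - ?\<mu>))\<^sup>2) \<partial>displacement_law (\<Lambda> n)) =
      ennreal (\<integral>x. (s + (x - ?\<mu>))\<^sup>2 \<partial>displacement_law (\<Lambda> n))"
    by (rule nn_integral_eq_integral[OF int]) simp
  also have "(\<integral>x. (s + (x - ?\<mu>))\<^sup>2 \<partial>displacement_law (\<Lambda> n)) = s\<^sup>2 + var n"
    unfolding eq using displacement_integrable displacement_square_integrable D.prob_space
    by (simp add: v mu)
  finally show ?thesis .
qed

text \<open>Averaged over a child's displacement, the squared deviation is that of the parent plus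
  \<open>var n\<close>, because the cross term is centred. Variances therefore add up along a line
  of descent.\<close>

lemma nn_integral_position_square:
  "(\<integral>\<^sup>+x. (\<Sum>u\<in>particles x n. ennreal ((position x u - drift n)\<^sup>2)) \<partial>tree_law) =
    ennreal (pop_mean n * (\<Sum>i<n. var i))"
proof (induction n)
  case 0
  show ?case by (simp add: position_root drift_def)
next
  case (Suc n)
  interpret T: prob_space tree_law by (rule prob_tree_law)
  let ?\<mu> = "displacement_mean (\<Lambda> n)"
  have P: "0 < pop_mean n" and m: "0 < L.mean n" by (rule pop_mean_gt_0 L.mean_gt_0)+
  have card: "(\<integral>\<^sup>+x. of_nat (card (particles x n)) \<partial>tree_law) = ennreal (pop_mean n)"
  proof -
    have "(\<integral>\<^sup>+x. of_nat (card (particles x n)) \<partial>tree_law) = (\<integral>\<^sup>+x. ennreal (pop_mean n) * (1 * ennreal (W n x)) \<partial>tree_law)"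
      using P by (intro nn_integral_cong) (simp add: W_def ennreal_of_nat_eq_real_of_nat flip: ennreal_mult)
    also have "\<dots> = ennreal (pop_mean n) * (\<integral>\<^sup>+x. 1 * ennreal (W n x) \<partial>tree_law)"
      by (rule nn_integral_cmult) measurable
    also have "(\<integral>\<^sup>+x. 1 * ennreal (W n x) \<partial>tree_law) = (\<integral>\<^sup>+x. 1 * ennreal (W 0 x) \<partial>tree_law)"
      by (rule nn_integral_W) (auto simp: predictable_def)
    finally show ?thesis using T.emeasure_space_1 by (simp add: W_0)
  qed
  have "(\<integral>\<^sup>+x. (\<Sum>u\<in>particles x (Suc n). ennreal ((position x u - drift (Suc n))\<^sup>2)) \<partial>tree_law) =
      (\<integral>\<^sup>+x. (\<Sum>u\<in>particles x n. \<Sum>i<fst (x u). ennreal (((position x u - drift n) + (snd (x u) i - ?\<mu>))\<^sup>2)) \<partial>tree_law)"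
    unfolding sum_particles_Suc by (simp add: position_child drift_def algebra_simps)
  also have "\<dots> = (\<integral>\<^sup>+x. (\<Sum>u\<in>particles x n. \<integral>\<^sup>+y. (\<Sum>i<fst ((x(u := y)) u).
      ennreal (((position (x(u := y)) u - drift n) + (snd ((x(u := y)) u) i - ?\<mu>))\<^sup>2)) \<partial>\<Lambda> n) \<partial>tree_law)"
    by (rule first_moment) (rule measurable_sum_children; measurable)
  also have "\<dots> = (\<integral>\<^sup>+x. (\<Sum>u\<in>particles x n. ennreal (L.mean n) * ennreal ((position x u - drift n)\<^sup>2)) +
      ennreal (L.mean n * var n) * of_nat (card (particles x n)) \<partial>tree_law)"
  proof (rule nn_integral_cong)
    fix x
    have "(\<integral>\<^sup>+y. (\<Sum>i<fst ((x(u := y)) u).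
        ennreal (((position (x(u := y)) u - drift n) + (snd ((x(u := y)) u) i - ?\<mu>))\<^sup>2)) \<partial>\<Lambda> n) =
        ennreal (L.mean n) * ennreal ((position x u - drift n)\<^sup>2) + ennreal (L.mean n * var n)" for u
    proof -
      let ?s = "position x u - drift n"
      have "(\<integral>\<^sup>+y. (\<Sum>i<fst y. ennreal ((?s + (snd y i - ?\<mu>))\<^sup>2)) \<partial>\<Lambda> n) / mean_offspring (\<Lambda> n) = ennreal (?s\<^sup>2 + var n)"
        unfolding nn_integral_displacement_shift[symmetric]
        by (rule nn_integral_displacement_law[OF sets_\<Lambda>, symmetric]) measurable
      then have "(\<integral>\<^sup>+y. (\<Sum>i<fst y. ennreal ((?s + (snd y i - ?\<mu>))\<^sup>2)) \<partial>\<Lambda> n) = ennreal (?s\<^sup>2 + var n) * mean_offspring (\<Lambda> n)"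
        by (rule ennreal_divide_eqD[OF _ mean_pos mean_finite])
      then show ?thesis
        using m var_nonneg[of n]
        by (simp add: position_upd ennreal_mult distrib_left mult.commute flip: L.ennreal_mean)
    qed
    then show "(\<Sum>u\<in>particles x n. \<integral>\<^sup>+y. (\<Sum>i<fst ((x(u := y)) u).
        ennreal (((position (x(u := y)) u - drift n) + (snd ((x(u := y)) u) i - ?\<mu>))\<^sup>2)) \<partial>\<Lambda> n) =
        (\<Sum>u\<in>particles x n. ennreal (L.mean n) * ennreal ((position x u - drift n)\<^sup>2)) +
        ennreal (L.mean n * var n) * of_nat (card (particles x n))"
      by (simp add: sum.distrib mult.commute)
  qed
  also have "\<dots> = ennreal (L.mean n) * (\<integral>\<^sup>+x. (\<Sum>u\<in>particles x n. ennreal ((position x u - drift n)\<^sup>2)) \<partial>tree_law) +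
      ennreal (L.mean n * var n) * (\<integral>\<^sup>+x. of_nat (card (particles x n)) \<partial>tree_law)"
  proof (subst nn_integral_add)
    show [measurable]: "(\<lambda>x. \<Sum>u\<in>particles x n. ennreal (L.mean n) * ennreal ((position x u - drift n)\<^sup>2)) \<in> borel_measurable tree_law"
      by (rule measurable_sum_particles) measurable
    have [measurable]: "(\<lambda>x. \<Sum>u\<in>particles x n. ennreal ((position x u - drift n)\<^sup>2)) \<in> borel_measurable tree_law"
      by (rule measurable_sum_particles) measurable
    show "(\<integral>\<^sup>+x. (\<Sum>u\<in>particles x n. ennreal (L.mean n) * ennreal ((position x u - drift n)\<^sup>2)) \<partial>tree_law) +
       (\<integral>\<^sup>+x. ennreal (L.mean n * var n) * of_nat (card (particles x n)) \<partial>tree_law) =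
       ennreal (L.mean n) * (\<integral>\<^sup>+x. (\<Sum>u\<in>particles x n. ennreal ((position x u - drift n)\<^sup>2)) \<partial>tree_law) +
       ennreal (L.mean n * var n) * (\<integral>\<^sup>+x. of_nat (card (particles x n)) \<partial>tree_law)"
      unfolding sum_distrib_left[symmetric] by (subst (1 2) nn_integral_cmult) (auto simp del: sum_ennreal)
  qed measurable
  also have "\<dots> = ennreal (pop_mean (Suc n) * (\<Sum>i<Suc n. var i))"
    unfolding Suc card using P m var_nonneg
    by (simp add: pop_mean_Suc algebra_simps sum_nonneg flip: ennreal_mult ennreal_plus)
  finally show ?case .
qed

lemma nn_integral_spread: "(\<integral>\<^sup>+x. ennreal (spread n x) \<partial>tree_law) \<le> ennreal (1 + (\<Sum>i<n. var i))"
proof -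
  interpret T: prob_space tree_law by (rule prob_tree_law)
  have P: "0 < pop_mean n" by (rule pop_mean_gt_0)
  have sm [measurable]: "(\<lambda>x. \<Sum>u\<in>particles x n. ennreal ((position x u - drift n)\<^sup>2)) \<in> borel_measurable tree_law"
    by (rule measurable_sum_particles) measurable
  have "(\<integral>\<^sup>+x. ennreal (spread n x) \<partial>tree_law) \<le> (\<integral>\<^sup>+x. 1 * ennreal (W n x) +
      ennreal (1 / pop_mean n) * (\<Sum>u\<in>particles x n. ennreal ((position x u - drift n)\<^sup>2)) \<partial>tree_law)"
  proof (rule nn_integral_mono)
    fix x
    have "spread n x \<le> (\<Sum>u\<in>particles x n. 1 + (position x u - drift n)\<^sup>2) / pop_mean n"
      unfolding spread_def using P by (intro divide_right_mono sum_mono abs_le_1_plus_square) auto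
    also have "\<dots> = W n x + 1 / pop_mean n * (\<Sum>u\<in>particles x n. (position x u - drift n)\<^sup>2)"
      by (simp add: sum.distrib W_def add_divide_distrib)
    finally have "ennreal (spread n x) \<le> ennreal \<dots>" by (rule ennreal_leI)
    also have "\<dots> = 1 * ennreal (W n x) + ennreal (1 / pop_mean n) * ennreal (\<Sum>u\<in>particles x n. (position x u - drift n)\<^sup>2)"
      using P by (subst ennreal_plus) (auto simp: W_nonneg sum_nonneg ennreal_mult'[symmetric])
    finally show "ennreal (spread n x) \<le> 1 * ennreal (W n x) +
        ennreal (1 / pop_mean n) * (\<Sum>u\<in>particles x n. ennreal ((position x u - drift n)\<^sup>2))"
      by (simp add: sum_ennreal)
  qed
  also have "\<dots> = (\<integral>\<^sup>+x. 1 * ennreal (W n x) \<partial>tree_law) +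
      ennreal (1 / pop_mean n) * (\<integral>\<^sup>+x. (\<Sum>u\<in>particles x n. ennreal ((position x u - drift n)\<^sup>2)) \<partial>tree_law)"
    by (subst nn_integral_add) (auto simp: nn_integral_cmult simp del: sum_ennreal)
  also have "(\<integral>\<^sup>+x. 1 * ennreal (W n x) \<partial>tree_law) = (\<integral>\<^sup>+x. 1 * ennreal (W 0 x) \<partial>tree_law)"
    by (rule nn_integral_W) (auto simp: predictable_def)
  also have "\<dots> = 1" using T.emeasure_space_1 by (simp add: W_0)
  also have "1 + ennreal (1 / pop_mean n) * (\<integral>\<^sup>+x. (\<Sum>u\<in>particles x n. ennreal ((position x u - drift n)\<^sup>2)) \<partial>tree_law) =
      ennreal (1 + (\<Sum>i<n. var i))"
    unfolding nn_integral_position_square using P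
    by (simp add: sum_nonneg var_nonneg flip: ennreal_mult ennreal_plus ennreal_1)
  finally show ?thesis .
qed

end


section \<open>Growth of the population\<close>

context quenched_env
begin

lemma \<phi>_0: "\<phi> n 0 = 1"
  by (rule real_distribution.char_zero[OF L.real_distribution_displacement_law])

lemma W_diff_le: "\<bar>W (Suc n) x - W n x\<bar> \<le> cmod (Mtr \<tau> n 0 x) + R \<tau> n x"
proof -
  have "cmod (of_real (W (Suc n) x - W n x)) \<le> cmod (Mtr \<tau> n 0 x) + R \<tau> n x"
    using martingale_difference_le[of n 0 x \<tau>] by (simp add: Zt_0 \<phi>_0)
  then show ?thesis by (simp only: norm_of_real)
qed

lemma AE_weighted_R_summable:
  assumes "summable (\<lambda>j. w j * large_mean (\<tau> j) j)" "\<And>j. 0 \<le> w j"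
  shows "AE x in tree_law. summable (\<lambda>j. w j * R (\<tau> j) j x)"
proof (rule AE_summable)
  show "summable (\<lambda>j. w j * (2 * large_mean (\<tau> j) j))"
    using summable_mult[OF assms(1), of 2] by (simp add: ac_simps)
  fix j
  show "(\<lambda>x. w j * R (\<tau> j) j x) \<in> borel_measurable tree_law" by measurable
  show "0 \<le> w j * R (\<tau> j) j x" for x by (intro mult_nonneg_nonneg assms R_nonneg)
  show "0 \<le> w j * (2 * large_mean (\<tau> j) j)" using assms(2)[of j] large_mean_nonneg[of "\<tau> j" j] by simp
  interpret T: prob_space tree_law by (rule prob_tree_law)
  have one: "emeasure tree_law UNIV = 1" using T.emeasure_space_1 by simp
  have "(\<integral>\<^sup>+x. ennreal (w j * R (\<tau> j) j x) \<partial>tree_law) = (\<integral>\<^sup>+x. ennreal (w j) * ennreal (R (\<tau> j) j x) \<partial>tree_law)"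
    by (simp add: ennreal_mult assms R_nonneg)
  also have "\<dots> = (\<integral>\<^sup>+x. ennreal (w j) * ennreal (W 0 x) \<partial>tree_law) * ennreal (2 * large_mean (\<tau> j) j)"
    by (rule nn_integral_R) (simp_all add: predictable_def)
  also have "\<dots> = ennreal (w j * (2 * large_mean (\<tau> j) j))"
    using assms(2)[of j] large_mean_nonneg[of "\<tau> j" j] by (simp add: W_0 one flip: ennreal_mult)
  finally show "(\<integral>\<^sup>+x. ennreal (w j * R (\<tau> j) j x) \<partial>tree_law) \<le> ennreal (w j * (2 * large_mean (\<tau> j) j))"
    by simp
qed

context
  fixes d C :: real
  assumes d: "0 < d" and C: "0 < C" and growth: "\<And>n. C * exp (2 * d * real n) \<le> pop_mean n"
begin

text \<open>The truncation level has half the exponent of the guaranteed population growth. The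
  quotient then decays like \<open>exp (- d * real j)\<close>, and its root at half that
  rate.\<close>

lemma truncated_sqrt_bound: "sqrt (exp (d * real j) / pop_mean (Suc j)) \<le> 1 / sqrt C * exp (- (d / 2) * real j)"
proof -
  have P: "0 < pop_mean (Suc j)" by (rule pop_mean_gt_0)
  have "C * exp (2 * d * real j) \<le> C * exp (2 * d * real (Suc j))"
    using C d by simp
  also have "\<dots> \<le> pop_mean (Suc j)" by (rule growth)
  finally have "exp (d * real j) / pop_mean (Suc j) \<le> exp (d * real j) / (C * exp (2 * d * real j))"
    using C by (intro divide_left_mono) (auto intro!: mult_pos_pos P)
  also have "\<dots> = (1 / sqrt C * exp (- (d / 2) * real j))\<^sup>2"
  proof -
    have "exp (d * real j) / exp (2 * d * real j) = (exp (- (d / 2) * real j))\<^sup>2"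
      unfolding exp_diff[symmetric] power2_eq_square exp_add[symmetric] by (rule arg_cong[where f = exp]) simp
    moreover have "exp (d * real j) / (C * exp (2 * d * real j)) = 1 / C * (exp (d * real j) / exp (2 * d * real j))"
      by simp
    moreover have "(1 / sqrt C)\<^sup>2 = 1 / C" using C by (simp add: power_divide mult_ac)
    ultimately show ?thesis by (simp only: power_mult_distrib)
  qed
  finally show ?thesis
    using C by (intro real_le_lsqrt) auto
qed

lemma AE_Mtr_0_summable: "AE x in tree_law. summable (\<lambda>j. cmod (Mtr (exp (d * real j)) j 0 x))"
proof (rule AE_summable)
  have "summable (\<lambda>j. exp (- (d / 2)) ^ j)" using d by (intro summable_geometric) simp
  then show "summable (\<lambda>j. 1 / sqrt C * exp (- (d / 2) * real j))"
    by (intro summable_mult) (simp add: exp_of_nat_mult[symmetric] mult.commute)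
  fix j
  show "(\<integral>\<^sup>+x. ennreal (cmod (Mtr (exp (d * real j)) j 0 x)) \<partial>tree_law) \<le> ennreal (1 / sqrt C * exp (- (d / 2) * real j))"
    by (rule order_trans[OF nn_integral_cmod_Mtr ennreal_leI[OF truncated_sqrt_bound]]) simp
  show "0 \<le> 1 / sqrt C * exp (- (d / 2) * real j)" using C by simp
qed auto

text \<open>Tonelli averages the \<open>L\<^sup>1\<close> norm over \<open>{-K..K}\<close>. Of the
  available decay \<open>exp (- (d / 2) * real j)\<close> half is kept for summability, and the
  other half becomes a weight that will beat \<open>b n\<close> when the sum starts at generation
  \<open>cut n\<close>.\<close>

lemma AE_Mtr_integral_finite:
  "AE x in tree_law. (\<Sum>j. ennreal (exp (d / 4 * real j)) *
    (\<integral>\<^sup>+t. ennreal (cmod (Mtr (exp (d * real j)) j t x)) * indicator {-K..K} t \<partial>lborel)) < \<infinity>"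
proof (rule AE_suminf_finite)
  interpret T: prob_space tree_law by (rule prob_tree_law)
  interpret pair_sigma_finite "lborel :: real measure" tree_law ..
  have [measurable]: "(\<lambda>x. \<integral>\<^sup>+t. ennreal (cmod (Mtr \<tau> j t x)) * indicator {-K..K} t \<partial>lborel) \<in> borel_measurable tree_law" for \<tau> j
  proof (rule lborel.borel_measurable_nn_integral)
    have "(\<lambda>p. Mtr \<tau> j (snd p) (fst p)) \<in> borel_measurable (tree_law \<Otimes>\<^sub>M lborel)"
      using measurable_compose[OF _ measurable_Mtr_joint[of \<tau> j], of "\<lambda>p. (snd p, fst p)" "tree_law \<Otimes>\<^sub>M lborel"]
      by simp
    then show "(\<lambda>(x, t). ennreal (cmod (Mtr \<tau> j t x)) * indicator {-K..K} t) \<in> borel_measurable (tree_law \<Otimes>\<^sub>M lborel)"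
      unfolding split_beta' by measurable
  qed
  show "(\<lambda>x. ennreal (exp (d / 4 * real j)) *
      (\<integral>\<^sup>+t. ennreal (cmod (Mtr (exp (d * real j)) j t x)) * indicator {-K..K} t \<partial>lborel)) \<in> borel_measurable tree_law" for j
    by measurable
  have bound: "(\<integral>\<^sup>+x. ennreal (exp (d / 4 * real j)) *
      (\<integral>\<^sup>+t. ennreal (cmod (Mtr (exp (d * real j)) j t x)) * indicator {-K..K} t \<partial>lborel) \<partial>tree_law) \<le>
      ennreal (1 / sqrt C * (2 * \<bar>K\<bar>) * exp (- (d / 4) * real j))" for j
  proof -
    let ?M = "\<lambda>t x. ennreal (cmod (Mtr (exp (d * real j)) j t x))"
    have [measurable]: "(\<lambda>p. Mtr \<tau> j (fst p) (snd p)) \<in> borel_measurable (lborel \<Otimes>\<^sub>M tree_law)" for \<tau>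
      using measurable_Mtr_joint[of \<tau> j] by (simp cong: measurable_cong_sets sets_pair_measure_cong)
    have "(\<integral>\<^sup>+x. ennreal (exp (d / 4 * real j)) * (\<integral>\<^sup>+t. ?M t x * indicator {-K..K} t \<partial>lborel) \<partial>tree_law) =
        ennreal (exp (d / 4 * real j)) * (\<integral>\<^sup>+x. (\<integral>\<^sup>+t. ?M t x * indicator {-K..K} t \<partial>lborel) \<partial>tree_law)"
      by (rule nn_integral_cmult) measurable
    also have "(\<integral>\<^sup>+x. (\<integral>\<^sup>+t. ?M t x * indicator {-K..K} t \<partial>lborel) \<partial>tree_law) =
        (\<integral>\<^sup>+t. (\<integral>\<^sup>+x. ?M t x * indicator {-K..K} t \<partial>tree_law) \<partial>lborel)"
      by (rule Fubini') (simp add: split_beta')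
    also have "\<dots> = (\<integral>\<^sup>+t. (\<integral>\<^sup>+x. ?M t x \<partial>tree_law) * indicator {-K..K} t \<partial>lborel)"
      by (intro nn_integral_cong nn_integral_multc) measurable
    also have "\<dots> \<le> (\<integral>\<^sup>+t. ennreal (1 / sqrt C * exp (- (d / 2) * real j)) * indicator {-K..K} t \<partial>lborel)"
      by (intro nn_integral_mono mult_right_mono
          order_trans[OF nn_integral_cmod_Mtr ennreal_leI[OF truncated_sqrt_bound]]) simp_all
    also have "\<dots> = ennreal (1 / sqrt C * exp (- (d / 2) * real j)) * emeasure lborel {-K..K}"
      by (rule nn_integral_cmult_indicator) simp
    also have "\<dots> \<le> ennreal (1 / sqrt C * exp (- (d / 2) * real j)) * ennreal (2 * \<bar>K\<bar>)"
      by (intro mult_left_mono) (auto simp: emeasure_lborel_Icc_eq intro!: ennreal_leI)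
    also have "ennreal (exp (d / 4 * real j)) * (ennreal (1 / sqrt C * exp (- (d / 2) * real j)) * ennreal (2 * \<bar>K\<bar>)) =
        ennreal (1 / sqrt C * (2 * \<bar>K\<bar>) * exp (- (d / 4) * real j))"
    proof -
      have "exp (d / 4 * real j) * exp (- (d / 2) * real j) = exp (- (d / 4) * real j)"
        unfolding exp_add[symmetric] by (rule arg_cong[where f = exp]) (simp add: field_simps)
      then have "exp (d / 4 * real j) * (1 / sqrt C * exp (- (d / 2) * real j) * (2 * \<bar>K\<bar>)) =
          1 / sqrt C * (2 * \<bar>K\<bar>) * exp (- (d / 4) * real j)"
        by (simp add: mult_ac)
      moreover have "0 \<le> 1 / sqrt C * exp (- (d / 2) * real j)" using C by simp
      ultimately show ?thesis by (simp only: ennreal_mult[symmetric] exp_ge_zero mult_nonneg_nonneg abs_ge_zero zero_le_numeral)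
    qed
    finally show ?thesis by (simp add: mult_left_mono)
  qed
  have "summable (\<lambda>j. exp (- (d / 4)) ^ j)" using d by (intro summable_geometric) simp
  then have sm: "summable (\<lambda>j. 1 / sqrt C * (2 * \<bar>K\<bar>) * exp (- (d / 4) * real j))"
    by (intro summable_mult) (simp add: exp_of_nat_mult[symmetric] mult.commute)
  have "(\<Sum>j. \<integral>\<^sup>+x. ennreal (exp (d / 4 * real j)) *
      (\<integral>\<^sup>+t. ennreal (cmod (Mtr (exp (d * real j)) j t x)) * indicator {-K..K} t \<partial>lborel) \<partial>tree_law) \<le>
      (\<Sum>j. ennreal (1 / sqrt C * (2 * \<bar>K\<bar>) * exp (- (d / 4) * real j)))"
    by (intro suminf_le bound) auto
  also have "\<dots> < \<infinity>"
    using C by (intro suminf_ennreal_finite sm) auto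
  finally show "(\<Sum>j. \<integral>\<^sup>+x. ennreal (exp (d / 4 * real j)) *
      (\<integral>\<^sup>+t. ennreal (cmod (Mtr (exp (d * real j)) j t x)) * indicator {-K..K} t \<partial>lborel) \<partial>tree_law) < \<infinity>" .
qed

lemma AE_W_convergent:
  assumes "summable (\<lambda>j. large_mean (exp (d * real j)) j)"
  shows "AE x in tree_law. convergent (\<lambda>n. W n x)"
proof -
  have "AE x in tree_law. summable (\<lambda>j. 1 * R (exp (d * real j)) j x)"
    using assms by (intro AE_weighted_R_summable) auto
  with AE_Mtr_0_summable show ?thesis
  proof eventually_elim
    case (elim x)
    have "summable (\<lambda>n. W (Suc n) x - W n x)"
      by (rule summable_comparison_test'[OF summable_add[OF elim]]) (use W_diff_le in simp)
    then obtain s where "(\<lambda>n. \<Sum>i<n. W (Suc i) x - W i x) \<longlonglongrightarrow> s"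
      by (auto simp: summable_def sums_def)
    then have "(\<lambda>n. W n x - W 0 x) \<longlonglongrightarrow> s"
      by (simp only: sum_lessThan_telescope[of "\<lambda>i. W i x"])
    then have "(\<lambda>n. (W n x - W 0 x) + W 0 x) \<longlonglongrightarrow> s + W 0 x"
      by (intro tendsto_intros)
    then show ?case by (auto simp: convergent_def)
  qed
qed

end

text \<open>
  Given generation \<open>k\<close>, the remainders have mean at most \<open>2 \<epsilon> W k\<close> and the truncated differences at most
  \<open>C W k / sqrt l\<close> on \<open>A\<close>; Markov's inequality combines both.
\<close>
lemma emeasure_large_fluctuation:
  fixes \<epsilon> B C d :: real and k l :: nat
  assumes l: "0 < l" and A [measurable]: "A \<in> sets tree_law"
    and pred: "predictable k (\<lambda>x. x \<in> A)" and card: "\<And>x. x \<in> A \<Longrightarrow> l \<le> card (particles x k)"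
    and rho: "(\<Sum>i. ennreal (large_mean (exp (d * (real i + B))) (k + i))) \<le> ennreal \<epsilon>"
    and s: "(\<Sum>i. ennreal (sqrt (exp (d * (real i + B)) * pop_mean k / pop_mean (Suc (k + i))))) \<le> ennreal C"
    and C: "C / sqrt (real l) \<le> \<epsilon>" "0 \<le> C"
  shows "emeasure tree_law {x\<in>A. ennreal (W k x / 2) \<le> (\<Sum>i. ennreal
      (cmod (Mtr (exp (d * (real i + B))) (k + i) 0 x) + R (exp (d * (real i + B))) (k + i) x))} \<le>
    ennreal (6 * \<epsilon>) * emeasure tree_law A"
proof -
  let ?\<tau> = "\<lambda>i :: nat. exp (d * (real i + B))"
  let ?M = "\<lambda>i x. cmod (Mtr (?\<tau> i) (k + i) 0 x)" and ?R = "\<lambda>i x. R (?\<tau> i) (k + i) x"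
  let ?D = "\<lambda>x. \<Sum>i. ennreal (?M i x + ?R i x)"
  \<comment> \<open>Dividing by \<open>W k\<close> turns fluctuations relative to \<open>W k\<close>
    into absolute ones. The weight is predictable because both \<open>A\<close> and
    \<open>W k\<close> are determined before generation \<open>k\<close> reproduces.\<close>
  define g where "g x = (if x \<in> A then 1 / W k x else 0)" for x
  have Ppos: "0 < pop_mean n" for n by (rule pop_mean_gt_0)
  have Wk: "real l / pop_mean k \<le> W k x" if "x \<in> A" for x
    using card[OF that] Ppos[of k] by (simp add: W_def divide_right_mono)
  have Wpos: "0 < W k x" if "x \<in> A" for x
    using Wk[OF that] l Ppos[of k] by (intro less_le_trans[OF _ Wk[OF that]]) simp
  have e0: "0 \<le> \<epsilon>" using C l by (meson divide_nonneg_nonneg order_trans real_sqrt_ge_zero of_nat_0_le_iff)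
  have gm [measurable]: "g \<in> borel_measurable tree_law" unfolding g_def by measurable
  have g0: "0 \<le> g x" for x by (simp add: g_def W_nonneg)
  have gp: "predictable k g"
  proof -
    have "(x(u := y) \<in> A) = (x \<in> A)" if "k \<le> length u" for x u y
      by (rule predictableD[OF pred that])
    then show ?thesis
      by (auto simp: predictable_def g_def W_def particles_upd)
  qed
  have gW: "(\<integral>\<^sup>+x. ennreal (g x) * ennreal (W k x) \<partial>tree_law) = emeasure tree_law A"
  proof -
    have "ennreal (g x) * ennreal (W k x) = indicator A x" for x
    proof (cases "x \<in> A")
      case True
      then have "g x * W k x = 1" "0 \<le> g x" "0 \<le> W k x" using Wpos[OF True] by (simp_all add: g_def)
      then show ?thesis using True by (simp flip: ennreal_mult)
    qed (simp add: g_def)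
    then show ?thesis by simp
  qed
  \<comment> \<open>On \<open>A\<close> there are at least \<open>l\<close> particles, so the second
    factor \<open>1 / W k x\<close> costs at most \<open>pop_mean k / real l\<close>. This is the
    origin of the gain \<open>1 / sqrt (real l)\<close>.\<close>
  have g2W: "(\<integral>\<^sup>+x. ennreal ((g x)\<^sup>2) * ennreal (W k x) \<partial>tree_law) \<le> ennreal (pop_mean k / real l) * emeasure tree_law A"
  proof -
    have "(\<integral>\<^sup>+x. ennreal ((g x)\<^sup>2) * ennreal (W k x) \<partial>tree_law) \<le> (\<integral>\<^sup>+x. ennreal (pop_mean k / real l) * indicator A x \<partial>tree_law)"
    proof (rule nn_integral_mono)
      fix x
      show "ennreal ((g x)\<^sup>2) * ennreal (W k x) \<le> ennreal (pop_mean k / real l) * indicator A x"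
      proof (cases "x \<in> A")
        case True
        have "(g x)\<^sup>2 * W k x = 1 / W k x"
          using Wpos[OF True] True by (simp add: g_def power2_eq_square)
        also have "\<dots> \<le> 1 / (real l / pop_mean k)"
          using Wk[OF True] l Ppos[of k] by (intro frac_le) auto
        finally have "(g x)\<^sup>2 * W k x \<le> pop_mean k / real l" by simp
        then show ?thesis
          using True by (simp add: ennreal_leI W_nonneg flip: ennreal_mult)
      qed (simp add: g_def)
    qed
    then show ?thesis by (simp add: nn_integral_cmult)
  qed
  have R: "(\<integral>\<^sup>+x. ennreal (g x) * ennreal (?R i x) \<partial>tree_law) = 2 * ennreal (large_mean (?\<tau> i) (k + i)) * emeasure tree_law A" for i
  proof -
    have "(\<integral>\<^sup>+x. ennreal (g x) * ennreal (?R i x) \<partial>tree_law) =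
        (\<integral>\<^sup>+x. ennreal (g x) * ennreal (W k x) \<partial>tree_law) * ennreal (2 * large_mean (?\<tau> i) (k + i))"
      using gp by (intro nn_integral_R) (auto simp: predictable_def)
    then show ?thesis
      unfolding gW by (simp add: ennreal_mult large_mean_nonneg mult.commute)
  qed
  have M: "(\<integral>\<^sup>+x. ennreal (g x) * ennreal (?M i x) \<partial>tree_law) \<le>
      ennreal (1 / sqrt (real l)) * ennreal (sqrt (?\<tau> i * pop_mean k / pop_mean (Suc (k + i)))) * emeasure tree_law A" for i
  proof -
    let ?l = "sqrt (?\<tau> i * pop_mean k / pop_mean (Suc (k + i))) / sqrt (real l)"
    have lpos: "0 < ?l" using l Ppos by (intro divide_pos_pos) auto
    have "(\<integral>\<^sup>+x. ennreal ((g x * ?M i x)\<^sup>2) \<partial>tree_law) \<le>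
        (\<integral>\<^sup>+x. ennreal ((g x)\<^sup>2) * ennreal (W k x) \<partial>tree_law) * ennreal (?\<tau> i / pop_mean (Suc (k + i)))"
      by (rule nn_integral_Mtr[OF gm gp]) auto
    also have "\<dots> \<le> ennreal (pop_mean k / real l) * emeasure tree_law A * ennreal (?\<tau> i / pop_mean (Suc (k + i)))"
      by (intro mult_right_mono g2W) simp
    also have "\<dots> = (ennreal (pop_mean k / real l) * ennreal (?\<tau> i / pop_mean (Suc (k + i)))) * emeasure tree_law A"
      by (simp only: mult_ac)
    also have "ennreal (pop_mean k / real l) * ennreal (?\<tau> i / pop_mean (Suc (k + i))) = ennreal (?l\<^sup>2)"
    proof -
      have "?l\<^sup>2 = pop_mean k / real l * (?\<tau> i / pop_mean (Suc (k + i)))"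
        using Ppos[of k] Ppos[of "Suc (k + i)"] by (simp add: power_divide mult_ac)
      then show ?thesis
        using Ppos[of k] Ppos[of "Suc (k + i)"] by (simp only: ennreal_mult divide_nonneg_nonneg less_imp_le of_nat_0_le_iff exp_ge_zero)
    qed
    finally have "(\<integral>\<^sup>+x. ennreal (g x * ?M i x) \<partial>tree_law) \<le> ennreal ?l * emeasure tree_law A"
      using lpos g0 by (intro nn_integral_le_sqrt_second_moment[where f = "\<lambda>x. g x * ?M i x" and A = A]) (auto simp: g_def)
    moreover have "ennreal ?l = ennreal (1 / sqrt (real l)) * ennreal (sqrt (?\<tau> i * pop_mean k / pop_mean (Suc (k + i))))"
    proof -
      have "?l = 1 / sqrt (real l) * sqrt (?\<tau> i * pop_mean k / pop_mean (Suc (k + i)))" by simp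
      then show ?thesis
        using Ppos[of k] Ppos[of "Suc (k + i)"]
        by (simp only: ennreal_mult real_sqrt_ge_zero divide_nonneg_nonneg mult_nonneg_nonneg less_imp_le of_nat_0_le_iff exp_ge_zero zero_le_one)
    qed
    ultimately show ?thesis by (simp add: ennreal_mult g0)
  qed
  have "emeasure tree_law {x\<in>A. ennreal (W k x / 2) \<le> ?D x} =
      (\<integral>\<^sup>+x. indicator {x\<in>A. ennreal (W k x / 2) \<le> ?D x} x \<partial>tree_law)"
  proof (rule nn_integral_indicator[symmetric])
    have "{x\<in>space tree_law. ennreal (W k x / 2) \<le> ?D x} \<in> sets tree_law" by measurable
    moreover have "{x\<in>A. ennreal (W k x / 2) \<le> ?D x} = A \<inter> {x\<in>space tree_law. ennreal (W k x / 2) \<le> ?D x}"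
      by auto
    ultimately show "{x\<in>A. ennreal (W k x / 2) \<le> ?D x} \<in> sets tree_law" using A by simp
  qed
  also have "\<dots> \<le> (\<integral>\<^sup>+x. 2 * (\<Sum>i. ennreal (g x) * ennreal (?M i x) + ennreal (g x) * ennreal (?R i x)) \<partial>tree_law)"
  proof (rule nn_integral_mono)
    fix x
    show "indicator {x\<in>A. ennreal (W k x / 2) \<le> ?D x} x \<le> 2 * (\<Sum>i. ennreal (g x) * ennreal (?M i x) + ennreal (g x) * ennreal (?R i x))"
    proof (cases "x \<in> A \<and> ennreal (W k x / 2) \<le> ?D x")
      case True
      have "(1 :: ennreal) = ennreal (2 * (g x * (W k x / 2)))"
        using Wpos[of x] True by (simp add: g_def)
      also have "\<dots> = 2 * (ennreal (g x) * ennreal (W k x / 2))"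
        using g0[of x] W_nonneg[of k x] ennreal_mult[of 2 "g x * (W k x / 2)"] ennreal_mult[of "g x" "W k x / 2"]
        by (simp del: times_divide_eq_right)
      also have "\<dots> \<le> 2 * (ennreal (g x) * ?D x)"
        using True by (intro mult_left_mono) auto
      also have "ennreal (g x) * ?D x = (\<Sum>i. ennreal (g x) * ennreal (?M i x + ?R i x))"
        by (rule ennreal_suminf_cmult[symmetric])
      also have "\<dots> = (\<Sum>i. ennreal (g x) * ennreal (?M i x) + ennreal (g x) * ennreal (?R i x))"
        by (simp add: ennreal_plus R_nonneg distrib_left)
      finally show ?thesis using True by simp
    next
      case False
      then have "x \<notin> {x\<in>A. ennreal (W k x / 2) \<le> ?D x}" by blast
      then show ?thesis by simp
    qed
  qed
  also have "\<dots> = 2 * (\<Sum>i. (\<integral>\<^sup>+x. ennreal (g x) * ennreal (?M i x) \<partial>tree_law) + (\<integral>\<^sup>+x. ennreal (g x) * ennreal (?R i x) \<partial>tree_law))"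
    by (subst nn_integral_cmult, measurable, subst nn_integral_suminf, measurable, subst nn_integral_add, measurable)
  also have "\<dots> \<le> 2 * (\<Sum>i. ennreal (1 / sqrt (real l)) * ennreal (sqrt (?\<tau> i * pop_mean k / pop_mean (Suc (k + i)))) * emeasure tree_law A
      + 2 * ennreal (large_mean (?\<tau> i) (k + i)) * emeasure tree_law A)"
    unfolding R by (intro mult_left_mono suminf_le add_right_mono M) auto
  also have "\<dots> = 2 * ((ennreal (1 / sqrt (real l)) * (\<Sum>i. ennreal (sqrt (?\<tau> i * pop_mean k / pop_mean (Suc (k + i)))))
      + 2 * (\<Sum>i. ennreal (large_mean (?\<tau> i) (k + i)))) * emeasure tree_law A)"
    by (simp add: distrib_right distrib_left suminf_add[symmetric] mult.assoc mult.commute[of _ "emeasure tree_law A"] mult.left_commute)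
  also have "\<dots> \<le> 2 * ((ennreal (1 / sqrt (real l)) * ennreal C + 2 * ennreal \<epsilon>) * emeasure tree_law A)"
    by (intro mult_left_mono mult_right_mono add_mono s rho) auto
  also have "\<dots> \<le> 2 * ((ennreal \<epsilon> + 2 * ennreal \<epsilon>) * emeasure tree_law A)"
    using C by (intro mult_left_mono mult_right_mono add_mono) (auto simp: ennreal_mult[symmetric] ennreal_leI)
  \<comment> \<open>The threshold \<open>W k x / 2\<close> gives a factor 2; the truncated
    differences contribute \<open>\<epsilon>\<close> and the remainders
    \<open>2 * \<epsilon>\<close>.\<close>
  also have "\<dots> = ennreal (6 * \<epsilon>) * emeasure tree_law A"
  proof -
    have "2 * (ennreal \<epsilon> + 2 * ennreal \<epsilon>) = (2 * (1 + 2)) * ennreal \<epsilon>"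
      by (simp only: distrib_right mult.assoc mult_1_left)
    also have "2 * (1 + 2) = (6 :: ennreal)" by simp
    also have "6 * ennreal \<epsilon> = ennreal (6 * \<epsilon>)" using e0 by (simp add: ennreal_mult)
    finally have "2 * (ennreal \<epsilon> + 2 * ennreal \<epsilon>) = ennreal (6 * \<epsilon>)" .
    then show ?thesis by (simp add: mult.assoc[symmetric])
  qed
  finally show ?thesis .
qed

text \<open>An unbounded population reaches every level \<open>l\<close> at some good generation.
  From the first such generation \<open>k\<close> on, \<open>W\<close> moves by less than
  \<open>W k x / 2\<close>, except on a set of relative measure at most
  \<open>6 * \<epsilon>\<close>. The sets belonging to different first generations are disjoint, so
  these relative bounds add up to \<open>6 * \<epsilon>\<close> in total.\<close>

lemma AE_W_bounded_below:
  fixes d :: real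
  assumes good: "\<And>\<epsilon>. 0 < \<epsilon> \<Longrightarrow> \<exists>B C. 0 \<le> C \<and> infinite {k.
      (\<Sum>i. ennreal (large_mean (exp (d * (real i + B))) (k + i))) \<le> ennreal \<epsilon> \<and>
      (\<Sum>i. ennreal (sqrt (exp (d * (real i + B)) * pop_mean k / pop_mean (Suc (k + i))))) \<le> ennreal C}"
  shows "AE x in tree_law. filterlim (\<lambda>n. card (particles x n)) at_top sequentially \<longrightarrow>
    (\<exists>c>0. \<forall>\<^sub>F n in sequentially. c \<le> W n x)"
proof -
  interpret T: prob_space tree_law by (rule prob_tree_law)
  let ?N = "{x. filterlim (\<lambda>n. card (particles x n)) at_top sequentially \<and>
    \<not> (\<exists>c>0. \<forall>\<^sub>F n in sequentially. c \<le> W n x)}"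
  have null: "\<exists>V\<in>sets tree_law. ?N \<subseteq> V \<and> emeasure tree_law V \<le> ennreal (6 * \<epsilon>)" if \<epsilon>: "0 < \<epsilon>" for \<epsilon>
  proof -
    obtain B C where C0: "0 \<le> C" and inf: "infinite {k.
        (\<Sum>i. ennreal (large_mean (exp (d * (real i + B))) (k + i))) \<le> ennreal \<epsilon> \<and>
        (\<Sum>i. ennreal (sqrt (exp (d * (real i + B)) * pop_mean k / pop_mean (Suc (k + i))))) \<le> ennreal C}"
      (is "infinite ?G") using good[OF \<epsilon>] by blast
    \<comment> \<open>Large enough for \<open>C / sqrt (real l) \<le> \<epsilon>\<close>, which
      balances truncated differences against remainders.\<close>
    obtain l where l: "(C / \<epsilon>)\<^sup>2 < real l" using reals_Archimedean2 by blast
    then have l0: "0 < l" by (metis of_nat_0 of_nat_0_less_iff le_less_trans zero_le_power2)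
    have "C / \<epsilon> \<le> sqrt (real l)" using l by (intro real_le_rsqrt) simp
    then have Cl: "C / sqrt (real l) \<le> \<epsilon>" using \<epsilon> l0 by (simp add: field_simps)
    \<comment> \<open>The trees for which \<open>k\<close> is the first good generation with at
      least \<open>l\<close> particles; being first makes the family disjoint, and only generations
      up to \<open>k\<close> are consulted.\<close>
    define A where "A k = {x. k \<in> ?G \<and> l \<le> card (particles x k) \<and> (\<forall>j<k. j \<in> ?G \<longrightarrow> card (particles x j) < l)}" for k
    let ?\<tau> = "\<lambda>i :: nat. exp (d * (real i + B))"
    let ?D = "\<lambda>k x. \<Sum>i. ennreal (cmod (Mtr (?\<tau> i) (k + i) 0 x) + R (?\<tau> i) (k + i) x)"
    define Bad where "Bad k = {x\<in>A k. ennreal (W k x / 2) \<le> ?D k x}" for k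
    have Am [measurable]: "A k \<in> sets tree_law" for k
    proof -
      have "Measurable.pred tree_law (\<lambda>x. k \<in> ?G \<and> l \<le> card (particles x k) \<and> (\<forall>j<k. j \<in> ?G \<longrightarrow> card (particles x j) < l))"
        by (intro pred_intros_logic pred_intros_countable pred_intros_imp') measurable
      then show ?thesis by (simp add: A_def pred_def)
    qed
    have pred: "predictable k (\<lambda>x. x \<in> A k)" for k
      unfolding predictable_def A_def by (simp add: particles_upd)
    have disj: "disjoint_family A"
      unfolding disjoint_family_on_def
    proof (intro ballI impI)
      fix i j :: nat assume "i \<noteq> j"
      then consider "i < j" | "j < i" by linarith
      then show "A i \<inter> A j = {}" by cases (fastforce simp: A_def)+
    qed
    have Badm [measurable]: "Bad k \<in> sets tree_law" for k
    proof -
      have "{x\<in>space tree_law. ennreal (W k x / 2) \<le> ?D k x} \<in> sets tree_law" by measurable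
      moreover have "Bad k = A k \<inter> {x\<in>space tree_law. ennreal (W k x / 2) \<le> ?D k x}"
        by (auto simp: Bad_def)
      ultimately show ?thesis using Am by simp
    qed
    have bad: "emeasure tree_law (Bad k) \<le> ennreal (6 * \<epsilon>) * emeasure tree_law (A k)" for k
    proof (cases "k \<in> ?G")
      case True
      show ?thesis
        unfolding Bad_def
        by (rule emeasure_large_fluctuation[OF l0 Am pred _ _ _ Cl C0]) (use True in \<open>auto simp: A_def\<close>)
    next
      case False
      then have "Bad k = {}" by (auto simp: Bad_def A_def)
      then show ?thesis by simp
    qed
    have sub: "?N \<subseteq> (\<Union>k. Bad k)"
    proof
      fix x assume x: "x \<in> ?N"
      then have "\<forall>\<^sub>F n in sequentially. l \<le> card (particles x n)"
        by (auto simp: filterlim_at_top)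
      then obtain n0 where n0: "\<And>n. n0 \<le> n \<Longrightarrow> l \<le> card (particles x n)"
        by (auto simp: eventually_sequentially)
      obtain n1 where "n0 \<le> n1" "n1 \<in> ?G"
        using inf unfolding infinite_nat_iff_unbounded_le by blast
      then have ex: "\<exists>k. k \<in> ?G \<and> l \<le> card (particles x k)" using n0 by blast
      define k where "k = (LEAST k. k \<in> ?G \<and> l \<le> card (particles x k))"
      have k: "k \<in> ?G \<and> l \<le> card (particles x k)"
        unfolding k_def by (rule LeastI_ex[OF ex])
      have "card (particles x j) < l" if "j < k" "j \<in> ?G" for j
        using not_less_Least[OF that(1)[unfolded k_def]] that(2) not_le by blast
      then have xA: "x \<in> A k" unfolding A_def using k by blast
      have Wk: "0 < W k x" using k l0 pop_mean_gt_0[of k] by (simp add: W_def)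
      have "x \<in> Bad k"
      proof (rule ccontr)
        assume "x \<notin> Bad k"
        then have lt: "?D k x < ennreal (W k x / 2)" using xA by (auto simp: Bad_def not_le)
        have "W k x / 2 \<le> W n x" if "k \<le> n" for n
        proof -
          have "\<bar>W n x - W k x\<bar> \<le> (\<Sum>i<n - k. cmod (Mtr (?\<tau> i) (k + i) 0 x) + R (?\<tau> i) (k + i) x)"
            using that
          proof (induction n rule: dec_induct)
            case (step n)
            have "\<bar>W (Suc n) x - W k x\<bar> \<le> \<bar>W (Suc n) x - W n x\<bar> + \<bar>W n x - W k x\<bar>" by linarith
            also have "\<bar>W (Suc n) x - W n x\<bar> \<le> cmod (Mtr (?\<tau> (n - k)) n 0 x) + R (?\<tau> (n - k)) n x"
              by (rule W_diff_le)
            finally show ?case using step by (simp add: Suc_diff_le)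
          qed simp
          then have "ennreal \<bar>W n x - W k x\<bar> \<le> ennreal (\<Sum>i<n - k. cmod (Mtr (?\<tau> i) (k + i) 0 x) + R (?\<tau> i) (k + i) x)"
            by (rule ennreal_leI)
          also have "\<dots> = (\<Sum>i<n - k. ennreal (cmod (Mtr (?\<tau> i) (k + i) 0 x) + R (?\<tau> i) (k + i) x))"
            by (intro sum_ennreal[symmetric]) (simp add: R_nonneg)
          also have "\<dots> \<le> ?D k x" by (rule sum_le_suminf) auto
          also have "\<dots> < ennreal (W k x / 2)" by (rule lt)
          finally have "\<bar>W n x - W k x\<bar> < W k x / 2" by (simp add: ennreal_less_iff)
          then show ?thesis by linarith
        qed
        then have "\<forall>\<^sub>F n in sequentially. W k x / 2 \<le> W n x"
          by (auto simp: eventually_sequentially)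
        then have "\<exists>c>0. \<forall>\<^sub>F n in sequentially. c \<le> W n x"
          using Wk by (intro exI[of _ "W k x / 2"]) simp
        with x show False by blast
      qed
      then show "x \<in> (\<Union>k. Bad k)" by blast
    qed
    have "emeasure tree_law (\<Union>k. Bad k) \<le> (\<Sum>k. emeasure tree_law (Bad k))"
      by (rule emeasure_subadditive_countably) auto
    also have "\<dots> \<le> (\<Sum>k. ennreal (6 * \<epsilon>) * emeasure tree_law (A k))"
      by (intro suminf_le bad) auto
    also have "\<dots> = ennreal (6 * \<epsilon>) * (\<Sum>k. emeasure tree_law (A k))"
      by (rule ennreal_suminf_cmult)
    also have "(\<Sum>k. emeasure tree_law (A k)) = emeasure tree_law (\<Union>k. A k)"
      using disj by (intro suminf_emeasure) auto
    also have "\<dots> \<le> 1" by (rule T.emeasure_le_1)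
    finally have "emeasure tree_law (\<Union>k. Bad k) \<le> ennreal (6 * \<epsilon>)"
      by (simp add: mult_left_mono)
    with sub show ?thesis by (intro bexI[of _ "\<Union>k. Bad k"]) auto
  qed
  \<comment> \<open>The exceptional set is enclosed in measurable sets of small measure instead of
    being measured itself; their intersection is a null set that contains it.\<close>
  define V where "V p = (SOME V. V \<in> sets tree_law \<and> ?N \<subseteq> V \<and> emeasure tree_law V \<le> ennreal (6 * (1 / real (Suc p))))" for p
  have "V p \<in> sets tree_law \<and> ?N \<subseteq> V p \<and> emeasure tree_law (V p) \<le> ennreal (6 * (1 / real (Suc p)))" for p
    unfolding V_def by (rule someI_ex) (rule null[unfolded Bex_def], simp)
  note V = conjunct1[OF this] conjunct1[OF conjunct2[OF this]] conjunct2[OF conjunct2[OF this]]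
  have "emeasure tree_law (\<Inter>p. V p) = 0"
  proof -
    have "emeasure tree_law (\<Inter>p. V p) \<le> ennreal (6 * (1 / real (Suc p)))" for p
      using V by (intro order_trans[OF emeasure_mono V(3)[of p]]) auto
    moreover have "(\<lambda>p. ennreal (6 * (1 / real (Suc p)))) \<longlonglongrightarrow> ennreal (6 * 0)"
      by (intro tendsto_intros LIMSEQ_Suc lim_1_over_n)
    ultimately have "emeasure tree_law (\<Inter>p. V p) \<le> ennreal (6 * 0)"
      by (intro LIMSEQ_le_const) auto
    then show ?thesis by simp
  qed
  then have "(\<Inter>p. V p) \<in> null_sets tree_law" using V by auto
  then have "AE x in tree_law. x \<notin> (\<Inter>p. V p)" by (rule AE_not_in)
  then show ?thesis
    by eventually_elim (use V(2) in blast)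
qed

end

text \<open>The mean spread grows at most linearly, so division by the cube leaves a summable series
  of expectations. A cube is affordable because \<open>real (cut n) ^ 8 \<le> real n\<close>, so
  that \<open>sqrt (real n)\<close> dominates a fourth power of \<open>cut n\<close>.\<close>

lemma (in quenched_env_var) AE_spread_bound:
  assumes "\<And>n. (\<Sum>i<n. var i) \<le> C * real (Suc n)"
  shows "AE x in tree_law. \<exists>D. \<forall>n. spread n x \<le> D * real (Suc n) ^ 3"
proof -
  have C0: "0 \<le> C" using assms[of 0] by simp
  have "AE x in tree_law. summable (\<lambda>n. spread n x / real (Suc n) ^ 3)"
  proof (rule AE_summable)
    have "summable (\<lambda>n. 1 / real (Suc n) ^ 2)"
      using inverse_power_summable[of 2, where 'a = real] by (subst summable_Suc_iff) (simp add: inverse_eq_divide)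
    then show "summable (\<lambda>n. (1 + C) * (1 / real (Suc n) ^ 2))" by (rule summable_mult)
    fix n
    have "(\<integral>\<^sup>+x. ennreal (spread n x / real (Suc n) ^ 3) \<partial>tree_law) =
        (\<integral>\<^sup>+x. ennreal (1 / real (Suc n) ^ 3) * ennreal (spread n x) \<partial>tree_law)"
      by (intro nn_integral_cong) (simp add: spread_nonneg flip: ennreal_mult)
    also have "\<dots> = ennreal (1 / real (Suc n) ^ 3) * (\<integral>\<^sup>+x. ennreal (spread n x) \<partial>tree_law)"
      by (rule nn_integral_cmult) measurable
    also have "\<dots> \<le> ennreal (1 / real (Suc n) ^ 3) * ennreal (1 + (\<Sum>i<n. var i))"
      by (intro mult_left_mono nn_integral_spread) simp
    also have "\<dots> \<le> ennreal (1 / real (Suc n) ^ 3) * ennreal ((1 + C) * real (Suc n))"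
      using assms[of n] C0 by (intro mult_left_mono ennreal_leI) (auto simp: algebra_simps)
    also have "\<dots> = ennreal ((1 + C) * (1 / real (Suc n) ^ 2))"
      using C0 by (simp add: power2_eq_square power3_eq_cube mult.commute flip: ennreal_mult)
    finally show "(\<integral>\<^sup>+x. ennreal (spread n x / real (Suc n) ^ 3) \<partial>tree_law) \<le> ennreal ((1 + C) * (1 / real (Suc n) ^ 2))" .
  qed (use C0 in \<open>auto simp: spread_nonneg\<close>)
  then show ?thesis
  proof eventually_elim
    case (elim x)
    then have "Bseq (\<lambda>n. spread n x / real (Suc n) ^ 3)"
      by (intro convergent_imp_Bseq) (auto simp: convergent_def dest: summable_LIMSEQ_zero)
    then obtain D where D: "\<And>n. norm (spread n x / real (Suc n) ^ 3) \<le> D" by (auto simp: Bseq_def)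
    have "spread n x \<le> D * real (Suc n) ^ 3" for n
    proof -
      have "spread n x / real (Suc n) ^ 3 \<le> D" using D[of n] spread_nonneg[of n x] by simp
      then show ?thesis by (simp add: divide_le_eq del: of_nat_Suc)
    qed
    then show ?case by blast
  qed
qed


section \<open>Fourier inversion with truncated characteristic functions\<close>

lemma nn_integral_gauss:
  assumes "0 < a"
  shows "(\<integral>\<^sup>+t. ennreal (exp (- a * t\<^sup>2)) \<partial>lborel) = ennreal (sqrt (pi / a))"
proof -
  have sd: "(sqrt (1 / (2 * a)))\<^sup>2 = 1 / (2 * a)" using assms by simp
  have *: "exp (- a * t\<^sup>2) = sqrt (pi / a) * normal_density 0 (sqrt (1 / (2 * a))) t" for t
    using assms unfolding normal_density_def sd by simp
  have "(\<integral>\<^sup>+t. ennreal (exp (- a * t\<^sup>2)) \<partial>lborel) =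
      (\<integral>\<^sup>+t. ennreal (sqrt (pi / a)) * ennreal (normal_density 0 (sqrt (1 / (2 * a))) t) \<partial>lborel)"
    unfolding * using assms by (intro nn_integral_cong) (simp add: ennreal_mult)
  also have "\<dots> = ennreal (sqrt (pi / a)) * (\<integral>\<^sup>+t. ennreal (normal_density 0 (sqrt (1 / (2 * a))) t) \<partial>lborel)"
    by (rule nn_integral_cmult) simp
  also have "(\<integral>\<^sup>+t. ennreal (normal_density 0 (sqrt (1 / (2 * a))) t) \<partial>lborel) = 1"
    using assms prob_space.emeasure_space_1[OF prob_space_normal_density[of "sqrt (1 / (2 * a))" 0]]
    by (simp add: emeasure_density)
  finally show ?thesis by simp
qed

lemma exp_minus_approx: "0 \<le> x \<Longrightarrow> \<bar>exp (- x) - (1 - x)\<bar> \<le> x\<^sup>2 / 2" for x :: real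
proof -
  assume x: "0 \<le> x"
  have 1: "1 - x \<le> exp (- x)" using exp_ge_add_one_self[of "- x"] by simp
  let ?g = "\<lambda>x :: real. 1 - x + x\<^sup>2 / 2 - exp (- x)"
  have "?g 0 \<le> ?g x"
  proof (rule DERIV_nonneg_imp_nondecreasing[OF x])
    fix y :: real assume "0 \<le> y" "y \<le> x"
    have "(?g has_real_derivative (- 1 + y + exp (- y))) (at y)"
      by (auto intro!: derivative_eq_intros)
    moreover have "0 \<le> - 1 + y + exp (- y)" using exp_ge_add_one_self[of "- y"] by simp
    ultimately show "\<exists>D. (?g has_real_derivative D) (at y) \<and> 0 \<le> D" by blast
  qed
  then show ?thesis using 1 by simp
qed

text \<open>What is required of a single environment, stated without probability. The number
  \<open>q A j\<close> stands for the part of the variance of the \<open>j\<close>-th displacement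
  law coming from deviations beyond \<open>A\<close>, so that \<open>lindeberg\<close> is the
  averaged Lindeberg condition. The restriction in \<open>\<phi>_decay\<close> leaves at least a
  third of the generations in the product.\<close>

locale clt_environment =
  fixes \<phi> :: "nat \<Rightarrow> real \<Rightarrow> complex" and \<mu> s2 :: "nat \<Rightarrow> real" and q :: "real \<Rightarrow> nat \<Rightarrow> real" and C :: real
  assumes \<phi>_measurable [measurable]: "\<And>j. \<phi> j \<in> borel_measurable borel"
    and cmod_\<phi>_le: "\<And>j t. cmod (\<phi> j t) \<le> 1"
    and \<phi>_approx: "\<And>A j t. 0 \<le> A \<Longrightarrow>
      cmod (\<phi> j t * iexp (- t * \<mu> j) - of_real (1 - s2 j * t\<^sup>2 / 2)) \<le> t\<^sup>2 * q A j + \<bar>t\<bar> ^ 3 * A * s2 j"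
    and s2_nonneg: "\<And>j. 0 \<le> s2 j" and s2_le: "\<And>A j. 0 \<le> A \<Longrightarrow> s2 j \<le> A\<^sup>2 + q A j"
    and q_nonneg: "\<And>A j. 0 \<le> q A j"
    and var_lower: "\<exists>c>0. \<forall>\<^sub>F n in sequentially. c * real n \<le> (\<Sum>i<n. s2 i)"
    and var_upper: "\<And>n. (\<Sum>i<n. s2 i) \<le> C * real (Suc n)"
    and lindeberg: "\<And>\<epsilon>. 0 < \<epsilon> \<Longrightarrow> \<exists>A\<ge>0. \<forall>\<^sub>F n in sequentially. (\<Sum>j<n. q A j) \<le> \<epsilon> * real n"
    and \<phi>_decay: "\<And>K. 0 < K \<Longrightarrow> \<exists>c>0. \<forall>\<^sub>F n in sequentially. \<forall>k t. 3 * k \<le> 2 * n \<longrightarrow> \<bar>t\<bar> \<le> K \<longrightarrow>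
      (\<Prod>i\<in>{k..<n}. cmod (\<phi> i t)) \<le> exp (- c * real n * t\<^sup>2)"
begin

definition a :: "nat \<Rightarrow> real" where "a n = (\<Sum>i<n. \<mu> i)"
definition v :: "nat \<Rightarrow> real" where "v n = (\<Sum>i<n. s2 i)"
definition b :: "nat \<Rightarrow> real" where "b n = sqrt (v n)"
text \<open>
  The generation up to which \<open>Z\<close> is only known to concentrate at \<open>a\<close> is chosen such that its spread,
  at most of order \<open>(cut n)\<^sup>3\<close>, is negligible against \<open>sqrt n\<close>.
\<close>
definition cut :: "nat \<Rightarrow> nat" where "cut n = nat \<lfloor>root 8 (real n)\<rfloor>"

lemma v_nonneg: "0 \<le> v n" by (simp add: v_def sum_nonneg s2_nonneg)
lemma b_nonneg: "0 \<le> b n" by (simp add: b_def v_nonneg)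
lemma b_sq: "(b n)\<^sup>2 = v n" by (simp add: b_def v_nonneg)

lemma C_nonneg: "0 \<le> C" using var_upper[of 0] by simp

lemma cut_le: "real (cut n) ^ 8 \<le> real n"
proof -
  have "real (cut n) \<le> root 8 (real n)"
    unfolding cut_def by (simp add: real_root_ge_zero)
  then have "real (cut n) ^ 8 \<le> root 8 (real n) ^ 8" by (rule power_mono) simp
  then show ?thesis by simp
qed

lemma le_cut: "real n \<le> (real (cut n) + 1) ^ 8"
proof -
  have "root 8 (real n) \<le> real (cut n) + 1"
    unfolding cut_def by (simp add: real_root_ge_zero)
  then have "root 8 (real n) ^ 8 \<le> (real (cut n) + 1) ^ 8" by (rule power_mono) (simp add: real_root_ge_zero)
  then show ?thesis by simp
qed

lemma cut_at_top: "filterlim cut at_top sequentially"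
  unfolding filterlim_at_top
proof
  fix Z :: nat
  show "\<forall>\<^sub>F n in sequentially. Z \<le> cut n"
    using eventually_gt_at_top[of "Z ^ 8"]
  proof eventually_elim
    case (elim n)
    show ?case
    proof (rule ccontr)
      assume "\<not> Z \<le> cut n"
      then have "(real (cut n) + 1) ^ 8 \<le> real Z ^ 8" by (intro power_mono) auto
      with le_cut[of n] have "real n \<le> real (Z ^ 8)" unfolding of_nat_power by (rule order_trans)
      with elim show False by (simp only: of_nat_le_iff)
    qed
  qed
qed

text \<open>Makes \<open>\<phi>_decay\<close> applicable to the product that starts at generation
  \<open>cut n\<close>.\<close>

lemma cut_less: "3 * cut n \<le> 2 * n" if "8 \<le> n"
proof (cases "cut n \<le> 1")
  case False
  then have "2 * cut n \<le> cut n ^ 8"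
  proof -
    have "2 * cut n \<le> cut n * cut n" using False by simp
    also have "cut n * cut n = cut n ^ 2" by (simp add: power2_eq_square)
    also have "\<dots> \<le> cut n ^ 8" using False by (intro power_increasing) auto
    finally show ?thesis .
  qed
  also have "\<dots> \<le> n" using cut_le[of n] by (simp flip: of_nat_power)
  finally show ?thesis by simp
qed (use that in auto)

lemma v_lower: obtains c where "0 < c" "\<forall>\<^sub>F n in sequentially. c * real n \<le> v n"
  using var_lower by (auto simp: v_def)

lemma v_at_top: "filterlim v at_top sequentially"
proof -
  obtain c where c: "0 < c" "\<forall>\<^sub>F n in sequentially. c * real n \<le> v n" by (rule v_lower)
  have "filterlim (\<lambda>n. c * real n) at_top sequentially"
    by (rule filterlim_tendsto_pos_mult_at_top[OF tendsto_const c(1) filterlim_real_sequentially])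
  then show ?thesis using c(2) by (rule filterlim_at_top_mono)
qed

lemma b_at_top: "filterlim b at_top sequentially"
  unfolding b_def[abs_def] by (rule filterlim_compose[OF sqrt_at_top v_at_top])

lemma v_le: "v n \<le> C * real (Suc n)"
  using var_upper[of n] by (simp add: v_def)

lemma v_le': "1 \<le> n \<Longrightarrow> v n \<le> 2 * C * real n"
proof -
  assume "1 \<le> n"
  then have "C * real (Suc n) \<le> C * (2 * real n)" by (intro mult_left_mono C_nonneg) auto
  then show ?thesis using v_le[of n] by simp
qed

lemma b_le: "b n \<le> sqrt C * (real (cut n) + 2) ^ 4"
proof -
  have "v n \<le> C * real (Suc n)" by (rule v_le)
  also have "\<dots> \<le> C * (real (cut n) + 2) ^ 8"
  proof (intro mult_left_mono C_nonneg)
    have "real (Suc n) \<le> (real (cut n) + 1) ^ 8 + 1" using le_cut[of n] by simp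
    also have "\<dots> \<le> (real (cut n) + 2) ^ 8"
    proof -
      have "y ^ 8 + 1 \<le> (y + 1) ^ 8" if y: "1 \<le> y" for y :: real
      proof -
        have "y ^ 8 + 1 \<le> y ^ 8 + y ^ 7" using y by simp
        also have "\<dots> = (y + 1) * y ^ 7" by (simp add: numeral_eq_Suc algebra_simps)
        also have "\<dots> \<le> (y + 1) * (y + 1) ^ 7" using y by (intro mult_left_mono power_mono) auto
        also have "\<dots> = (y + 1) ^ 8" by (simp add: numeral_eq_Suc)
        finally show ?thesis .
      qed
      from this[of "real (cut n) + 1"] show ?thesis by (simp add: add.assoc)
    qed
    finally show "real (Suc n) \<le> (real (cut n) + 2) ^ 8" .
  qed
  finally have "b n \<le> sqrt (C * (real (cut n) + 2) ^ 8)" unfolding b_def by simp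
  also have "\<dots> = sqrt C * (real (cut n) + 2) ^ 4"
  proof -
    have "sqrt ((real (cut n) + 2) ^ 8) = (real (cut n) + 2) ^ 4"
      by (rule real_sqrt_unique) (simp_all flip: power_mult)
    then show ?thesis by (simp only: real_sqrt_mult)
  qed
  finally show ?thesis .
qed

lemma b_exp_cut:
  assumes "0 < \<delta>"
  shows "(\<lambda>n. b n * exp (- \<delta> * real (cut n))) \<longlonglongrightarrow> 0"
proof (rule tendsto_sandwich[OF _ _ tendsto_const])
  have "(\<lambda>k::nat. sqrt C * (real k + 2) ^ 4 * exp (- \<delta> * real k)) \<longlonglongrightarrow> 0"
    using assms by real_asymp
  then show "(\<lambda>n. sqrt C * (real (cut n) + 2) ^ 4 * exp (- \<delta> * real (cut n))) \<longlonglongrightarrow> 0"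
    by (rule filterlim_compose[OF _ cut_at_top])
qed (auto simp: b_nonneg b_le intro!: always_eventually mult_right_mono)

lemma cut_cube_over_b: "(\<lambda>n. (real (cut n) + 1) ^ 3 / b n) \<longlonglongrightarrow> 0"
proof -
  obtain c where c: "0 < c" "\<forall>\<^sub>F n in sequentially. c * real n \<le> v n" by (rule v_lower)
  have lim: "(\<lambda>n. (real (cut n) + 1) ^ 3 / (sqrt c * real (cut n) ^ 4)) \<longlonglongrightarrow> 0"
  proof -
    have "(\<lambda>k::nat. (real k + 1) ^ 3 / (sqrt c * real k ^ 4)) \<longlonglongrightarrow> 0" using c(1) by real_asymp
    then show ?thesis by (rule filterlim_compose[OF _ cut_at_top])
  qed
  have "\<forall>\<^sub>F n in sequentially. 1 \<le> cut n" using cut_at_top by (simp add: filterlim_at_top)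
  with c(2) have "\<forall>\<^sub>F n in sequentially. (real (cut n) + 1) ^ 3 / b n \<le> (real (cut n) + 1) ^ 3 / (sqrt c * real (cut n) ^ 4)"
  proof eventually_elim
    case (elim n)
    have "(sqrt c * real (cut n) ^ 4)\<^sup>2 = c * real (cut n) ^ 8"
      using c by (simp add: power_mult_distrib flip: power_mult)
    also have "\<dots> \<le> c * real n" using c cut_le[of n] by (intro mult_left_mono) auto
    also have "\<dots> \<le> v n" by (rule elim)
    finally have "sqrt c * real (cut n) ^ 4 \<le> b n" unfolding b_def by (rule real_le_rsqrt)
    moreover have "0 < sqrt c * real (cut n) ^ 4" using c elim by simp
    ultimately show ?case by (intro divide_left_mono) auto
  qed
  then show ?thesis
    by (rule tendsto_sandwich[OF always_eventually _ tendsto_const lim, rotated]) (simp add: b_nonneg)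
qed

lemma v_cut_over_v: "(\<lambda>n. v (cut n) / v n) \<longlonglongrightarrow> 0"
proof -
  obtain c where c: "0 < c" "\<forall>\<^sub>F n in sequentially. c * real n \<le> v n" by (rule v_lower)
  have lim: "(\<lambda>n. C * (real (cut n) + 1) / (c * real (cut n) ^ 8)) \<longlonglongrightarrow> 0"
  proof -
    have "(\<lambda>k::nat. C * (real k + 1) / (c * real k ^ 8)) \<longlonglongrightarrow> 0" using c(1) by real_asymp
    then show ?thesis by (rule filterlim_compose[OF _ cut_at_top])
  qed
  have "\<forall>\<^sub>F n in sequentially. 1 \<le> cut n" using cut_at_top by (simp add: filterlim_at_top)
  with c(2) have "\<forall>\<^sub>F n in sequentially. v (cut n) / v n \<le> C * (real (cut n) + 1) / (c * real (cut n) ^ 8)"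
  proof eventually_elim
    case (elim n)
    have "c * real (cut n) ^ 8 \<le> c * real n" using c cut_le[of n] by (intro mult_left_mono) auto
    also have "\<dots> \<le> v n" by (rule elim)
    finally have le: "c * real (cut n) ^ 8 \<le> v n" .
    have "0 < c * real (cut n) ^ 8" using c elim by simp
    moreover have "v (cut n) \<le> C * (real (cut n) + 1)" using v_le[of "cut n"] by (simp add: algebra_simps)
    moreover have "0 \<le> C * (real (cut n) + 1)" using C_nonneg by simp
    ultimately show ?case using le by (intro frac_le) auto
  qed
  then show ?thesis
    by (rule tendsto_sandwich[OF always_eventually _ tendsto_const lim, rotated]) (simp add: v_nonneg)
qed

definition \<psi> :: "nat \<Rightarrow> real \<Rightarrow> complex" where
  "\<psi> j t = \<phi> j t * iexp (- t * \<mu> j)"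

lemma cmod_\<psi>_le: "cmod (\<psi> j t) \<le> 1"
  unfolding \<psi>_def norm_mult norm_exp_i_times using cmod_\<phi>_le[of j t] by simp

lemma prod_\<psi>: "k \<le> n \<Longrightarrow> (\<Prod>i\<in>{k..<n}. \<psi> i t) = (\<Prod>i\<in>{k..<n}. \<phi> i t) * iexp (- t * (a n - a k))"
proof (induction n rule: dec_induct)
  case (step n)
  have "iexp (- t * (a n - a k)) * iexp (- t * \<mu> n) = iexp (- t * (a (Suc n) - a k))"
    unfolding exp_add[symmetric] a_def by (rule arg_cong[where f = exp]) (simp add: algebra_simps)
  then show ?case using step
    by (simp add: prod.atLeastLessThan_Suc \<psi>_def mult_ac del: of_real_mult of_real_minus of_real_diff)
qed simp

text \<open>Lindeberg's proof: each factor is replaced by a Gaussian one at a cost controlled by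
  \<open>\<phi>_approx\<close>, and since all factors have modulus at most 1 these costs just add
  up. The factors before \<open>cut n\<close> are missing, which does no harm because
  \<open>v (cut n) / v n\<close> vanishes.\<close>

lemma gaussian_limit: "(\<lambda>n. \<Prod>i\<in>{cut n..<n}. \<psi> i (s / b n)) \<longlonglongrightarrow> of_real (exp (- s\<^sup>2 / 2))"
proof -
  let ?t = "\<lambda>n. s / b n"
  let ?e = "\<lambda>i n. of_real (exp (- (s2 i * (?t n)\<^sup>2 / 2))) :: complex"
  have quartic: "(s * t\<^sup>2 / 2)\<^sup>2 / 2 = t ^ 4 * (s * s) / 8" for s t :: real
    by (simp add: power2_eq_square power4_eq_xxxx)
  obtain c where c: "0 < c" "\<forall>\<^sub>F n in sequentially. c * real n \<le> v n" by (rule v_lower)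
  have bpos: "\<forall>\<^sub>F n in sequentially. 0 < b n"
    using b_at_top by (simp add: filterlim_at_top_dense)
  have cutn: "\<forall>\<^sub>F n in sequentially. cut n \<le> n"
    using eventually_ge_at_top[of 8] by eventually_elim (use cut_less in force)
  have diff: "(\<lambda>n. (\<Prod>i\<in>{cut n..<n}. \<psi> i (?t n)) - (\<Prod>i\<in>{cut n..<n}. ?e i n)) \<longlonglongrightarrow> 0"
  proof (rule tendstoI)
    fix \<epsilon> :: real assume \<epsilon>: "0 < \<epsilon>"
    \<comment> \<open>Chosen such that \<open>(s\<^sup>2 + s ^ 4 + 1) * (\<epsilon>' / c)\<close>
      equals \<open>\<epsilon> / 2\<close>; the summand 1 covers \<open>s = 0\<close>.\<close>
    define \<epsilon>' where "\<epsilon>' = \<epsilon> * c / (2 * (s\<^sup>2 + s ^ 4 + 1))"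
    have pos: "0 < s\<^sup>2 + s ^ 4 + 1" by (intro add_nonneg_pos) auto
    have \<epsilon>': "0 < \<epsilon>'" using \<epsilon> c pos by (simp add: \<epsilon>'_def)
    obtain A where A: "0 \<le> A" "\<forall>\<^sub>F n in sequentially. (\<Sum>j<n. q A j) \<le> \<epsilon>' * real n"
      using lindeberg[OF \<epsilon>'] by blast
    have "(\<lambda>n. \<bar>s\<bar> ^ 3 * A / b n + s ^ 4 * A\<^sup>2 / v n) \<longlonglongrightarrow> 0 + 0"
      by (intro tendsto_add tendsto_divide_0[OF tendsto_const] filterlim_at_top_imp_at_infinity b_at_top v_at_top)
    then have small: "\<forall>\<^sub>F n in sequentially. \<bar>s\<bar> ^ 3 * A / b n + s ^ 4 * A\<^sup>2 / v n < \<epsilon> / 2"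
      using \<epsilon> by (intro order_tendstoD) auto
    from A(2) c(2) bpos small show "\<forall>\<^sub>F n in sequentially.
        dist ((\<Prod>i\<in>{cut n..<n}. \<psi> i (?t n)) - (\<Prod>i\<in>{cut n..<n}. ?e i n)) 0 < \<epsilon>"
    proof eventually_elim
      case (elim n)
      let ?Q = "\<Sum>j<n. q A j"
      have vp: "0 < v n" using elim(3) by (simp add: b_def)
      have t2: "(?t n)\<^sup>2 = s\<^sup>2 / v n" by (simp add: power_divide b_sq)
      have Q0: "0 \<le> ?Q" by (simp add: sum_nonneg q_nonneg)
      have Qv: "?Q / v n \<le> \<epsilon>' / c"
      proof -
        have "?Q * c \<le> (\<epsilon>' * real n) * c" using elim(1) c by (intro mult_right_mono) auto
        also have "\<dots> = \<epsilon>' * (c * real n)" by simp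
        also have "\<dots> \<le> \<epsilon>' * v n" using \<epsilon>' elim(2) by (intro mult_left_mono) auto
        finally show ?thesis using c vp by (simp add: field_simps)
      qed
      have one: "cmod (\<psi> j (?t n) - ?e j n) \<le> (?t n)\<^sup>2 * q A j + \<bar>?t n\<bar> ^ 3 * A * s2 j + (?t n) ^ 4 * (A\<^sup>2 + ?Q) * s2 j"
        if j: "j < n" for j
      proof -
        let ?x = "s2 j * (?t n)\<^sup>2 / 2"
        have x: "0 \<le> ?x" by (simp add: s2_nonneg)
        \<comment> \<open>Bounding one truncated variance by the sum of all of them makes every
          single \<open>s2 j\<close> small against \<open>v n\<close>, as the Lindeberg condition
          should. This handles the quadratic error of the exponential.\<close>
        have "q A j \<le> ?Q" using j by (intro member_le_sum) (auto simp: q_nonneg)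
        then have s2Q: "s2 j \<le> A\<^sup>2 + ?Q" using s2_le[OF A(1), of j] by linarith
        have "cmod (of_real (1 - ?x) - ?e j n) = \<bar>exp (- ?x) - (1 - ?x)\<bar>"
          unfolding of_real_diff[symmetric] norm_of_real by (simp add: abs_minus_commute)
        also have "\<dots> \<le> ?x\<^sup>2 / 2" by (rule exp_minus_approx[OF x])
        also have "\<dots> = (?t n) ^ 4 * (s2 j * s2 j) / 8"
          by (rule quartic)
        also have "\<dots> \<le> (?t n) ^ 4 * (s2 j * s2 j)"
          using s2_nonneg[of j] by simp
        also have "\<dots> \<le> (?t n) ^ 4 * ((A\<^sup>2 + ?Q) * s2 j)"
          using s2_nonneg s2Q by (intro mult_left_mono mult_right_mono) auto
        finally have "cmod (of_real (1 - ?x) - ?e j n) \<le> (?t n) ^ 4 * (A\<^sup>2 + ?Q) * s2 j" by (simp add: mult.assoc)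
        moreover have "cmod (\<psi> j (?t n) - of_real (1 - ?x)) \<le> (?t n)\<^sup>2 * q A j + \<bar>?t n\<bar> ^ 3 * A * s2 j"
          unfolding \<psi>_def by (rule \<phi>_approx[OF A(1)])
        moreover have "\<psi> j (?t n) - ?e j n = (\<psi> j (?t n) - of_real (1 - ?x)) + (of_real (1 - ?x) - ?e j n)" by simp
        ultimately show ?thesis by (metis (no_types, lifting) add_mono norm_triangle_le)
      qed
      have "cmod ((\<Prod>i\<in>{cut n..<n}. \<psi> i (?t n)) - (\<Prod>i\<in>{cut n..<n}. ?e i n)) \<le>
          (\<Sum>i\<in>{cut n..<n}. cmod (\<psi> i (?t n) - ?e i n))"
      proof (rule norm_prod_diff)
        show "cmod (?e i n) \<le> 1" for i by (simp add: s2_nonneg)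
      qed (rule cmod_\<psi>_le)
      also have "\<dots> \<le> (\<Sum>i<n. cmod (\<psi> i (?t n) - ?e i n))"
        by (rule sum_mono2) auto
      also have "\<dots> \<le> (\<Sum>i<n. (?t n)\<^sup>2 * q A i + \<bar>?t n\<bar> ^ 3 * A * s2 i + (?t n) ^ 4 * (A\<^sup>2 + ?Q) * s2 i)"
        by (intro sum_mono one) auto
      also have "\<dots> = (?t n)\<^sup>2 * ?Q + \<bar>?t n\<bar> ^ 3 * A * v n + (?t n) ^ 4 * (A\<^sup>2 + ?Q) * v n"
        by (simp add: sum.distrib v_def sum_distrib_left)
      also have "\<dots> = s\<^sup>2 * (?Q / v n) + \<bar>s\<bar> ^ 3 * A / b n + s ^ 4 * A\<^sup>2 / v n + s ^ 4 * (?Q / v n)"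
      proof -
        have cube: "\<bar>?t n\<bar> ^ 3 * A * v n = \<bar>s\<bar> ^ 3 * A / b n"
          using elim(3) by (simp add: power_divide b_sq[symmetric] power3_eq_cube power2_eq_square abs_divide)
        have t4: "(?t n) ^ 4 = s ^ 4 / (v n * v n)"
        proof -
          have "(?t n) ^ 4 = ((?t n)\<^sup>2)\<^sup>2" by simp
          then show ?thesis unfolding t2 by (simp add: power2_eq_square power4_eq_xxxx)
        qed
        show ?thesis unfolding t2 t4 cube using vp by (simp add: field_simps)
      qed
      also have "\<dots> \<le> s\<^sup>2 * (\<epsilon>' / c) + \<bar>s\<bar> ^ 3 * A / b n + s ^ 4 * A\<^sup>2 / v n + s ^ 4 * (\<epsilon>' / c)"
        by (intro add_mono mult_left_mono Qv) auto
      also have "\<dots> < \<epsilon>"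
      proof -
        have "s\<^sup>2 * (\<epsilon>' / c) + s ^ 4 * (\<epsilon>' / c) = (s\<^sup>2 + s ^ 4) * (\<epsilon>' / c)" by (rule distrib_right[symmetric])
        also have "\<dots> \<le> (s\<^sup>2 + s ^ 4 + 1) * (\<epsilon>' / c)" using \<epsilon>' c by (intro mult_right_mono) auto
        also have "\<dots> = \<epsilon> / 2"
        proof -
          have "u * (\<epsilon> * c / (2 * u) / c) = \<epsilon> / 2" if "0 < u" for u using c that by simp
          from this[OF pos] show ?thesis unfolding \<epsilon>'_def .
        qed
        finally show ?thesis using elim(4) by linarith
      qed
      finally show ?case by (simp add: dist_norm)
    qed
  qed
  have "(\<lambda>n. \<Prod>i\<in>{cut n..<n}. ?e i n) \<longlonglongrightarrow> of_real (exp (- s\<^sup>2 / 2))"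
  proof (rule Lim_transform_eventually)
    have "(\<lambda>n. of_real (exp (- (s\<^sup>2 / 2) * (1 - v (cut n) / v n)))) \<longlonglongrightarrow> (of_real (exp (- (s\<^sup>2 / 2) * (1 - 0))) :: complex)"
      by (intro tendsto_of_real tendsto_exp tendsto_mult tendsto_const tendsto_diff v_cut_over_v)
    then show "(\<lambda>n. of_real (exp (- (s\<^sup>2 / 2) * (1 - v (cut n) / v n)))) \<longlonglongrightarrow> (of_real (exp (- s\<^sup>2 / 2)) :: complex)" by simp
    from bpos cutn show "\<forall>\<^sub>F n in sequentially. of_real (exp (- (s\<^sup>2 / 2) * (1 - v (cut n) / v n))) = (\<Prod>i\<in>{cut n..<n}. ?e i n)"
    proof eventually_elim
      case (elim n)
      have vp: "0 < v n" using elim(1) by (simp add: b_def)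
      have "(\<Sum>i\<in>{cut n..<n}. s2 i) = v n - v (cut n)"
        using sum_diff_nat_ivl[of 0 "cut n" n s2] elim(2) unfolding v_def lessThan_atLeast0 by simp
      then have "(\<Sum>i\<in>{cut n..<n}. - (s2 i * (?t n)\<^sup>2 / 2)) = - ((v n - v (cut n)) * (?t n)\<^sup>2 / 2)"
        by (simp only: sum_negf sum_distrib_right[symmetric] sum_divide_distrib[symmetric])
      also have "\<dots> = - (s\<^sup>2 / 2) * (1 - v (cut n) / v n)"
      proof -
        have "- ((x - y) * (s\<^sup>2 / x) / 2) = - (s\<^sup>2 / 2) * (1 - y / x)" if "0 < x" for x y :: real
          using that by (simp add: field_simps)
        from this[OF vp, of "v (cut n)"] show ?thesis by (simp only: power_divide b_sq)
      qed
      finally have eq: "(\<Sum>i\<in>{cut n..<n}. - (s2 i * (?t n)\<^sup>2 / 2)) = - (s\<^sup>2 / 2) * (1 - v (cut n) / v n)" .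
      show ?case
        unfolding eq[symmetric] exp_sum[OF finite_atLeastLessThan] of_real_prod ..
    qed
  qed
  from tendsto_add[OF diff this] show ?thesis by simp
qed

end


section \<open>The local limit on the Fourier side\<close>

text \<open>One environment together with one tree, all probability being removed. \<open>Z\<close>
  is the normalised empirical characteristic function, \<open>D\<close> the size of the truncated
  differences, \<open>R\<close> the remainder, \<open>V\<close> the spread, and
  \<open>\<gamma>\<close> will be \<open>\<beta> - 1\<close>.\<close>

locale fourier_martingale = clt_environment +
  fixes Z :: "nat \<Rightarrow> real \<Rightarrow> complex" and W :: "nat \<Rightarrow> real" and D :: "nat \<Rightarrow> real \<Rightarrow> real" and R :: "nat \<Rightarrow> real"
    and V :: "nat \<Rightarrow> real" and \<gamma> \<delta> E :: real
  assumes Z_measurable [measurable]: "\<And>n. Z n \<in> borel_measurable borel"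
    and D_measurable [measurable]: "\<And>n. D n \<in> borel_measurable borel"
    and cmod_Z_le: "\<And>n t. cmod (Z n t) \<le> W n"
    and W_convergent: "convergent W"
    and D_nonneg: "\<And>n t. 0 \<le> D n t" and R_nonneg: "\<And>n. 0 \<le> R n"
    and Z_step: "\<And>n t. cmod (Z (Suc n) t - \<phi> n t * Z n t) \<le> D n t + R n"
    and \<gamma>: "1 / 2 < \<gamma>" and R_summable: "summable (\<lambda>j. real (Suc j) powr \<gamma> * R j)"
    and \<delta>: "0 < \<delta>"
    and D_summable: "\<And>K. (\<Sum>j. ennreal (exp (\<delta> * real j)) * (\<integral>\<^sup>+t. ennreal (D j t) * indicator {-K..K} t \<partial>lborel)) < \<infinity>"
    and Z_centered: "\<And>n t. cmod (Z n t * iexp (- t * a n) - of_real (W n)) \<le> \<bar>t\<bar> * V n"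
    and V_le: "\<And>n. V n \<le> E * real (Suc n) ^ 3" and E: "0 \<le> E"
begin

lemma W_nonneg: "0 \<le> W n"
  using cmod_Z_le[of n 0] norm_ge_zero order_trans by blast

lemma W_bounded: obtains B where "0 \<le> B" "\<And>n. W n \<le> B"
proof -
  obtain B where "\<And>n. norm (W n) \<le> B"
    using convergent_imp_Bseq[OF W_convergent] by (auto simp: Bseq_def)
  then have "W n \<le> B" for n using abs_ge_self[of "W n"] order_trans by (metis real_norm_def)
  moreover from this[of 0] have "0 \<le> B" using W_nonneg[of 0] by linarith
  ultimately show ?thesis using that by blast
qed

lemma telescoping:
  assumes "k \<le> n"
  shows "cmod (Z n t - Z k t * (\<Prod>i\<in>{k..<n}. \<phi> i t)) \<le>
    (\<Sum>j\<in>{k..<n}. (\<Prod>i\<in>{Suc j..<n}. cmod (\<phi> i t)) * (D j t + R j))"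
  using assms
proof (induction n rule: dec_induct)
  case (step n)
  let ?p = "\<lambda>n. \<Prod>i\<in>{k..<n}. \<phi> i t"
  have "Z (Suc n) t - Z k t * ?p (Suc n) = (Z (Suc n) t - \<phi> n t * Z n t) + \<phi> n t * (Z n t - Z k t * ?p n)"
    using step.hyps by (simp add: prod.atLeastLessThan_Suc algebra_simps)
  also have "cmod \<dots> \<le> (D n t + R n) + cmod (\<phi> n t) * (\<Sum>j\<in>{k..<n}. (\<Prod>i\<in>{Suc j..<n}. cmod (\<phi> i t)) * (D j t + R j))"
    by (rule norm_triangle_le) (intro add_mono Z_step, simp add: norm_mult mult_left_mono step.IH)
  also have "cmod (\<phi> n t) * (\<Sum>j\<in>{k..<n}. (\<Prod>i\<in>{Suc j..<n}. cmod (\<phi> i t)) * (D j t + R j)) =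
      (\<Sum>j\<in>{k..<n}. (\<Prod>i\<in>{Suc j..<Suc n}. cmod (\<phi> i t)) * (D j t + R j))"
    unfolding sum_distrib_left by (intro sum.cong refl) (simp add: prod.atLeastLessThan_Suc)
  also have "(D n t + R n) + \<dots> = (\<Sum>j\<in>{k..<Suc n}. (\<Prod>i\<in>{Suc j..<Suc n}. cmod (\<phi> i t)) * (D j t + R j))"
    using step.hyps by (simp add: sum.atLeastLessThan_Suc)
  finally show ?case .
qed simp

lemma prod_cmod_le_1: "(\<Prod>i\<in>I. cmod (\<phi> i t)) \<le> 1"
  by (rule prod_le_1) (simp add: cmod_\<phi>_le)

lemma R_summable': "summable R"
proof (rule summable_comparison_test'[OF R_summable])
  fix n :: nat
  have "1 \<le> real (Suc n) powr \<gamma>" using \<gamma> by (intro ge_one_powr_ge_zero) auto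
  then show "norm (R n) \<le> real (Suc n) powr \<gamma> * R n"
    using mult_right_mono[of 1 "real (Suc n) powr \<gamma>" "R n"] R_nonneg[of n] by simp
qed

text \<open>For late \<open>j\<close> the weight \<open>real (Suc j) powr \<gamma>\<close> is at
  least \<open>(2 / 3 * real n) powr \<gamma>\<close>, so the sum is of order
  \<open>real n powr (- \<gamma>)\<close>. Since \<open>b n\<close> is at most of order
  \<open>sqrt (real n)\<close>, this is the place where \<open>1 / 2 < \<gamma>\<close> is
  decisive.\<close>

lemma R_late_sum: "(\<lambda>n. b n * (\<Sum>j | j < n \<and> 2 * n < 3 * Suc j. R j)) \<longlonglongrightarrow> 0"
proof -
  define S where "S = (\<Sum>j. real (Suc j) powr \<gamma> * R j)"
  have S0: "0 \<le> S" unfolding S_def by (intro suminf_nonneg R_summable mult_nonneg_nonneg R_nonneg) auto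
  have le: "b n * (\<Sum>j | j < n \<and> 2 * n < 3 * Suc j. R j) \<le> sqrt (2 * C) * S * (2 / 3) powr (- \<gamma>) * real n powr (1 / 2 - \<gamma>)" if n: "1 \<le> n" for n
  proof -
    let ?J = "{j. j < n \<and> 2 * n < 3 * Suc j}"
    have x: "0 < 2 / 3 * real n" using n by simp
    have "(\<Sum>j\<in>?J. R j) \<le> (\<Sum>j\<in>?J. (2 / 3 * real n) powr (- \<gamma>) * (real (Suc j) powr \<gamma> * R j))"
    proof (rule sum_mono)
      fix j assume "j \<in> ?J"
      then have "2 / 3 * real n \<le> real (Suc j)" by (simp add: field_simps)
      then have "(2 / 3 * real n) powr \<gamma> \<le> real (Suc j) powr \<gamma>"
        using x \<gamma> by (intro powr_mono2) auto
      then have "1 \<le> (2 / 3 * real n) powr (- \<gamma>) * real (Suc j) powr \<gamma>"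
        using x by (simp add: powr_minus field_simps)
      from mult_right_mono[OF this R_nonneg[of j]]
      show "R j \<le> (2 / 3 * real n) powr (- \<gamma>) * (real (Suc j) powr \<gamma> * R j)"
        by (simp only: mult.assoc mult_1_left)
    qed
    also have "\<dots> = (2 / 3 * real n) powr (- \<gamma>) * (\<Sum>j\<in>?J. real (Suc j) powr \<gamma> * R j)"
      by (rule sum_distrib_left[symmetric])
    also have "\<dots> \<le> (2 / 3 * real n) powr (- \<gamma>) * S"
      unfolding S_def by (intro mult_left_mono sum_le_suminf R_summable) (auto simp: R_nonneg)
    finally have 1: "(\<Sum>j\<in>?J. R j) \<le> (2 / 3 * real n) powr (- \<gamma>) * S" .
    have "b n \<le> sqrt (2 * C * real n)" unfolding b_def using v_le'[OF n] by simp
    also have "\<dots> = sqrt (2 * C) * real n powr (1 / 2)"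
      using C_nonneg by (simp add: real_sqrt_mult powr_half_sqrt)
    finally have 2: "b n \<le> sqrt (2 * C) * real n powr (1 / 2)" .
    have "b n * (\<Sum>j\<in>?J. R j) \<le> (sqrt (2 * C) * real n powr (1 / 2)) * ((2 / 3 * real n) powr (- \<gamma>) * S)"
      using 1 2 S0 C_nonneg by (intro mult_mono) (auto simp: b_nonneg sum_nonneg R_nonneg)
    also have "\<dots> = sqrt (2 * C) * S * (2 / 3) powr (- \<gamma>) * (real n powr (1 / 2) * real n powr (- \<gamma>))"
    proof -
      have "(2 / 3 * real n) powr (- \<gamma>) = (2 / 3) powr (- \<gamma>) * real n powr (- \<gamma>)"
        by (rule powr_mult)
      then show ?thesis by (simp only: mult_ac)
    qed
    also have "real n powr (1 / 2) * real n powr (- \<gamma>) = real n powr (1 / 2 - \<gamma>)"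
      by (simp add: powr_add[symmetric])
    finally show ?thesis .
  qed
  have "(\<lambda>n. real n powr (1 / 2 - \<gamma>)) \<longlonglongrightarrow> 0"
    using \<gamma> by (intro tendsto_neg_powr filterlim_real_sequentially) simp
  then have lim: "(\<lambda>n. sqrt (2 * C) * S * (2 / 3) powr (- \<gamma>) * real n powr (1 / 2 - \<gamma>)) \<longlonglongrightarrow> 0"
    by (rule tendsto_mult_right_zero)
  show ?thesis
  proof (rule tendsto_sandwich[OF _ _ tendsto_const lim])
    show "\<forall>\<^sub>F n in sequentially. 0 \<le> b n * (\<Sum>j | j < n \<and> 2 * n < 3 * Suc j. R j)"
      by (intro always_eventually allI mult_nonneg_nonneg b_nonneg sum_nonneg R_nonneg)
    show "\<forall>\<^sub>F n in sequentially. b n * (\<Sum>j | j < n \<and> 2 * n < 3 * Suc j. R j) \<le>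
        sqrt (2 * C) * S * (2 / 3) powr (- \<gamma>) * real n powr (1 / 2 - \<gamma>)"
      using eventually_ge_at_top[of 1] by eventually_elim (rule le)
  qed
qed

lemma R_tail: "(\<lambda>n. \<Sum>j\<in>{cut n..<n}. R j) \<longlonglongrightarrow> 0"
proof -
  have lim: "(\<lambda>k. \<Sum>j. R (j + k)) \<longlonglongrightarrow> 0"
    by (rule suminf_exist_split2[OF R_summable'])
  have "(\<lambda>n. \<Sum>j. R (j + cut n)) \<longlonglongrightarrow> 0"
    by (rule filterlim_compose[OF lim cut_at_top])
  then show ?thesis
  proof (rule tendsto_sandwich[OF _ _ tendsto_const, rotated 2])
    show "\<forall>\<^sub>F n in sequentially. (\<Sum>j\<in>{cut n..<n}. R j) \<le> (\<Sum>j. R (j + cut n))"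
      using eventually_ge_at_top[of 8]
    proof eventually_elim
      case (elim n)
      have "cut n \<le> n" using cut_less[OF elim] by linarith
      then have "(\<Sum>j\<in>{cut n..<n}. R j) = (\<Sum>j<n - cut n. R (j + cut n))"
        using sum.shift_bounds_nat_ivl[of R 0 "cut n" "n - cut n"] by (simp add: lessThan_atLeast0)
      also have "\<dots> \<le> (\<Sum>j. R (j + cut n))"
        by (intro sum_le_suminf) (auto simp: R_nonneg summable_iff_shift R_summable')
      finally show ?case .
    qed
  qed (auto intro!: always_eventually sum_nonneg R_nonneg)
qed

definition first_error :: "real \<Rightarrow> nat \<Rightarrow> ennreal" where
  "first_error K n = ennreal (b n) * (\<integral>\<^sup>+t. ennreal (cmod (Z n t - Z (cut n) t * (\<Prod>i\<in>{cut n..<n}. \<phi> i t))) * indicator {-K..K} t \<partial>lborel)"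

text \<open>The telescoping sum is split in three. Truncated differences are bounded without
  damping, since starting at \<open>cut n\<close> already makes them exponentially small. Early
  remainders gain the integral of \<open>exp (- c * real n * t\<^sup>2)\<close>. Late ones gain
  nothing and are left to \<open>R_late_sum\<close>.\<close>

lemma first_error_tendsto_0:
  assumes K: "0 < K"
  shows "first_error K \<longlonglongrightarrow> 0"
proof -
  define I where "I j = (\<integral>\<^sup>+t. ennreal (D j t) * indicator {-K..K} t \<partial>lborel)" for j
  define S where "S = (\<Sum>j. ennreal (exp (\<delta> * real j)) * I j)"
  have Sfin: "S < \<infinity>" unfolding S_def I_def by (rule D_summable)
  define S' where "S' = enn2real S"
  have SS': "S = ennreal S'" "0 \<le> S'" using Sfin by (auto simp: S'_def)
  obtain c where c: "0 < c" and decay: "\<forall>\<^sub>F n in sequentially. \<forall>k t. 3 * k \<le> 2 * n \<longrightarrow> \<bar>t\<bar> \<le> K \<longrightarrow>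
      (\<Prod>i\<in>{k..<n}. cmod (\<phi> i t)) \<le> exp (- c * real n * t\<^sup>2)"
    using \<phi>_decay[OF K] by blast
  \<comment> \<open>In this order: truncated differences, damped remainders, late
    remainders.\<close>
  define e where "e n = b n * exp (- \<delta> * real (cut n)) * S' + sqrt (2 * C * pi / c) * (\<Sum>j\<in>{cut n..<n}. R j) +
    2 * K * (b n * (\<Sum>j | j < n \<and> 2 * n < 3 * Suc j. R j))" for n
  have e0: "e \<longlonglongrightarrow> 0"
  proof -
    have "e \<longlonglongrightarrow> 0 * S' + sqrt (2 * C * pi / c) * 0 + 2 * K * 0"
      unfolding e_def by (intro tendsto_add tendsto_mult tendsto_const b_exp_cut R_tail R_late_sum \<delta>)
    then show ?thesis by simp
  qed
  have bound: "first_error K n \<le> ennreal (e n)"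
    if n: "8 \<le> n" and dec: "\<forall>k t. 3 * k \<le> 2 * n \<longrightarrow> \<bar>t\<bar> \<le> K \<longrightarrow> (\<Prod>i\<in>{k..<n}. cmod (\<phi> i t)) \<le> exp (- c * real n * t\<^sup>2)" for n
  proof -
    let ?k = "cut n"
    let ?J1 = "{j\<in>{?k..<n}. 3 * Suc j \<le> 2 * n}" and ?J2 = "{j\<in>{?k..<n}. 2 * n < 3 * Suc j}"
    let ?i = "\<lambda>t. indicator {-K..K} t :: ennreal"
    have kn: "?k \<le> n" using cut_less[OF n] by linarith
    have cn: "0 < c * real n" using c n by simp
    have pointwise: "cmod (Z n t - Z ?k t * (\<Prod>i\<in>{?k..<n}. \<phi> i t)) \<le>
        (\<Sum>j\<in>{?k..<n}. D j t) + (\<Sum>j\<in>?J1. R j) * exp (- (c * real n) * t\<^sup>2) + (\<Sum>j\<in>?J2. R j)" if t: "\<bar>t\<bar> \<le> K" for t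
    proof -
      have "(\<Sum>j\<in>{?k..<n}. (\<Prod>i\<in>{Suc j..<n}. cmod (\<phi> i t)) * (D j t + R j)) =
          (\<Sum>j\<in>{?k..<n}. (\<Prod>i\<in>{Suc j..<n}. cmod (\<phi> i t)) * D j t) + (\<Sum>j\<in>{?k..<n}. (\<Prod>i\<in>{Suc j..<n}. cmod (\<phi> i t)) * R j)"
        by (simp add: distrib_left sum.distrib)
      also have "(\<Sum>j\<in>{?k..<n}. (\<Prod>i\<in>{Suc j..<n}. cmod (\<phi> i t)) * R j) =
          (\<Sum>j\<in>?J1. (\<Prod>i\<in>{Suc j..<n}. cmod (\<phi> i t)) * R j) + (\<Sum>j\<in>?J2. (\<Prod>i\<in>{Suc j..<n}. cmod (\<phi> i t)) * R j)"
        by (subst sum.union_disjoint[symmetric]) (auto intro!: sum.cong)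
      also have "(\<Sum>j\<in>{?k..<n}. (\<Prod>i\<in>{Suc j..<n}. cmod (\<phi> i t)) * D j t) + \<dots> \<le>
          (\<Sum>j\<in>{?k..<n}. D j t) + ((\<Sum>j\<in>?J1. exp (- (c * real n) * t\<^sup>2) * R j) + (\<Sum>j\<in>?J2. R j))"
      proof (intro add_mono sum_mono)
        show "(\<Prod>i\<in>{Suc j..<n}. cmod (\<phi> i t)) * D j t \<le> D j t" for j
          using mult_right_mono[OF prod_cmod_le_1 D_nonneg] by simp
        show "(\<Prod>i\<in>{Suc j..<n}. cmod (\<phi> i t)) * R j \<le> R j" for j
          using mult_right_mono[OF prod_cmod_le_1 R_nonneg] by simp
        fix j assume "j \<in> ?J1"
        then have "(\<Prod>i\<in>{Suc j..<n}. cmod (\<phi> i t)) \<le> exp (- c * real n * t\<^sup>2)"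
          using dec t by blast
        then show "(\<Prod>i\<in>{Suc j..<n}. cmod (\<phi> i t)) * R j \<le> exp (- (c * real n) * t\<^sup>2) * R j"
          by (intro mult_right_mono R_nonneg) simp
      qed
      also have "(\<Sum>j\<in>?J1. exp (- (c * real n) * t\<^sup>2) * R j) = (\<Sum>j\<in>?J1. R j) * exp (- (c * real n) * t\<^sup>2)"
        by (subst sum_distrib_left[symmetric]) (rule mult.commute)
      finally show ?thesis
        using telescoping[OF kn, of t] by linarith
    qed
    have Rs: "0 \<le> (\<Sum>j\<in>J. R j)" for J by (intro sum_nonneg R_nonneg)
    have "(\<integral>\<^sup>+t. ennreal (cmod (Z n t - Z ?k t * (\<Prod>i\<in>{?k..<n}. \<phi> i t))) * ?i t \<partial>lborel) \<le>
        (\<integral>\<^sup>+t. (\<Sum>j\<in>{?k..<n}. ennreal (D j t) * ?i t) + (ennreal (\<Sum>j\<in>?J1. R j) * ennreal (exp (- (c * real n) * t\<^sup>2)) + ennreal (\<Sum>j\<in>?J2. R j) * ?i t) \<partial>lborel)"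
    proof (rule nn_integral_mono)
      fix t
      show "ennreal (cmod (Z n t - Z ?k t * (\<Prod>i\<in>{?k..<n}. \<phi> i t))) * ?i t \<le>
          (\<Sum>j\<in>{?k..<n}. ennreal (D j t) * ?i t) + (ennreal (\<Sum>j\<in>?J1. R j) * ennreal (exp (- (c * real n) * t\<^sup>2)) + ennreal (\<Sum>j\<in>?J2. R j) * ?i t)"
      proof (cases "\<bar>t\<bar> \<le> K")
        case True
        then have i1: "?i t = 1" by (auto simp: indicator_def)
        have "ennreal (cmod (Z n t - Z ?k t * (\<Prod>i\<in>{?k..<n}. \<phi> i t))) \<le>
            ennreal ((\<Sum>j\<in>{?k..<n}. D j t) + (\<Sum>j\<in>?J1. R j) * exp (- (c * real n) * t\<^sup>2) + (\<Sum>j\<in>?J2. R j))"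
          by (rule ennreal_leI[OF pointwise[OF True]])
        also have "\<dots> = (\<Sum>j\<in>{?k..<n}. ennreal (D j t)) + (ennreal (\<Sum>j\<in>?J1. R j) * ennreal (exp (- (c * real n) * t\<^sup>2)) + ennreal (\<Sum>j\<in>?J2. R j))"
          using Rs by (simp add: ennreal_plus[symmetric] ennreal_mult[symmetric] sum_ennreal D_nonneg sum_nonneg add.assoc del: ennreal_plus)
        finally show ?thesis by (simp only: i1 mult_1_right)
      next
        case False
        then have "?i t = 0" by (auto simp: indicator_def)
        then show ?thesis by simp
      qed
    qed
    also have "\<dots> = (\<Sum>j\<in>{?k..<n}. I j) + (ennreal (\<Sum>j\<in>?J1. R j) * ennreal (sqrt (pi / (c * real n))) + ennreal (\<Sum>j\<in>?J2. R j) * ennreal (2 * K))"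
    proof -
      have "(\<integral>\<^sup>+t. ennreal (\<Sum>j\<in>?J2. R j) * ?i t \<partial>lborel) = ennreal (\<Sum>j\<in>?J2. R j) * ennreal (2 * K)"
        using K by (subst nn_integral_cmult_indicator) auto
      moreover have "(\<integral>\<^sup>+t. ennreal (\<Sum>j\<in>?J1. R j) * ennreal (exp (- (c * real n) * t\<^sup>2)) \<partial>lborel) =
          ennreal (\<Sum>j\<in>?J1. R j) * ennreal (sqrt (pi / (c * real n)))"
        by (subst nn_integral_cmult, measurable, subst nn_integral_gauss[OF cn]) simp
      ultimately show ?thesis
        unfolding I_def by (subst nn_integral_add, measurable, subst nn_integral_add, measurable, subst nn_integral_sum) auto
    qed
    finally have "first_error K n \<le> ennreal (b n) * ((\<Sum>j\<in>{?k..<n}. I j) +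
        (ennreal (\<Sum>j\<in>?J1. R j) * ennreal (sqrt (pi / (c * real n))) + ennreal (\<Sum>j\<in>?J2. R j) * ennreal (2 * K)))"
      unfolding first_error_def by (rule mult_left_mono) simp
    also have "\<dots> \<le> ennreal (b n) * (ennreal (exp (- \<delta> * real ?k) * S') +
        (ennreal (\<Sum>j\<in>{?k..<n}. R j) * ennreal (sqrt (pi / (c * real n))) + ennreal (\<Sum>j | j < n \<and> 2 * n < 3 * Suc j. R j) * ennreal (2 * K)))"
    proof (intro mult_left_mono add_mono mult_right_mono ennreal_leI)
      have "(\<Sum>j\<in>{?k..<n}. I j) \<le> (\<Sum>j\<in>{?k..<n}. ennreal (exp (- \<delta> * real ?k)) * (ennreal (exp (\<delta> * real j)) * I j))"
      proof (rule sum_mono)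
        fix j assume "j \<in> {?k..<n}"
        then have "1 \<le> exp (- \<delta> * real ?k) * exp (\<delta> * real j)"
          using \<delta> by (simp add: exp_add[symmetric] mult_left_mono)
        then have "ennreal 1 \<le> ennreal (exp (- \<delta> * real ?k)) * ennreal (exp (\<delta> * real j))"
          unfolding ennreal_mult[symmetric, OF exp_ge_zero exp_ge_zero] by (rule ennreal_leI)
        from mult_right_mono[OF this, of "I j"]
        show "I j \<le> ennreal (exp (- \<delta> * real ?k)) * (ennreal (exp (\<delta> * real j)) * I j)" by (simp add: mult.assoc)
      qed
      also have "\<dots> = ennreal (exp (- \<delta> * real ?k)) * (\<Sum>j\<in>{?k..<n}. ennreal (exp (\<delta> * real j)) * I j)"
        by (rule sum_distrib_left[symmetric])
      also have "\<dots> \<le> ennreal (exp (- \<delta> * real ?k)) * S"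
        unfolding S_def by (intro mult_left_mono sum_le_suminf) auto
      finally show "(\<Sum>j\<in>{?k..<n}. I j) \<le> ennreal (exp (- \<delta> * real ?k) * S')"
        unfolding SS'(1) by (simp only: ennreal_mult[OF exp_ge_zero SS'(2)])
    qed (auto intro!: sum_mono2 R_nonneg)
    also have "\<dots> = ennreal (b n * (exp (- \<delta> * real ?k) * S' +
        ((\<Sum>j\<in>{?k..<n}. R j) * sqrt (pi / (c * real n)) + (\<Sum>j | j < n \<and> 2 * n < 3 * Suc j. R j) * (2 * K))))"
    proof -
      have p: "0 \<le> exp (- \<delta> * real ?k) * S'" "0 \<le> sqrt (pi / (c * real n))" "0 \<le> 2 * K"
        using SS'(2) cn K by auto
      show ?thesis
        using p Rs b_nonneg[of n]
        by (simp only: ennreal_mult[symmetric] ennreal_plus[symmetric] add_nonneg_nonneg mult_nonneg_nonneg)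
    qed
    also have "\<dots> \<le> ennreal (e n)"
    proof (rule ennreal_leI)
      \<comment> \<open>The Gaussian integral is of order \<open>1 / sqrt (real n)\<close> and
        cancels \<open>b n\<close> up to a constant, so damped remainders vanish merely because they
        form a tail of a convergent series.\<close>
      have bs: "b n * sqrt (pi / (c * real n)) \<le> sqrt (2 * C * pi / c)"
      proof -
        have "b n * sqrt (pi / (c * real n)) = sqrt (v n * (pi / (c * real n)))"
          unfolding b_def by (rule real_sqrt_mult[symmetric])
        also have "v n * (pi / (c * real n)) \<le> (2 * C * real n) * (pi / (c * real n))"
          using v_le'[of n] n cn by (intro mult_right_mono) auto
        also have "(2 * C * real n) * (pi / (c * real n)) = 2 * C * pi / c" using n by simp
        finally show ?thesis by simp
      qed
      have "(\<Sum>j\<in>{?k..<n}. R j) * (b n * sqrt (pi / (c * real n))) \<le> (\<Sum>j\<in>{?k..<n}. R j) * sqrt (2 * C * pi / c)"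
        by (intro mult_left_mono bs Rs)
      then show "b n * (exp (- \<delta> * real ?k) * S' +
          ((\<Sum>j\<in>{?k..<n}. R j) * sqrt (pi / (c * real n)) + (\<Sum>j | j < n \<and> 2 * n < 3 * Suc j. R j) * (2 * K))) \<le> e n"
        unfolding e_def by (simp add: distrib_left mult_ac)
    qed
    finally show ?thesis .
  qed
  have ev: "\<forall>\<^sub>F n in sequentially. first_error K n \<le> ennreal (e n)"
    using decay eventually_ge_at_top[of 8] by eventually_elim (rule bound)
  have "(\<lambda>n. ennreal (e n)) \<longlonglongrightarrow> ennreal 0"
    by (rule tendsto_ennrealI[OF e0])
  then show ?thesis
    by (intro tendsto_sandwich[OF _ ev tendsto_const]) auto
qed

definition second_integrand :: "nat \<Rightarrow> real \<Rightarrow> real" where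
  "second_integrand n t = cmod (Z (cut n) t * (\<Prod>i\<in>{cut n..<n}. \<phi> i t) - of_real (W n) * (iexp (t * a n) * of_real (exp (- v n * t\<^sup>2 / 2))))"

lemma measurable_second_integrand [measurable]: "second_integrand n \<in> borel_measurable borel"
  unfolding second_integrand_def by measurable

text \<open>Multiplication by the unimodular \<open>iexp (- t * a n)\<close> removes the drift from
  both terms and turns \<open>\<phi>\<close> into the centred \<open>\<psi>\<close>.\<close>

lemma second_integrand_eq:
  assumes "cut n \<le> n"
  shows "second_integrand n t = cmod ((Z (cut n) t * iexp (- t * a (cut n))) * (\<Prod>i\<in>{cut n..<n}. \<psi> i t) -
    of_real (W n) * of_real (exp (- v n * t\<^sup>2 / 2)))"
proof -
  let ?p = "\<Prod>i\<in>{cut n..<n}. \<phi> i t" and ?g = "of_real (exp (- v n * t\<^sup>2 / 2)) :: complex"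
  have e: "iexp (- t * a (cut n)) * iexp (- t * (a n - a (cut n))) = iexp (- t * a n)"
    unfolding exp_add[symmetric] by (rule arg_cong[where f = exp]) (simp add: algebra_simps)
  have e': "iexp (t * a n) * iexp (- t * a n) = 1"
    unfolding exp_add[symmetric] by simp
  have "(Z (cut n) t * ?p - of_real (W n) * (iexp (t * a n) * ?g)) * iexp (- t * a n) =
      Z (cut n) t * ?p * iexp (- t * a n) - of_real (W n) * ?g * (iexp (t * a n) * iexp (- t * a n))"
    by (simp only: left_diff_distrib right_diff_distrib mult_ac)
  also have "Z (cut n) t * ?p * iexp (- t * a n) = (Z (cut n) t * iexp (- t * a (cut n))) * (?p * iexp (- t * (a n - a (cut n))))"
    unfolding e[symmetric] by (simp only: mult_ac)
  also have "?p * iexp (- t * (a n - a (cut n))) = (\<Prod>i\<in>{cut n..<n}. \<psi> i t)"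
    by (rule prod_\<psi>[OF assms, symmetric])
  finally have "(Z (cut n) t * ?p - of_real (W n) * (iexp (t * a n) * ?g)) * iexp (- t * a n) =
      (Z (cut n) t * iexp (- t * a (cut n))) * (\<Prod>i\<in>{cut n..<n}. \<psi> i t) - of_real (W n) * ?g"
    unfolding e' by simp
  then have "cmod ((Z (cut n) t * ?p - of_real (W n) * (iexp (t * a n) * ?g)) * iexp (- t * a n)) =
      cmod ((Z (cut n) t * iexp (- t * a (cut n))) * (\<Prod>i\<in>{cut n..<n}. \<psi> i t) - of_real (W n) * ?g)"
    by (rule arg_cong)
  then show ?thesis
    unfolding second_integrand_def norm_mult[of _ "iexp (- t * a n)"] norm_exp_i_times by simp
qed

text \<open>At frequency \<open>s / b n\<close> three errors vanish separately: the spread of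
  generation \<open>cut n\<close>, which is of smaller order than \<open>b n\<close>; the change of
  \<open>W\<close> after that generation; and the error in \<open>gaussian_limit\<close>.\<close>

lemma second_integrand_tendsto_0: "(\<lambda>n. second_integrand n (s / b n)) \<longlonglongrightarrow> 0"
proof -
  obtain B where B: "0 \<le> B" "\<And>n. W n \<le> B" using W_bounded by blast
  let ?t = "\<lambda>n. s / b n"
  let ?\<beta> = "\<lambda>n. \<Prod>i\<in>{cut n..<n}. \<psi> i (?t n)" and ?\<omega> = "of_real (exp (- s\<^sup>2 / 2)) :: complex"
  have cutn: "\<forall>\<^sub>F n in sequentially. cut n \<le> n"
    using eventually_ge_at_top[of 8] by eventually_elim (use cut_less in force)
  have bpos: "\<forall>\<^sub>F n in sequentially. 0 < b n"
    using b_at_top by (simp add: filterlim_at_top_dense)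
  obtain w where w: "W \<longlonglongrightarrow> w" using W_convergent by (auto simp: convergent_def)
  have "(\<lambda>n. W (cut n) - W n) \<longlonglongrightarrow> w - w"
    by (intro tendsto_diff w filterlim_compose[OF w cut_at_top])
  then have WW: "(\<lambda>n. \<bar>W (cut n) - W n\<bar>) \<longlonglongrightarrow> 0" by (intro tendsto_rabs_zero) simp
  have \<beta>\<omega>: "(\<lambda>n. cmod (?\<beta> n - ?\<omega>)) \<longlonglongrightarrow> 0"
    by (intro tendsto_norm_zero) (use gaussian_limit[of s] in \<open>simp add: LIM_zero_iff\<close>)
  have bound: "second_integrand n (?t n) \<le> \<bar>s\<bar> * E * ((real (cut n) + 1) ^ 3 / b n) + \<bar>W (cut n) - W n\<bar> + B * cmod (?\<beta> n - ?\<omega>)"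
    if "cut n \<le> n" "0 < b n" for n
  proof -
    let ?\<alpha> = "Z (cut n) (?t n) * iexp (- ?t n * a (cut n))"
    have vt: "- v n * (?t n)\<^sup>2 / 2 = - s\<^sup>2 / 2"
      using that(2) by (simp add: power_divide b_sq[symmetric])
    have "second_integrand n (?t n) = cmod (?\<alpha> * ?\<beta> n - of_real (W n) * ?\<omega>)"
      unfolding second_integrand_eq[OF that(1)] vt ..
    also have "?\<alpha> * ?\<beta> n - of_real (W n) * ?\<omega> =
        ((?\<alpha> - of_real (W (cut n))) + of_real (W (cut n) - W n)) * ?\<beta> n + of_real (W n) * (?\<beta> n - ?\<omega>)"
      by (simp add: algebra_simps)
    also have "cmod \<dots> \<le> (cmod (?\<alpha> - of_real (W (cut n))) + \<bar>W (cut n) - W n\<bar>) * 1 + B * cmod (?\<beta> n - ?\<omega>)"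
    proof (rule norm_triangle_le, rule add_mono)
      have "cmod (?\<beta> n) \<le> 1"
        unfolding prod_norm[symmetric] by (rule prod_le_1) (simp add: cmod_\<psi>_le)
      moreover have "cmod ((?\<alpha> - of_real (W (cut n))) + of_real (W (cut n) - W n)) \<le> cmod (?\<alpha> - of_real (W (cut n))) + \<bar>W (cut n) - W n\<bar>"
        by (rule order_trans[OF norm_triangle_ineq]) (simp only: norm_of_real)
      ultimately show "cmod (((?\<alpha> - of_real (W (cut n))) + of_real (W (cut n) - W n)) * ?\<beta> n) \<le>
          (cmod (?\<alpha> - of_real (W (cut n))) + \<bar>W (cut n) - W n\<bar>) * 1"
        unfolding norm_mult by (intro mult_mono) auto
      show "cmod (of_real (W n) * (?\<beta> n - ?\<omega>)) \<le> B * cmod (?\<beta> n - ?\<omega>)"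
        unfolding norm_mult norm_of_real using B(2)[of n] W_nonneg[of n] by (intro mult_right_mono) auto
    qed
    also have "cmod (?\<alpha> - of_real (W (cut n))) \<le> \<bar>s\<bar> * E * ((real (cut n) + 1) ^ 3 / b n)"
    proof -
      have "cmod (?\<alpha> - of_real (W (cut n))) \<le> \<bar>?t n\<bar> * V (cut n)" by (rule Z_centered)
      also have "\<dots> \<le> \<bar>?t n\<bar> * (E * real (Suc (cut n)) ^ 3)" by (intro mult_left_mono V_le) simp
      also have "\<dots> = \<bar>s\<bar> * E * ((real (cut n) + 1) ^ 3 / b n)"
        using that(2) by (simp add: abs_divide algebra_simps)
      finally show ?thesis .
    qed
    finally show ?thesis by simp
  qed
  have lim: "(\<lambda>n. \<bar>s\<bar> * E * ((real (cut n) + 1) ^ 3 / b n) + \<bar>W (cut n) - W n\<bar> + B * cmod (?\<beta> n - ?\<omega>)) \<longlonglongrightarrow> \<bar>s\<bar> * E * 0 + 0 + B * 0"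
    by (intro tendsto_add tendsto_mult tendsto_const cut_cube_over_b WW \<beta>\<omega>)
  show ?thesis
  proof (rule tendsto_sandwich[OF _ _ tendsto_const])
    show "\<forall>\<^sub>F n in sequentially. second_integrand n (?t n) \<le> \<bar>s\<bar> * E * ((real (cut n) + 1) ^ 3 / b n) + \<bar>W (cut n) - W n\<bar> + B * cmod (?\<beta> n - ?\<omega>)"
      using cutn bpos by eventually_elim (rule bound)
  qed (use lim in \<open>auto simp: second_integrand_def\<close>)
qed

text \<open>The substitution \<open>t = s / b n\<close> absorbs the factor \<open>b n\<close>, and
  \<open>\<phi>_decay\<close> then provides a Gaussian majorant in \<open>s\<close>, so pointwise
  convergence is enough.\<close>

lemma second_error_tendsto_0:
  assumes K: "0 < K"
  shows "(\<lambda>n. ennreal (b n) * (\<integral>\<^sup>+t. ennreal (second_integrand n t) * indicator {-K..K} t \<partial>lborel)) \<longlonglongrightarrow> 0"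
proof -
  obtain B where B: "0 \<le> B" "\<And>n. W n \<le> B" using W_bounded by blast
  obtain c where c: "0 < c" and decay: "\<forall>\<^sub>F n in sequentially. \<forall>k t. 3 * k \<le> 2 * n \<longrightarrow> \<bar>t\<bar> \<le> K \<longrightarrow>
      (\<Prod>i\<in>{k..<n}. cmod (\<phi> i t)) \<le> exp (- c * real n * t\<^sup>2)"
    using \<phi>_decay[OF K] by blast
  have bpos: "\<forall>\<^sub>F n in sequentially. 0 < b n"
    using b_at_top by (simp add: filterlim_at_top_dense)
  obtain n0 where n0: "\<And>n. n0 \<le> n \<Longrightarrow> 0 < b n \<and> 8 \<le> n \<and> (\<forall>k t. 3 * k \<le> 2 * n \<longrightarrow> \<bar>t\<bar> \<le> K \<longrightarrow>
      (\<Prod>i\<in>{k..<n}. cmod (\<phi> i t)) \<le> exp (- c * real n * t\<^sup>2))"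
    using eventually_conj[OF bpos eventually_conj[OF eventually_ge_at_top[of 8] decay]]
    unfolding eventually_sequentially by blast
  have Cpos: "0 < C"
  proof -
    have "0 < v n0" using n0[of n0] by (simp add: b_def)
    then have "0 < C * real (Suc n0)" using v_le[of n0] by linarith
    then show ?thesis by (simp add: zero_less_mult_iff)
  qed
  \<comment> \<open>From \<open>v n \<le> 2 * C * real n\<close>: a decay
    \<open>c * real n * t\<^sup>2\<close> at \<open>t = s / b n\<close> is at least
    \<open>c' * s\<^sup>2\<close>.\<close>
  define c' where "c' = c / (2 * C)"
  have c': "0 < c'" using c Cpos by (simp add: c'_def)
  let ?G = "\<lambda>n s. ennreal (second_integrand n (s / b n)) * indicator {-K..K} (s / b n)"
  have subst: "ennreal (b n) * (\<integral>\<^sup>+t. ennreal (second_integrand n t) * indicator {-K..K} t \<partial>lborel) = (\<integral>\<^sup>+s. ?G n s \<partial>lborel)"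
    if "0 < b n" for n
  proof -
    have "(\<integral>\<^sup>+s. ?G n s \<partial>lborel) = ennreal \<bar>b n\<bar> * (\<integral>\<^sup>+t. ?G n (0 + b n * t) \<partial>lborel)"
      using that by (intro nn_integral_real_affine) auto
    then show ?thesis using that by simp
  qed
  \<comment> \<open>The majorant is available from \<open>n0\<close> on, so the sequence is shifted
    before dominated convergence is applied.\<close>
  have "(\<lambda>n. \<integral>\<^sup>+s. ?G (n + n0) s \<partial>lborel) \<longlonglongrightarrow> (\<integral>\<^sup>+s. 0 \<partial>(lborel :: real measure))"
  proof (rule nn_integral_dominated_convergence[where w = "\<lambda>s. ennreal B * ennreal (exp (- c' * s\<^sup>2)) + ennreal B * ennreal (exp (- (1 / 2) * s\<^sup>2))"])
    have "(\<integral>\<^sup>+s. ennreal B * ennreal (exp (- c' * s\<^sup>2)) + ennreal B * ennreal (exp (- (1 / 2) * s\<^sup>2)) \<partial>lborel) =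
        ennreal B * ennreal (sqrt (pi / c')) + ennreal B * ennreal (sqrt (pi / (1 / 2)))"
      by (subst nn_integral_add, measurable, subst (1 2) nn_integral_cmult, measurable,
          subst nn_integral_gauss[OF c'], subst nn_integral_gauss, simp_all)
    also have "\<dots> < \<infinity>" by (simp add: ennreal_mult_less_top)
    finally show "(\<integral>\<^sup>+s. ennreal B * ennreal (exp (- c' * s\<^sup>2)) + ennreal B * ennreal (exp (- (1 / 2) * s\<^sup>2)) \<partial>lborel) < \<infinity>" .
    show "AE s in lborel. ?G (j + n0) s \<le> ennreal B * ennreal (exp (- c' * s\<^sup>2)) + ennreal B * ennreal (exp (- (1 / 2) * s\<^sup>2))" for j
    proof (rule AE_I2)
      fix s :: real
      define n where "n = j + n0"
      have n: "0 < b n" "8 \<le> n" and dec: "\<And>k t. 3 * k \<le> 2 * n \<Longrightarrow> \<bar>t\<bar> \<le> K \<Longrightarrow>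
          (\<Prod>i\<in>{k..<n}. cmod (\<phi> i t)) \<le> exp (- c * real n * t\<^sup>2)"
        using n0[of n] by (auto simp: n_def)
      have vn: "0 < v n" using n(1) by (simp add: b_def)
      let ?t = "s / b n"
      show "?G (j + n0) s \<le> ennreal B * ennreal (exp (- c' * s\<^sup>2)) + ennreal B * ennreal (exp (- (1 / 2) * s\<^sup>2))"
      proof (cases "\<bar>?t\<bar> \<le> K")
        case True
        have "second_integrand n ?t \<le> B * exp (- c' * s\<^sup>2) + B * exp (- (1 / 2) * s\<^sup>2)"
          unfolding second_integrand_def
        proof (rule order_trans[OF norm_triangle_ineq4], rule add_mono)
          have "cmod (\<Prod>i\<in>{cut n..<n}. \<phi> i ?t) = (\<Prod>i\<in>{cut n..<n}. cmod (\<phi> i ?t))"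
            by (rule prod_norm[symmetric])
          also have "\<dots> \<le> exp (- c * real n * ?t\<^sup>2)"
            by (rule dec[OF cut_less[OF n(2)] True])
          also have "\<dots> \<le> exp (- c' * s\<^sup>2)"
          proof -
            have "v n \<le> 2 * C * real n" using v_le'[of n] n by simp
            then have "1 / (2 * C) \<le> real n / v n" using vn Cpos by (simp add: field_simps)
            then have "c * (1 / (2 * C)) * s\<^sup>2 \<le> c * (real n / v n) * s\<^sup>2"
              using c by (intro mult_right_mono mult_left_mono) auto
            then have "c' * s\<^sup>2 \<le> c * real n * ?t\<^sup>2"
              by (simp add: c'_def power_divide b_sq)
            then show ?thesis by simp
          qed
          finally have "cmod (\<Prod>i\<in>{cut n..<n}. \<phi> i ?t) \<le> exp (- c' * s\<^sup>2)" .
          moreover have "cmod (Z (cut n) ?t) \<le> B" using cmod_Z_le B(2) by (rule order_trans)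
          ultimately show "cmod (Z (cut n) ?t * (\<Prod>i\<in>{cut n..<n}. \<phi> i ?t)) \<le> B * exp (- c' * s\<^sup>2)"
            unfolding norm_mult using B by (intro mult_mono) auto
          have "- v n * ?t\<^sup>2 / 2 = - (1 / 2) * s\<^sup>2" using n(1) by (simp add: power_divide b_sq[symmetric])
          then show "cmod (of_real (W n) * (iexp (?t * a n) * of_real (exp (- v n * ?t\<^sup>2 / 2)))) \<le> B * exp (- (1 / 2) * s\<^sup>2)"
            unfolding norm_mult norm_exp_i_times norm_of_real using B(2)[of n] W_nonneg[of n] by (simp add: mult_right_mono)
        qed
        then have "ennreal (second_integrand n ?t) \<le> ennreal (B * exp (- c' * s\<^sup>2) + B * exp (- (1 / 2) * s\<^sup>2))"
          by (rule ennreal_leI)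
        also have "\<dots> = ennreal B * ennreal (exp (- c' * s\<^sup>2)) + ennreal B * ennreal (exp (- (1 / 2) * s\<^sup>2))"
          using B(1) by (simp add: ennreal_mult)
        finally have le: "ennreal (second_integrand n ?t) \<le> ennreal B * ennreal (exp (- c' * s\<^sup>2)) + ennreal B * ennreal (exp (- (1 / 2) * s\<^sup>2))" .
        have "indicator {-K..K} ?t = (1 :: ennreal)"
          using True by (intro indicator_simps(1)) (simp only: atLeastAtMost_iff, linarith)
        with le show ?thesis unfolding n_def by (simp only: mult_1_right)
      next
        case False
        then have "?t \<notin> {-K..K}" unfolding atLeastAtMost_iff by linarith
        then have "indicator {-K..K} ?t = (0 :: ennreal)" by (rule indicator_simps(2))
        then show ?thesis by (simp add: n_def)
      qed
    qed
    show "AE s in lborel. (\<lambda>n. ?G (n + n0) s) \<longlonglongrightarrow> 0"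
    proof (rule AE_I2)
      fix s
      have "(\<lambda>n. second_integrand (n + n0) (s / b (n + n0))) \<longlonglongrightarrow> 0"
        using second_integrand_tendsto_0[of s] by (rule LIMSEQ_ignore_initial_segment)
      then have lim: "(\<lambda>n. ennreal (second_integrand (n + n0) (s / b (n + n0)))) \<longlonglongrightarrow> 0"
        using tendsto_ennrealI[of _ 0] by simp
      show "(\<lambda>n. ?G (n + n0) s) \<longlonglongrightarrow> 0"
        by (rule tendsto_sandwich[OF _ _ tendsto_const lim])
          (auto intro!: always_eventually mult_left_mono[of _ 1, simplified] simp: indicator_def)
    qed
  qed measurable
  then have "(\<lambda>n. \<integral>\<^sup>+s. ?G (n + n0) s \<partial>lborel) \<longlonglongrightarrow> 0" by simp
  then have "(\<lambda>n. \<integral>\<^sup>+s. ?G n s \<partial>lborel) \<longlonglongrightarrow> 0" by (rule LIMSEQ_offset)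
  then show ?thesis
  proof (rule Lim_transform_eventually)
    show "\<forall>\<^sub>F n in sequentially. (\<integral>\<^sup>+s. ?G n s \<partial>lborel) =
        ennreal (b n) * (\<integral>\<^sup>+t. ennreal (second_integrand n t) * indicator {-K..K} t \<partial>lborel)"
      using bpos by eventually_elim (rule subst[symmetric])
  qed
qed

theorem fourier_convergence:
  assumes K: "0 < K"
  shows "(\<lambda>n. ennreal (b n) * (\<integral>\<^sup>+t. ennreal (cmod (Z n t - of_real (W n) *
    (iexp (t * a n) * of_real (exp (- v n * t\<^sup>2 / 2))))) * indicator {-K..K} t \<partial>lborel)) \<longlonglongrightarrow> 0"
proof (rule tendsto_sandwich[OF _ _ tendsto_const])
  have "(\<lambda>n. first_error K n + ennreal (b n) * (\<integral>\<^sup>+t. ennreal (second_integrand n t) * indicator {-K..K} t \<partial>lborel)) \<longlonglongrightarrow> 0 + 0"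
    by (intro tendsto_add first_error_tendsto_0 second_error_tendsto_0 K)
  then show "(\<lambda>n. first_error K n + ennreal (b n) * (\<integral>\<^sup>+t. ennreal (second_integrand n t) * indicator {-K..K} t \<partial>lborel)) \<longlonglongrightarrow> 0"
    by simp
  show "\<forall>\<^sub>F n in sequentially. ennreal (b n) * (\<integral>\<^sup>+t. ennreal (cmod (Z n t - of_real (W n) *
      (iexp (t * a n) * of_real (exp (- v n * t\<^sup>2 / 2))))) * indicator {-K..K} t \<partial>lborel) \<le>
      first_error K n + ennreal (b n) * (\<integral>\<^sup>+t. ennreal (second_integrand n t) * indicator {-K..K} t \<partial>lborel)"
  proof (intro always_eventually allI)
    fix n
    let ?p = "\<lambda>t. Z (cut n) t * (\<Prod>i\<in>{cut n..<n}. \<phi> i t)"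
    let ?g = "\<lambda>t. of_real (W n) * (iexp (t * a n) * of_real (exp (- v n * t\<^sup>2 / 2)))"
    have "(\<integral>\<^sup>+t. ennreal (cmod (Z n t - ?g t)) * indicator {-K..K} t \<partial>lborel) \<le>
        (\<integral>\<^sup>+t. ennreal (cmod (Z n t - ?p t)) * indicator {-K..K} t + ennreal (second_integrand n t) * indicator {-K..K} t \<partial>lborel)"
    proof (rule nn_integral_mono)
      fix t
      have "cmod (Z n t - ?g t) \<le> cmod (Z n t - ?p t) + second_integrand n t"
        unfolding second_integrand_def using norm_triangle_ineq[of "Z n t - ?p t" "?p t - ?g t"] by simp
      then have "ennreal (cmod (Z n t - ?g t)) \<le> ennreal (cmod (Z n t - ?p t)) + ennreal (second_integrand n t)"
        using ennreal_leI ennreal_plus norm_ge_zero by (metis second_integrand_def)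
      then show "ennreal (cmod (Z n t - ?g t)) * indicator {-K..K} t \<le>
          ennreal (cmod (Z n t - ?p t)) * indicator {-K..K} t + ennreal (second_integrand n t) * indicator {-K..K} t"
        unfolding distrib_right[symmetric] by (intro mult_right_mono) auto
    qed
    also have "\<dots> = (\<integral>\<^sup>+t. ennreal (cmod (Z n t - ?p t)) * indicator {-K..K} t \<partial>lborel) +
        (\<integral>\<^sup>+t. ennreal (second_integrand n t) * indicator {-K..K} t \<partial>lborel)"
      by (rule nn_integral_add) measurable
    finally show "ennreal (b n) * (\<integral>\<^sup>+t. ennreal (cmod (Z n t - ?g t)) * indicator {-K..K} t \<partial>lborel) \<le>
        first_error K n + ennreal (b n) * (\<integral>\<^sup>+t. ennreal (second_integrand n t) * indicator {-K..K} t \<partial>lborel)"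
      unfolding first_error_def distrib_left[symmetric] by (rule mult_left_mono) simp
  qed
qed simp

end


section \<open>Band-limited majorants and minorants of an interval\<close>

text \<open>The Fejer kernel: a probability density, up to \<open>1 / pi\<close> the cosine
  transform of \<open>1 - t\<close> on \<open>{0..1}\<close>, with its limit inserted at 0.\<close>

definition fejer :: "real \<Rightarrow> real" where
  "fejer y = (if y = 0 then 1 / (2 * pi) else (1 - cos y) / (pi * y\<^sup>2))"

text \<open>The odd antiderivative of \<open>fejer\<close>, with limits \<open>1 / 2\<close> and
  \<open>- 1 / 2\<close>; integration by parts leaves the sine integral. At \<open>z = 0\<close>
  division by zero happens to give the right value.\<close>

definition fejer_primitive :: "real \<Rightarrow> real" where
  "fejer_primitive z = (Si z - (1 - cos z) / z) / pi"

lemma fejer_nonneg: "0 \<le> fejer y"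
  by (simp add: fejer_def)

lemma fejer_le: "z \<noteq> 0 \<Longrightarrow> fejer z \<le> 2 / (pi * z\<^sup>2)"
proof -
  assume z: "z \<noteq> 0"
  have "1 - cos z \<le> 2" using cos_ge_minus_one[of z] by linarith
  then show ?thesis using z by (auto simp: fejer_def intro!: divide_right_mono)
qed

lemma DERIV_fejer_primitive:
  assumes "z \<noteq> 0"
  shows "(fejer_primitive has_real_derivative fejer z) (at z)"
proof -
  have "(fejer_primitive has_real_derivative
      ((if z = 0 then 1 else sin z / z) - (sin z * z - (1 - cos z) * 1) / (z * z)) / pi) (at z)"
    unfolding fejer_primitive_def
    using assms by (auto intro!: derivative_eq_intros DERIV_Si)
  moreover have "((if z = 0 then 1 else sin z / z) - (sin z * z - (1 - cos z) * 1) / (z * z)) / pi = fejer z"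
    using assms by (simp add: fejer_def field_simps power2_eq_square)
  ultimately show ?thesis by simp
qed

lemma fejer_primitive_0: "fejer_primitive 0 = 0"
  by (simp add: fejer_primitive_def Si_def zero_ereal_def[symmetric])

lemma fejer_primitive_minus: "fejer_primitive (- z) = - fejer_primitive z"
proof -
  have "Si (- z) = - Si z"
    using Si_neg[of z] Si_neg[of "- z"] by (cases "0 \<le> z") auto
  then show ?thesis by (simp add: fejer_primitive_def diff_divide_distrib)
qed

lemma fejer_primitive_at_top: "(fejer_primitive \<longlongrightarrow> 1 / 2) at_top"
proof -
  have "((\<lambda>z::real. (1 - cos z) / z) \<longlongrightarrow> 0) at_top"
  proof (rule Lim_null_comparison)
    show "\<forall>\<^sub>F z::real in at_top. norm ((1 - cos z) / z) \<le> 2 / z"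
      using eventually_gt_at_top[of 0]
    proof eventually_elim
      case (elim z)
      have "\<bar>1 - cos z\<bar> \<le> 2" using cos_ge_minus_one[of z] cos_le_one[of z] by linarith
      then show ?case using elim by (simp add: divide_right_mono)
    qed
    show "((\<lambda>z::real. 2 / z) \<longlongrightarrow> 0) at_top" by real_asymp
  qed
  then have "((\<lambda>z. (Si z - (1 - cos z) / z) / pi) \<longlongrightarrow> (pi / 2 - 0) / pi) at_top"
    by (intro tendsto_intros Si_at_top) auto
  then show ?thesis unfolding fejer_primitive_def by simp
qed

lemma fejer_primitive_mono_pos:
  assumes "0 < z" "z \<le> w"
  shows "fejer_primitive z \<le> fejer_primitive w"
  using assms by (intro DERIV_nonneg_imp_nondecreasing[where f = fejer_primitive])
    (auto intro!: exI[of _ "fejer _"] DERIV_fejer_primitive fejer_nonneg)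

lemma fejer_primitive_le_half: "0 < z \<Longrightarrow> fejer_primitive z \<le> 1 / 2"
  by (rule tendsto_lowerbound[OF fejer_primitive_at_top])
    (auto simp: eventually_at_top_linorder intro!: exI[of _ z] fejer_primitive_mono_pos)

text \<open>Since \<open>fejer v\<close> is at most \<open>2 / (pi * v\<^sup>2)\<close>, adding the
  primitive of that bound gives a decreasing function with limit \<open>1 / 2\<close>.\<close>

lemma fejer_primitive_ge:
  assumes "0 < z"
  shows "1 / 2 - 2 / (pi * z) \<le> fejer_primitive z"
proof -
  let ?g = "\<lambda>w. fejer_primitive w + 2 / (pi * w)"
  have "?g w \<le> ?g z" if "z \<le> w" for w
  proof (rule DERIV_nonpos_imp_nonincreasing[OF that])
    fix v assume "z \<le> v" "v \<le> w"
    then have v: "0 < v" using assms by simp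
    have "(?g has_real_derivative fejer v - 2 / (pi * v\<^sup>2)) (at v)"
      using v by (auto intro!: derivative_eq_intros DERIV_fejer_primitive simp: power2_eq_square field_simps)
    moreover have "fejer v - 2 / (pi * v\<^sup>2) \<le> 0" using fejer_le[of v] v by simp
    ultimately show "\<exists>D. (?g has_real_derivative D) (at v) \<and> D \<le> 0" by blast
  qed
  moreover have "(?g \<longlongrightarrow> 1 / 2 + 0) at_top"
    by (intro tendsto_add fejer_primitive_at_top) real_asymp
  ultimately have "1 / 2 + 0 \<le> ?g z"
    by (intro tendsto_upperbound[where f = ?g]) (auto simp: eventually_at_top_linorder intro!: exI[of _ z])
  then show ?thesis by simp
qed

lemma fejer_primitive_diff_le:
  assumes "0 < z" "z \<le> w"
  shows "fejer_primitive w - fejer_primitive z \<le> (w - z) * (2 / (pi * z\<^sup>2))"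
proof (cases "z = w")
  case False
  then have "z < w" using assms by simp
  then have "\<exists>v>z. v < w \<and> fejer_primitive w - fejer_primitive z = (w - z) * fejer v"
    using assms by (intro MVT2 DERIV_fejer_primitive) auto
  then obtain v where v: "z < v" "v < w" "fejer_primitive w - fejer_primitive z = (w - z) * fejer v"
    by blast
  have "fejer v \<le> 2 / (pi * v\<^sup>2)" using v assms by (intro fejer_le) auto
  also have "\<dots> \<le> 2 / (pi * z\<^sup>2)"
    using v assms by (intro divide_left_mono mult_left_mono power_mono mult_pos_pos) auto
  finally show ?thesis unfolding v(3) using v assms by (intro mult_left_mono) auto
qed simp

text \<open>The derivative is known away from 0 only, so monotonicity on the positive axis is
  carried to 0 by continuity from the right.\<close>

lemma fejer_primitive_nonneg: "0 \<le> z \<Longrightarrow> 0 \<le> fejer_primitive z"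
proof (cases "z = 0")
  case False
  assume "0 \<le> z"
  have "continuous (at 0) fejer_primitive"
  proof -
    have "((\<lambda>z::real. (1 - cos z) / z) \<longlongrightarrow> 0) (at 0)" by real_asymp
    then have "((\<lambda>z. (Si z - (1 - cos z) / z) / pi) \<longlongrightarrow> (Si 0 - 0) / pi) (at 0)"
      by (intro tendsto_intros isCont_Si[unfolded isCont_def]) auto
    then show ?thesis
      by (simp add: isCont_def fejer_primitive_def[abs_def])
  qed
  then have "(fejer_primitive \<longlongrightarrow> fejer_primitive 0) (at_right 0)"
    unfolding isCont_def by (rule filterlim_mono[OF _ order.refl at_le]) simp
  then have "fejer_primitive 0 \<le> fejer_primitive z"
  proof (rule tendsto_upperbound)
    show "\<forall>\<^sub>F i in at_right 0. fejer_primitive i \<le> fejer_primitive z"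
      unfolding eventually_at_right_field
      using False \<open>0 \<le> z\<close> by (intro exI[of _ z]) (auto intro!: fejer_primitive_mono_pos)
  qed simp
  then show ?thesis by (simp add: fejer_primitive_0)
qed (simp add: fejer_primitive_0)

lemma fejer_primitive_mono:
  assumes "z \<le> w"
  shows "fejer_primitive z \<le> fejer_primitive w"
proof -
  consider "0 < z" | "z \<le> 0" "0 \<le> w" | "w < 0" by linarith
  then show ?thesis
  proof cases
    case 2
    then show ?thesis
      using fejer_primitive_nonneg[of w] fejer_primitive_nonneg[of "- z"]
      by (simp add: fejer_primitive_minus)
  next
    case 3
    then show ?thesis
      using fejer_primitive_mono_pos[of "- w" "- z"] assms by (simp add: fejer_primitive_minus)
  qed (use assms in \<open>simp add: fejer_primitive_mono_pos\<close>)
qed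

lemma abs_fejer_primitive_le: "\<bar>fejer_primitive z\<bar> \<le> 1 / 2"
proof -
  have "\<bar>fejer_primitive z\<bar> \<le> 1 / 2" if "0 \<le> z" for z
    using that fejer_primitive_nonneg[of z] fejer_primitive_le_half[of z]
    by (cases "z = 0") (auto simp: fejer_primitive_0)
  from this[of z] this[of "- z"] show ?thesis
    by (cases "0 \<le> z") (auto simp: fejer_primitive_minus)
qed

lemma set_integral_fejer: "(LBINT t:{0..1}. (1 - t) * cos (t * y)) = pi * fejer y"
proof (cases "y = 0")
  case True
  have "(LBINT t:{0..1}. (1 - t) * cos (t * y)) = (1 - 1\<^sup>2 / 2) - (0 - 0\<^sup>2 / 2 :: real)"
    unfolding set_lebesgue_integral_def
    by (rule integral_FTC_atLeastAtMost[where F = "\<lambda>t. t - t\<^sup>2 / 2"])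
      (auto simp: True intro!: derivative_eq_intros continuous_intros simp: has_real_derivative_iff_has_vector_derivative[symmetric])
  then show ?thesis by (simp add: fejer_def True)
next
  case False
  let ?F = "\<lambda>t. (1 - t) * sin (t * y) / y - cos (t * y) / y\<^sup>2"
  have "(LBINT t:{0..1}. (1 - t) * cos (t * y)) = ?F 1 - ?F 0"
    unfolding set_lebesgue_integral_def
    by (rule integral_FTC_atLeastAtMost[where F = ?F])
      (use False in \<open>auto intro!: derivative_eq_intros continuous_intros
        simp: has_real_derivative_iff_has_vector_derivative[symmetric] power2_eq_square field_simps\<close>)
  then show ?thesis
    using False by (simp add: fejer_def flip: diff_divide_distrib)
qed

text \<open>The antiderivative of \<open>cos (t * z)\<close> in \<open>z\<close>, extended
  continuously to \<open>t = 0\<close>. It does for \<open>fejer_primitive\<close> what the cosine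
  does for \<open>fejer\<close>.\<close>

definition dsin :: "real \<Rightarrow> real \<Rightarrow> real" where
  "dsin z t = (if t = 0 then z else sin (t * z) / t)"

lemma dsin_eq: "dsin z t = z * sinc (t * z)"
  by (simp add: dsin_def)

lemma dsin_minus: "dsin (- z) t = - dsin z t"
  by (simp add: dsin_def)

lemma continuous_on_dsin [continuous_intros]: "continuous_on S (dsin z)"
proof -
  have "dsin z = (\<lambda>t. z * sinc (t * z))" by (rule ext) (rule dsin_eq)
  moreover have "continuous_on S (\<lambda>t. z * sinc (t * z))" by (intro continuous_intros)
  ultimately show ?thesis by simp
qed

lemma measurable_dsin [measurable]: "dsin z \<in> borel_measurable borel"
  by (intro borel_measurable_continuous_onI continuous_intros)

text \<open>As \<open>t * dsin z t\<close> is \<open>sin (t * z)\<close>, the integral splits into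
  \<open>Si z\<close> and an elementary one. Both sides are odd in \<open>z\<close>, so positive
  \<open>z\<close> suffices.\<close>

lemma set_integral_fejer_primitive:
  "(LBINT t:{0..1}. (1 - t) * dsin z t) = pi * fejer_primitive z"
proof -
  have pos: "(LBINT t:{0..1}. (1 - t) * dsin z t) = pi * fejer_primitive z" if z: "0 < z" for z
  proof -
    have "Si z = (LBINT x. indicator {0..z} x *\<^sub>R sinc x)"
      unfolding Si_alt_def using z
      by (simp add: interval_integral_Icc[of 0 z] zero_ereal_def set_lebesgue_integral_def)
    also have "\<dots> = \<bar>z\<bar> *\<^sub>R (LBINT x. indicator {0..z} (0 + z * x) *\<^sub>R sinc (0 + z * x))"
      using z by (intro lborel_integral_real_affine) simp
    also have "\<dots> = z * (LBINT x. indicator {0..z} (0 + z * x) *\<^sub>R sinc (0 + z * x))"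
      using z by (simp only: abs_of_pos real_scaleR_def)
    also have "\<dots> = (LBINT x. z * (indicator {0..z} (0 + z * x) *\<^sub>R sinc (0 + z * x)))"
      by (rule integral_mult_right_zero[symmetric])
    also have "\<dots> = (LBINT t:{0..1}. dsin z t)"
      unfolding set_lebesgue_integral_def
    proof (rule Bochner_Integration.integral_cong[OF refl])
      fix x
      have "indicator {0..z} (0 + z * x) = (indicator {0..1} x :: real)"
        using z by (auto simp: indicator_def zero_le_mult_iff)
      then show "z * (indicator {0..z} (0 + z * x) *\<^sub>R sinc (0 + z * x)) = indicator {0..1} x *\<^sub>R dsin z x"
        using z by (simp add: dsin_def mult.commute)
    qed
    finally have 1: "(LBINT t:{0..1}. dsin z t) = Si z" ..
    have 2: "(LBINT t:{0..1}. sin (t * z)) = (1 - cos z) / z"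
    proof -
      have "(LBINT t:{0..1}. sin (t * z)) = - cos (1 * z) / z - (- cos (0 * z) / z)"
        unfolding set_lebesgue_integral_def
        by (rule integral_FTC_atLeastAtMost[where F = "\<lambda>t. - cos (t * z) / z"])
          (use z in \<open>auto intro!: derivative_eq_intros continuous_intros
            simp: has_real_derivative_iff_has_vector_derivative[symmetric]\<close>)
      then show ?thesis by (simp add: diff_divide_distrib)
    qed
    have "(LBINT t:{0..1}. (1 - t) * dsin z t) = (LBINT t:{0..1}. dsin z t - sin (t * z))"
      by (intro set_lebesgue_integral_cong) (auto simp: dsin_def algebra_simps)
    also have "\<dots> = (LBINT t:{0..1}. dsin z t) - (LBINT t:{0..1}. sin (t * z))"
      by (intro set_integral_diff borel_integrable_atLeastAtMost') (intro continuous_intros)+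
    finally show ?thesis unfolding 1 2 by (simp add: fejer_primitive_def)
  qed
  consider "0 < z" | "z = 0" | "0 < - z" by linarith
  then show ?thesis
  proof cases
    case 2
    then have "dsin z t = 0" for t by (simp add: dsin_def)
    then show ?thesis by (simp add: 2 fejer_primitive_0 set_lebesgue_integral_def)
  next
    case 3
    from pos[OF 3] show ?thesis
      by (simp add: dsin_minus fejer_primitive_minus set_lebesgue_integral_def)
  qed (simp add: pos)
qed

section \<open>Functions with compactly supported Fourier transform\<close>

lemma Re_of_real_mult: "Re (of_real r * z) = r * Re z"
  by simp

text \<open>For a real function nonnegative frequencies suffice once the real part is taken. The
  number \<open>c\<close> plays the role of the integral of \<open>f\<close>, encoded as the limit
  \<open>c / pi\<close> of \<open>H\<close> at 0; continuity of \<open>H\<close> elsewhere is not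
  asked for, since rescaling by \<open>b n\<close> looks at \<open>H\<close> near 0 only.\<close>

definition bandlimited :: "(real \<Rightarrow> real) \<Rightarrow> real \<Rightarrow> bool" where
  "bandlimited f c \<longleftrightarrow> (\<exists>K B. \<exists>H :: real \<Rightarrow> complex. 0 < K \<and> H \<in> borel_measurable borel \<and>
     (\<forall>t. cmod (H t) \<le> B) \<and> (\<forall>t. t \<notin> {0..K} \<longrightarrow> H t = 0) \<and>
     (H \<longlongrightarrow> of_real (c / pi)) (at_right 0) \<and>
     (\<forall>y. f y = (LBINT t. Re (H t * iexp (t * y)))))"

lemma bandlimitedI:
  fixes H :: "real \<Rightarrow> complex"
  assumes "0 < K" "H \<in> borel_measurable borel" "\<And>t. cmod (H t) \<le> B" "\<And>t. t \<notin> {0..K} \<Longrightarrow> H t = 0"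
    "(H \<longlongrightarrow> of_real (c / pi)) (at_right 0)" "\<And>y. f y = (LBINT t. Re (H t * iexp (t * y)))"
  shows "bandlimited f c"
  using assms unfolding bandlimited_def by blast

lemma integrable_bandlimited_integrand:
  fixes H :: "real \<Rightarrow> complex" and g :: "real \<Rightarrow> complex"
  assumes [measurable]: "H \<in> borel_measurable borel" and B: "\<And>t. cmod (H t) \<le> B"
    and K: "\<And>t. t \<notin> {0..K} \<Longrightarrow> H t = 0"
    and g [measurable]: "g \<in> borel_measurable borel" and g1: "\<And>t. cmod (g t) \<le> 1"
  shows "integrable lborel (\<lambda>t. H t * g t)"
proof (rule Bochner_Integration.integrable_bound)
  show "integrable lborel (\<lambda>t. B * indicator {0..K} t)"
    by (intro integrable_mult_right integrable_real_indicator) (auto simp: emeasure_lborel_Icc_eq)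
  have B0: "0 \<le> B" using B[of 0] norm_ge_zero order_trans by blast
  show "AE t in lborel. norm (H t * g t) \<le> norm (B * indicator {0..K} t)"
  proof (rule AE_I2)
    fix t
    show "norm (H t * g t) \<le> norm (B * indicator {0..K} t)"
      using mult_mono[OF B[of t] g1[of t]] B0 K[of t]
      by (cases "t \<in> {0..K}") (auto simp: norm_mult)
  qed
qed measurable

lemma bandlimited_add:
  assumes "bandlimited f c" "bandlimited g d"
  shows "bandlimited (\<lambda>y. f y + g y) (c + d)"
proof -
  obtain K B H where f: "0 < K" "H \<in> borel_measurable borel" "\<And>t. cmod (H t) \<le> B"
      "\<And>t. t \<notin> {0..K} \<Longrightarrow> H t = 0" "(H \<longlongrightarrow> of_real (c / pi)) (at_right 0)"
      "\<And>y. f y = (LBINT t. Re (H t * iexp (t * y)))"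
    using assms(1) unfolding bandlimited_def by blast
  obtain K' B' H' where g: "0 < K'" "H' \<in> borel_measurable borel" "\<And>t. cmod (H' t) \<le> B'"
      "\<And>t. t \<notin> {0..K'} \<Longrightarrow> H' t = 0" "(H' \<longlongrightarrow> of_real (d / pi)) (at_right 0)"
      "\<And>y. g y = (LBINT t. Re (H' t * iexp (t * y)))"
    using assms(2) unfolding bandlimited_def by blast
  have "f y + g y = (LBINT t. Re ((H t + H' t) * iexp (t * y)))" for y
  proof -
    have "integrable lborel (\<lambda>t. Re (H t * iexp (t * y)))" "integrable lborel (\<lambda>t. Re (H' t * iexp (t * y)))"
      by (intro integrable_Re integrable_bandlimited_integrand[OF f(2-4)]
          integrable_bandlimited_integrand[OF g(2-4)]; simp)+
    then show ?thesis
      unfolding f(6) g(6) by (simp only: distrib_right plus_complex.sel Bochner_Integration.integral_add)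
  qed
  moreover have "((\<lambda>t. H t + H' t) \<longlongrightarrow> of_real ((c + d) / pi)) (at_right 0)"
    using tendsto_add[OF f(5) g(5)] by (simp add: add_divide_distrib)
  moreover have "cmod (H t + H' t) \<le> B + B'" for t
    by (intro norm_triangle_le add_mono f g)
  moreover have "H t + H' t = 0" if "t \<notin> {0..max K K'}" for t
  proof -
    have "t \<notin> {0..K}" "t \<notin> {0..K'}" using that by auto
    from f(4)[OF this(1)] g(4)[OF this(2)] show ?thesis by simp
  qed
  moreover have "0 < max K K'" "(\<lambda>t. H t + H' t) \<in> borel_measurable borel"
    using f(1,2) g(1,2) by auto
  ultimately show ?thesis by (intro bandlimitedI)
qed

lemma bandlimited_scale:
  assumes "bandlimited f c"
  shows "bandlimited (\<lambda>y. a * f y) (a * c)"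
proof -
  obtain K B H where f: "0 < K" "H \<in> borel_measurable borel" "\<And>t. cmod (H t) \<le> B"
      "\<And>t. t \<notin> {0..K} \<Longrightarrow> H t = 0" "(H \<longlongrightarrow> of_real (c / pi)) (at_right 0)"
      "\<And>y. f y = (LBINT t. Re (H t * iexp (t * y)))"
    using assms(1) unfolding bandlimited_def by blast
  have "a * f y = (LBINT t. Re ((of_real a * H t) * iexp (t * y)))" for y
  proof -
    have "Re ((of_real a * H t) * iexp (t * y)) = a * Re (H t * iexp (t * y))" for t
      by (simp add: mult.assoc)
    then show ?thesis unfolding f(6) by simp
  qed
  moreover have "((\<lambda>t. of_real a * H t) \<longlongrightarrow> of_real (a * c / pi)) (at_right 0)"
    using tendsto_mult[OF tendsto_const f(5), of "of_real a"] by simp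
  moreover have "cmod (of_real a * H t) \<le> \<bar>a\<bar> * B" for t
    by (simp add: norm_mult f mult_left_mono)
  moreover have "of_real a * H t = 0" if "t \<notin> {0..K}" for t
    using f(4)[OF that] by simp
  moreover have "(\<lambda>t. of_real a * H t) \<in> borel_measurable borel" using f(2) by simp
  ultimately show ?thesis using f(1) by (intro bandlimitedI)
qed

lemma bandlimited_fejer_shift: "bandlimited (\<lambda>y. fejer (y + s)) 1"
proof -
  define H :: "real \<Rightarrow> complex" where "H t = of_real (indicator {0..1} t * (1 - t) / pi) * iexp (t * s)" for t
  have "fejer (y + s) = (LBINT t. Re (H t * iexp (t * y)))" for y
  proof -
    have "Re (H t * iexp (t * y)) = indicator {0..1} t *\<^sub>R ((1 - t) * cos (t * (y + s))) / pi" for t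
    proof -
      have "H t * iexp (t * y) = of_real (indicator {0..1} t * (1 - t) / pi) * iexp (t * (y + s))"
        unfolding H_def mult.assoc exp_add[symmetric] by (simp add: algebra_simps)
      also have "Re \<dots> = (indicator {0..1} t * (1 - t) / pi) * Re (iexp (t * (y + s)))"
        by (rule Re_of_real_mult)
      finally show ?thesis by (simp add: Re_exp)
    qed
    then show ?thesis
      using set_integral_fejer[of "y + s"] by (simp add: set_lebesgue_integral_def)
  qed
  moreover have "(H \<longlongrightarrow> of_real (1 / pi)) (at_right 0)"
  proof (rule Lim_transform_eventually)
    have "((\<lambda>t. of_real ((1 - t) / pi) * iexp (t * s)) \<longlongrightarrow> of_real ((1 - 0) / pi) * iexp (0 * s)) (at_right 0)"
      by (intro tendsto_intros) auto
    then show "((\<lambda>t. of_real ((1 - t) / pi) * iexp (t * s)) \<longlongrightarrow> of_real (1 / pi)) (at_right 0)" by simp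
    have "\<forall>\<^sub>F t in at_right (0::real). t \<in> {0<..<1}" by (rule eventually_at_right_real) simp
    then show "\<forall>\<^sub>F t in at_right 0. of_real ((1 - t) / pi) * iexp (t * s) = H t"
      by eventually_elim (simp add: H_def)
  qed
  moreover have "cmod (H t) \<le> 1 / pi" for t
    unfolding H_def norm_mult norm_exp_i_times norm_of_real by (auto simp: indicator_def norm_divide divide_right_mono)
  moreover have "H \<in> borel_measurable borel" unfolding H_def by measurable
  moreover have "H t = 0" if "t \<notin> {0..1}" for t using that by (simp add: H_def)
  moreover have "0 < (1 :: real)" by simp
  ultimately show ?thesis by (intro bandlimitedI)
qed

text \<open>The indicator of \<open>{a..b}\<close> convolved with the Fejer kernel
  \<open>T * fejer (T * y)\<close>. Large \<open>T\<close> means a sharp edge and a wide frequency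
  band.\<close>

definition smooth_interval :: "real \<Rightarrow> real \<Rightarrow> real \<Rightarrow> real \<Rightarrow> real" where
  "smooth_interval T a b y = fejer_primitive (T * (y - a)) - fejer_primitive (T * (y - b))"

lemma bandlimited_smooth_interval:
  assumes T: "0 < T" and ab: "a \<le> b"
  shows "bandlimited (smooth_interval T a b) (b - a)"
proof -
  \<comment> \<open>The triangle on \<open>{0..T}\<close> times the integral of
    \<open>iexp (- (t * x))\<close> over \<open>x\<close> in \<open>{a..b}\<close>, divided by
    \<open>pi\<close>: convolution has become a product. The value at \<open>t = 0\<close> is
    irrelevant for the integral.\<close>
  define H :: "real \<Rightarrow> complex" where
    "H t = of_real (indicator {0..T} t * (1 - t / T) / pi) * ((iexp (-(t * a)) - iexp (-(t * b))) / (\<i> * t))" for t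
  have prim: "fejer_primitive (T * z) = (LBINT t:{0..T}. (1 - t / T) * dsin z t) / pi" for z
  proof -
    have "pi * fejer_primitive (T * z) = (LBINT t. indicator {0..1} t *\<^sub>R ((1 - t) * dsin (T * z) t))"
      using set_integral_fejer_primitive[of "T * z"] by (simp add: set_lebesgue_integral_def)
    also have "\<dots> = \<bar>1 / T\<bar> *\<^sub>R (LBINT t. indicator {0..1} (0 + 1 / T * t) *\<^sub>R
        ((1 - (0 + 1 / T * t)) * dsin (T * z) (0 + 1 / T * t)))"
      using T by (intro lborel_integral_real_affine) simp
    also have "\<dots> = 1 / T * (LBINT t. indicator {0..1} (0 + 1 / T * t) *\<^sub>R
        ((1 - (0 + 1 / T * t)) * dsin (T * z) (0 + 1 / T * t)))"
      using T by simp
    also have "\<dots> = (LBINT t. 1 / T * (indicator {0..1} (0 + 1 / T * t) *\<^sub>R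
        ((1 - (0 + 1 / T * t)) * dsin (T * z) (0 + 1 / T * t))))"
      by (rule integral_mult_right_zero[symmetric])
    also have "\<dots> = (LBINT t:{0..T}. (1 - t / T) * dsin z t)"
      unfolding set_lebesgue_integral_def
    proof (rule Bochner_Integration.integral_cong[OF refl])
      fix t
      have "indicator {0..1} (0 + 1 / T * t) = (indicator {0..T} t :: real)"
        using T by (auto simp: indicator_def field_simps)
      moreover have "dsin (T * z) (0 + 1 / T * t) = T * dsin z t"
        using T by (simp add: dsin_def)
      ultimately show "1 / T * (indicator {0..1} (0 + 1 / T * t) *\<^sub>R ((1 - (0 + 1 / T * t)) * dsin (T * z) (0 + 1 / T * t))) =
          indicator {0..T} t *\<^sub>R ((1 - t / T) * dsin z t)"
        using T by simp
    qed
    finally show ?thesis by (simp add: field_simps)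
  qed
  have lin: "i * c / pi * (A - B) = i *\<^sub>R (c * A) / pi - i *\<^sub>R (c * B) / pi" for i c A B :: real
    by (simp add: field_simps)
  have Re_H: "Re (H t * iexp (t * y)) = indicator {0..T} t *\<^sub>R ((1 - t / T) * dsin (y - a) t) / pi -
      indicator {0..T} t *\<^sub>R ((1 - t / T) * dsin (y - b) t) / pi" if t: "t \<noteq> 0" for t y
  proof -
    have e: "iexp (-(t * a)) * iexp (t * y) = iexp (t * (y - a))" for a
      unfolding exp_add[symmetric] by (rule arg_cong[where f = exp]) (simp add: algebra_simps)
    have "H t * iexp (t * y) = of_real (indicator {0..T} t * (1 - t / T) / pi) * ((iexp (t * (y - a)) - iexp (t * (y - b))) / (\<i> * t))"
      unfolding H_def mult.assoc times_divide_eq_left left_diff_distrib e ..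
    also have "Re \<dots> = indicator {0..T} t * (1 - t / T) / pi * Re ((iexp (t * (y - a)) - iexp (t * (y - b))) / (\<i> * t))"
      by (rule Re_of_real_mult)
    also have "Re ((iexp (t * (y - a)) - iexp (t * (y - b))) / (\<i> * t)) = (sin (t * (y - a)) - sin (t * (y - b))) / t"
    proof -
      have "(iexp (t * (y - a)) - iexp (t * (y - b))) / (\<i> * t) = (- \<i> * (iexp (t * (y - a)) - iexp (t * (y - b)))) / of_real t"
        using t by (simp add: field_simps)
      then show ?thesis by (simp add: Re_divide_of_real Im_exp diff_divide_distrib del: times_divide_eq_left)
    qed
    also have "(sin (t * (y - a)) - sin (t * (y - b))) / t = dsin (y - a) t - dsin (y - b) t"
      using t by (simp add: dsin_def diff_divide_distrib)
    finally show ?thesis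
      unfolding lin .
  qed
  have "smooth_interval T a b y = (LBINT t. Re (H t * iexp (t * y)))" for y
  proof -
    have i: "set_integrable lborel {0..T} (\<lambda>t. (1 - t / T) * dsin z t)" for z
      using T by (intro borel_integrable_atLeastAtMost' continuous_intros) auto
    have "(LBINT t. Re (H t * iexp (t * y))) = (LBINT t. indicator {0..T} t *\<^sub>R ((1 - t / T) * dsin (y - a) t) / pi -
        indicator {0..T} t *\<^sub>R ((1 - t / T) * dsin (y - b) t) / pi)"
    proof (rule integral_cong_AE)
      show "(\<lambda>t. Re (H t * iexp (t * y))) \<in> borel_measurable lborel" unfolding H_def by measurable
      show "AE t in lborel. Re (H t * iexp (t * y)) = indicator {0..T} t *\<^sub>R ((1 - t / T) * dsin (y - a) t) / pi -
        indicator {0..T} t *\<^sub>R ((1 - t / T) * dsin (y - b) t) / pi"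
        using AE_lborel_singleton[of 0] by eventually_elim (rule Re_H)
    qed measurable
    also have "\<dots> = (LBINT t. indicator {0..T} t *\<^sub>R ((1 - t / T) * dsin (y - a) t) / pi) -
        (LBINT t. indicator {0..T} t *\<^sub>R ((1 - t / T) * dsin (y - b) t) / pi)"
      using i unfolding set_integrable_def by (intro Bochner_Integration.integral_diff integrable_divide)
    also have "\<dots> = smooth_interval T a b y"
      unfolding smooth_interval_def prim set_lebesgue_integral_def by simp
    finally show ?thesis ..
  qed
  moreover have "(H \<longlongrightarrow> of_real ((b - a) / pi)) (at_right 0)"
  proof (rule Lim_transform_eventually)
    have "((\<lambda>t. (iexp (-(t * a)) - iexp (-(t * b))) / (\<i> * t)) \<longlongrightarrow> of_real (b - a)) (at_right 0)"
      by (rule filterlim_mono[OF Levy_Inversion_aux1[OF ab] order.refl at_le]) simp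
    then have "((\<lambda>t. of_real ((1 - t / T) / pi) * ((iexp (-(t * a)) - iexp (-(t * b))) / (\<i> * t))) \<longlongrightarrow>
        of_real ((1 - 0 / T) / pi) * of_real (b - a)) (at_right 0)"
      by (intro tendsto_mult[OF tendsto_of_real]) (intro tendsto_intros; use T in auto)+
    then show "((\<lambda>t. of_real ((1 - t / T) / pi) * ((iexp (-(t * a)) - iexp (-(t * b))) / (\<i> * t))) \<longlongrightarrow>
        of_real ((b - a) / pi)) (at_right 0)" by simp
    have "\<forall>\<^sub>F t in at_right (0::real). t \<in> {0<..<T}" by (rule eventually_at_right_real) (rule T)
    then show "\<forall>\<^sub>F t in at_right 0. of_real ((1 - t / T) / pi) * ((iexp (-(t * a)) - iexp (-(t * b))) / (\<i> * t)) = H t"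
      by eventually_elim (simp add: H_def)
  qed
  moreover have "cmod (H t) \<le> 1 / pi * (b - a)" for t
  proof -
    have 1: "cmod (of_real (indicator {0..T} t * (1 - t / T) / pi)) \<le> 1 / pi"
      unfolding norm_of_real using T by (auto simp: indicator_def divide_right_mono)
    have 2: "cmod ((iexp (-(t * a)) - iexp (-(t * b))) / (\<i> * t)) \<le> b - a"
    proof (cases "t = 0")
      case False
      then show ?thesis using Levy_Inversion_aux2[of "- b" "- a" t] ab by simp
    qed (use ab in simp)
    show ?thesis unfolding H_def norm_mult by (intro mult_mono 1 2) auto
  qed
  moreover have "H \<in> borel_measurable borel" unfolding H_def by measurable
  moreover have "H t = 0" if "t \<notin> {0..T}" for t using that by (simp add: H_def)
  ultimately show ?thesis using T by (intro bandlimitedI)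
qed

text \<open>A single Fejer kernel has zeros; a shift by \<open>pi\<close> turns
  \<open>1 - cos y\<close> into \<open>1 + cos y\<close>, and the two numerators add up to 2. Both
  denominators are at most \<open>22 * (1 + y\<^sup>2)\<close> times \<open>pi\<close>, because
  \<open>2 * pi\<^sup>2 \<le> 22\<close>, and \<open>22 * pi \<le> 80\<close> gives 40. The pair is
  a band-limited function with tails of order \<open>1 / (1 + y\<^sup>2)\<close>, used to absorb
  smoothing errors.\<close>

lemma fejer_pair_ge: "1 / (40 * (1 + y\<^sup>2)) \<le> fejer y + fejer (y + pi)"
proof -
  have 0: "1 / (40 * (1 + z\<^sup>2)) \<le> fejer 0" for z :: real
  proof -
    have "1 / (40 * (1 + z\<^sup>2)) \<le> 1 / (40 * 1)"
      by (intro divide_left_mono mult_left_mono) (auto intro: add_pos_nonneg)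
    also have "\<dots> \<le> 1 / (2 * pi)" using pi_less_4 by (intro divide_left_mono) auto
    finally show ?thesis by (simp add: fejer_def)
  qed
  consider "y = 0" | "y = - pi" | "y \<noteq> 0" "y + pi \<noteq> 0" by linarith
  then show ?thesis
  proof cases
    case 3
    let ?m = "22 * (1 + y\<^sup>2)"
    have c: "0 \<le> 1 - cos y" "0 \<le> 1 + cos y"
      using cos_le_one[of y] cos_ge_minus_one[of y] by linarith+
    have m1: "y\<^sup>2 \<le> ?m" and m0: "0 < ?m" by (auto intro: add_pos_nonneg)
    have m2: "(y + pi)\<^sup>2 \<le> ?m"
    proof -
      have "0 \<le> (y - pi)\<^sup>2" by simp
      then have "(y + pi)\<^sup>2 \<le> 2 * y\<^sup>2 + 2 * pi\<^sup>2" by (simp add: power2_eq_square algebra_simps)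
      moreover have "pi\<^sup>2 \<le> (32 / 10)\<^sup>2" using pi_approx by (intro power_mono) auto
      then have "2 * pi\<^sup>2 \<le> 22" by (simp add: power2_eq_square)
      ultimately show ?thesis using zero_le_power2[of y] unfolding distrib_left by linarith
    qed
    have "1 / (40 * (1 + y\<^sup>2)) \<le> 2 / (pi * ?m)"
    proof -
      have "pi * ?m \<le> 80 * (1 + y\<^sup>2)"
        using mult_right_mono[of "pi * 22" 80 "1 + y\<^sup>2"] pi_approx by (simp add: mult.assoc)
      then have le: "2 / (80 * (1 + y\<^sup>2)) \<le> 2 / (pi * ?m)"
        using m0 by (intro divide_left_mono mult_pos_pos) (auto intro: add_pos_nonneg)
      have eq: "2 / (80 * q) = 1 / (40 * q)" for q :: real by simp
      show ?thesis by (rule le[unfolded eq])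
    qed
    also have "2 / (pi * ?m) = (1 - cos y) / (pi * ?m) + (1 + cos y) / (pi * ?m)"
      by (simp add: add_divide_distrib[symmetric])
    also have "\<dots> \<le> (1 - cos y) / (pi * y\<^sup>2) + (1 + cos y) / (pi * (y + pi)\<^sup>2)"
      using 3 m0 m1 m2 c
      by (intro add_mono divide_left_mono mult_left_mono mult_pos_pos) auto
    also have "\<dots> = fejer y + fejer (y + pi)"
      using 3 by (simp add: fejer_def)
    finally show ?thesis .
  next
    case 1
    then show ?thesis using 0[of 0] fejer_nonneg[of pi] by simp
  next
    case 2
    then show ?thesis using 0[of y] fejer_nonneg[of y] by simp
  qed
qed

lemma bandlimited_fejer_pair: "bandlimited (\<lambda>y. fejer y + fejer (y + pi)) 2"
  using bandlimited_add[OF bandlimited_fejer_shift[of 0] bandlimited_fejer_shift[of pi]] by simp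

text \<open>Smoothing the widened interval from \<open>- \<delta>\<close> to
  \<open>h + \<delta>\<close> gives a nonnegative function that is at least
  \<open>1 - \<kappa>\<close> on the original interval. The pair of Fejer kernels is at least
  \<open>1 / D\<close> there, so \<open>\<kappa> * D\<close> times it repairs the deficit. Widening
  and repair cost \<open>\<epsilon> / 2\<close> each.\<close>

lemma bandlimited_majorant:
  assumes h: "0 < h" and \<epsilon>: "0 < \<epsilon>"
  shows "\<exists>f c. bandlimited f c \<and> c \<le> h + \<epsilon> \<and> (\<forall>y. indicator {0<..<h} y \<le> f y)"
proof -
  define \<delta> where "\<delta> = \<epsilon> / 4"
  have \<delta>: "0 < \<delta>" using \<epsilon> by (simp add: \<delta>_def)
  define D where "D = 40 * (1 + h\<^sup>2)"
  have D: "0 < D" by (simp add: D_def add_pos_nonneg)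
  \<comment> \<open>Solves \<open>2 * (\<kappa> * D) = \<epsilon> / 2\<close> for the deficit
    \<open>\<kappa>\<close> below, which collects \<open>2 / (pi * (T * \<delta>))\<close> from each
    of the two edges.\<close>
  define T where "T = 16 * D / (pi * \<delta> * \<epsilon>)"
  have T: "0 < T" using D \<delta> \<epsilon> by (simp add: T_def)
  define \<kappa> where "\<kappa> = 4 / (pi * (T * \<delta>))"
  have \<kappa>: "0 < \<kappa>" using T \<delta> by (simp add: \<kappa>_def)
  have \<kappa>D: "2 * (\<kappa> * D) = \<epsilon> / 2" using \<delta> \<epsilon> D by (simp add: \<kappa>_def T_def)
  let ?G = "\<lambda>y. fejer y + fejer (y + pi)"
  let ?f = "\<lambda>y. smooth_interval T (- \<delta>) (h + \<delta>) y + \<kappa> * D * ?G y"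
  have "bandlimited ?f (h + \<delta> - (- \<delta>) + \<kappa> * D * 2)"
    using h \<delta> T by (intro bandlimited_add bandlimited_smooth_interval bandlimited_scale bandlimited_fejer_pair) auto
  moreover have "h + \<delta> - (- \<delta>) + \<kappa> * D * 2 \<le> h + \<epsilon>"
    using \<kappa>D by (simp add: \<delta>_def)
  moreover have "indicator {0<..<h} y \<le> ?f y" for y
  proof -
    have G0: "0 \<le> ?G y" by (simp add: fejer_nonneg)
    have s0: "0 \<le> smooth_interval T (- \<delta>) (h + \<delta>) y"
      unfolding smooth_interval_def using T h \<delta> by (simp add: fejer_primitive_mono)
    show ?thesis
    proof (cases "y \<in> {0<..<h}")
      case True
      then have y: "0 < y" "y < h" by auto
      have ge: "1 / 2 - \<kappa> / 2 \<le> fejer_primitive (T * z)" if z: "\<delta> \<le> z" for z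
      proof -
        have Tz: "0 < T * z" using T \<delta> z by simp
        have "2 / (pi * (T * z)) \<le> 2 / (pi * (T * \<delta>))"
          using T \<delta> z by (intro divide_left_mono mult_left_mono) auto
        moreover have "\<kappa> / 2 = 2 / (pi * (T * \<delta>))" by (simp add: \<kappa>_def)
        ultimately show ?thesis using fejer_primitive_ge[OF Tz] by linarith
      qed
      have "fejer_primitive (T * (y - (h + \<delta>))) = - fejer_primitive (T * (h + \<delta> - y))"
        using fejer_primitive_minus[of "T * (h + \<delta> - y)"] by (simp add: algebra_simps)
      then have s1: "1 - \<kappa> \<le> smooth_interval T (- \<delta>) (h + \<delta>) y"
        unfolding smooth_interval_def using ge[of "y - - \<delta>"] ge[of "h + \<delta> - y"] y by simp
      have "y\<^sup>2 \<le> h\<^sup>2" using y by (intro power_mono) auto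
      then have "1 / D \<le> 1 / (40 * (1 + y\<^sup>2))"
        unfolding D_def by (intro divide_left_mono) (auto intro!: mult_pos_pos add_pos_nonneg)
      then have "1 / D \<le> ?G y" using fejer_pair_ge[of y] by linarith
      then have "\<kappa> * D * (1 / D) \<le> \<kappa> * D * ?G y" using \<kappa> D by (intro mult_left_mono) auto
      then show ?thesis using s1 True D by simp
    next
      case False
      then show ?thesis using G0 s0 \<kappa> D by simp
    qed
  qed
  ultimately show ?thesis by blast
qed

text \<open>Smoothing the narrowed interval from \<open>\<delta>\<close> to
  \<open>h - \<delta>\<close> never exceeds 1, but leaks outside the original interval. The leak is
  of order \<open>1 / (T * (1 + y\<^sup>2))\<close>, so a small multiple of the pair of Fejer
  kernels dominates it and is subtracted.\<close>

lemma bandlimited_minorant: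
  assumes h: "0 < h" and \<epsilon>: "0 < \<epsilon>"
  shows "\<exists>f c. bandlimited f c \<and> h - \<epsilon> \<le> c \<and> (\<forall>y. f y \<le> indicator {0<..<h} y)"
proof -
  define \<delta> where "\<delta> = min (min (\<epsilon> / 4) (h / 4)) 1"
  have \<delta>: "0 < \<delta>" "\<delta> \<le> \<epsilon> / 4" "\<delta> \<le> h / 4" "\<delta> \<le> 1" using h \<epsilon> by (auto simp: \<delta>_def)
  \<comment> \<open>The constant that comes out of the leak estimate \<open>key\<close>;
    \<open>T\<close> and \<open>C\<close> are then tuned so that the subtraction costs
    \<open>2 * C = \<epsilon> / 2\<close> in mass.\<close>
  define D where "D = 2 * (1 + h\<^sup>2) * (2 * h / (pi * \<delta>\<^sup>2))"
  have D: "0 < D" using h \<delta> by (simp add: D_def add_pos_nonneg)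
  define T where "T = 160 * D / \<epsilon>"
  have T: "0 < T" using D \<epsilon> by (simp add: T_def)
  define C where "C = 40 * D / T"
  have C: "0 < C" using D T by (simp add: C_def)
  have Cq: "C / (40 * q) = D / (T * q)" for q :: real by (simp add: C_def)
  have C2: "2 * C = \<epsilon> / 2" using D \<epsilon> by (simp add: C_def T_def)
  let ?G = "\<lambda>y. fejer y + fejer (y + pi)"
  let ?f = "\<lambda>y. smooth_interval T \<delta> (h - \<delta>) y + - C * ?G y"
  have "bandlimited ?f (h - \<delta> - \<delta> + - C * 2)"
    using h \<delta> T by (intro bandlimited_add bandlimited_smooth_interval bandlimited_scale bandlimited_fejer_pair) auto
  moreover have "h - \<epsilon> \<le> h - \<delta> - \<delta> + - C * 2"
    using C2 \<delta> by simp
  moreover have "?f y \<le> indicator {0<..<h} y" for y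
  proof (cases "y \<in> {0<..<h}")
    case True
    have "0 \<le> C * ?G y" using C by (simp add: fejer_nonneg)
    moreover have "smooth_interval T \<delta> (h - \<delta>) y \<le> 1"
      unfolding smooth_interval_def
      using abs_fejer_primitive_le[of "T * (y - \<delta>)"] abs_fejer_primitive_le[of "T * (y - (h - \<delta>))"] by linarith
    ultimately show ?thesis using True by simp
  next
    case False
    \<comment> \<open>Here \<open>v\<close> is the distance from \<open>y\<close> to the nearer edge
      of the narrowed interval and \<open>v - \<delta>\<close> that to the nearer edge of the
      original one. The second hypothesis translates decay in \<open>v\<close> into decay in
      \<open>y\<close>.\<close>
    have key: "fejer_primitive (T * (v + (h - 2 * \<delta>))) - fejer_primitive (T * v) \<le> C / (40 * (1 + y\<^sup>2))"
      if v: "\<delta> \<le> v" "y\<^sup>2 \<le> 2 * (h\<^sup>2 + (v - \<delta>)\<^sup>2)" for v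
    proof -
      have v0: "0 < v" using v \<delta> by simp
      have "fejer_primitive (T * (v + (h - 2 * \<delta>))) - fejer_primitive (T * v) \<le>
          (T * (v + (h - 2 * \<delta>)) - T * v) * (2 / (pi * (T * v)\<^sup>2))"
        using T v0 h \<delta> by (intro fejer_primitive_diff_le) auto
      also have "\<dots> = (h - 2 * \<delta>) * (2 / (pi * T * v\<^sup>2))"
        using T v0 by (simp add: field_simps power2_eq_square)
      also have "\<dots> \<le> h * (2 / (pi * T * v\<^sup>2))"
        using \<delta> T by (intro mult_right_mono) auto
      also have "\<dots> = (2 * h / (pi * T)) * (1 / v\<^sup>2)" by simp
      also have "\<dots> \<le> (2 * h / (pi * T)) * (2 * (1 + h\<^sup>2) / (\<delta>\<^sup>2 * (1 + y\<^sup>2)))"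
      proof (intro mult_left_mono)
        let ?w = "v - \<delta>"
        have "\<delta>\<^sup>2 * (1 + ?w\<^sup>2) \<le> v\<^sup>2"
        proof -
          have "\<delta>\<^sup>2 * ?w\<^sup>2 \<le> 1 * ?w\<^sup>2" using \<delta> by (intro mult_right_mono) (auto simp: power_le_one)
          moreover have "\<delta>\<^sup>2 + ?w\<^sup>2 \<le> v\<^sup>2"
          proof -
            have "0 \<le> \<delta> * ?w" using \<delta> v by (intro mult_nonneg_nonneg) auto
            moreover have "v\<^sup>2 = \<delta>\<^sup>2 + ?w\<^sup>2 + 2 * (\<delta> * ?w)" by (simp add: power2_eq_square algebra_simps)
            ultimately show ?thesis by linarith
          qed
          ultimately show ?thesis by (simp add: algebra_simps)
        qed
        moreover have "1 + y\<^sup>2 \<le> 2 * (1 + h\<^sup>2) * (1 + ?w\<^sup>2)"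
        proof -
          have "2 * (1 + h\<^sup>2) * (1 + ?w\<^sup>2) = 2 + 2 * h\<^sup>2 + 2 * ?w\<^sup>2 + 2 * (h\<^sup>2 * ?w\<^sup>2)" by (simp add: algebra_simps)
          moreover have "0 \<le> h\<^sup>2 * ?w\<^sup>2" by simp
          ultimately show ?thesis using v(2) unfolding distrib_left by linarith
        qed
        then have "\<delta>\<^sup>2 * (1 + y\<^sup>2) \<le> \<delta>\<^sup>2 * (2 * (1 + h\<^sup>2) * (1 + ?w\<^sup>2))"
          by (intro mult_left_mono) auto
        ultimately have "\<delta>\<^sup>2 * (1 + y\<^sup>2) \<le> 2 * (1 + h\<^sup>2) * v\<^sup>2"
          using mult_left_mono[of "\<delta>\<^sup>2 * (1 + ?w\<^sup>2)" "v\<^sup>2" "2 * (1 + h\<^sup>2)"] by (simp add: mult_ac)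
        moreover have "0 < \<delta>\<^sup>2 * (1 + y\<^sup>2)" using \<delta> by (intro mult_pos_pos add_pos_nonneg) auto
        ultimately show "1 / v\<^sup>2 \<le> 2 * (1 + h\<^sup>2) / (\<delta>\<^sup>2 * (1 + y\<^sup>2))"
          using v0 by (simp add: pos_le_divide_eq pos_divide_le_eq)
        show "0 \<le> 2 * h / (pi * T)" using h T by simp
      qed
      also have "\<dots> = D / (T * (1 + y\<^sup>2))"
        by (simp add: D_def mult_ac)
      also have "\<dots> = C / (40 * (1 + y\<^sup>2))"
        unfolding Cq ..
      finally show ?thesis .
    qed
    have "smooth_interval T \<delta> (h - \<delta>) y \<le> C / (40 * (1 + y\<^sup>2))"
    proof (cases "y \<le> 0")
      case True
      have "smooth_interval T \<delta> (h - \<delta>) y =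
          fejer_primitive (T * ((\<delta> - y) + (h - 2 * \<delta>))) - fejer_primitive (T * (\<delta> - y))"
        using fejer_primitive_minus[of "T * (y - \<delta>)"] fejer_primitive_minus[of "T * (y - (h - \<delta>))"]
        by (simp add: smooth_interval_def algebra_simps)
      also have "\<dots> \<le> C / (40 * (1 + y\<^sup>2))"
        using True by (intro key) auto
      finally show ?thesis .
    next
      case y: False
      then have yh: "h \<le> y" using False by simp
      have "smooth_interval T \<delta> (h - \<delta>) y =
          fejer_primitive (T * ((y - h + \<delta>) + (h - 2 * \<delta>))) - fejer_primitive (T * (y - h + \<delta>))"
        by (simp add: smooth_interval_def algebra_simps)
      also have "\<dots> \<le> C / (40 * (1 + y\<^sup>2))"
      proof (intro key)
        have "0 \<le> (h - (y - h))\<^sup>2" by simp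
        then show "y\<^sup>2 \<le> 2 * (h\<^sup>2 + (y - h + \<delta> - \<delta>)\<^sup>2)" by (simp add: power2_eq_square algebra_simps)
      qed (use yh in simp)
      finally show ?thesis .
    qed
    also have "\<dots> = C * (1 / (40 * (1 + y\<^sup>2)))" by simp
    also have "\<dots> \<le> C * ?G y" using C by (intro mult_left_mono fejer_pair_ge) auto
    finally show ?thesis using False by simp
  qed
  ultimately show ?thesis by blast
qed


section \<open>From characteristic functions to intervals\<close>

text \<open>Fourier inversion for the normal density, in the one-sided form that matches
  \<open>bandlimited\<close>; evenness halves the integral over the whole line.\<close>

lemma half_gaussian_cos:
  "has_bochner_integral lborel (\<lambda>s. indicator {0..} s *\<^sub>R (cos (s * y) * exp (- s\<^sup>2 / 2))) (pi * std_normal_density y)"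
proof -
  let ?f = "\<lambda>s :: real. cos (s * y) * exp (- s\<^sup>2 / 2)"
  have gauss: "integrable lborel (\<lambda>s :: real. exp (- s\<^sup>2 / 2))"
  proof -
    have "integrable lborel (\<lambda>s. sqrt (2 * pi) * std_normal_density s)"
      by (intro integrable_mult_right integrable_normal_density) simp
    then show ?thesis by (simp add: std_normal_density_def)
  qed
  have int: "integrable lborel ?f"
    by (rule Bochner_Integration.integrable_bound[OF gauss]) (auto simp: abs_mult intro!: mult_left_le_one_le)
  interpret N: real_distribution std_normal_distribution by (rule real_dist_normal_dist)
  have full: "(LBINT s. ?f s) = sqrt (2 * pi) * exp (- y\<^sup>2 / 2)"
  proof -
    have "Re (char std_normal_distribution y) = (\<integral>s. Re (iexp (y * s)) \<partial>std_normal_distribution)"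
      unfolding char_def by (rule integral_Re[symmetric]) (rule N.integrable_iexp, auto)
    also have "\<dots> = (LBINT s. std_normal_density s * cos (y * s))"
      by (subst integral_density) (auto simp: Re_exp)
    finally have "(LBINT s. std_normal_density s * cos (y * s)) = exp (- y\<^sup>2 / 2)"
      unfolding char_std_normal_distribution by simp
    then have "sqrt (2 * pi) * (LBINT s. std_normal_density s * cos (y * s)) = sqrt (2 * pi) * exp (- y\<^sup>2 / 2)"
      by simp
    also have "sqrt (2 * pi) * (LBINT s. std_normal_density s * cos (y * s)) =
        (LBINT s. sqrt (2 * pi) * (std_normal_density s * cos (y * s)))"
      by (rule integral_mult_right_zero[symmetric])
    also have "\<dots> = (LBINT s. ?f s)"
      by (intro Bochner_Integration.integral_cong) (auto simp: std_normal_density_def mult.commute)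
    finally show ?thesis .
  qed
  let ?h = "\<lambda>s. indicator {0..} s *\<^sub>R ?f s"
  have inth: "integrable lborel ?h"
    by (rule integrable_mult_indicator[OF _ int]) simp
  have "has_bochner_integral lborel ?f (2 *\<^sub>R (LBINT s. ?h s))"
    by (rule has_bochner_integral_even_function[OF has_bochner_integral_integrable[OF inth]]) simp
  then have "2 * (LBINT s. ?h s) = sqrt (2 * pi) * exp (- y\<^sup>2 / 2)"
    using full by (simp add: has_bochner_integral_integral_eq)
  moreover have "2 * (pi * std_normal_density y) = sqrt (2 * pi) * exp (- y\<^sup>2 / 2)"
  proof -
    have "2 * pi = sqrt (2 * pi) * sqrt (2 * pi)" by simp
    then have "2 * pi * (1 / sqrt (2 * pi)) = sqrt (2 * pi)" by (simp add: field_simps)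
    then show ?thesis unfolding std_normal_density_def by (simp only: mult.assoc[symmetric])
  qed
  ultimately have "(LBINT s. ?h s) = pi * std_normal_density y" by linarith
  then show ?thesis using inth by (simp add: has_bochner_integral_iff)
qed

lemma std_normal_density_le_1: "std_normal_density y \<le> 1"
proof -
  have "1 \<le> sqrt (2 * pi)" using pi_gt3 by simp
  then have "1 / sqrt (2 * pi) \<le> 1" by simp
  then show ?thesis unfolding std_normal_density_def by (intro mult_le_one) auto
qed

locale positions_sequence =
  fixes T :: "nat \<Rightarrow> 'u set" and S :: "nat \<Rightarrow> 'u \<Rightarrow> real" and b A :: "nat \<Rightarrow> real"
  assumes finite_T: "\<And>n. finite (T n)" and b_nonneg: "\<And>n. 0 \<le> b n" and b_at_top: "filterlim b at_top sequentially"
    and conv: "\<And>K. 0 < K \<Longrightarrow> (\<lambda>n. ennreal (b n) * (\<integral>\<^sup>+t. ennreal (cmod ((\<Sum>u\<in>T n. iexp (t * S n u)) / of_nat (card (T n)) -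
      iexp (t * A n) * of_real (exp (- (b n)\<^sup>2 * t\<^sup>2 / 2)))) * indicator {-K..K} t \<partial>lborel)) \<longlonglongrightarrow> 0"
begin

definition ecf :: "nat \<Rightarrow> real \<Rightarrow> complex" where
  "ecf n t = (\<Sum>u\<in>T n. iexp (t * S n u)) / of_nat (card (T n))"

definition G :: "nat \<Rightarrow> real \<Rightarrow> complex" where
  "G n t = iexp (t * A n) * of_real (exp (- (b n)\<^sup>2 * t\<^sup>2 / 2))"

lemma measurable_ecf [measurable]: "ecf n \<in> borel_measurable borel"
  unfolding ecf_def by measurable

lemma measurable_G [measurable]: "G n \<in> borel_measurable borel"
  unfolding G_def by measurable

lemma cmod_ecf_le: "cmod (ecf n t) \<le> 1"
proof -
  have "cmod (\<Sum>u\<in>T n. iexp (t * S n u)) \<le> (\<Sum>u\<in>T n. 1)" by (rule sum_norm_le) simp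
  then show ?thesis
    by (cases "card (T n) = 0") (simp_all add: ecf_def norm_divide divide_le_eq_1)
qed

lemma cmod_G_le: "cmod (G n t) \<le> 1"
  unfolding G_def norm_mult norm_exp_i_times norm_of_real by simp

text \<open>Inserting the representation of \<open>f\<close> turns the average into the integral of
  \<open>H\<close> against the empirical characteristic function. The location \<open>x\<close>
  enters only through a phase of modulus 1, so replacing that function by its Gaussian counterpart
  costs at most \<open>B\<close> times the \<open>L\<^sup>1\<close> error, uniformly in
  \<open>x\<close>. At scale \<open>s = b n * t\<close> the factor \<open>H (s / b n)\<close> tends
  to \<open>c / pi\<close>, and \<open>half_gaussian_cos\<close> yields the density.\<close>

lemma bandlimited_average:
  assumes f: "bandlimited f c" and \<epsilon>: "0 < \<epsilon>"
  shows "\<forall>\<^sub>F n in sequentially. \<forall>x. \<bar>b n * ((\<Sum>u\<in>T n. f (S n u - x)) / card (T n)) - c * std_normal_density ((x - A n) / b n)\<bar> \<le> \<epsilon>"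
proof -
  obtain K B and H :: "real \<Rightarrow> complex" where K: "0 < K" and Hm [measurable]: "H \<in> borel_measurable borel" and B: "\<And>t. cmod (H t) \<le> B"
      and supp: "\<And>t. t \<notin> {0..K} \<Longrightarrow> H t = 0" and H0: "(H \<longlongrightarrow> of_real (c / pi)) (at_right 0)"
      and rep: "\<And>y. f y = (LBINT t. Re (H t * iexp (t * y)))"
    using f unfolding bandlimited_def by blast
  have B0: "0 \<le> B" using B[of 0] norm_ge_zero order_trans by blast
  let ?err = "\<lambda>n. \<integral>\<^sup>+t. ennreal (cmod (ecf n t - G n t)) * indicator {-K..K} t \<partial>lborel"
  let ?d = "\<lambda>n s. cmod (H (s / b n) - of_real (c / pi)) * exp (- s\<^sup>2 / 2) * indicator {0<..} s"
  note int = integrable_bandlimited_integrand[OF Hm B supp]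
  have bpos: "\<forall>\<^sub>F n in sequentially. 0 < b n"
    using b_at_top by (simp add: filterlim_at_top_dense)
  have "(\<lambda>n. ennreal B * (ennreal (b n) * ?err n)) \<longlonglongrightarrow> ennreal B * 0"
    using conv[OF K] unfolding ecf_def[symmetric] G_def[symmetric]
    by (intro ennreal_tendsto_cmult) auto
  then have "\<forall>\<^sub>F n in sequentially. ennreal B * (ennreal (b n) * ?err n) < ennreal (\<epsilon> / 2)"
    using \<epsilon> by (intro order_tendstoD(2)) auto
  moreover have "(\<lambda>n. \<integral>\<^sup>+s. ennreal (?d n s) \<partial>lborel) \<longlonglongrightarrow> (\<integral>\<^sup>+s. 0 \<partial>(lborel :: real measure))"
  proof (rule nn_integral_dominated_convergence[where w = "\<lambda>s. ennreal (B + \<bar>c / pi\<bar>) * ennreal (sqrt (2 * pi) * std_normal_density s)"])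
    have "(\<integral>\<^sup>+s. ennreal (B + \<bar>c / pi\<bar>) * ennreal (sqrt (2 * pi) * std_normal_density s) \<partial>lborel) =
        ennreal (B + \<bar>c / pi\<bar>) * (\<integral>\<^sup>+s. ennreal (sqrt (2 * pi) * std_normal_density s) \<partial>lborel)"
      by (rule nn_integral_cmult) simp
    also have "(\<integral>\<^sup>+s. ennreal (sqrt (2 * pi) * std_normal_density s) \<partial>lborel) = ennreal (LBINT s. sqrt (2 * pi) * std_normal_density s)"
      by (intro nn_integral_eq_integral integrable_mult_right integrable_normal_density) auto
    finally show "(\<integral>\<^sup>+s. ennreal (B + \<bar>c / pi\<bar>) * ennreal (sqrt (2 * pi) * std_normal_density s) \<partial>lborel) < \<infinity>"
      by (simp add: ennreal_mult_less_top)
    show "AE s in lborel. ennreal (?d n s) \<le> ennreal (B + \<bar>c / pi\<bar>) * ennreal (sqrt (2 * pi) * std_normal_density s)" for n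
    proof (rule AE_I2)
      fix s :: real
      have "cmod (H (s / b n) - of_real (c / pi)) \<le> B + \<bar>c / pi\<bar>"
        by (rule order_trans[OF norm_triangle_ineq4]) (intro add_mono B, simp only: norm_of_real)
      then have "?d n s \<le> (B + \<bar>c / pi\<bar>) * exp (- s\<^sup>2 / 2) * 1"
        using B0 by (intro mult_mono) (auto simp: indicator_def)
      also have "\<dots> = (B + \<bar>c / pi\<bar>) * (sqrt (2 * pi) * std_normal_density s)"
        by (simp add: std_normal_density_def)
      finally show "ennreal (?d n s) \<le> ennreal (B + \<bar>c / pi\<bar>) * ennreal (sqrt (2 * pi) * std_normal_density s)"
        using B0 by (subst ennreal_mult[symmetric]) (auto intro!: ennreal_leI)
    qed
    show "AE s in lborel. (\<lambda>n. ennreal (?d n s)) \<longlonglongrightarrow> 0"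
    proof (rule AE_I2)
      fix s :: real
      show "(\<lambda>n. ennreal (?d n s)) \<longlonglongrightarrow> 0"
      proof (cases "0 < s")
        case True
        have "filterlim (\<lambda>n. s / b n) (at_right 0) sequentially"
          unfolding filterlim_at
        proof (intro conjI)
          show "\<forall>\<^sub>F n in sequentially. s / b n \<in> {0<..} \<and> s / b n \<noteq> 0"
            using bpos by eventually_elim (use True in simp)
          show "(\<lambda>n. s / b n) \<longlonglongrightarrow> 0"
            by (rule tendsto_divide_0[OF tendsto_const filterlim_at_top_imp_at_infinity[OF b_at_top]])
        qed
        then have "(\<lambda>n. H (s / b n)) \<longlonglongrightarrow> of_real (c / pi)" by (rule filterlim_compose[OF H0])
        then have "(\<lambda>n. cmod (H (s / b n) - of_real (c / pi))) \<longlonglongrightarrow> 0"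
          by (intro tendsto_norm_zero) (simp add: LIM_zero_iff)
        then have "(\<lambda>n. ?d n s) \<longlonglongrightarrow> 0 * exp (- s\<^sup>2 / 2) * indicator {0<..} s"
          by (intro tendsto_mult tendsto_const)
        from tendsto_ennrealI[OF this] show ?thesis by simp
      qed (simp add: indicator_def)
    qed
  qed measurable
  then have "(\<lambda>n. \<integral>\<^sup>+s. ennreal (?d n s) \<partial>lborel) \<longlonglongrightarrow> 0" by simp
  then have "\<forall>\<^sub>F n in sequentially. (\<integral>\<^sup>+s. ennreal (?d n s) \<partial>lborel) < ennreal (\<epsilon> / 2)"
    using \<epsilon> by (intro order_tendstoD(2)) auto
  ultimately show ?thesis using bpos
  proof eventually_elim
    case (elim n)
    show ?case
    proof
      fix x
      define y where "y = (x - A n) / b n"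
      let ?X = "\<lambda>t. H t * (iexp (- t * x) * ecf n t)" and ?Y = "\<lambda>t. H t * (iexp (- t * x) * G n t)"
      have c1: "cmod (iexp (- t * x) * z) \<le> 1" if "cmod z \<le> 1" for t z
        unfolding norm_mult norm_exp_i_times using that by simp
      have iX: "integrable lborel ?X" by (rule int) (measurable, intro c1 cmod_ecf_le)
      have iY: "integrable lborel ?Y" by (rule int) (measurable, intro c1 cmod_G_le)
      have avg: "(\<Sum>u\<in>T n. f (S n u - x)) / card (T n) = (LBINT t. Re (?X t))"
      proof -
        have i: "integrable lborel (\<lambda>t. H t * iexp (t * (S n u - x)))" for u
          by (rule int) auto
        have "(\<Sum>u\<in>T n. f (S n u - x)) = (LBINT t. (\<Sum>u\<in>T n. Re (H t * iexp (t * (S n u - x)))))"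
          unfolding rep by (rule Bochner_Integration.integral_sum[symmetric]) (intro integrable_Re i)
        then have "(\<Sum>u\<in>T n. f (S n u - x)) / card (T n) = (LBINT t. (\<Sum>u\<in>T n. Re (H t * iexp (t * (S n u - x)))) / card (T n))"
          by simp
        also have "\<dots> = (LBINT t. Re (?X t))"
        proof (rule Bochner_Integration.integral_cong[OF refl])
          fix t
          have e: "iexp (t * (S n u - x)) = iexp (- t * x) * iexp (t * S n u)" for u
            unfolding exp_add[symmetric] by (rule arg_cong[where f = exp]) (simp add: algebra_simps)
          have "?X t = (\<Sum>u\<in>T n. H t * iexp (t * (S n u - x))) / of_real (real (card (T n)))"
            unfolding ecf_def e by (simp only: sum_distrib_left mult.assoc times_divide_eq_right of_real_of_nat_eq)
          then show "(\<Sum>u\<in>T n. Re (H t * iexp (t * (S n u - x)))) / card (T n) = Re (?X t)"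
            by (simp only: Re_divide_of_real Re_sum)
        qed
        finally show ?thesis .
      qed
      have part1: "\<bar>b n * (LBINT t. Re (?X t)) - b n * (LBINT t. Re (?Y t))\<bar> \<le> \<epsilon> / 2"
      proof -
        have "(LBINT t. Re (?X t)) - (LBINT t. Re (?Y t)) = (LBINT t. Re (?X t - ?Y t))"
          using iX iY by (simp only: minus_complex.sel Bochner_Integration.integral_diff integrable_Re)
        then have "ennreal \<bar>(LBINT t. Re (?X t)) - (LBINT t. Re (?Y t))\<bar> \<le> (\<integral>\<^sup>+t. ennreal (norm (Re (?X t - ?Y t))) \<partial>lborel)"
          unfolding real_norm_def[symmetric] using iX iY
          by (simp only:) (intro integral_norm_bound_ennreal integrable_Re Bochner_Integration.integrable_diff)
        also have "\<dots> \<le> (\<integral>\<^sup>+t. ennreal B * (ennreal (cmod (ecf n t - G n t)) * indicator {-K..K} t) \<partial>lborel)"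
        proof (rule nn_integral_mono)
          fix t
          have eq: "?X t - ?Y t = H t * iexp (- t * x) * (ecf n t - G n t)"
            by (simp only: right_diff_distrib mult.assoc)
          have "cmod (?X t - ?Y t) = cmod (H t) * cmod (ecf n t - G n t)"
            unfolding eq norm_mult norm_exp_i_times by simp
          then have 1: "norm (Re (?X t - ?Y t)) \<le> cmod (H t) * cmod (ecf n t - G n t)"
            using abs_Re_le_cmod[of "?X t - ?Y t"] by (simp only: real_norm_def)
          show "ennreal (norm (Re (?X t - ?Y t))) \<le> ennreal B * (ennreal (cmod (ecf n t - G n t)) * indicator {-K..K} t)"
          proof (cases "t \<in> {0..K}")
            case True
            then have i: "indicator {-K..K} t = (1 :: ennreal)" by simp
            have "norm (Re (?X t - ?Y t)) \<le> B * cmod (ecf n t - G n t)"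
              using 1 mult_right_mono[OF B[of t] norm_ge_zero[of "ecf n t - G n t"]] by linarith
            then have "ennreal (norm (Re (?X t - ?Y t))) \<le> ennreal (B * cmod (ecf n t - G n t))" by (rule ennreal_leI)
            then show ?thesis unfolding i by (simp only: ennreal_mult[OF B0 norm_ge_zero] mult_1_right)
          next
            case False
            then have "H t = 0" by (rule supp)
            then have "norm (Re (?X t - ?Y t)) = 0" by simp
            then show ?thesis by (simp only: ennreal_0 zero_le)
          qed
        qed
        also have "\<dots> = ennreal B * ?err n" by (rule nn_integral_cmult) measurable
        finally have "ennreal (b n) * ennreal \<bar>(LBINT t. Re (?X t)) - (LBINT t. Re (?Y t))\<bar> \<le> ennreal (b n) * (ennreal B * ?err n)"
          by (rule mult_left_mono) simp
        also have "\<dots> < ennreal (\<epsilon> / 2)" using elim(1) by (simp only: mult.left_commute)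
        finally have "ennreal (b n * \<bar>(LBINT t. Re (?X t)) - (LBINT t. Re (?Y t))\<bar>) < ennreal (\<epsilon> / 2)"
          by (simp only: ennreal_mult[OF b_nonneg abs_ge_zero])
        then have "b n * \<bar>(LBINT t. Re (?X t)) - (LBINT t. Re (?Y t))\<bar> < \<epsilon> / 2"
          using b_nonneg[of n] by (subst (asm) ennreal_less_iff) auto
        then show ?thesis
          using b_nonneg[of n] by (simp only: right_diff_distrib[symmetric] abs_mult abs_of_nonneg less_imp_le)
      qed
      let ?q = "\<lambda>s. indicator {0..} s *\<^sub>R (cos (s * y) * exp (- s\<^sup>2 / 2))"
      let ?U = "\<lambda>s. Re (H (s / b n) * iexp (- s * y)) * exp (- s\<^sup>2 / 2)"
      have subst: "b n * (LBINT t. Re (?Y t)) = (LBINT s. ?U s)"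
      proof -
        have "(LBINT s. ?U s) = \<bar>b n\<bar> *\<^sub>R (LBINT t. ?U (0 + b n * t))"
          using elim(3) by (intro lborel_integral_real_affine) simp
        also have "(\<lambda>t. ?U (0 + b n * t)) = (\<lambda>t. Re (?Y t))"
        proof
          fix t
          have e: "iexp (- t * x) * iexp (t * A n) = iexp (- (0 + b n * t) * y)"
            unfolding exp_add[symmetric] y_def using elim(3)
            by (intro arg_cong[where f = exp]) (simp add: field_simps)
          have "?Y t = of_real (exp (- (b n)\<^sup>2 * t\<^sup>2 / 2)) * (H t * iexp (- (0 + b n * t) * y))"
            unfolding G_def e[symmetric] by (simp only: mult_ac)
          then have "Re (?Y t) = exp (- (b n)\<^sup>2 * t\<^sup>2 / 2) * Re (H t * iexp (- (0 + b n * t) * y))"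
            by (simp only: Re_of_real_mult)
          then show "?U (0 + b n * t) = Re (?Y t)"
            using elim(3) by (simp add: power_mult_distrib)
        qed
        finally show ?thesis using elim(3) by simp
      qed
      have iq: "integrable lborel ?q" "(LBINT s. ?q s) = pi * std_normal_density y"
        using half_gaussian_cos[of y] by (auto simp: has_bochner_integral_iff)
      have iU: "integrable lborel ?U"
      proof -
        have "integrable lborel (\<lambda>t. Re (?Y t))" by (rule integrable_Re[OF iY])
        then have "integrable lborel (\<lambda>s. Re (?Y (0 + 1 / b n * s)))"
          using elim(3) by (intro lborel_integrable_real_affine) auto
        also have "(\<lambda>s. Re (?Y (0 + 1 / b n * s))) = ?U"
        proof
          fix s
          have e: "iexp (- (s / b n) * x) * iexp (s / b n * A n) = iexp (- s * y)"
            unfolding exp_add[symmetric] y_def using elim(3)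
            by (intro arg_cong[where f = exp]) (simp add: field_simps)
          have "?Y (s / b n) = of_real (exp (- (b n)\<^sup>2 * (s / b n)\<^sup>2 / 2)) * (H (s / b n) * iexp (- s * y))"
            unfolding G_def e[symmetric] by (simp only: mult_ac)
          then have "Re (?Y (s / b n)) = exp (- (b n)\<^sup>2 * (s / b n)\<^sup>2 / 2) * Re (H (s / b n) * iexp (- s * y))"
            by (simp only: Re_of_real_mult)
          then show "Re (?Y (0 + 1 / b n * s)) = ?U s"
            using elim(3) by (simp add: power_divide)
        qed
        finally show ?thesis .
      qed
      have part2: "\<bar>(LBINT s. ?U s) - c * std_normal_density y\<bar> \<le> \<epsilon> / 2"
      proof -
        have "c * std_normal_density y = (LBINT s. c / pi * ?q s)"
          unfolding integral_mult_right_zero iq(2) by simp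
        then have "(LBINT s. ?U s) - c * std_normal_density y = (LBINT s. ?U s - c / pi * ?q s)"
          using iU iq(1) by (simp only: Bochner_Integration.integral_diff integrable_mult_right)
        then have "ennreal \<bar>(LBINT s. ?U s) - c * std_normal_density y\<bar> \<le> (\<integral>\<^sup>+s. ennreal (norm (?U s - c / pi * ?q s)) \<partial>lborel)"
          unfolding real_norm_def[symmetric] using iU iq(1)
          by (simp only:) (intro integral_norm_bound_ennreal Bochner_Integration.integrable_diff integrable_mult_right)
        also have "\<dots> \<le> (\<integral>\<^sup>+s. ennreal (?d n s) \<partial>lborel)"
        proof (rule nn_integral_mono_AE)
          show "AE s in lborel. ennreal (norm (?U s - c / pi * ?q s)) \<le> ennreal (?d n s)"
            using AE_lborel_singleton[of 0]
          proof eventually_elim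
            case (elim s)
            show ?case
            proof (cases "0 < s")
              case True
              have "?U s - c / pi * ?q s = Re ((H (s / b n) - of_real (c / pi)) * iexp (- s * y)) * exp (- s\<^sup>2 / 2)"
              proof -
                have "Re (iexp (- s * y)) = cos (s * y)" by (simp add: Re_exp)
                then have "Re (of_real (c / pi) * iexp (- s * y)) = c / pi * cos (s * y)" by (simp only: Re_of_real_mult)
                then show ?thesis using True
                  by (simp only: left_diff_distrib minus_complex.sel) (simp add: indicator_def)
              qed
              also have "norm \<dots> \<le> cmod (H (s / b n) - of_real (c / pi)) * exp (- s\<^sup>2 / 2)"
              proof -
                have "\<bar>Re ((H (s / b n) - of_real (c / pi)) * iexp (- s * y))\<bar> \<le> cmod (H (s / b n) - of_real (c / pi))"
                  by (rule order_trans[OF abs_Re_le_cmod]) (simp only: norm_mult norm_exp_i_times mult_1_right order_refl)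
                then show ?thesis by (simp only: real_norm_def abs_mult abs_exp_cancel mult_right_mono exp_ge_zero)
              qed
              finally show ?thesis using True by (intro ennreal_leI) simp
            next
              case False
              then have s: "s < 0" using elim by simp
              then have "s / b n < 0" using \<open>0 < b n\<close> by (simp add: divide_neg_pos)
              then have "s / b n \<notin> {0..K}" by simp
              then have "H (s / b n) = 0" by (rule supp)
              then show ?thesis using s by simp
            qed
          qed
        qed
        also have "\<dots> < ennreal (\<epsilon> / 2)" by (rule elim(2))
        finally show ?thesis by (subst (asm) ennreal_less_iff) auto
      qed
      show "\<bar>b n * ((\<Sum>u\<in>T n. f (S n u - x)) / card (T n)) - c * std_normal_density ((x - A n) / b n)\<bar> \<le> \<epsilon>"
        unfolding avg y_def[symmetric] using part1 part2 unfolding subst by linarith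
    qed
  qed
qed

text \<open>The indicator lies between a majorant and a minorant whose masses differ from
  \<open>h\<close> by at most \<open>\<epsilon>\<close>. As the density is at most 1, the mass costs
  \<open>\<epsilon>\<close> and \<open>bandlimited_average\<close> another
  \<open>\<epsilon>\<close>, uniformly in \<open>x\<close>; with \<open>\<epsilon> = e / 4\<close>
  the total stays below \<open>e\<close>.\<close>

theorem interval_limit:
  assumes h: "0 < h"
  shows "(\<lambda>n. SUP x. \<bar>b n * (real (card {u\<in>T n. S n u \<in> {x<..<x + h}}) / real (card (T n))) -
    h * std_normal_density ((x - A n) / b n)\<bar>) \<longlonglongrightarrow> 0"
proof (rule tendstoI)
  let ?D = "\<lambda>n x. \<bar>b n * (real (card {u\<in>T n. S n u \<in> {x<..<x + h}}) / real (card (T n))) -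
    h * std_normal_density ((x - A n) / b n)\<bar>"
  fix e :: real assume "0 < e"
  define \<epsilon> where "\<epsilon> = e / 4"
  have \<epsilon>: "0 < \<epsilon>" using \<open>0 < e\<close> by (simp add: \<epsilon>_def)
  obtain f c where f: "bandlimited f c" "c \<le> h + \<epsilon>" "\<And>y. indicator {0<..<h} y \<le> f y"
    using bandlimited_majorant[OF h \<epsilon>] by blast
  obtain g d where g: "bandlimited g d" "h - \<epsilon> \<le> d" "\<And>y. g y \<le> indicator {0<..<h} y"
    using bandlimited_minorant[OF h \<epsilon>] by blast
  from bandlimited_average[OF f(1) \<epsilon>] bandlimited_average[OF g(1) \<epsilon>]
  show "\<forall>\<^sub>F n in sequentially. dist (SUP x. ?D n x) 0 < e"
  proof eventually_elim
    case (elim n)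
    have le: "?D n x \<le> 2 * \<epsilon>" for x
    proof -
      let ?p = "std_normal_density ((x - A n) / b n)"
      let ?N = "real (card (T n))"
      have p: "0 \<le> ?p" "?p \<le> 1" by (auto intro: std_normal_density_le_1)
      have card: "real (card {u\<in>T n. S n u \<in> {x<..<x + h}}) = (\<Sum>u\<in>T n. indicator {0<..<h} (S n u - x))"
      proof -
        have "(\<Sum>u\<in>T n. indicator {0<..<h} (S n u - x) :: real) = (\<Sum>u\<in>{u\<in>T n. S n u \<in> {x<..<x + h}}. 1)"
          by (rule sum.mono_neutral_cong_right) (auto simp: finite_T indicator_def)
        then show ?thesis by simp
      qed
      have "b n * ((\<Sum>u\<in>T n. indicator {0<..<h} (S n u - x)) / ?N) \<le> b n * ((\<Sum>u\<in>T n. f (S n u - x)) / ?N)"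
        by (intro mult_left_mono divide_right_mono sum_mono f b_nonneg) auto
      moreover have "b n * ((\<Sum>u\<in>T n. g (S n u - x)) / ?N) \<le> b n * ((\<Sum>u\<in>T n. indicator {0<..<h} (S n u - x)) / ?N)"
        by (intro mult_left_mono divide_right_mono sum_mono g b_nonneg) auto
      moreover have "\<bar>b n * ((\<Sum>u\<in>T n. f (S n u - x)) / ?N) - c * ?p\<bar> \<le> \<epsilon>" using elim(1) by blast
      moreover have "\<bar>b n * ((\<Sum>u\<in>T n. g (S n u - x)) / ?N) - d * ?p\<bar> \<le> \<epsilon>" using elim(2) by blast
      moreover have "c * ?p \<le> h * ?p + \<epsilon>"
      proof -
        have "c * ?p \<le> (h + \<epsilon>) * ?p" using f(2) p by (intro mult_right_mono) auto
        also have "\<dots> \<le> h * ?p + \<epsilon>" using mult_left_mono[OF p(2), of \<epsilon>] \<epsilon> by (simp add: distrib_right)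
        finally show ?thesis .
      qed
      moreover have "h * ?p - \<epsilon> \<le> d * ?p"
      proof -
        have "h * ?p - \<epsilon> \<le> (h - \<epsilon>) * ?p" using mult_left_mono[OF p(2), of \<epsilon>] \<epsilon> by (simp add: left_diff_distrib)
        also have "\<dots> \<le> d * ?p" using g(2) p by (intro mult_right_mono) auto
        finally show ?thesis .
      qed
      ultimately show ?thesis unfolding card by linarith
    qed
    have "(SUP x. ?D n x) \<le> 2 * \<epsilon>" by (rule cSUP_least[OF UNIV_not_empty]) (rule le)
    moreover have "0 \<le> (SUP x. ?D n x)"
    proof -
      have "?D n 0 \<le> (SUP x. ?D n x)"
        by (rule cSUP_upper[OF UNIV_I bdd_aboveI2]) (rule le)
      then show ?thesis using abs_ge_zero order_trans by blast
    qed
    ultimately show ?case using \<epsilon> by (simp add: \<epsilon>_def dist_real_def)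
  qed
qed

end


section \<open>Characteristic functions of displacement laws\<close>

text \<open>In the Taylor remainder, a minimum of a quadratic and a cubic term, the quadratic one is
  used for deviations beyond \<open>A\<close> and the cubic one otherwise. No third moment is thus
  involved.\<close>

lemma char_approx_truncated:
  fixes \<nu> :: "real measure" and \<mu> :: real
  assumes \<nu>: "real_distribution \<nu>" and int: "integrable \<nu> (\<lambda>x. x)" and int2: "integrable \<nu> (\<lambda>x. (x - \<mu>)\<^sup>2)"
    and mean: "(\<integral>x. x \<partial>\<nu>) = \<mu>" and A: "0 \<le> A"
  shows "cmod (char \<nu> t * iexp (- t * \<mu>) - of_real (1 - (\<integral>x. (x - \<mu>)\<^sup>2 \<partial>\<nu>) * t\<^sup>2 / 2)) \<le>
    t\<^sup>2 * (\<integral>x. (x - \<mu>)\<^sup>2 * indicator {x. A < \<bar>x - \<mu>\<bar>} x \<partial>\<nu>) + \<bar>t\<bar> ^ 3 * A * (\<integral>x. (x - \<mu>)\<^sup>2 \<partial>\<nu>)"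
proof -
  interpret real_distribution \<nu> by (rule \<nu>)
  let ?X = "\<lambda>x. x - \<mu>"
  let ?q = "\<integral>x. (x - \<mu>)\<^sup>2 * indicator {x. A < \<bar>x - \<mu>\<bar>} x \<partial>\<nu>" and ?s = "\<integral>x. (x - \<mu>)\<^sup>2 \<partial>\<nu>"
  have m: "random_variable borel ?X" by simp
  have X0: "expectation ?X = 0" using int mean prob_space by simp
  have "cmod (char (distr \<nu> borel ?X) t - (1 - t\<^sup>2 * ?s / 2)) \<le>
      (t\<^sup>2 / 6) * expectation (\<lambda>x. min (6 * (?X x)\<^sup>2) (\<bar>t\<bar> * \<bar>?X x\<bar> ^ 3))"
    by (rule char_approx3'[OF m]) (use int int2 X0 in auto)
  also have "char (distr \<nu> borel ?X) t = char \<nu> t * iexp (- t * \<mu>)"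
  proof -
    have "char (distr \<nu> borel ?X) t = (\<integral>x. iexp (t * (x - \<mu>)) \<partial>\<nu>)"
      unfolding char_def by (rule integral_distr) (auto intro: m)
    also have "\<dots> = (\<integral>x. iexp (t * x) * iexp (- t * \<mu>) \<partial>\<nu>)"
      unfolding exp_add[symmetric] by (intro Bochner_Integration.integral_cong refl arg_cong[where f = exp]) (simp add: algebra_simps)
    also have "\<dots> = char \<nu> t * iexp (- t * \<mu>)"
      unfolding char_def by (rule integral_mult_left_zero)
    finally show ?thesis .
  qed
  also have "expectation (\<lambda>x. min (6 * (?X x)\<^sup>2) (\<bar>t\<bar> * \<bar>?X x\<bar> ^ 3)) \<le> 6 * ?q + \<bar>t\<bar> * A * ?s"
  proof -
    have iq: "integrable \<nu> (\<lambda>x. (x - \<mu>)\<^sup>2 * indicator {x. A < \<bar>x - \<mu>\<bar>} x)"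
      by (rule integrable_real_mult_indicator[OF _ int2]) simp
    have "expectation (\<lambda>x. min (6 * (?X x)\<^sup>2) (\<bar>t\<bar> * \<bar>?X x\<bar> ^ 3)) \<le>
        expectation (\<lambda>x. 6 * ((x - \<mu>)\<^sup>2 * indicator {x. A < \<bar>x - \<mu>\<bar>} x) + \<bar>t\<bar> * A * (x - \<mu>)\<^sup>2)"
    proof (rule integral_mono)
      show "integrable \<nu> (\<lambda>x. min (6 * (?X x)\<^sup>2) (\<bar>t\<bar> * \<bar>?X x\<bar> ^ 3))"
        by (rule Bochner_Integration.integrable_bound[OF integrable_mult_right[OF int2, of 6]]) auto
      show "integrable \<nu> (\<lambda>x. 6 * ((x - \<mu>)\<^sup>2 * indicator {x. A < \<bar>x - \<mu>\<bar>} x) + \<bar>t\<bar> * A * (x - \<mu>)\<^sup>2)"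
        by (intro Bochner_Integration.integrable_add integrable_mult_right iq int2)
      fix x
      have nn: "0 \<le> \<bar>t\<bar> * A * (x - \<mu>)\<^sup>2" using A by simp
      show "min (6 * (?X x)\<^sup>2) (\<bar>t\<bar> * \<bar>?X x\<bar> ^ 3) \<le> 6 * ((x - \<mu>)\<^sup>2 * indicator {x. A < \<bar>x - \<mu>\<bar>} x) + \<bar>t\<bar> * A * (x - \<mu>)\<^sup>2"
      proof (cases "A < \<bar>x - \<mu>\<bar>")
        case True
        then show ?thesis using nn by simp
      next
        case False
        have "\<bar>?X x\<bar> ^ 3 = \<bar>?X x\<bar> * (?X x)\<^sup>2" by (simp add: power3_eq_cube power2_eq_square)
        also have "\<dots> \<le> A * (?X x)\<^sup>2" using False by (intro mult_right_mono) auto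
        finally have "\<bar>t\<bar> * \<bar>?X x\<bar> ^ 3 \<le> \<bar>t\<bar> * (A * (?X x)\<^sup>2)" by (rule mult_left_mono) simp
        then show ?thesis using False by (simp add: mult.assoc min_le_iff_disj)
      qed
    qed
    also have "\<dots> = 6 * ?q + \<bar>t\<bar> * A * ?s"
      using iq int2 by simp
    finally show ?thesis .
  qed
  finally have "cmod (char \<nu> t * iexp (- t * \<mu>) - (1 - t\<^sup>2 * ?s / 2)) \<le> t\<^sup>2 / 6 * (6 * ?q + \<bar>t\<bar> * A * ?s)"
    by (simp add: mult_left_mono)
  also have "\<dots> = t\<^sup>2 * ?q + \<bar>t\<bar> ^ 3 * A * ?s / 6"
  proof -
    have "\<bar>t\<bar> ^ 3 = t\<^sup>2 * \<bar>t\<bar>" by (simp add: power3_eq_cube power2_eq_square)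
    then show ?thesis by (simp add: distrib_left)
  qed
  also have "\<dots> \<le> t\<^sup>2 * ?q + \<bar>t\<bar> ^ 3 * A * ?s"
  proof -
    have "0 \<le> \<bar>t\<bar> ^ 3 * A * ?s" using A by simp
    then show ?thesis by linarith
  qed
  finally show ?thesis by (simp add: mult.commute)
qed

text \<open>Modulus 1 is the equality case of the triangle inequality: all
  \<open>iexp (t * x)\<close> point in the same direction \<open>\<alpha>\<close>, so
  \<open>x\<close> almost surely lies in a lattice of span \<open>2 * pi / t\<close>.\<close>

lemma cmod_char_less_1:
  assumes \<nu>: "real_distribution \<nu>" and nl: "non_lattice \<nu>" and t: "t \<noteq> 0"
  shows "cmod (char \<nu> t) < 1"
proof (rule ccontr)
  interpret real_distribution \<nu> by (rule \<nu>)
  assume "\<not> cmod (char \<nu> t) < 1"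
  then have one: "cmod (char \<nu> t) = 1" using cmod_char_le_1[of t] by simp
  define \<alpha> where "\<alpha> = Arg (char \<nu> t)"
  have rot: "char \<nu> t = iexp \<alpha>"
    using one rcis_cmod_Arg[of "char \<nu> t"] unfolding \<alpha>_def rcis_def cis_conv_exp by simp
  have int: "integrable \<nu> (\<lambda>x. iexp (t * x) * iexp (- \<alpha>))"
    by (intro integrable_mult_left integrable_iexp) simp_all
  have "(\<integral>x. iexp (t * x) * iexp (- \<alpha>) \<partial>\<nu>) = char \<nu> t * iexp (- \<alpha>)"
    unfolding char_def by (rule integral_mult_left_zero)
  also have "\<dots> = 1" unfolding rot exp_add[symmetric] by simp
  finally have I: "(\<integral>x. iexp (t * x) * iexp (- \<alpha>) \<partial>\<nu>) = 1" .
  have Re: "Re (iexp (t * x) * iexp (- \<alpha>)) = cos (t * x - \<alpha>)" for x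
  proof -
    have "iexp (t * x) * iexp (- \<alpha>) = iexp (t * x - \<alpha>)"
      unfolding exp_add[symmetric] by (rule arg_cong[where f = exp]) (simp add: algebra_simps)
    then show ?thesis by (simp add: Re_exp)
  qed
  have "(\<integral>x. cos (t * x - \<alpha>) \<partial>\<nu>) = 1"
    using integral_Re[OF int] unfolding I Re by simp
  moreover have ic: "integrable \<nu> (\<lambda>x. cos (t * x - \<alpha>))"
    using integrable_Re[OF int] unfolding Re .
  ultimately have "(\<integral>x. 1 - cos (t * x - \<alpha>) \<partial>\<nu>) = 0"
    using prob_space by (simp add: Bochner_Integration.integral_diff)
  then have "AE x in \<nu>. 1 - cos (t * x - \<alpha>) = 0"
    using ic by (subst (asm) integral_nonneg_eq_0_iff_AE) auto
  then have "AE x in \<nu>. x \<in> range (\<lambda>k::int. \<alpha> / t + (2 * pi / t) * of_int k)"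
  proof eventually_elim
    case (elim x)
    then have "cos (t * x - \<alpha>) = 1" by simp
    then obtain k :: int where "t * x - \<alpha> = of_int k * (2 * pi)"
      using cos_one_2pi_int[of "t * x - \<alpha>"] by (auto simp: mult.commute)
    then have "x = \<alpha> / t + (2 * pi / t) * of_int k" using t by (simp add: field_simps)
    then show ?case by blast
  qed
  then show False using nl unfolding non_lattice_def by blast
qed

text \<open>Near 0 the second order expansion gives the bound. On the remaining compact set of
  frequencies the modulus attains its maximum, which is below 1 by
  \<open>cmod_char_less_1\<close>.\<close>

lemma char_decay_constant:
  assumes \<nu>: "real_distribution \<nu>" and nl: "non_lattice \<nu>" and K: "0 < K"
    and int: "integrable \<nu> (\<lambda>x. x)" and int2: "integrable \<nu> (\<lambda>x. (x - (\<integral>x. x \<partial>\<nu>))\<^sup>2)"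
  shows "\<exists>\<kappa>>0. \<forall>t. \<bar>t\<bar> \<le> K \<longrightarrow> cmod (char \<nu> t) \<le> 1 - \<kappa> * t\<^sup>2"
proof -
  interpret real_distribution \<nu> by (rule \<nu>)
  define \<mu> where "\<mu> = (\<integral>x. x \<partial>\<nu>)"
  define s where "s = (\<integral>x. (x - \<mu>)\<^sup>2 \<partial>\<nu>)"
  have int2': "integrable \<nu> (\<lambda>x. (x - \<mu>)\<^sup>2)" using int2 by (simp add: \<mu>_def)
  have s: "0 < s"
  proof (rule ccontr)
    assume "\<not> 0 < s"
    moreover have "0 \<le> s" unfolding s_def by (intro integral_nonneg_AE) simp
    ultimately have "s = 0" by linarith
    then have "AE x in \<nu>. (x - \<mu>)\<^sup>2 = 0"
      unfolding s_def using int2' by (subst (asm) integral_nonneg_eq_0_iff_AE) auto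
    \<comment> \<open>A degenerate law is a lattice law with span 0, which
      \<open>non_lattice\<close> excludes.\<close>
    then have "AE x in \<nu>. x \<in> range (\<lambda>k::int. \<mu> + 0 * of_int k)"
      by eventually_elim simp
    then show False using nl unfolding non_lattice_def by blast
  qed
  let ?q = "\<lambda>A. \<integral>x. (x - \<mu>)\<^sup>2 * indicator {x. A < \<bar>x - \<mu>\<bar>} x \<partial>\<nu>"
  have "(\<lambda>n::nat. ?q (real n)) \<longlonglongrightarrow> (\<integral>x. 0 \<partial>\<nu>)"
  proof (rule integral_dominated_convergence[OF _ _ int2'])
    show "AE x in \<nu>. (\<lambda>n. (x - \<mu>)\<^sup>2 * indicator {x. real n < \<bar>x - \<mu>\<bar>} x) \<longlonglongrightarrow> 0"
    proof (rule AE_I2)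
      fix x
      obtain N :: nat where N: "\<bar>x - \<mu>\<bar> \<le> real N" using real_arch_simple by blast
      have "\<forall>\<^sub>F n in sequentially. (x - \<mu>)\<^sup>2 * indicator {x. real n < \<bar>x - \<mu>\<bar>} x = 0"
        using eventually_ge_at_top[of N] by eventually_elim (use N in \<open>auto simp: indicator_def\<close>)
      then show "(\<lambda>n. (x - \<mu>)\<^sup>2 * indicator {x. real n < \<bar>x - \<mu>\<bar>} x) \<longlonglongrightarrow> 0"
        by (rule tendsto_eventually)
    qed
  qed (auto simp: indicator_def)
  then have "\<forall>\<^sub>F n in sequentially. ?q (real n) < s / 8"
    using s by (intro order_tendstoD(2)) auto
  then obtain n :: nat where n: "?q (real n) < s / 8" by (auto simp: eventually_sequentially)
  define A where "A = real n"
  have A: "0 \<le> A" "?q A < s / 8" using n by (auto simp: A_def)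
  \<comment> \<open>The first bound ensures \<open>\<bar>t\<bar> * A \<le> 1 / 8\<close>, the second
    \<open>s * t\<^sup>2 \<le> 1\<close>.\<close>
  define \<delta> where "\<delta> = min (1 / (8 * (A + 1))) (1 / (s + 1))"
  have \<delta>: "0 < \<delta>" using A s by (simp add: \<delta>_def)
  \<comment> \<open>The quadratic term contributes \<open>1 / 2\<close> and each of the two errors
    takes away at most \<open>1 / 8\<close>, which leaves \<open>1 / 4\<close>.\<close>
  have near: "cmod (char \<nu> t) \<le> 1 - s / 4 * t\<^sup>2" if t: "\<bar>t\<bar> \<le> \<delta>" for t
  proof -
    have tA: "\<bar>t\<bar> * A \<le> 1 / 8"
    proof -
      have "\<bar>t\<bar> * A \<le> 1 / (8 * (A + 1)) * (A + 1)"
        using t A by (intro mult_mono) (auto simp: \<delta>_def)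
      moreover have "1 / (8 * z) * z = 1 / 8" if "0 < z" for z :: real using that by simp
      ultimately show ?thesis using A by (metis add_nonneg_pos zero_less_one)
    qed
    have ts: "s * t\<^sup>2 \<le> 1"
    proof -
      have "\<bar>t\<bar> \<le> 1 / (s + 1)" using t by (simp add: \<delta>_def)
      then have "\<bar>t\<bar> * \<bar>t\<bar> \<le> 1 / (s + 1) * 1"
        using s by (intro mult_mono) (auto intro: order_trans[of _ "1 / (s + 1)"])
      then have "s * t\<^sup>2 \<le> s * (1 / (s + 1))" using s by (intro mult_left_mono) (auto simp: power2_eq_square)
      also have "\<dots> \<le> 1" using s by simp
      finally show ?thesis .
    qed
    have "cmod (char \<nu> t) = cmod (char \<nu> t * iexp (- t * \<mu>))" unfolding norm_mult norm_exp_i_times by simp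
    also have "\<dots> \<le> cmod (of_real (1 - s * t\<^sup>2 / 2)) + cmod (char \<nu> t * iexp (- t * \<mu>) - of_real (1 - s * t\<^sup>2 / 2))"
      using norm_triangle_sub[of "char \<nu> t * iexp (- t * \<mu>)" "of_real (1 - s * t\<^sup>2 / 2)"] by simp
    also have "cmod (of_real (1 - s * t\<^sup>2 / 2)) = 1 - s * t\<^sup>2 / 2"
      unfolding norm_of_real using ts by simp
    also have "cmod (char \<nu> t * iexp (- t * \<mu>) - of_real (1 - s * t\<^sup>2 / 2)) \<le> t\<^sup>2 * ?q A + \<bar>t\<bar> ^ 3 * A * s"
      unfolding s_def by (rule char_approx_truncated[OF \<nu> int int2' \<mu>_def[symmetric] A(1)])
    also have "t\<^sup>2 * ?q A \<le> t\<^sup>2 * (s / 8)" using A(2) by (intro mult_left_mono) auto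
    also have "\<bar>t\<bar> ^ 3 * A * s \<le> t\<^sup>2 * (s / 8)"
    proof -
      have "\<bar>t\<bar> ^ 3 * A * s = t\<^sup>2 * (\<bar>t\<bar> * A * s)"
        by (simp add: power3_eq_cube power2_eq_square)
      also have "\<dots> \<le> t\<^sup>2 * (1 / 8 * s)" using tA s by (intro mult_left_mono mult_right_mono) auto
      finally show ?thesis by simp
    qed
    finally show ?thesis by (simp add: algebra_simps)
  qed
  have cont: "continuous_on {t. \<delta> \<le> \<bar>t\<bar> \<and> \<bar>t\<bar> \<le> K} (\<lambda>t. cmod (char \<nu> t))"
    by (intro continuous_on_norm continuous_at_imp_continuous_on ballI isCont_char)
  have comp: "compact {t. \<delta> \<le> \<bar>t\<bar> \<and> \<bar>t\<bar> \<le> K}"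
  proof (rule compact_Int_closed[of "{-K..K}" "{t. \<delta> \<le> \<bar>t\<bar>}", THEN arg_cong[where f = compact, THEN iffD1, rotated]])
    show "{-K..K} \<inter> {t. \<delta> \<le> \<bar>t\<bar>} = {t. \<delta> \<le> \<bar>t\<bar> \<and> \<bar>t\<bar> \<le> K}" by auto
    show "closed {t. \<delta> \<le> \<bar>t\<bar>}" by (intro closed_Collect_le continuous_intros)
  qed simp
  obtain \<kappa>' where \<kappa>': "0 < \<kappa>'" "\<And>t. \<delta> \<le> \<bar>t\<bar> \<Longrightarrow> \<bar>t\<bar> \<le> K \<Longrightarrow> cmod (char \<nu> t) \<le> 1 - \<kappa>' * t\<^sup>2"
  proof (cases "{t. \<delta> \<le> \<bar>t\<bar> \<and> \<bar>t\<bar> \<le> K} = {}")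
    case True
    then show ?thesis by (intro that[of 1]) auto
  next
    case False
    from continuous_attains_sup[OF comp False cont] obtain t0 where t0: "\<delta> \<le> \<bar>t0\<bar>"
        "\<And>t. \<delta> \<le> \<bar>t\<bar> \<Longrightarrow> \<bar>t\<bar> \<le> K \<Longrightarrow> cmod (char \<nu> t) \<le> cmod (char \<nu> t0)" by blast
    have lt: "cmod (char \<nu> t0) < 1" using t0(1) \<delta> by (intro cmod_char_less_1[OF \<nu> nl]) auto
    show ?thesis
    proof (rule that[of "(1 - cmod (char \<nu> t0)) / K\<^sup>2"])
      show "0 < (1 - cmod (char \<nu> t0)) / K\<^sup>2" using lt K by simp
      fix t assume t: "\<delta> \<le> \<bar>t\<bar>" "\<bar>t\<bar> \<le> K"
      have "t\<^sup>2 \<le> K\<^sup>2" using t K by (simp add: abs_le_square_iff[symmetric])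
      then have "(1 - cmod (char \<nu> t0)) / K\<^sup>2 * t\<^sup>2 \<le> (1 - cmod (char \<nu> t0)) / K\<^sup>2 * K\<^sup>2"
        using lt by (intro mult_left_mono) auto
      also have "\<dots> = 1 - cmod (char \<nu> t0)" using K by simp
      finally show "cmod (char \<nu> t) \<le> 1 - (1 - cmod (char \<nu> t0)) / K\<^sup>2 * t\<^sup>2" using t0(2)[OF t] by simp
    qed
  qed
  show ?thesis
  proof (intro exI[of _ "min (s / 4) \<kappa>'"] conjI allI impI)
    show "0 < min (s / 4) \<kappa>'" using s \<kappa>' by simp
    fix t assume t: "\<bar>t\<bar> \<le> K"
    have le: "1 - c * t\<^sup>2 \<le> 1 - min (s / 4) \<kappa>' * t\<^sup>2" if "min (s / 4) \<kappa>' \<le> c" for c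
      using that by (simp add: mult_right_mono)
    show "cmod (char \<nu> t) \<le> 1 - min (s / 4) \<kappa>' * t\<^sup>2"
    proof (cases "\<bar>t\<bar> \<le> \<delta>")
      case True
      show ?thesis by (rule order_trans[OF near[OF True] le]) simp
    next
      case False
      show ?thesis by (rule order_trans[OF \<kappa>'(2) le]) (use False t in auto)
    qed
  qed
qed

section \<open>Almost every environment\<close>

locale offspring_kernel =
  fixes \<Theta> :: "'e measure" and \<eta> :: "'e \<Rightarrow> offspring measure"
  assumes kernel: "\<eta> \<in> \<Theta> \<rightarrow>\<^sub>M prob_algebra offspring_space"
begin

lemma kernel_subprob [measurable]: "\<eta> \<in> \<Theta> \<rightarrow>\<^sub>M subprob_algebra offspring_space"
  by (rule measurable_prob_algebraD[OF kernel])

lemma prob_space_kernel: "\<theta> \<in> space \<Theta> \<Longrightarrow> prob_space (\<eta> \<theta>)"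
  using measurable_space[OF kernel] by (auto simp: space_prob_algebra)

lemma sets_kernel_offspring: "\<theta> \<in> space \<Theta> \<Longrightarrow> sets (\<eta> \<theta>) = sets offspring_space"
  using measurable_space[OF kernel] by (auto simp: space_prob_algebra)

lemma measurable_mean_offspring [measurable]: "(\<lambda>\<theta>. mean_offspring (\<eta> \<theta>)) \<in> borel_measurable \<Theta>"
  unfolding mean_offspring_def
  by (rule measurable_compose[OF kernel_subprob nn_integral_measurable_subprob_algebra]) measurable

text \<open>The formula for integrals against the displacement law reduces the claim to integrals
  against the kernel \<open>\<eta>\<close>, where measurability in the parameter is
  available.\<close>

lemma measurable_nn_integral_displacement_law:
  assumes f: "(\<lambda>p. f (fst p) (snd p)) \<in> borel_measurable (\<Theta> \<Otimes>\<^sub>M borel)"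
  shows "(\<lambda>\<theta>. \<integral>\<^sup>+x. f \<theta> x \<partial>displacement_law (\<eta> \<theta>)) \<in> borel_measurable \<Theta>"
proof -
  have "(\<lambda>p. \<Sum>i<fst (snd p). f (fst p) (snd (snd p) i)) \<in> borel_measurable (\<Theta> \<Otimes>\<^sub>M offspring_space)"
  proof (rule measurable_sum_children)
    fix i
    have "(\<lambda>p. (fst p, snd (snd p) i)) \<in> \<Theta> \<Otimes>\<^sub>M offspring_space \<rightarrow>\<^sub>M \<Theta> \<Otimes>\<^sub>M borel" by measurable
    from measurable_compose[OF this f] show "(\<lambda>p. f (fst p) (snd (snd p) i)) \<in> borel_measurable (\<Theta> \<Otimes>\<^sub>M offspring_space)" by simp
  qed measurable
  then have "(\<lambda>\<theta>. \<integral>\<^sup>+y. (\<Sum>i<fst y. f \<theta> (snd y i)) \<partial>\<eta> \<theta>) \<in> borel_measurable \<Theta>"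
    by (intro nn_integral_measurable_subprob_algebra2[OF _ kernel_subprob]) (simp add: split_beta')
  then have "(\<lambda>\<theta>. (\<integral>\<^sup>+y. (\<Sum>i<fst y. f \<theta> (snd y i)) \<partial>\<eta> \<theta>) / mean_offspring (\<eta> \<theta>)) \<in> borel_measurable \<Theta>"
    by measurable
  also have "?this \<longleftrightarrow> ?thesis"
  proof (rule measurable_cong)
    fix \<theta> assume \<theta>: "\<theta> \<in> space \<Theta>"
    have "(\<lambda>x. (\<theta>, x)) \<in> borel \<rightarrow>\<^sub>M \<Theta> \<Otimes>\<^sub>M borel" using \<theta> by measurable
    from measurable_compose[OF this f] have "f \<theta> \<in> borel_measurable borel" by simp
    then show "(\<integral>\<^sup>+y. (\<Sum>i<fst y. f \<theta> (snd y i)) \<partial>\<eta> \<theta>) / mean_offspring (\<eta> \<theta>) = (\<integral>\<^sup>+x. f \<theta> x \<partial>displacement_law (\<eta> \<theta>))"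
      by (rule nn_integral_displacement_law[OF sets_kernel_offspring[OF \<theta>], symmetric])
  qed
  finally show ?thesis .
qed

lemma measurable_displacement_mean [measurable]: "(\<lambda>\<theta>. displacement_mean (\<eta> \<theta>)) \<in> borel_measurable \<Theta>"
proof -
  let ?n = "\<lambda>\<theta>. \<integral>\<^sup>+x. ennreal (norm x) \<partial>displacement_law (\<eta> \<theta>)"
  let ?p = "\<lambda>\<theta>. \<integral>\<^sup>+x. ennreal x \<partial>displacement_law (\<eta> \<theta>)" and ?m = "\<lambda>\<theta>. \<integral>\<^sup>+x. ennreal (- x) \<partial>displacement_law (\<eta> \<theta>)"
  have [measurable]: "?n \<in> borel_measurable \<Theta>" "?p \<in> borel_measurable \<Theta>" "?m \<in> borel_measurable \<Theta>"
    by (rule measurable_nn_integral_displacement_law; measurable)+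
  \<comment> \<open>The Bochner integral is 0 when the first absolute moment is infinite; the case
    distinction reproduces this default value.\<close>
  have "displacement_mean (\<eta> \<theta>) = (if ?n \<theta> < \<infinity> then enn2real (?p \<theta>) - enn2real (?m \<theta>) else 0)" for \<theta>
  proof (cases "?n \<theta> < \<infinity>")
    case True
    have "integrable (displacement_law (\<eta> \<theta>)) (\<lambda>x. x)"
      using True by (intro integrableI_bounded) (auto simp: measurable_cong_sets[OF sets_displacement_law refl])
    then show ?thesis using True unfolding displacement_mean_def by (simp add: real_lebesgue_integral_def)
  next
    case False
    then have "\<not> integrable (displacement_law (\<eta> \<theta>)) (\<lambda>x. x)" by (auto simp: integrable_iff_bounded)
    then show ?thesis using False unfolding displacement_mean_def by (simp add: not_integrable_integral_eq)
  qed
  then have "(\<lambda>\<theta>. displacement_mean (\<eta> \<theta>)) = (\<lambda>\<theta>. if ?n \<theta> < \<infinity> then enn2real (?p \<theta>) - enn2real (?m \<theta>) else 0)"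
    by (rule ext)
  also have "\<dots> \<in> borel_measurable \<Theta>" by measurable
  finally show ?thesis .
qed

definition tail_variance :: "real \<Rightarrow> 'e \<Rightarrow> ennreal" where
  "tail_variance A \<theta> = (\<integral>\<^sup>+x. ennreal ((x - displacement_mean (\<eta> \<theta>))\<^sup>2 *
     indicator {x. A < \<bar>x - displacement_mean (\<eta> \<theta>)\<bar>} x) \<partial>displacement_law (\<eta> \<theta>))"

lemma measurable_tail_variance [measurable]: "tail_variance A \<in> borel_measurable \<Theta>"
  unfolding tail_variance_def indicator_def by (rule measurable_nn_integral_displacement_law) measurable

lemma measurable_displacement_variance [measurable]: "(\<lambda>\<theta>. displacement_variance (\<eta> \<theta>)) \<in> borel_measurable \<Theta>"
  unfolding displacement_variance_def by (rule measurable_nn_integral_displacement_law) measurable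

text \<open>The characteristic function of the displacement law, written as an integral against the
  kernel to obtain measurability in \<open>\<theta>\<close>.\<close>

definition char_kernel :: "real \<Rightarrow> 'e \<Rightarrow> complex" where
  "char_kernel t \<theta> = (\<integral>y. (\<Sum>i<fst y. iexp (t * snd y i)) \<partial>\<eta> \<theta>) / of_real (enn2real (mean_offspring (\<eta> \<theta>)))"

lemma measurable_char_kernel [measurable]: "char_kernel t \<in> borel_measurable \<Theta>"
proof -
  have "(\<lambda>y. \<Sum>i<fst y. iexp (t * snd y i)) \<in> borel_measurable offspring_space"
    by (rule measurable_sum_children) measurable
  then have [measurable]: "(\<lambda>\<theta>. \<integral>y. (\<Sum>i<fst y. iexp (t * snd y i)) \<partial>\<eta> \<theta>) \<in> borel_measurable \<Theta>"
    by (intro measurable_compose[OF kernel_subprob integral_measurable_subprob_algebra])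
  show ?thesis unfolding char_kernel_def by measurable
qed

text \<open>Only rational arguments are tested, so that the set is measurable.\<close>
definition decay_set :: "nat \<Rightarrow> nat \<Rightarrow> 'e set" where
  "decay_set K m = {\<theta>\<in>space \<Theta>. \<forall>r::rat. \<bar>of_rat r\<bar> \<le> real (Suc K) \<longrightarrow>
     cmod (char_kernel (of_rat r) \<theta>) \<le> 1 - (of_rat r)\<^sup>2 / real (Suc m)}"

lemma sets_decay_set [measurable]: "decay_set K m \<in> sets \<Theta>"
  unfolding decay_set_def by measurable

definition tail_mean :: "real \<Rightarrow> 'e \<Rightarrow> ennreal" where
  "tail_mean \<tau> \<theta> = (\<integral>\<^sup>+y. ennreal (if real (fst y) \<le> \<tau> then 0 else real (fst y) / enn2real (mean_offspring (\<eta> \<theta>))) \<partial>\<eta> \<theta>)"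

lemma measurable_tail_mean [measurable]: "tail_mean \<tau> \<in> borel_measurable \<Theta>"
proof -
  have [measurable]: "(\<lambda>p. real (fst (snd p))) \<in> borel_measurable (\<Theta> \<Otimes>\<^sub>M offspring_space)"
    by (rule measurable_compose[OF measurable_compose[OF measurable_snd measurable_fst]]) simp
  have [measurable]: "(\<lambda>p. mean_offspring (\<eta> (fst p))) \<in> borel_measurable (\<Theta> \<Otimes>\<^sub>M offspring_space)"
    by (rule measurable_compose[OF measurable_fst measurable_mean_offspring])
  have "(\<lambda>p. ennreal (if real (fst (snd p)) \<le> \<tau> then 0 else real (fst (snd p)) / enn2real (mean_offspring (\<eta> (fst p)))))
      \<in> borel_measurable (\<Theta> \<Otimes>\<^sub>M offspring_space)"
    by measurable
  then show ?thesis
    unfolding tail_mean_def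
    by (intro nn_integral_measurable_subprob_algebra2[OF _ kernel_subprob]) (simp add: split_beta')
qed

lemma measurable_log_weight:
  "(\<lambda>p. ennreal (real (fst (snd p)) / enn2real (mean_offspring (\<eta> (fst p))) * log_plus (real (fst (snd p))) powr \<beta>))
    \<in> borel_measurable (\<Theta> \<Otimes>\<^sub>M offspring_space)"
proof -
  have [measurable]: "(\<lambda>p. real (fst (snd p))) \<in> borel_measurable (\<Theta> \<Otimes>\<^sub>M offspring_space)"
    by (rule measurable_compose[OF measurable_compose[OF measurable_snd measurable_fst]]) simp
  have [measurable]: "(\<lambda>p. log_plus (real (fst (snd p))) powr \<beta>) \<in> borel_measurable (\<Theta> \<Otimes>\<^sub>M offspring_space)"
    by (rule measurable_compose[OF measurable_compose[OF measurable_snd measurable_fst]]) simp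
  have [measurable]: "(\<lambda>p. mean_offspring (\<eta> (fst p))) \<in> borel_measurable (\<Theta> \<Otimes>\<^sub>M offspring_space)"
    by (rule measurable_compose[OF measurable_fst measurable_mean_offspring])
  show ?thesis by measurable
qed

lemma measurable_log_moment:
  "(\<lambda>\<theta>. \<integral>\<^sup>+y. ennreal (real (fst y) / enn2real (mean_offspring (\<eta> \<theta>)) * log_plus (real (fst y)) powr \<beta>) \<partial>\<eta> \<theta>)
    \<in> borel_measurable \<Theta>"
  using measurable_log_weight
  by (intro nn_integral_measurable_subprob_algebra2[OF _ kernel_subprob]) (unfold split_beta', assumption)

end

text \<open>The source of the weight \<open>\<beta> - 1\<close>: a value \<open>N\<close> is
  truncated only at times \<open>j\<close> with \<open>exp (d * real j) < real N\<close>, that is at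
  about \<open>ln (real N) / d\<close> times. Each carries a weight of at most that number to the
  power \<open>\<beta> - 1\<close>, so the sum is of order \<open>ln (real N) powr \<beta>\<close>.
  The summand \<open>1 / ln 2\<close> absorbs rounding, as \<open>N\<close> is at least 2.\<close>

lemma tail_weight_sum_le:
  fixes d \<beta> :: real and N :: nat
  assumes d: "0 < d" and \<beta>: "1 \<le> \<beta>" and w: "0 \<le> w"
  shows "(\<Sum>j. ennreal (real (Suc j) powr (\<beta> - 1)) * ennreal (if real N \<le> exp (d * real j) then 0 else w)) \<le>
    ennreal ((1 / d + 1 / ln 2) powr \<beta>) * ennreal (w * log_plus (real N) powr \<beta>)"
proof (cases "N \<le> 1")
  case True
  then have "real N \<le> exp (d * real j)" for j
    using d by (auto intro!: order_trans[of "real N" 1 "exp (d * real j)"])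
  then show ?thesis by simp
next
  case False
  then have N: "2 \<le> N" by simp
  define x where "x = ln (real N) / d + 1"
  define J where "J = nat \<lfloor>ln (real N) / d\<rfloor> + 1"
  have lnN: "ln 2 \<le> ln (real N)" "0 < ln (real N)" using N by auto
  have Jx: "real J \<le> x"
    unfolding J_def x_def using d lnN by simp
  have x0: "0 < x" unfolding x_def using d lnN by (intro add_nonneg_pos) auto
  have zero: "real N \<le> exp (d * real j)" if "j \<notin> {..<J}" for j
  proof -
    have "ln (real N) / d < real j + 1" if "nat \<lfloor>ln (real N) / d\<rfloor> + 1 \<le> j" using that by linarith
    then have "ln (real N) / d \<le> real j" using \<open>j \<notin> {..<J}\<close> unfolding J_def by simp linarith
    then have "ln (real N) \<le> d * real j" using d by (simp add: field_simps)
    then show ?thesis using N by (subst ln_le_cancel_iff[symmetric]) auto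
  qed
  have "(\<Sum>j. ennreal (real (Suc j) powr (\<beta> - 1)) * ennreal (if real N \<le> exp (d * real j) then 0 else w)) =
      (\<Sum>j<J. ennreal (real (Suc j) powr (\<beta> - 1)) * ennreal (if real N \<le> exp (d * real j) then 0 else w))"
    by (rule suminf_finite) (auto simp: zero)
  also have "\<dots> \<le> (\<Sum>j<J. ennreal (x powr (\<beta> - 1) * w))"
  proof (rule sum_mono)
    fix j assume "j \<in> {..<J}"
    then have "real (Suc j) \<le> x" using Jx by simp
    then have "real (Suc j) powr (\<beta> - 1) \<le> x powr (\<beta> - 1)" using \<beta> by (intro powr_mono2) auto
    then show "ennreal (real (Suc j) powr (\<beta> - 1)) * ennreal (if real N \<le> exp (d * real j) then 0 else w) \<le> ennreal (x powr (\<beta> - 1) * w)"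
      unfolding ennreal_mult[OF powr_ge_zero w] using w by (intro mult_mono ennreal_leI) auto
  qed
  also have "\<dots> = ennreal (real J * (x powr (\<beta> - 1) * w))"
    using w by (simp add: ennreal_mult ennreal_of_nat_eq_real_of_nat)
  also have "\<dots> \<le> ennreal (x * (x powr (\<beta> - 1) * w))"
    using Jx w by (intro ennreal_leI mult_right_mono) auto
  also have "x * (x powr (\<beta> - 1) * w) = x powr \<beta> * w"
    using x0 by (simp add: powr_diff)
  also have "\<dots> \<le> ((1 / d + 1 / ln 2) * ln (real N)) powr \<beta> * w"
  proof (intro mult_right_mono powr_mono2 w)
    have "1 \<le> 1 / ln 2 * ln (real N)" using lnN by (simp add: field_simps)
    then show "x \<le> (1 / d + 1 / ln 2) * ln (real N)" by (simp add: x_def distrib_right)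
  qed (use x0 \<beta> in auto)
  also have "((1 / d + 1 / ln 2) * ln (real N)) powr \<beta> * w = (1 / d + 1 / ln 2) powr \<beta> * (w * log_plus (real N) powr \<beta>)"
    using N d lnN by (simp add: powr_mult log_plus_def)
  also have "ennreal \<dots> = ennreal ((1 / d + 1 / ln 2) powr \<beta>) * ennreal (w * log_plus (real N) powr \<beta>)"
    using w by (simp add: ennreal_mult)
  finally show ?thesis by (simp add: ennreal_leI)
qed

section \<open>Growth, tails and good generations along an ergodic environment\<close>

locale ergodic_environment = ergodic_shift Q \<Theta> + offspring_kernel \<Theta> \<eta>
  for Q :: "(nat \<Rightarrow> 'e) measure" and \<Theta> :: "'e measure" and \<eta> :: "'e \<Rightarrow> offspring measure" +
  fixes \<beta> :: real
  assumes mean_ok: "AE e in Q. 0 < mean_offspring (\<eta> (e 0)) \<and> mean_offspring (\<eta> (e 0)) < \<infinity>"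
    and log_integrable: "integrable Q (\<lambda>e. ln (enn2real (mean_offspring (\<eta> (e 0)))))"
    and log_pos: "0 < (\<integral>e. ln (enn2real (mean_offspring (\<eta> (e 0)))) \<partial>Q)"
    and decay: "\<And>K. AE e in Q. \<exists>m. e 0 \<in> decay_set K m"
    and var_pos: "0 < (\<integral>\<^sup>+e. displacement_variance (\<eta> (e 0)) \<partial>Q)"
    and var_fin: "(\<integral>\<^sup>+e. displacement_variance (\<eta> (e 0)) \<partial>Q) < \<infinity>"
    and \<beta>: "3 / 2 < \<beta>"
    and moment: "(\<integral>\<^sup>+e. \<integral>\<^sup>+y. ennreal (real (fst y) / enn2real (mean_offspring (\<eta> (e 0))) *
      log_plus (real (fst y)) powr \<beta>) \<partial>\<eta> (e 0) \<partial>Q) < \<infinity>"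
begin

lemma coordinate_in_space: "e \<in> space Q \<Longrightarrow> e k \<in> space \<Theta>"
  by (simp add: space_Q space_PiM PiE_iff)

lemma measurable_coordinate [measurable]: "(\<lambda>e. e k) \<in> Q \<rightarrow>\<^sub>M \<Theta>"
  by measurable

lemma AE_shift:
  assumes "AE e in Q. P e"
  shows "AE e in Q. P (shift_seq e)"
proof (rule AE_distrD[of shift_seq Q "seq_space \<Theta>" P])
  show "shift_seq \<in> Q \<rightarrow>\<^sub>M seq_space \<Theta>" by measurable
  show "AE e in distr Q (seq_space \<Theta>) shift_seq. P e" unfolding invariant by (rule assms)
qed

lemma AE_coordinates:
  assumes "AE e in Q. P (e 0)"
  shows "AE e in Q. \<forall>k. P (e k)"
  unfolding AE_all_countable
proof
  fix k
  have "AE e in Q. P (((shift_seq ^^ k) e) 0)"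
  proof (induction k)
    case (Suc k)
    from AE_shift[OF this] show ?case by (simp add: funpow_swap1)
  qed (use assms in simp)
  then show "AE e in Q. P (e k)" by (simp add: shift_seq_funpow)
qed

lemma birkhoff_coordinate:
  fixes f :: "'e \<Rightarrow> real"
  assumes f: "integrable Q (\<lambda>e. f (e 0))"
  shows "(\<integral>e. f (e 0) \<partial>Q) < c \<Longrightarrow> AE e in Q. \<exists>C. \<forall>n. (\<Sum>k<n. f (e k)) \<le> C + c * real n"
    and "c < (\<integral>e. f (e 0) \<partial>Q) \<Longrightarrow> AE e in Q. \<exists>C. \<forall>n. c * real n - C \<le> (\<Sum>k<n. f (e k))"
  using AE_birkhoff_le[OF f, of c] AE_birkhoff_ge[OF f, of c] by (simp_all add: shift_seq_funpow)

text \<open>A quarter of the mean logarithm, so that the growth exponent \<open>2 * rate\<close>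
  lies strictly below the mean and the truncation exponent \<open>rate\<close> is half of the growth
  exponent.\<close>

definition rate :: real where
  "rate = (\<integral>e. ln (enn2real (mean_offspring (\<eta> (e 0)))) \<partial>Q) / 4"

lemma rate_pos: "0 < rate"
  using log_pos by (simp add: rate_def)

lemma var_finite_AE: "AE e in Q. displacement_variance (\<eta> (e 0)) < \<infinity>"
proof -
  have "AE e in Q. displacement_variance (\<eta> (e 0)) \<noteq> \<infinity>"
    using var_fin by (intro nn_integral_PInf_AE) auto
  then show ?thesis by eventually_elim (simp add: less_top)
qed

lemma quenched_env_var_AE: "AE e in Q. quenched_env_var (\<lambda>n. \<eta> (e n))"
  using AE_coordinates[OF mean_ok] AE_coordinates[OF var_finite_AE] AE_space
proof eventually_elim
  case (elim e)
  have \<theta>: "e n \<in> space \<Theta>" for n using elim(3) by (rule coordinate_in_space)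
  show ?case
  proof (intro quenched_env_var.intro quenched_env.intro quenched_tree.intro quenched_env_axioms.intro quenched_env_var_axioms.intro)
    fix n
    show "prob_space (\<eta> (e n))" by (rule prob_space_kernel[OF \<theta>])
    show "sets (\<eta> (e n)) = sets offspring_space" by (rule sets_kernel_offspring[OF \<theta>])
  qed (use elim(1,2) in simp_all)
qed

lemma growth_AE: "AE e in Q. \<exists>C>0. \<forall>n. C * exp (2 * rate * real n) \<le> (\<Prod>i<n. enn2real (mean_offspring (\<eta> (e i))))"
proof -
  have "2 * rate < (\<integral>e. ln (enn2real (mean_offspring (\<eta> (e 0)))) \<partial>Q)"
    using log_pos by (simp add: rate_def)
  from birkhoff_coordinate(2)[OF log_integrable this] AE_coordinates[OF mean_ok] show ?thesis
  proof eventually_elim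
    case (elim e)
    then obtain C where C: "\<And>n. 2 * rate * real n - C \<le> (\<Sum>k<n. ln (enn2real (mean_offspring (\<eta> (e k)))))" by blast
    have "exp (- C) * exp (2 * rate * real n) \<le> (\<Prod>i<n. enn2real (mean_offspring (\<eta> (e i))))" for n
    proof -
      have "exp (- C) * exp (2 * rate * real n) = exp (2 * rate * real n - C)"
        by (simp add: exp_add[symmetric])
      also have "\<dots> \<le> exp (\<Sum>k<n. ln (enn2real (mean_offspring (\<eta> (e k)))))" using C[of n] by simp
      also have "\<dots> = (\<Prod>k<n. exp (ln (enn2real (mean_offspring (\<eta> (e k))))))" by (rule exp_sum) simp
      also have "\<dots> = (\<Prod>i<n. enn2real (mean_offspring (\<eta> (e i))))"
        using elim(2) by (intro prod.cong refl exp_ln) (simp add: enn2real_positive_iff)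
      finally show ?thesis .
    qed
    then show ?case by (intro exI[of _ "exp (- C)"]) simp
  qed
qed

lemma tail_mean_sum: "(\<Sum>j. ennreal (real (Suc j) powr (\<beta> - 1)) * (\<integral>\<^sup>+e. tail_mean (exp (rate * real j)) (e 0) \<partial>Q)) < \<infinity>"
proof -
  let ?c = "ennreal ((1 / rate + 1 / ln 2) powr \<beta>)"
  let ?w = "\<lambda>\<theta> y. real (fst y) / enn2real (mean_offspring (\<eta> \<theta>))"
  let ?t = "\<lambda>j \<theta> y. ennreal (real (Suc j) powr (\<beta> - 1)) * ennreal (if real (fst y) \<le> exp (rate * real j) then 0 else ?w \<theta> y)"
  have meas: "(\<lambda>e. tail_mean \<tau> (e 0)) \<in> borel_measurable Q" for \<tau> by measurable
  have meas': "(\<lambda>e. c * tail_mean \<tau> (e 0)) \<in> borel_measurable Q" for c \<tau> by measurable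
  have "(\<Sum>j. ennreal (real (Suc j) powr (\<beta> - 1)) * (\<integral>\<^sup>+e. tail_mean (exp (rate * real j)) (e 0) \<partial>Q)) =
      (\<integral>\<^sup>+e. (\<Sum>j. ennreal (real (Suc j) powr (\<beta> - 1)) * tail_mean (exp (rate * real j)) (e 0)) \<partial>Q)"
    by (subst nn_integral_suminf) (simp_all only: nn_integral_cmult meas meas')
  also have "\<dots> = (\<integral>\<^sup>+e. (\<integral>\<^sup>+y. (\<Sum>j. ?t j (e 0) y) \<partial>\<eta> (e 0)) \<partial>Q)"
  proof (rule nn_integral_cong)
    fix e assume "e \<in> space Q"
    then have "e 0 \<in> space \<Theta>" by (rule coordinate_in_space)
    note cong = measurable_cong_sets[OF sets_kernel_offspring[OF this] refl]
    have meas_y: "(\<lambda>y. ennreal (if real (fst y) \<le> \<tau> then 0 else ?w (e 0) y)) \<in> borel_measurable (\<eta> (e 0))" for \<tau>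
      unfolding cong by measurable
    have meas_y': "(\<lambda>y. c * ennreal (if real (fst y) \<le> \<tau> then 0 else ?w (e 0) y)) \<in> borel_measurable (\<eta> (e 0))" for c \<tau>
      using borel_measurable_const meas_y by (rule borel_measurable_times_ennreal)
    show "(\<Sum>j. ennreal (real (Suc j) powr (\<beta> - 1)) * tail_mean (exp (rate * real j)) (e 0)) = (\<integral>\<^sup>+y. (\<Sum>j. ?t j (e 0) y) \<partial>\<eta> (e 0))"
      unfolding tail_mean_def by (subst nn_integral_suminf) (simp_all only: nn_integral_cmult meas_y meas_y')
  qed
  also have "\<dots> \<le> (\<integral>\<^sup>+e. (\<integral>\<^sup>+y. ?c * ennreal (?w (e 0) y * log_plus (real (fst y)) powr \<beta>) \<partial>\<eta> (e 0)) \<partial>Q)"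
    using \<beta> by (intro nn_integral_mono tail_weight_sum_le rate_pos) auto
  also have "\<dots> = (\<integral>\<^sup>+e. ?c * (\<integral>\<^sup>+y. ennreal (?w (e 0) y * log_plus (real (fst y)) powr \<beta>) \<partial>\<eta> (e 0)) \<partial>Q)"
  proof (rule nn_integral_cong)
    fix e assume "e \<in> space Q"
    then have "e 0 \<in> space \<Theta>" by (rule coordinate_in_space)
    note cong = measurable_cong_sets[OF sets_kernel_offspring[OF this] refl]
    show "(\<integral>\<^sup>+y. ?c * ennreal (?w (e 0) y * log_plus (real (fst y)) powr \<beta>) \<partial>\<eta> (e 0)) =
        ?c * (\<integral>\<^sup>+y. ennreal (?w (e 0) y * log_plus (real (fst y)) powr \<beta>) \<partial>\<eta> (e 0))"
    proof (rule nn_integral_cmult)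
      show "(\<lambda>y. ennreal (?w (e 0) y * log_plus (real (fst y)) powr \<beta>)) \<in> borel_measurable (\<eta> (e 0))"
        unfolding cong log_plus_def by measurable
    qed
  qed
  also have "\<dots> = ?c * (\<integral>\<^sup>+e. (\<integral>\<^sup>+y. ennreal (?w (e 0) y * log_plus (real (fst y)) powr \<beta>) \<partial>\<eta> (e 0)) \<partial>Q)"
  proof (rule nn_integral_cmult)
    from measurable_compose[OF measurable_coordinate measurable_log_moment]
    show "(\<lambda>e. \<integral>\<^sup>+y. ennreal (?w (e 0) y * log_plus (real (fst y)) powr \<beta>) \<partial>\<eta> (e 0)) \<in> borel_measurable Q" .
  qed
  also have "\<dots> < \<infinity>" using moment ennreal_less_top unfolding infinity_ennreal_def ennreal_mult_less_top by blast
  finally show ?thesis .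
qed

lemma nn_integral_tail_mean: "(\<integral>\<^sup>+e. tail_mean \<tau> (e k) \<partial>Q) = (\<integral>\<^sup>+e. tail_mean \<tau> (e 0) \<partial>Q)"
  using nn_integral_shift_funpow[of "\<lambda>e. tail_mean \<tau> (e 0)" k] by (simp add: shift_seq_funpow)

lemma tail_mean_eq:
  assumes "quenched_env_var (\<lambda>n. \<eta> (e n))"
  shows "tail_mean \<tau> (e n) = ennreal (quenched_env.large_mean (\<lambda>n. \<eta> (e n)) \<tau> n)"
proof -
  interpret E: quenched_env_var "\<lambda>n. \<eta> (e n)" by (rule assms)
  have "tail_mean \<tau> (e n) = (\<integral>\<^sup>+y. ennreal (E.large \<tau> n y) \<partial>\<eta> (e n))"
    unfolding tail_mean_def E.large_def E.L.mean_def ..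
  also have "\<dots> = ennreal (E.large_mean \<tau> n)"
    unfolding E.large_mean_def by (rule nn_integral_eq_integral[OF E.integrable_large]) (simp add: E.large_nonneg)
  finally show ?thesis .
qed

lemma large_mean_summable_AE:
  "AE e in Q. summable (\<lambda>j. real (Suc j) powr (\<beta> - 1) * quenched_env.large_mean (\<lambda>n. \<eta> (e n)) (exp (rate * real j)) j)"
proof -
  have "AE e in Q. (\<Sum>j. ennreal (real (Suc j) powr (\<beta> - 1)) * tail_mean (exp (rate * real j)) (e j)) < \<infinity>"
  proof (rule AE_suminf_finite)
    have "(\<integral>\<^sup>+e. ennreal (real (Suc j) powr (\<beta> - 1)) * tail_mean (exp (rate * real j)) (e j) \<partial>Q) =
        ennreal (real (Suc j) powr (\<beta> - 1)) * (\<integral>\<^sup>+e. tail_mean (exp (rate * real j)) (e 0) \<partial>Q)" for j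
      unfolding nn_integral_tail_mean[symmetric, of _ j] by (rule nn_integral_cmult) measurable
    then show "(\<Sum>j. \<integral>\<^sup>+e. ennreal (real (Suc j) powr (\<beta> - 1)) * tail_mean (exp (rate * real j)) (e j) \<partial>Q) < \<infinity>"
      using tail_mean_sum by simp
  qed measurable
  with quenched_env_var_AE show ?thesis
  proof eventually_elim
    case (elim e)
    interpret E: quenched_env_var "\<lambda>n. \<eta> (e n)" by (rule elim)
    let ?a = "\<lambda>j. real (Suc j) powr (\<beta> - 1) * E.large_mean (exp (rate * real j)) j"
    have "(\<Sum>j. ennreal (?a j)) < \<infinity>"
      using elim(2) unfolding tail_mean_eq[OF elim(1)] by (simp only: ennreal_mult[OF powr_ge_zero E.large_mean_nonneg])
    then show ?case
      by (intro summable_suminf_not_top) (auto simp: less_top E.large_mean_nonneg)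
  qed
qed

text \<open>Both series at generation \<open>k\<close> are the functions \<open>\<rho> B\<close> and
  \<open>s B\<close> of the environment shifted by \<open>k\<close>. It is therefore enough that
  \<open>\<rho> B\<close> is small and \<open>s B\<close> bounded with positive probability;
  recurrence under the shift does the rest. The offset \<open>B\<close> raises the truncation level
  from the start, which makes the tails small at the price of a larger but finite
  \<open>s B\<close>.\<close>

lemma good_times_AE:
  "AE e in Q. \<forall>\<epsilon>>0. \<exists>B C. 0 \<le> C \<and> infinite {k.
      (\<Sum>i. ennreal (quenched_env.large_mean (\<lambda>n. \<eta> (e n)) (exp (rate * (real i + B))) (k + i))) \<le> ennreal \<epsilon> \<and>
      (\<Sum>i. ennreal (sqrt (exp (rate * (real i + B)) * quenched_env.pop_mean (\<lambda>n. \<eta> (e n)) k /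
        quenched_env.pop_mean (\<lambda>n. \<eta> (e n)) (Suc (k + i))))) \<le> ennreal C}"
proof -
  let ?m = "\<lambda>e i. enn2real (mean_offspring (\<eta> (e i)))"
  define \<rho> where "\<rho> B e = (\<Sum>i. tail_mean (exp (rate * (real i + real B))) (e i))" for B :: nat and e :: "nat \<Rightarrow> 'e"
  define s where "s B e = (\<Sum>i. ennreal (sqrt (exp (rate * (real i + real B)) / (\<Prod>l<Suc i. ?m e l))))" for B :: nat and e :: "nat \<Rightarrow> 'e"
  have [measurable]: "\<rho> B \<in> borel_measurable Q" "s B \<in> borel_measurable Q" for B
    unfolding \<rho>_def s_def by measurable
  have s_fin: "AE e in Q. s B e < \<infinity>" for B
    using growth_AE
  proof eventually_elim
    case (elim e)
    then obtain C where C: "0 < C" "\<And>n. C * exp (2 * rate * real n) \<le> (\<Prod>i<n. ?m e i)" by blast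
    have le: "sqrt (exp (rate * (real i + real B)) / (\<Prod>l<Suc i. ?m e l)) \<le> sqrt (exp (rate * real B) / C) * exp (- (rate / 2) * real i)" for i
    proof (rule real_le_lsqrt)
      have "C * exp (2 * rate * real i) \<le> C * exp (2 * rate * real (Suc i))" using C rate_pos by simp
      also have "\<dots> \<le> (\<Prod>l<Suc i. ?m e l)" by (rule C)
      finally have P: "C * exp (2 * rate * real i) \<le> (\<Prod>l<Suc i. ?m e l)" .
      note P0 = less_le_trans[OF mult_pos_pos[OF C(1) exp_gt_zero] P]
      have "exp (rate * (real i + real B)) / (\<Prod>l<Suc i. ?m e l) \<le> exp (rate * (real i + real B)) / (C * exp (2 * rate * real i))"
        using P P0 C(1) by (intro divide_left_mono) auto
      also have "\<dots> = (sqrt (exp (rate * real B) / C) * exp (- (rate / 2) * real i))\<^sup>2"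
      proof -
        have "exp (rate * (real i + real B)) / exp (2 * rate * real i) = exp (rate * real B) * (exp (- (rate / 2) * real i))\<^sup>2"
          unfolding exp_diff[symmetric] power2_eq_square exp_add[symmetric] by (rule arg_cong[where f = exp]) (simp add: algebra_simps)
        moreover have "(sqrt (exp (rate * real B) / C))\<^sup>2 = exp (rate * real B) / C" using C(1) by simp
        moreover have "exp (rate * (real i + real B)) / (C * exp (2 * rate * real i)) = exp (rate * (real i + real B)) / exp (2 * rate * real i) / C"
          by simp
        ultimately show ?thesis by (simp only: power_mult_distrib times_divide_eq_left)
      qed
      finally show "exp (rate * (real i + real B)) / (\<Prod>l<Suc i. ?m e l) \<le> (sqrt (exp (rate * real B) / C) * exp (- (rate / 2) * real i))\<^sup>2" .
    qed (use C in auto)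
    have "summable (\<lambda>i. exp (- (rate / 2)) ^ i)" using rate_pos by (intro summable_geometric) simp
    then have sm: "summable (\<lambda>i. sqrt (exp (rate * real B) / C) * exp (- (rate / 2) * real i))"
      by (intro summable_mult) (simp add: exp_of_nat_mult[symmetric] mult.commute)
    have "s B e \<le> (\<Sum>i. ennreal (sqrt (exp (rate * real B) / C) * exp (- (rate / 2) * real i)))"
      unfolding s_def by (intro suminf_le ennreal_leI le) auto
    also have "\<dots> < \<infinity>" using C(1) by (intro suminf_ennreal_finite sm) auto
    finally show ?case .
  qed
  define a where "a j = (\<integral>\<^sup>+e. tail_mean (exp (rate * real j)) (e 0) \<partial>Q)" for j :: nat
  have a_sum: "(\<Sum>j. a j) < \<infinity>"
  proof -
    have "(\<Sum>j. a j) \<le> (\<Sum>j. ennreal (real (Suc j) powr (\<beta> - 1)) * a j)"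
    proof (intro suminf_le)
      fix j :: nat
      have "1 \<le> real (Suc j) powr (\<beta> - 1)" using \<beta> by (intro ge_one_powr_ge_zero) auto
      then have "ennreal 1 \<le> ennreal (real (Suc j) powr (\<beta> - 1))" by (rule ennreal_leI)
      from mult_right_mono[OF this, of "a j"] show "a j \<le> ennreal (real (Suc j) powr (\<beta> - 1)) * a j" by simp
    qed auto
    also have "\<dots> < \<infinity>" unfolding a_def by (rule tail_mean_sum)
    finally show ?thesis .
  qed
  have a_tail: "\<exists>B. (\<Sum>i. a (i + B)) < ennreal \<epsilon>" if "0 < \<epsilon>" for \<epsilon>
  proof -
    have fin: "a j < \<infinity>" for j using a_sum ennreal_suminf_lessD[of a \<infinity> j] by simp
    define a' where "a' j = enn2real (a j)" for j
    have aa: "a j = ennreal (a' j)" "0 \<le> a' j" for j using fin[of j] by (auto simp: a'_def)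
    have sm: "summable a'"
      using a_sum aa by (intro summable_suminf_not_top) (auto simp: less_top)
    from suminf_exist_split[OF that sm] obtain B where B: "\<And>n. B \<le> n \<Longrightarrow> norm (\<Sum>i. a' (i + n)) < \<epsilon>" by blast
    have "(\<Sum>i. a (i + B)) = ennreal (\<Sum>i. a' (i + B))"
      unfolding aa(1) using sm aa(2) by (intro suminf_ennreal2) (auto simp: summable_iff_shift)
    also have "\<dots> < ennreal \<epsilon>"
      using B[of B] aa(2) that by (intro ennreal_lessI) auto
    finally show ?thesis by blast
  qed
  \<comment> \<open>First \<open>B\<close> is chosen to push the mean of \<open>\<rho> B\<close>
    below \<open>\<epsilon>\<close>, then \<open>C\<close>. If every \<open>C\<close> failed,
    finiteness of \<open>s B\<close> would force \<open>\<rho> B\<close> to be at least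
    \<open>\<epsilon>\<close> almost surely, against that mean.\<close>
  have ex: "\<exists>B C. 0 < prob {e\<in>space Q. \<rho> B e \<le> ennreal \<epsilon> \<and> s B e \<le> ennreal (real C)}" if \<epsilon>: "0 < \<epsilon>" for \<epsilon>
  proof -
    obtain B where B: "(\<Sum>i. a (i + B)) < ennreal \<epsilon>" using a_tail[OF \<epsilon>] by blast
    have E\<rho>: "(\<integral>\<^sup>+e. \<rho> B e \<partial>Q) < ennreal \<epsilon>"
    proof -
      have meas_tail: "(\<lambda>e. tail_mean (exp (rate * (real i + real B))) (e i)) \<in> borel_measurable Q" for i
        by measurable
      have "(\<integral>\<^sup>+e. \<rho> B e \<partial>Q) = (\<Sum>i. a (i + B))"
        unfolding \<rho>_def a_def of_nat_add
        by (subst nn_integral_suminf[OF meas_tail]) (rule suminf_cong, rule nn_integral_tail_mean)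
      then show ?thesis using B by simp
    qed
    have "\<exists>C. 0 < prob {e\<in>space Q. \<rho> B e \<le> ennreal \<epsilon> \<and> s B e \<le> ennreal (real C)}"
    proof (rule ccontr)
      assume "\<not> ?thesis"
      then have "prob {e\<in>space Q. \<rho> B e \<le> ennreal \<epsilon> \<and> s B e \<le> ennreal (real C)} \<le> 0" for C
        by (meson not_less)
      then have null: "prob {e\<in>space Q. \<rho> B e \<le> ennreal \<epsilon> \<and> s B e \<le> ennreal (real C)} = 0" for C
        by (intro antisym measure_nonneg)
      have "AE e in Q. \<not> (\<rho> B e \<le> ennreal \<epsilon> \<and> s B e \<le> ennreal (real C))" for C
      proof -
        have "{e\<in>space Q. \<rho> B e \<le> ennreal \<epsilon> \<and> s B e \<le> ennreal (real C)} \<in> sets Q" by measurable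
        from prob_eq_0[OF this] null[of C] have "AE e in Q. e \<notin> {e\<in>space Q. \<rho> B e \<le> ennreal \<epsilon> \<and> s B e \<le> ennreal (real C)}" by blast
        with AE_space show ?thesis by eventually_elim blast
      qed
      then have "AE e in Q. \<forall>C. \<not> (\<rho> B e \<le> ennreal \<epsilon> \<and> s B e \<le> ennreal (real C))"
        by (subst AE_all_countable) simp
      with s_fin[of B] have "AE e in Q. ennreal \<epsilon> \<le> \<rho> B e"
      proof eventually_elim
        case (elim e)
        obtain r where r: "s B e = ennreal r" "0 \<le> r" using elim(1) by (cases "s B e") auto
        obtain C :: nat where "r \<le> real C" using real_arch_simple by blast
        then have "s B e \<le> ennreal (real C)" unfolding r by (rule ennreal_leI)
        with elim(2) show ?case by (meson linear)
      qed
      then have "(\<integral>\<^sup>+e. ennreal \<epsilon> \<partial>Q) \<le> (\<integral>\<^sup>+e. \<rho> B e \<partial>Q)" by (rule nn_integral_mono_AE)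
      then show False using E\<rho> by (simp add: emeasure_space_1)
    qed
    then show ?thesis by blast
  qed
  \<comment> \<open>Tolerances \<open>1 / real (Suc p)\<close> leave countably many events, so a
    single null set of environments serves all \<open>\<epsilon>\<close>.\<close>
  have "\<forall>p::nat. \<exists>B C. 0 < prob {e\<in>space Q. \<rho> B e \<le> ennreal (1 / real (Suc p)) \<and> s B e \<le> ennreal (real C)}"
    by (intro allI ex) simp
  from choice[OF this] obtain B where "\<forall>p. \<exists>C. 0 < prob {e\<in>space Q. \<rho> (B p) e \<le> ennreal (1 / real (Suc p)) \<and> s (B p) e \<le> ennreal (real (C))}" by blast
  from choice[OF this] obtain C where BC: "\<And>p. 0 < prob {e\<in>space Q. \<rho> (B p) e \<le> ennreal (1 / real (Suc p)) \<and> s (B p) e \<le> ennreal (real (C p))}" by blast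
  have "AE e in Q. \<forall>p. infinite {k. (shift_seq ^^ k) e \<in> {e\<in>space Q. \<rho> (B p) e \<le> ennreal (1 / real (Suc p)) \<and> s (B p) e \<le> ennreal (real (C p))}}"
    unfolding AE_all_countable by (intro allI AE_infinitely_often BC) measurable
  with quenched_env_var_AE show ?thesis
  proof eventually_elim
    case (elim e)
    interpret E: quenched_env_var "\<lambda>n. \<eta> (e n)" by (rule elim)
    show ?case
    proof (intro allI impI)
      fix \<epsilon> :: real assume "0 < \<epsilon>"
      then obtain p where p: "1 / real (Suc p) < \<epsilon>" using nat_approx_posE by blast
      let ?S = "{k. (shift_seq ^^ k) e \<in> {e\<in>space Q. \<rho> (B p) e \<le> ennreal (1 / real (Suc p)) \<and> s (B p) e \<le> ennreal (real (C p))}}"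
      let ?T = "{k. (\<Sum>i. ennreal (E.large_mean (exp (rate * (real i + real (B p)))) (k + i))) \<le> ennreal \<epsilon> \<and>
        (\<Sum>i. ennreal (sqrt (exp (rate * (real i + real (B p))) * E.pop_mean k / E.pop_mean (Suc (k + i))))) \<le> ennreal (real (C p))}"
      have "?S \<subseteq> ?T"
      proof
        fix k assume "k \<in> ?S"
        then have k: "\<rho> (B p) (\<lambda>n. e (n + k)) \<le> ennreal (1 / real (Suc p))" "s (B p) (\<lambda>n. e (n + k)) \<le> ennreal (real (C p))"
          by (auto simp: shift_seq_funpow)
        have "\<rho> (B p) (\<lambda>n. e (n + k)) = (\<Sum>i. ennreal (E.large_mean (exp (rate * (real i + real (B p)))) (k + i)))"
          unfolding \<rho>_def tail_mean_eq[OF elim(1)] by (simp only: add.commute)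
        moreover have "ennreal (1 / real (Suc p)) \<le> ennreal \<epsilon>" using p by (intro ennreal_leI) simp
        moreover have "s (B p) (\<lambda>n. e (n + k)) = (\<Sum>i. ennreal (sqrt (exp (rate * (real i + real (B p))) * E.pop_mean k / E.pop_mean (Suc (k + i)))))"
        proof -
          have "E.pop_mean (Suc (k + i)) = E.pop_mean k * (\<Prod>l<Suc i. ?m (\<lambda>n. e (n + k)) l)" for i
          proof (induction i)
            case (Suc i)
            then show ?case by (simp add: E.pop_mean_Suc[of "Suc (i + k)"] E.L.mean_def add.commute mult.assoc)
          qed (simp add: E.pop_mean_Suc E.L.mean_def)
          then have "exp (rate * (real i + real (B p))) * E.pop_mean k / E.pop_mean (Suc (k + i)) =
              exp (rate * (real i + real (B p))) / (\<Prod>l<Suc i. ?m (\<lambda>n. e (n + k)) l)" for i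
            using E.pop_mean_gt_0[of k] by simp
          then show ?thesis unfolding s_def by simp
        qed
        ultimately show "k \<in> ?T" using k by (auto intro: order_trans)
      qed
      moreover have "infinite ?S" using elim(2) by blast
      ultimately have "infinite ?T" using infinite_super by blast
      then show "\<exists>B C. 0 \<le> C \<and> infinite {k.
          (\<Sum>i. ennreal (E.large_mean (exp (rate * (real i + B))) (k + i))) \<le> ennreal \<epsilon> \<and>
          (\<Sum>i. ennreal (sqrt (exp (rate * (real i + B)) * E.pop_mean k / E.pop_mean (Suc (k + i))))) \<le> ennreal C}"
        by (intro exI[of _ "real (B p)"] exI[of _ "real (C p)"]) simp
    qed
  qed
qed

end


section \<open>Truncated variances and decay sets\<close>

context quenched_env_var begin

definition tail_var :: "real \<Rightarrow> nat \<Rightarrow> real" where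
  "tail_var A n = (\<integral>x. (x - displacement_mean (\<Lambda> n))\<^sup>2 *
     indicator {x. A < \<bar>x - displacement_mean (\<Lambda> n)\<bar>} x \<partial>displacement_law (\<Lambda> n))"

lemma borel_measurable_displacement_law:
  "borel_measurable (displacement_law (\<Lambda> n)) = borel_measurable (borel :: real measure)"
  by (rule measurable_cong_sets[OF sets_displacement_law refl])

lemma tail_var_integrable:
  "integrable (displacement_law (\<Lambda> n)) (\<lambda>x. (x - displacement_mean (\<Lambda> n))\<^sup>2 *
     indicator {x. A < \<bar>x - displacement_mean (\<Lambda> n)\<bar>} x)"
proof (rule Bochner_Integration.integrable_bound[OF displacement_square_integrable[of n]])
  show "(\<lambda>x. (x - displacement_mean (\<Lambda> n))\<^sup>2 * indicator {x. A < \<bar>x - displacement_mean (\<Lambda> n)\<bar>} x)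
      \<in> borel_measurable (displacement_law (\<Lambda> n))"
    unfolding borel_measurable_displacement_law by measurable
qed (auto simp: indicator_def)

lemma ennreal_tail_var:
  "(\<integral>\<^sup>+x. ennreal ((x - displacement_mean (\<Lambda> n))\<^sup>2 *
     indicator {x. A < \<bar>x - displacement_mean (\<Lambda> n)\<bar>} x) \<partial>displacement_law (\<Lambda> n)) = ennreal (tail_var A n)"
  unfolding tail_var_def by (rule nn_integral_eq_integral[OF tail_var_integrable]) (auto simp: indicator_def)

lemma tail_var_nonneg: "0 \<le> tail_var A n"
  unfolding tail_var_def by (rule integral_nonneg_AE) (auto simp: indicator_def)

lemma var_eq: "var n = (\<integral>x. (x - displacement_mean (\<Lambda> n))\<^sup>2 \<partial>displacement_law (\<Lambda> n))"
proof -
  have "ennreal (var n) = ennreal (\<integral>x. (x - displacement_mean (\<Lambda> n))\<^sup>2 \<partial>displacement_law (\<Lambda> n))"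
    unfolding ennreal_var displacement_variance_def
    by (rule nn_integral_eq_integral[OF displacement_square_integrable]) auto
  then show ?thesis
    by (subst (asm) ennreal_inj) (auto intro!: integral_nonneg_AE var_nonneg)
qed

lemma tail_var_le: "tail_var A n \<le> var n"
  unfolding tail_var_def var_eq
  by (intro integral_mono tail_var_integrable displacement_square_integrable) (auto simp: indicator_def)

lemma var_le_tail_var: assumes "0 \<le> A" shows "var n \<le> A\<^sup>2 + tail_var A n"
proof -
  interpret D: real_distribution "displacement_law (\<Lambda> n)" by (rule L.real_distribution_displacement_law)
  have "var n \<le> (\<integral>x. A\<^sup>2 + (x - displacement_mean (\<Lambda> n))\<^sup>2 *
      indicator {x. A < \<bar>x - displacement_mean (\<Lambda> n)\<bar>} x \<partial>displacement_law (\<Lambda> n))"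
    unfolding var_eq
  proof (rule integral_mono)
    fix x
    have "(x - displacement_mean (\<Lambda> n))\<^sup>2 \<le> A\<^sup>2" if "\<bar>x - displacement_mean (\<Lambda> n)\<bar> \<le> A"
      using that assms power_mono[OF that, of 2] by simp
    then show "(x - displacement_mean (\<Lambda> n))\<^sup>2 \<le> A\<^sup>2 + (x - displacement_mean (\<Lambda> n))\<^sup>2 *
        indicator {x. A < \<bar>x - displacement_mean (\<Lambda> n)\<bar>} x"
      by (cases "A < \<bar>x - displacement_mean (\<Lambda> n)\<bar>") (simp_all add: not_less)
  qed (use displacement_square_integrable tail_var_integrable in \<open>simp_all\<close>)
  also have "\<dots> = A\<^sup>2 + tail_var A n"
    unfolding tail_var_def using tail_var_integrable[of n A] D.prob_space
    by (subst Bochner_Integration.integral_add) simp_all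
  finally show ?thesis .
qed

lemma tail_var_tendsto: "(\<lambda>A::nat. tail_var (real A) n) \<longlonglongrightarrow> 0"
proof -
  let ?f = "\<lambda>(A::nat) x. (x - displacement_mean (\<Lambda> n))\<^sup>2 * indicator {x. real A < \<bar>x - displacement_mean (\<Lambda> n)\<bar>} x"
  have "(\<lambda>A. \<integral>x. ?f A x \<partial>displacement_law (\<Lambda> n)) \<longlonglongrightarrow> (\<integral>x. 0 \<partial>displacement_law (\<Lambda> n))"
  proof (rule integral_dominated_convergence)
    show "?f A \<in> borel_measurable (displacement_law (\<Lambda> n))" for A
      using tail_var_integrable[of n "real A"] by (rule borel_measurable_integrable)
    show "integrable (displacement_law (\<Lambda> n)) (\<lambda>x. (x - displacement_mean (\<Lambda> n))\<^sup>2)"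
      by (rule displacement_square_integrable)
    show "AE x in displacement_law (\<Lambda> n). norm (?f A x) \<le> (x - displacement_mean (\<Lambda> n))\<^sup>2" for A
      by (auto simp: indicator_def)
    show "AE x in displacement_law (\<Lambda> n). (\<lambda>A. ?f A x) \<longlonglongrightarrow> 0"
    proof (rule AE_I2)
      fix x :: real
      obtain B :: nat where B: "\<bar>x - displacement_mean (\<Lambda> n)\<bar> \<le> real B" using real_arch_simple by blast
      have "?f A x = 0" if "B \<le> A" for A
      proof -
        have "\<not> real A < \<bar>x - displacement_mean (\<Lambda> n)\<bar>" using B that by linarith
        then show ?thesis by simp
      qed
      then show "(\<lambda>A. ?f A x) \<longlonglongrightarrow> 0"
        by (intro tendsto_eventually) (auto simp: eventually_sequentially)
    qed
  qed simp
  then show ?thesis by (simp add: tail_var_def)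
qed

text \<open>Continuity of the characteristic function extends the bound from rational arguments.
  Approximating \<open>t\<close> from the right may leave the interval up to \<open>K\<close>, hence
  the margin 1, which is also the reason for \<open>Suc K\<close> in
  \<open>decay_set\<close>.\<close>

lemma cmod_char_le_of_rat:
  assumes rat: "\<And>r::rat. \<bar>of_rat r\<bar> \<le> K + 1 \<Longrightarrow> cmod (\<phi> n (of_rat r)) \<le> 1 - (of_rat r)\<^sup>2 / d" and t: "\<bar>t\<bar> \<le> K"
  shows "cmod (\<phi> n t) \<le> 1 - t\<^sup>2 / d"
proof -
  interpret D: real_distribution "displacement_law (\<Lambda> n)" by (rule L.real_distribution_displacement_law)
  have "\<forall>k::nat. \<exists>r::rat. t < of_rat r \<and> of_rat r < t + 1 / real (Suc k)"
    by (intro allI of_rat_dense) simp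
  from choice[OF this] obtain r :: "nat \<Rightarrow> rat" where r: "\<And>k. t < of_rat (r k)" "\<And>k. of_rat (r k) < t + 1 / real (Suc k)"
    by blast
  have lim: "(\<lambda>k. of_rat (r k)) \<longlonglongrightarrow> t"
  proof (rule tendsto_sandwich[OF _ _ tendsto_const])
    show "(\<lambda>k. t + 1 / real (Suc k)) \<longlonglongrightarrow> t"
      using tendsto_add[OF tendsto_const lim_1_over_n[THEN LIMSEQ_Suc], of t] by simp
    show "\<forall>\<^sub>F k in sequentially. t \<le> of_rat (r k)" using r(1) by (intro always_eventually allI less_imp_le)
    show "\<forall>\<^sub>F k in sequentially. of_rat (r k) \<le> t + 1 / real (Suc k)" using r(2) by (intro always_eventually allI less_imp_le)
  qed
  have "\<bar>of_rat (r k)\<bar> \<le> K + 1" for k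
  proof -
    have "1 / real (Suc k) \<le> 1" by simp
    then show ?thesis using r[of k] t by linarith
  qed
  then have le: "cmod (\<phi> n (of_rat (r k))) \<le> 1 - (of_rat (r k))\<^sup>2 / d" for k by (rule rat)
  have "(\<lambda>k. \<phi> n (of_rat (r k))) \<longlonglongrightarrow> \<phi> n t"
    using D.isCont_char lim by (rule isCont_tendsto_compose)
  from tendsto_norm[OF this] have "(\<lambda>k. cmod (\<phi> n (of_rat (r k)))) \<longlonglongrightarrow> cmod (\<phi> n t)" .
  moreover have "(\<lambda>k. 1 - (of_rat (r k))\<^sup>2 / d) \<longlonglongrightarrow> 1 - t\<^sup>2 / d"
    unfolding divide_inverse by (intro tendsto_intros lim)
  ultimately show ?thesis using le by (intro LIMSEQ_le) auto
qed

end

context offspring_kernel begin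

lemma char_kernel_eq:
  assumes "quenched_env_var (\<lambda>n. \<eta> (e n))"
  shows "char_kernel t (e n) = char (displacement_law (\<eta> (e n))) t"
proof -
  interpret E: quenched_env_var "\<lambda>n. \<eta> (e n)" by (rule assms)
  show ?thesis unfolding char_kernel_def E.L.char_displacement_law E.L.mean_def ..
qed

lemma tail_variance_eq:
  assumes "quenched_env_var (\<lambda>n. \<eta> (e n))"
  shows "enn2real (tail_variance A (e n)) = quenched_env_var.tail_var (\<lambda>n. \<eta> (e n)) A n"
proof -
  interpret E: quenched_env_var "\<lambda>n. \<eta> (e n)" by (rule assms)
  show ?thesis unfolding tail_variance_def E.ennreal_tail_var using E.tail_var_nonneg by simp
qed

lemma in_decay_set:
  assumes \<theta>: "\<theta> \<in> space \<Theta>" and m: "0 < mean_offspring (\<eta> \<theta>)" "mean_offspring (\<eta> \<theta>) < \<infinity>"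
    and v: "displacement_variance (\<eta> \<theta>) < \<infinity>" and nl: "non_lattice (displacement_law (\<eta> \<theta>))"
  shows "\<exists>m. \<theta> \<in> decay_set K m"
proof -
  \<comment> \<open>A constant environment makes the results on sequences of laws available for a
    single law.\<close>
  have E: "quenched_env_var (\<lambda>n::nat. \<eta> \<theta>)"
    by (intro quenched_env_var.intro quenched_env.intro quenched_tree.intro quenched_env_axioms.intro
      quenched_env_var_axioms.intro prob_space_kernel sets_kernel_offspring m v \<theta>)
  interpret E: quenched_env_var "\<lambda>n::nat. \<eta> \<theta>" by (rule E)
  have int: "integrable (displacement_law (\<eta> \<theta>)) (\<lambda>x. x)"
    "integrable (displacement_law (\<eta> \<theta>)) (\<lambda>x. (x - (\<integral>x. x \<partial>displacement_law (\<eta> \<theta>)))\<^sup>2)"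
    using E.displacement_integrable E.displacement_square_integrable unfolding displacement_mean_def by auto
  obtain \<kappa> where \<kappa>: "0 < \<kappa>" "\<And>t. \<bar>t\<bar> \<le> real (Suc K) \<Longrightarrow> cmod (char (displacement_law (\<eta> \<theta>)) t) \<le> 1 - \<kappa> * t\<^sup>2"
    using char_decay_constant[OF E.L.real_distribution_displacement_law nl _ int, of "real (Suc K)"] by auto
  obtain m where m: "1 / real (Suc m) < \<kappa>" using nat_approx_posE[OF \<kappa>(1)] by blast
  have "cmod (char (displacement_law (\<eta> \<theta>)) t) \<le> 1 - t\<^sup>2 / real (Suc m)" if "\<bar>t\<bar> \<le> real (Suc K)" for t
  proof -
    have "1 / real (Suc m) * t\<^sup>2 \<le> \<kappa> * t\<^sup>2" using m by (intro mult_right_mono) auto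
    then show ?thesis using \<kappa>(2)[OF that] by (simp add: divide_inverse mult.commute)
  qed
  then have "\<theta> \<in> decay_set K m"
    unfolding decay_set_def using \<theta> char_kernel_eq[of "\<lambda>_. \<theta>", OF E] by auto
  then show ?thesis ..
qed

end

section \<open>Conditions of the central limit theorem along the environment\<close>

context ergodic_environment begin

lemma variance_integrable: "integrable Q (\<lambda>e. enn2real (displacement_variance (\<eta> (e 0))))"
  and integral_variance_pos: "0 < (\<integral>e. enn2real (displacement_variance (\<eta> (e 0))) \<partial>Q)"
proof -
  have meas: "(\<lambda>e. enn2real (displacement_variance (\<eta> (e 0)))) \<in> borel_measurable Q" by measurable
  have eq: "(\<integral>\<^sup>+e. ennreal (enn2real (displacement_variance (\<eta> (e 0)))) \<partial>Q) = (\<integral>\<^sup>+e. displacement_variance (\<eta> (e 0)) \<partial>Q)"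
    by (rule nn_integral_cong_AE) (use var_finite_AE in eventually_elim, simp)
  show "integrable Q (\<lambda>e. enn2real (displacement_variance (\<eta> (e 0))))"
    using var_fin by (intro integrableI_nonneg meas) (simp_all add: eq)
  show "0 < (\<integral>e. enn2real (displacement_variance (\<eta> (e 0))) \<partial>Q)"
    using var_fin var_pos by (subst integral_eq_nn_integral[OF meas]) (simp_all add: eq enn2real_positive_iff)
qed

lemma variance_bounds_AE:
  "AE e in Q. (\<exists>c>0. \<forall>\<^sub>F n in sequentially. c * real n \<le> (\<Sum>i<n. enn2real (displacement_variance (\<eta> (e i))))) \<and>
     (\<exists>C. \<forall>n. (\<Sum>i<n. enn2real (displacement_variance (\<eta> (e i)))) \<le> C * real (Suc n))"
proof -
  let ?V = "\<integral>e. enn2real (displacement_variance (\<eta> (e 0))) \<partial>Q"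
  have V: "0 < ?V" by (rule integral_variance_pos)
  have "?V / 2 < ?V" "?V < ?V + 1" using V by simp_all
  from birkhoff_coordinate(2)[OF variance_integrable this(1)] birkhoff_coordinate(1)[OF variance_integrable this(2)]
  show ?thesis
  proof eventually_elim
    case (elim e)
    let ?S = "\<lambda>n. \<Sum>i<n. enn2real (displacement_variance (\<eta> (e i)))"
    obtain C where C: "\<And>n. ?V / 2 * real n - C \<le> ?S n" using elim(1) by blast
    obtain D where D: "\<And>n. ?S n \<le> D + (?V + 1) * real n" using elim(2) by blast
    have "\<forall>\<^sub>F n in sequentially. C / (?V / 4) \<le> real n"
      by (rule eventually_compose_filterlim[OF eventually_ge_at_top filterlim_real_sequentially])
    then have "\<forall>\<^sub>F n in sequentially. ?V / 4 * real n \<le> ?S n"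
    proof eventually_elim
      case (elim n)
      then have "C \<le> ?V / 4 * real n" using V by (simp add: field_simps)
      then show ?case using C[of n] by linarith
    qed
    moreover have "?S n \<le> (\<bar>D\<bar> + (?V + 1)) * real (Suc n)" for n
    proof -
      have "D \<le> \<bar>D\<bar> * real (Suc n)" using mult_left_mono[of 1 "real (Suc n)" "\<bar>D\<bar>"] by simp
      moreover have "(?V + 1) * real n \<le> (?V + 1) * real (Suc n)" using V by (intro mult_left_mono) auto
      ultimately show ?thesis using D[of n] unfolding distrib_right by linarith
    qed
    moreover have "0 < ?V / 4" using V by simp
    ultimately show ?case by blast
  qed
qed

text \<open>The mean truncated variance \<open>T A\<close> tends to 0 by dominated convergence. The
  Birkhoff bound holds for all natural \<open>A\<close> at once, with slope
  \<open>T A + 1 / real (Suc A)\<close>, where the second summand provides the required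
  strictness.\<close>

lemma lindeberg_AE:
  "AE e in Q. \<forall>\<epsilon>>0. \<exists>A\<ge>0. \<forall>\<^sub>F n in sequentially. (\<Sum>j<n. enn2real (tail_variance A (e j))) \<le> \<epsilon> * real n"
proof -
  define T where "T A = (\<integral>e. enn2real (tail_variance (real A) (e 0)) \<partial>Q)" for A :: nat
  have meas: "(\<lambda>e. enn2real (tail_variance (real A) (e 0))) \<in> borel_measurable Q" for A by measurable
  have le: "AE e in Q. norm (enn2real (tail_variance (real A) (e 0))) \<le> enn2real (displacement_variance (\<eta> (e 0)))" for A
    using quenched_env_var_AE
  proof eventually_elim
    case (elim e)
    interpret E: quenched_env_var "\<lambda>n. \<eta> (e n)" by (rule elim)
    show ?case unfolding tail_variance_eq[OF elim] using E.tail_var_le[of _ 0] E.tail_var_nonneg by (simp add: E.var_def)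
  qed
  have int: "integrable Q (\<lambda>e. enn2real (tail_variance (real A) (e 0)))" for A
  proof (rule Bochner_Integration.integrable_bound[OF variance_integrable meas])
    show "AE e in Q. norm (enn2real (tail_variance (real A) (e 0))) \<le> norm (enn2real (displacement_variance (\<eta> (e 0))))"
      using le[of A] by simp
  qed
  have "T \<longlonglongrightarrow> (\<integral>e. 0 \<partial>Q)"
    unfolding T_def
  proof (rule integral_dominated_convergence[OF _ meas variance_integrable _ le])
    show "AE e in Q. (\<lambda>A. enn2real (tail_variance (real A) (e 0))) \<longlonglongrightarrow> 0"
      using quenched_env_var_AE
    proof eventually_elim
      case (elim e)
      interpret E: quenched_env_var "\<lambda>n. \<eta> (e n)" by (rule elim)
      show ?case unfolding tail_variance_eq[OF elim] by (rule E.tail_var_tendsto)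
    qed
  qed simp
  then have T0: "T \<longlonglongrightarrow> 0" by simp
  have "AE e in Q. \<forall>A. \<exists>C. \<forall>n. (\<Sum>k<n. enn2real (tail_variance (real A) (e k))) \<le> C + (T A + 1 / real (Suc A)) * real n"
    unfolding AE_all_countable
    by (intro allI birkhoff_coordinate(1)[OF int]) (simp add: T_def)
  then show ?thesis
  proof eventually_elim
    case (elim e)
    show ?case
    proof (intro allI impI)
      fix \<epsilon> :: real assume \<epsilon>: "0 < \<epsilon>"
      have "(\<lambda>A. T A + 1 / real (Suc A)) \<longlonglongrightarrow> 0 + 0"
        by (intro tendsto_add T0 lim_1_over_n[THEN LIMSEQ_Suc])
      then have "\<forall>\<^sub>F A in sequentially. T A + 1 / real (Suc A) < \<epsilon> / 2"
        by (rule order_tendstoD(2)) (use \<epsilon> in simp)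
      then obtain A where A: "T A + 1 / real (Suc A) < \<epsilon> / 2" using eventually_happens' sequentially_bot by blast
      obtain C where C: "\<And>n. (\<Sum>k<n. enn2real (tail_variance (real A) (e k))) \<le> C + (T A + 1 / real (Suc A)) * real n"
        using elim by blast
      have "\<forall>\<^sub>F n in sequentially. C / (\<epsilon> / 2) \<le> real n" by real_asymp
      then have "\<forall>\<^sub>F n in sequentially. (\<Sum>k<n. enn2real (tail_variance (real A) (e k))) \<le> \<epsilon> * real n"
      proof eventually_elim
        case (elim n)
        have "C \<le> \<epsilon> / 2 * real n" using elim \<epsilon> by (simp add: field_simps)
        moreover have "(T A + 1 / real (Suc A)) * real n \<le> \<epsilon> / 2 * real n" using A by (intro mult_right_mono) auto
        ultimately show ?case using C[of n] by linarith
      qed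
      then show "\<exists>A\<ge>0. \<forall>\<^sub>F n in sequentially. (\<Sum>j<n. enn2real (tail_variance A (e j))) \<le> \<epsilon> * real n"
        by (intro exI[of _ "real A"]) simp
    qed
  qed
qed

text \<open>The decay sets for all \<open>m\<close> cover almost every environment, so one of them
  has positive probability and is visited with positive frequency. Each visit contributes a factor
  \<open>exp (- t\<^sup>2 / real (Suc m))\<close>. The visits between \<open>k\<close> and
  \<open>n\<close> are counted by a difference of two Birkhoff sums, which makes the bound uniform
  in \<open>k\<close>.\<close>

lemma decay_AE:
  "AE e in Q. \<exists>c>0. \<forall>\<^sub>F n in sequentially. \<forall>k t. 3 * k \<le> 2 * n \<longrightarrow> \<bar>t\<bar> \<le> real K \<longrightarrow>
      (\<Prod>i\<in>{k..<n}. cmod (char (displacement_law (\<eta> (e i))) t)) \<le> exp (- c * real n * t\<^sup>2)"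
proof -
  obtain m where m: "0 < prob {e\<in>space Q. e 0 \<in> decay_set K m}"
  proof (rule ccontr)
    assume "\<not> thesis"
    with that have "\<not> 0 < prob {e\<in>space Q. e 0 \<in> decay_set K m}" for m by blast
    then have "prob {e\<in>space Q. e 0 \<in> decay_set K m} \<le> 0" for m by (simp only: not_less)
    then have null: "prob {e\<in>space Q. e 0 \<in> decay_set K m} = 0" for m by (intro antisym measure_nonneg)
    have "AE e in Q. e 0 \<notin> decay_set K m" for m
    proof -
      have "{e\<in>space Q. e 0 \<in> decay_set K m} \<in> sets Q" by measurable
      from prob_eq_0[OF this] null[of m] have "AE e in Q. e \<notin> {e\<in>space Q. e 0 \<in> decay_set K m}" by blast
      with AE_space show ?thesis by eventually_elim blast
    qed
    then have "AE e in Q. \<forall>m. e 0 \<notin> decay_set K m" unfolding AE_all_countable by blast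
    with decay[of K] have "AE e in Q. False" by eventually_elim blast
    then show False by simp
  qed
  define \<kappa> where "\<kappa> \<theta> = indicator (decay_set K m) \<theta> / real (Suc m)" for \<theta>
  have int: "integrable Q (\<lambda>e. \<kappa> (e 0))"
  proof (rule integrable_const_bound[where B = 1])
    show "AE e in Q. norm (\<kappa> (e 0)) \<le> 1" by (rule AE_I2) (simp add: \<kappa>_def indicator_def)
    show "(\<lambda>e. \<kappa> (e 0)) \<in> borel_measurable Q" unfolding \<kappa>_def by measurable
  qed
  define c where "c = (\<integral>e. \<kappa> (e 0) \<partial>Q)"
  have c: "0 < c"
  proof -
    have "c = (\<integral>e. indicator {e\<in>space Q. e 0 \<in> decay_set K m} e / real (Suc m) \<partial>Q)"
      unfolding c_def \<kappa>_def by (intro Bochner_Integration.integral_cong) (auto simp: indicator_def)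
    also have "\<dots> = prob {e\<in>space Q. e 0 \<in> decay_set K m} / real (Suc m)" by simp
    finally show ?thesis using m by simp
  qed
  \<comment> \<open>With \<open>k\<close> at most \<open>2 / 3\<close> of \<open>n\<close>, these
    slopes leave \<open>19 / 20 - 21 / 20 * (2 / 3) = 1 / 4\<close> of \<open>c * real n\<close>.
    Half of it absorbs the two additive constants, and the other half is the decay rate
    \<open>c / 8\<close>.\<close>
  have "19 / 20 * c < (\<integral>e. \<kappa> (e 0) \<partial>Q)" "(\<integral>e. \<kappa> (e 0) \<partial>Q) < 21 / 20 * c"
    using c by (simp_all add: c_def[symmetric])
  from birkhoff_coordinate(2)[OF int this(1)] birkhoff_coordinate(1)[OF int this(2)] quenched_env_var_AE
  show ?thesis
  proof eventually_elim
    case (elim e)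
    interpret E: quenched_env_var "\<lambda>n. \<eta> (e n)" by (rule elim)
    obtain C where C: "\<And>n. 19 / 20 * c * real n - C \<le> (\<Sum>k<n. \<kappa> (e k))" using elim(1) by blast
    obtain D where D: "\<And>n. (\<Sum>k<n. \<kappa> (e k)) \<le> D + 21 / 20 * c * real n" using elim(2) by blast
    have char_le: "cmod (char (displacement_law (\<eta> (e i))) t) \<le> exp (- \<kappa> (e i) * t\<^sup>2)" if t: "\<bar>t\<bar> \<le> real K" for i t
    proof (cases "e i \<in> decay_set K m")
      case True
      have "cmod (char (displacement_law (\<eta> (e i))) t) \<le> 1 - t\<^sup>2 / real (Suc m)"
      proof (rule E.cmod_char_le_of_rat[OF _ t])
        fix r :: rat assume "\<bar>of_rat r\<bar> \<le> real K + 1"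
        then show "cmod (char (displacement_law (\<eta> (e i))) (of_rat r)) \<le> 1 - (of_rat r)\<^sup>2 / real (Suc m)"
          using True char_kernel_eq[OF elim(3)] unfolding decay_set_def by (auto simp: add.commute)
      qed
      also have "\<dots> \<le> exp (- (t\<^sup>2 / real (Suc m)))" using exp_ge_add_one_self[of "- (t\<^sup>2 / real (Suc m))"] by simp
      finally show ?thesis using True by (simp add: \<kappa>_def)
    next
      case False
      interpret D: real_distribution "displacement_law (\<eta> (e i))" by (rule E.L.real_distribution_displacement_law)
      show ?thesis using False D.cmod_char_le_1 by (simp add: \<kappa>_def)
    qed
    have "\<forall>\<^sub>F n in sequentially. (C + D) / (c / 8) \<le> real n" by real_asymp
    then have "\<forall>\<^sub>F n in sequentially. \<forall>k t. 3 * k \<le> 2 * n \<longrightarrow> \<bar>t\<bar> \<le> real K \<longrightarrow>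
      (\<Prod>i\<in>{k..<n}. cmod (char (displacement_law (\<eta> (e i))) t)) \<le> exp (- (c / 8) * real n * t\<^sup>2)"
    proof eventually_elim
      case (elim n)
      then have CD: "C + D \<le> c / 8 * real n" using c by (simp add: field_simps)
      show ?case
      proof (intro allI impI)
        fix k :: nat and t :: real assume k: "3 * k \<le> 2 * n" and t: "\<bar>t\<bar> \<le> real K"
        have "(\<Sum>i<k. \<kappa> (e i)) + (\<Sum>i\<in>{k..<n}. \<kappa> (e i)) = (\<Sum>i<n. \<kappa> (e i))"
          using k by (subst sum.union_disjoint[symmetric]) (auto intro!: sum.cong)
        moreover have "21 / 20 * c * real k \<le> 21 / 20 * c * (2 / 3 * real n)"
          using k c by (intro mult_left_mono) auto
        moreover have "19 / 20 * c * real n - 21 / 20 * c * (2 / 3 * real n) = c / 8 * real n + c / 8 * real n"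
          by (simp add: field_simps)
        ultimately have sum: "c / 8 * real n \<le> (\<Sum>i\<in>{k..<n}. \<kappa> (e i))"
          using C[of n] D[of k] CD by linarith
        have "(\<Prod>i\<in>{k..<n}. cmod (char (displacement_law (\<eta> (e i))) t)) \<le> (\<Prod>i\<in>{k..<n}. exp (- \<kappa> (e i) * t\<^sup>2))"
          by (intro prod_mono conjI char_le t) simp
        also have "\<dots> = exp (\<Sum>i\<in>{k..<n}. - \<kappa> (e i) * t\<^sup>2)" by (rule exp_sum[symmetric]) simp
        also have "(\<Sum>i\<in>{k..<n}. - \<kappa> (e i) * t\<^sup>2) = - ((\<Sum>i\<in>{k..<n}. \<kappa> (e i)) * t\<^sup>2)"
          by (simp add: sum_negf sum_distrib_right)
        also have "\<dots> \<le> - (c / 8) * real n * t\<^sup>2"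
          using mult_right_mono[OF sum, of "t\<^sup>2"] by simp
        finally show "(\<Prod>i\<in>{k..<n}. cmod (char (displacement_law (\<eta> (e i))) t)) \<le> exp (- (c / 8) * real n * t\<^sup>2)" by simp
      qed
    qed
    then show ?case using c by (intro exI[of _ "c / 8"]) simp
  qed
qed

lemma clt_environment_AE:
  "AE e in Q. \<exists>C. clt_environment (\<lambda>n. char (displacement_law (\<eta> (e n)))) (\<lambda>n. displacement_mean (\<eta> (e n)))
     (\<lambda>n. enn2real (displacement_variance (\<eta> (e n)))) (\<lambda>A n. enn2real (tail_variance A (e n))) C"
proof -
  have "AE e in Q. \<forall>K. \<exists>c>0. \<forall>\<^sub>F n in sequentially. \<forall>k t. 3 * k \<le> 2 * n \<longrightarrow> \<bar>t\<bar> \<le> real K \<longrightarrow>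
      (\<Prod>i\<in>{k..<n}. cmod (char (displacement_law (\<eta> (e i))) t)) \<le> exp (- c * real n * t\<^sup>2)"
    unfolding AE_all_countable by (intro allI decay_AE)
  from quenched_env_var_AE variance_bounds_AE lindeberg_AE this show ?thesis
  proof eventually_elim
    case (elim e)
    interpret E: quenched_env_var "\<lambda>n. \<eta> (e n)" by (rule elim)
    obtain C where C: "\<And>n. (\<Sum>i<n. enn2real (displacement_variance (\<eta> (e i)))) \<le> C * real (Suc n)"
      using elim(2) by blast
    have "clt_environment (\<lambda>n. char (displacement_law (\<eta> (e n)))) (\<lambda>n. displacement_mean (\<eta> (e n)))
     (\<lambda>n. enn2real (displacement_variance (\<eta> (e n)))) (\<lambda>A n. enn2real (tail_variance A (e n))) C"
    proof (rule clt_environment.intro)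
      fix j :: nat and t :: real
      interpret D: real_distribution "displacement_law (\<eta> (e j))" by (rule E.L.real_distribution_displacement_law)
      show "cmod (char (displacement_law (\<eta> (e j))) t) \<le> 1" by (rule D.cmod_char_le_1)
      show "char (displacement_law (\<eta> (e j))) \<in> borel_measurable borel" by (rule D.char_measurable)
    next
      fix A :: real and j :: nat and t assume A: "0 \<le> A"
      show "cmod (char (displacement_law (\<eta> (e j))) t * iexp (- t * displacement_mean (\<eta> (e j))) -
          of_real (1 - enn2real (displacement_variance (\<eta> (e j))) * t\<^sup>2 / 2)) \<le>
        t\<^sup>2 * enn2real (tail_variance A (e j)) + \<bar>t\<bar> ^ 3 * A * enn2real (displacement_variance (\<eta> (e j)))"
        using char_approx_truncated[OF E.L.real_distribution_displacement_law E.displacement_integrable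
          E.displacement_square_integrable displacement_mean_def[symmetric] A, of j t]
        unfolding tail_variance_eq[OF elim(1)] E.var_def[symmetric] E.var_eq E.tail_var_def .
    next
      fix A :: real and j :: nat assume A: "0 \<le> A"
      show "enn2real (displacement_variance (\<eta> (e j))) \<le> A\<^sup>2 + enn2real (tail_variance A (e j))"
        using E.var_le_tail_var[OF A] unfolding tail_variance_eq[OF elim(1)] E.var_def .
    next
      fix K :: real
      obtain K' :: nat where K': "K \<le> real K'" using real_arch_simple by blast
      obtain c where c: "0 < c" "\<forall>\<^sub>F n in sequentially. \<forall>k t. 3 * k \<le> 2 * n \<longrightarrow> \<bar>t\<bar> \<le> real K' \<longrightarrow>
          (\<Prod>i\<in>{k..<n}. cmod (char (displacement_law (\<eta> (e i))) t)) \<le> exp (- c * real n * t\<^sup>2)"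
        using elim(4) by blast
      from c(2) have "\<forall>\<^sub>F n in sequentially. \<forall>k t. 3 * k \<le> 2 * n \<longrightarrow> \<bar>t\<bar> \<le> K \<longrightarrow>
          (\<Prod>i\<in>{k..<n}. cmod (char (displacement_law (\<eta> (e i))) t)) \<le> exp (- c * real n * t\<^sup>2)"
        by eventually_elim (use K' in \<open>auto dest: order_trans\<close>)
      with c(1) show "\<exists>c>0. \<forall>\<^sub>F n in sequentially. \<forall>k t. 3 * k \<le> 2 * n \<longrightarrow> \<bar>t\<bar> \<le> K \<longrightarrow>
          (\<Prod>i\<in>{k..<n}. cmod (char (displacement_law (\<eta> (e i))) t)) \<le> exp (- c * real n * t\<^sup>2)" by blast
    qed (use elim(2,3) C in simp_all)
    then show ?case ..
  qed
qed

end


section \<open>Fourier convergence in almost every environment\<close>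

text \<open>The passage from the quenched to the annealed law is made for this quantity rather than
  for the supremum over \<open>x\<close>: as an integral it is readily measurable jointly in
  environment and tree.\<close>

definition fourier_error ::
    "('e \<Rightarrow> offspring measure) \<Rightarrow> real \<Rightarrow> nat \<Rightarrow> (nat \<Rightarrow> 'e) \<Rightarrow> (nat list \<Rightarrow> offspring) \<Rightarrow> ennreal" where
  "fourier_error \<eta> K n e x = ennreal (scaling \<eta> e n) * (\<integral>\<^sup>+t. ennreal (cmod (
     (\<Sum>u\<in>particles x n. iexp (t * position x u)) / of_nat (card (particles x n)) -
     iexp (t * centering \<eta> e n) * of_real (exp (- (scaling \<eta> e n)\<^sup>2 * t\<^sup>2 / 2)))) * indicator {-K..K} t \<partial>lborel)"

context ergodic_environment begin

lemma scaling_at_top_AE: "AE e in Q. filterlim (scaling \<eta> e) at_top sequentially"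
  using clt_environment_AE
proof eventually_elim
  case (elim e)
  then obtain C where "clt_environment (\<lambda>n. char (displacement_law (\<eta> (e n)))) (\<lambda>n. displacement_mean (\<eta> (e n)))
     (\<lambda>n. enn2real (displacement_variance (\<eta> (e n)))) (\<lambda>A n. enn2real (tail_variance A (e n))) C" by blast
  then interpret F: clt_environment "\<lambda>n. char (displacement_law (\<eta> (e n)))" "\<lambda>n. displacement_mean (\<eta> (e n))"
     "\<lambda>n. enn2real (displacement_variance (\<eta> (e n)))" "\<lambda>A n. enn2real (tail_variance A (e n))" C .
  have "scaling \<eta> e = F.b" unfolding F.b_def F.v_def scaling_def by (rule ext) simp
  then show ?case using F.b_at_top by simp
qed

text \<open>All almost sure bounds for the tree are collected on one event; on it
  \<open>fourier_martingale\<close> applies to the single tree \<open>x\<close>, and the rest is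
  deterministic.\<close>

lemma fourier_error_quenched:
  assumes env: "quenched_env_var (\<lambda>n. \<eta> (e n))"
    and clt: "clt_environment (\<lambda>n. char (displacement_law (\<eta> (e n)))) (\<lambda>n. displacement_mean (\<eta> (e n)))
     (\<lambda>n. enn2real (displacement_variance (\<eta> (e n)))) (\<lambda>A n. enn2real (tail_variance A (e n))) C"
    and growth: "0 < G" "\<And>n. G * exp (2 * rate * real n) \<le> (\<Prod>i<n. enn2real (mean_offspring (\<eta> (e i))))"
    and large: "summable (\<lambda>j. real (Suc j) powr (\<beta> - 1) * quenched_env.large_mean (\<lambda>n. \<eta> (e n)) (exp (rate * real j)) j)"
    and good: "\<And>\<epsilon>. 0 < \<epsilon> \<Longrightarrow> \<exists>B C. 0 \<le> C \<and> infinite {k.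
      (\<Sum>i. ennreal (quenched_env.large_mean (\<lambda>n. \<eta> (e n)) (exp (rate * (real i + B))) (k + i))) \<le> ennreal \<epsilon> \<and>
      (\<Sum>i. ennreal (sqrt (exp (rate * (real i + B)) * quenched_env.pop_mean (\<lambda>n. \<eta> (e n)) k /
        quenched_env.pop_mean (\<lambda>n. \<eta> (e n)) (Suc (k + i))))) \<le> ennreal C}"
  shows "AE x in quenched_law \<eta> e. filterlim (\<lambda>n. card (particles x n)) at_top sequentially \<longrightarrow>
    (\<forall>K::nat. (\<lambda>n. fourier_error \<eta> (real K) n e x) \<longlonglongrightarrow> 0)"
proof -
  interpret E: quenched_env_var "\<lambda>n. \<eta> (e n)" by (rule env)
  interpret F: clt_environment "\<lambda>n. char (displacement_law (\<eta> (e n)))" "\<lambda>n. displacement_mean (\<eta> (e n))"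
     "\<lambda>n. enn2real (displacement_variance (\<eta> (e n)))" "\<lambda>A n. enn2real (tail_variance A (e n))" C by (rule clt)
  have law: "quenched_law \<eta> e = E.tree_law" by (simp add: quenched_law_def E.tree_law_def)
  have growth': "G * exp (2 * rate * real n) \<le> E.pop_mean n" for n
    using growth(2) by (simp add: E.pop_mean_def E.L.mean_def)
  have large1: "summable (\<lambda>j. E.large_mean (exp (rate * real j)) j)"
  proof (rule summable_comparison_test'[OF large])
    fix j :: nat
    have "1 \<le> real (Suc j) powr (\<beta> - 1)" using \<beta> by (intro ge_one_powr_ge_zero) auto
    from mult_right_mono[OF this E.large_mean_nonneg]
    show "norm (E.large_mean (exp (rate * real j)) j) \<le> real (Suc j) powr (\<beta> - 1) * E.large_mean (exp (rate * real j)) j"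
      using E.large_mean_nonneg by simp
  qed
  have "(\<Sum>i<n. E.var i) \<le> C * real (Suc n)" for n
    using F.var_upper[of n] by (simp add: E.var_def)
  note spread = E.AE_spread_bound[OF this]
  have R: "AE x in E.tree_law. summable (\<lambda>j. real (Suc j) powr (\<beta> - 1) * E.R (exp (rate * real j)) j x)"
    by (rule E.AE_weighted_R_summable[OF large]) simp
  have M: "AE x in E.tree_law. \<forall>K::nat. (\<Sum>j. ennreal (exp (rate / 4 * real j)) *
    (\<integral>\<^sup>+t. ennreal (cmod (E.Mtr (exp (rate * real j)) j t x)) * indicator {-real K..real K} t \<partial>lborel)) < \<infinity>"
    unfolding AE_all_countable by (intro allI E.AE_Mtr_integral_finite[OF rate_pos growth(1) growth'])
  have below: "AE x in E.tree_law. filterlim (\<lambda>n. card (particles x n)) at_top sequentially \<longrightarrow>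
    (\<exists>c>0. \<forall>\<^sub>F n in sequentially. c \<le> E.W n x)"
    using good by (rule E.AE_W_bounded_below)
  from E.AE_W_convergent[OF rate_pos growth(1) growth' large1] below spread R M
  show ?thesis
    unfolding law
  proof eventually_elim
    case (elim x)
    show ?case
    proof (intro impI allI)
      fix K :: nat
      assume top: "filterlim (\<lambda>n. card (particles x n)) at_top sequentially"
      then obtain c where c: "0 < c" "\<forall>\<^sub>F n in sequentially. c \<le> E.W n x" using elim(2) by blast
      obtain S where S: "\<And>n. E.spread n x \<le> S * real (Suc n) ^ 3" using elim(3) by blast
      have Zm: "(\<lambda>t. E.Zt n t x) \<in> borel_measurable borel" for n unfolding E.Zt_def by measurable
      \<comment> \<open>The weight exponent is \<open>\<beta> - 1\<close>, the exponential weight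
        \<open>rate / 4\<close> is the one from \<open>AE_Mtr_integral_finite\<close>, and
        \<open>max 0 S\<close> makes the spread constant nonnegative.\<close>
      interpret M: fourier_martingale "\<lambda>n. char (displacement_law (\<eta> (e n)))" "\<lambda>n. displacement_mean (\<eta> (e n))"
        "\<lambda>n. enn2real (displacement_variance (\<eta> (e n)))" "\<lambda>A n. enn2real (tail_variance A (e n))" C
        "\<lambda>n t. E.Zt n t x" "\<lambda>n. E.W n x" "\<lambda>j t. cmod (E.Mtr (exp (rate * real j)) j t x)"
        "\<lambda>j. E.R (exp (rate * real j)) j x" "\<lambda>n. E.spread n x" "\<beta> - 1" "rate / 4" "max 0 S"
      proof (intro fourier_martingale.intro clt fourier_martingale_axioms.intro)
        show "(\<lambda>t. cmod (E.Mtr (exp (rate * real j)) j t x)) \<in> borel_measurable borel" for j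
        proof -
          have "(\<lambda>t. (t, x)) \<in> borel \<rightarrow>\<^sub>M borel \<Otimes>\<^sub>M E.tree_law" by (intro measurable_Pair) simp_all
          from measurable_compose[OF this E.measurable_Mtr_joint]
          have "(\<lambda>t. E.Mtr (exp (rate * real j)) j t x) \<in> borel_measurable borel" by simp
          from measurable_compose[OF this borel_measurable_norm] show ?thesis .
        qed
        show "cmod (E.Zt (Suc n) t x - char (displacement_law (\<eta> (e n))) t * E.Zt n t x) \<le>
            cmod (E.Mtr (exp (rate * real n)) n t x) + E.R (exp (rate * real n)) n x" for n t
          by (rule E.martingale_difference_le)
        show "cmod (E.Zt n t x * iexp (- t * F.a n) - of_real (E.W n x)) \<le> \<bar>t\<bar> * E.spread n x" for n t
          using E.cmod_Zt_centered[of n t x] by (simp only: F.a_def E.drift_def)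
        show "E.spread n x \<le> max 0 S * real (Suc n) ^ 3" for n
          by (rule order_trans[OF S]) (intro mult_right_mono, auto)
        fix L :: real
        obtain K :: nat where K: "L \<le> real K" using real_arch_simple by blast
        have "(\<Sum>j. ennreal (exp (rate / 4 * real j)) *
          (\<integral>\<^sup>+t. ennreal (cmod (E.Mtr (exp (rate * real j)) j t x)) * indicator {-L..L} t \<partial>lborel)) \<le>
          (\<Sum>j. ennreal (exp (rate / 4 * real j)) *
          (\<integral>\<^sup>+t. ennreal (cmod (E.Mtr (exp (rate * real j)) j t x)) * indicator {-real K..real K} t \<partial>lborel))"
          using K by (intro suminf_le mult_left_mono nn_integral_mono) (auto simp: indicator_def)
        also have "\<dots> < \<infinity>" using elim(5) by blast
        finally show "(\<Sum>j. ennreal (exp (rate / 4 * real j)) *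
          (\<integral>\<^sup>+t. ennreal (cmod (E.Mtr (exp (rate * real j)) j t x)) * indicator {-L..L} t \<partial>lborel)) < \<infinity>" .
      qed (use elim(1,4) \<beta> rate_pos E.R_nonneg E.cmod_Zt_le Zm in simp_all)
      \<comment> \<open>\<open>Suc K\<close> keeps the frequency bound positive when
        \<open>K = 0\<close>.\<close>
      let ?FE = "\<lambda>n. ennreal (F.b n) * (\<integral>\<^sup>+t. ennreal (cmod (E.Zt n t x - of_real (E.W n x) *
        (iexp (t * F.a n) * of_real (exp (- F.v n * t\<^sup>2 / 2))))) * indicator {- real (Suc K)..real (Suc K)} t \<partial>lborel)"
      have FE: "?FE \<longlonglongrightarrow> 0" by (rule M.fourier_convergence) simp
      \<comment> \<open>On survival \<open>W\<close> is eventually at least \<open>c\<close>, so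
        normalising by the actual instead of the mean population costs a factor of at most
        \<open>1 / c\<close>.\<close>
      have le: "\<forall>\<^sub>F n in sequentially. fourier_error \<eta> (real K) n e x \<le> ennreal (1 / c) * ?FE n"
        using c(2)
      proof eventually_elim
        case (elim n)
        have b: "scaling \<eta> e n = F.b n" by (simp add: scaling_def F.b_def F.v_def)
        have a: "centering \<eta> e n = F.a n" by (simp add: centering_def F.a_def)
        have W: "0 < E.W n x" using elim c(1) by linarith
        have pm: "0 < E.pop_mean n" by (rule E.pop_mean_gt_0)
        have quot: "(\<Sum>u\<in>particles x n. iexp (t * position x u)) / of_nat (card (particles x n)) = E.Zt n t x / of_real (E.W n x)" for t
          using pm W unfolding E.Zt_def E.W_def by (simp add: field_simps)
        have pt: "cmod (E.Zt n t x / of_real (E.W n x) - g) \<le> 1 / c * cmod (E.Zt n t x - of_real (E.W n x) * g)" for t g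
        proof -
          have "E.Zt n t x / of_real (E.W n x) - g = (E.Zt n t x - of_real (E.W n x) * g) / of_real (E.W n x)"
            using W by (simp add: field_simps)
          then have "cmod (E.Zt n t x / of_real (E.W n x) - g) = cmod (E.Zt n t x - of_real (E.W n x) * g) / E.W n x"
            using W by (simp add: norm_divide)
          also have "\<dots> \<le> cmod (E.Zt n t x - of_real (E.W n x) * g) / c"
            using elim c(1) W by (intro divide_left_mono) auto
          finally show ?thesis by simp
        qed
        let ?g = "\<lambda>t. cmod (E.Zt n t x - of_real (E.W n x) * (iexp (t * F.a n) * of_real (exp (- F.v n * t\<^sup>2 / 2))))"
        have gm: "(\<lambda>t. ennreal (?g t) * indicator {- real (Suc K)..real (Suc K)} t) \<in> borel_measurable lborel"
          using Zm[of n] by measurable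
        have "fourier_error \<eta> (real K) n e x \<le> ennreal (F.b n) *
          (\<integral>\<^sup>+t. ennreal (1 / c) * (ennreal (?g t) * indicator {- real (Suc K)..real (Suc K)} t) \<partial>lborel)"
          unfolding fourier_error_def quot b a F.b_sq
        proof (intro mult_left_mono nn_integral_mono)
          fix t :: real
          have "ennreal (cmod (E.Zt n t x / of_real (E.W n x) - iexp (t * F.a n) * of_real (exp (- F.v n * t\<^sup>2 / 2))))
              \<le> ennreal (1 / c) * ennreal (?g t)"
            using c(1) pt[of t] by (subst ennreal_mult[symmetric]) (auto intro!: ennreal_leI)
          then show "ennreal (cmod (E.Zt n t x / of_real (E.W n x) - iexp (t * F.a n) * of_real (exp (- F.v n * t\<^sup>2 / 2))))
              * indicator {- real K..real K} t
              \<le> ennreal (1 / c) * (ennreal (?g t) * indicator {- real (Suc K)..real (Suc K)} t)"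
            by (auto simp: indicator_def)
        qed simp
        also have "\<dots> = ennreal (1 / c) * ?FE n"
          by (subst nn_integral_cmult[OF gm]) (simp only: mult.left_commute)
        finally show ?case .
      qed
      have "(\<lambda>n. ennreal (1 / c) * ?FE n) \<longlonglongrightarrow> ennreal (1 / c) * 0"
        by (rule ennreal_tendsto_cmult[OF _ FE]) simp
      then have lim: "(\<lambda>n. ennreal (1 / c) * ?FE n) \<longlonglongrightarrow> 0" by simp
      show "(\<lambda>n. fourier_error \<eta> (real K) n e x) \<longlonglongrightarrow> 0"
        by (rule tendsto_sandwich[OF always_eventually le tendsto_const lim]) simp
    qed
  qed
qed

theorem fourier_error_AE:
  "AE e in Q. AE x in quenched_law \<eta> e. filterlim (\<lambda>n. card (particles x n)) at_top sequentially \<longrightarrow>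
    (\<forall>K::nat. (\<lambda>n. fourier_error \<eta> (real K) n e x) \<longlonglongrightarrow> 0)"
  using quenched_env_var_AE clt_environment_AE growth_AE large_mean_summable_AE good_times_AE
proof eventually_elim
  case (elim e)
  obtain C where C: "clt_environment (\<lambda>n. char (displacement_law (\<eta> (e n)))) (\<lambda>n. displacement_mean (\<eta> (e n)))
     (\<lambda>n. enn2real (displacement_variance (\<eta> (e n)))) (\<lambda>A n. enn2real (tail_variance A (e n))) C" using elim(2) by blast
  obtain G where G: "0 < G" "\<And>n. G * exp (2 * rate * real n) \<le> (\<Prod>i<n. enn2real (mean_offspring (\<eta> (e i))))"
    using elim(3) by blast
  show ?case by (rule fourier_error_quenched[OF elim(1) C G elim(4)]) (use elim(5) in blast)
qed

end


section \<open>The annealed law\<close>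

lemma nn_integral_distr':
  "T \<in> M \<rightarrow>\<^sub>M N \<Longrightarrow> f \<in> borel_measurable N \<Longrightarrow> (\<integral>\<^sup>+y. f y \<partial>distr M N T) = (\<integral>\<^sup>+x. f (T x) \<partial>M)"
  by (simp add: nn_integral_distr)

lemma measurable_coordinate_compose: "f \<in> \<Theta> \<rightarrow>\<^sub>M N \<Longrightarrow> (\<lambda>e. f (e k)) \<in> seq_space \<Theta> \<rightarrow>\<^sub>M N"
  using measurable_compose[OF measurable_component_singleton[of k UNIV "\<lambda>_. \<Theta>"]] by simp

context offspring_kernel begin

lemma sets_quenched_law: "e \<in> space (seq_space \<Theta>) \<Longrightarrow> sets (quenched_law \<eta> e) = sets marked_tree_space"
  unfolding quenched_law_def
  by (intro sets_PiM_cong refl sets_kernel_offspring) (simp add: space_PiM PiE_iff)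

text \<open>Measurability in the environment needs checking on cylinder sets only, where the product
  law is a finite product of values of the kernel.\<close>

lemma measurable_quenched_law: "quenched_law \<eta> \<in> seq_space \<Theta> \<rightarrow>\<^sub>M prob_algebra marked_tree_space"
proof (rule measurable_prob_algebra_generated[OF sets_PiM Int_stable_prod_algebra prod_algebra_sets_into_space])
  fix e assume e: "e \<in> space (seq_space \<Theta>)"
  then have e': "e n \<in> space \<Theta>" for n by (simp add: space_PiM PiE_iff)
  show "prob_space (quenched_law \<eta> e)"
    unfolding quenched_law_def by (intro prob_space_PiM prob_space_kernel e')
  show "sets (quenched_law \<eta> e) = sets marked_tree_space" using e by (rule sets_quenched_law)
next
  fix A :: "(nat list \<Rightarrow> offspring) set"
  assume "A \<in> prod_algebra UNIV (\<lambda>_. offspring_space)"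
  then obtain J E where A: "A = prod_emb UNIV (\<lambda>_. offspring_space) J (\<Pi>\<^sub>E j\<in>J. E j)" and J: "finite J"
    and E: "\<And>i. i \<in> J \<Longrightarrow> E i \<in> sets offspring_space"
    by (rule prod_algebraE) blast
  have eq: "emeasure (quenched_law \<eta> e) A = (\<Prod>u\<in>J. emeasure (\<eta> (e (length u))) (E u))"
    if e: "e \<in> space (seq_space \<Theta>)" for e
  proof -
    have e': "e n \<in> space \<Theta>" for n using e by (simp add: space_PiM PiE_iff)
    have sp: "space (\<eta> (e n)) = space offspring_space" for n
      by (rule sets_eq_imp_space_eq[OF sets_kernel_offspring[OF e']])
    have A': "A = prod_emb UNIV (\<lambda>u. \<eta> (e (length u))) J (\<Pi>\<^sub>E j\<in>J. E j)"
      unfolding A prod_emb_def sp ..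
    show ?thesis
      unfolding quenched_law_def A'
      by (rule emeasure_PiM_emb) (use J E e' in \<open>simp_all add: prob_space_kernel sets_kernel_offspring\<close>)
  qed
  have "(\<lambda>e. \<Prod>u\<in>J. emeasure (\<eta> (e (length u))) (E u)) \<in> borel_measurable (seq_space \<Theta>)"
  proof (rule borel_measurable_prod_ennreal)
    fix u assume "u \<in> J"
    have "(\<lambda>e. \<eta> (e (length u))) \<in> seq_space \<Theta> \<rightarrow>\<^sub>M subprob_algebra offspring_space"
      by (rule measurable_coordinate_compose[OF kernel_subprob])
    from measurable_compose[OF this measurable_emeasure_subprob_algebra[OF E[OF \<open>u \<in> J\<close>]]]
    show "(\<lambda>e. emeasure (\<eta> (e (length u))) (E u)) \<in> borel_measurable (seq_space \<Theta>)" .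
  qed
  then show "(\<lambda>e. emeasure (quenched_law \<eta> e) A) \<in> borel_measurable (seq_space \<Theta>)"
    by (subst measurable_cong[OF eq])
qed

lemma measurable_quenched_law_subprob: "quenched_law \<eta> \<in> seq_space \<Theta> \<rightarrow>\<^sub>M subprob_algebra marked_tree_space"
  by (rule measurable_prob_algebraD[OF measurable_quenched_law])

lemma measurable_centering: "(\<lambda>e. centering \<eta> e n) \<in> borel_measurable (seq_space \<Theta>)"
  unfolding centering_def
  by (intro borel_measurable_sum measurable_coordinate_compose measurable_displacement_mean)

lemma measurable_scaling: "(\<lambda>e. scaling \<eta> e n) \<in> borel_measurable (seq_space \<Theta>)"
proof -
  have "(\<lambda>e. displacement_variance (\<eta> (e i))) \<in> borel_measurable (seq_space \<Theta>)" for i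
    by (intro measurable_coordinate_compose measurable_displacement_variance)
  note this [measurable]
  show ?thesis unfolding scaling_def by measurable
qed

lemma measurable_fourier_error:
  "(\<lambda>p. fourier_error \<eta> K n (fst p) (snd p)) \<in> borel_measurable (seq_space \<Theta> \<Otimes>\<^sub>M marked_tree_space)"
proof -
  let ?S = "seq_space \<Theta> \<Otimes>\<^sub>M marked_tree_space"
  note measurable_compose[OF measurable_fst measurable_centering, measurable]
    and measurable_compose[OF measurable_fst measurable_scaling, measurable]
  have tree [measurable]: "(\<lambda>q. snd (fst q)) \<in> ?S \<Otimes>\<^sub>M lborel \<rightarrow>\<^sub>M marked_tree_space"
    by (rule measurable_compose[OF measurable_fst measurable_snd])
  have pos [measurable]: "(\<lambda>q. position (snd (fst q)) u) \<in> borel_measurable (?S \<Otimes>\<^sub>M lborel)" for u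
    by (rule measurable_position[OF tree])
  have t [measurable]: "(\<lambda>q. snd q :: real) \<in> borel_measurable (?S \<Otimes>\<^sub>M lborel)"
    using measurable_snd[of ?S "lborel :: real measure"] by simp
  have cen [measurable]: "(\<lambda>q. centering \<eta> (fst (fst q)) n) \<in> borel_measurable (?S \<Otimes>\<^sub>M lborel)"
    "(\<lambda>q. scaling \<eta> (fst (fst q)) n) \<in> borel_measurable (?S \<Otimes>\<^sub>M lborel)"
    by (rule measurable_compose[OF measurable_fst measurable_compose[OF measurable_fst measurable_centering]]
        measurable_compose[OF measurable_fst measurable_compose[OF measurable_fst measurable_scaling]])+
  have sum [measurable]: "(\<lambda>q. \<Sum>u\<in>particles (snd (fst q)) n. iexp (snd q * position (snd (fst q)) u)) \<in> borel_measurable (?S \<Otimes>\<^sub>M lborel)"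
    by (rule measurable_sum_particles[OF tree]) measurable
  have card [measurable]: "(\<lambda>q. of_nat (card (particles (snd (fst q)) n)) :: complex) \<in> borel_measurable (?S \<Otimes>\<^sub>M lborel)"
    by (rule measurable_compose[OF measurable_card_particles[OF tree]]) simp
  have "(\<lambda>q. ennreal (cmod (
     (\<Sum>u\<in>particles (snd (fst q)) n. iexp (snd q * position (snd (fst q)) u)) / of_nat (card (particles (snd (fst q)) n)) -
     iexp (snd q * centering \<eta> (fst (fst q)) n) * of_real (exp (- (scaling \<eta> (fst (fst q)) n)\<^sup>2 * (snd q)\<^sup>2 / 2)))) *
     indicator {-K..K} (snd q)) \<in> borel_measurable (?S \<Otimes>\<^sub>M lborel)"
    by measurable
  then have [measurable]: "(\<lambda>p. \<integral>\<^sup>+t. ennreal (cmod (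
     (\<Sum>u\<in>particles (snd p) n. iexp (t * position (snd p) u)) / of_nat (card (particles (snd p) n)) -
     iexp (t * centering \<eta> (fst p) n) * of_real (exp (- (scaling \<eta> (fst p) n)\<^sup>2 * t\<^sup>2 / 2)))) * indicator {-K..K} t \<partial>lborel)
     \<in> borel_measurable ?S"
    by (intro lborel.borel_measurable_nn_integral) (unfold split_beta', assumption)
  have [measurable]: "(\<lambda>p. scaling \<eta> (fst p) n) \<in> borel_measurable ?S"
    by (rule measurable_compose[OF measurable_fst measurable_scaling])
  show ?thesis unfolding fourier_error_def by measurable
qed

lemma pred_fourier_convergence:
  "Measurable.pred (seq_space \<Theta> \<Otimes>\<^sub>M marked_tree_space) (\<lambda>p.
     filterlim (\<lambda>n. card (particles (snd p) n)) at_top sequentially \<longrightarrow>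
     (\<forall>K::nat. (\<lambda>n. fourier_error \<eta> (real K) n (fst p) (snd p)) \<longlonglongrightarrow> 0))"
proof -
  let ?S = "seq_space \<Theta> \<Otimes>\<^sub>M marked_tree_space"
  have top: "filterlim (\<lambda>n. card (particles x n)) at_top sequentially \<longleftrightarrow> (\<forall>Z. \<exists>m. \<forall>n. m \<le> n \<longrightarrow> Z \<le> card (particles x n))" for x
    by (simp add: filterlim_at_top eventually_sequentially)
  \<comment> \<open>A sequence in \<open>ennreal\<close> tends to 0 exactly when its limsup
    vanishes, which is visibly a measurable condition.\<close>
  have lim: "f \<longlonglongrightarrow> 0 \<longleftrightarrow> limsup f = 0" for f :: "nat \<Rightarrow> ennreal"
    using Liminf_le_Limsup[OF sequentially_bot, of f] by (auto simp: tendsto_iff_Liminf_eq_Limsup)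
  have [measurable]: "(\<lambda>p. card (particles (snd p) n)) \<in> ?S \<rightarrow>\<^sub>M count_space UNIV" for n
    by (rule measurable_card_particles[OF measurable_snd])
  note measurable_fourier_error [measurable]
  show ?thesis unfolding top lim by measurable
qed

end

section \<open>Disintegration of the joint law of environment and tree\<close>

context branching_random_walk_random_environment begin

sublocale offspring_kernel \<Theta> \<eta>
  by (rule offspring_kernel.intro[OF kernel])

abbreviation environment :: "'w \<Rightarrow> nat \<Rightarrow> 'e" where
  "environment \<omega> \<equiv> \<lambda>n. \<xi> n \<omega>"

abbreviation tree :: "'w \<Rightarrow> nat list \<Rightarrow> offspring" where
  "tree \<omega> \<equiv> \<lambda>u. X u \<omega>"

definition Q :: "(nat \<Rightarrow> 'e) measure" where
  "Q = distr M (seq_space \<Theta>) environment"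

lemma measurable_environment: "environment \<in> M \<rightarrow>\<^sub>M seq_space \<Theta>"
proof (rule measurable_PiM_single')
  show "environment \<in> space M \<rightarrow> (\<Pi>\<^sub>E i\<in>UNIV. space \<Theta>)"
    using measurable_space[OF random_variable_environment] by auto
qed (rule random_variable_environment)

lemma measurable_tree: "tree \<in> M \<rightarrow>\<^sub>M marked_tree_space"
proof (rule measurable_PiM_single')
  show "tree \<in> space M \<rightarrow> (\<Pi>\<^sub>E i\<in>UNIV. space offspring_space)"
    using measurable_space[OF random_variable_offspring] by auto
qed (rule random_variable_offspring)

lemma measurable_environment_tree:
  "(\<lambda>\<omega>. (environment \<omega>, tree \<omega>)) \<in> M \<rightarrow>\<^sub>M seq_space \<Theta> \<Otimes>\<^sub>M marked_tree_space"
  by (intro measurable_Pair measurable_environment measurable_tree)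

definition joint_kernel :: "(nat \<Rightarrow> 'e) \<Rightarrow> ((nat \<Rightarrow> 'e) \<times> (nat list \<Rightarrow> offspring)) measure" where
  "joint_kernel e = distr (quenched_law \<eta> e) (seq_space \<Theta> \<Otimes>\<^sub>M marked_tree_space) (Pair e)"

lemma measurable_joint_kernel: "joint_kernel \<in> Q \<rightarrow>\<^sub>M subprob_algebra (seq_space \<Theta> \<Otimes>\<^sub>M marked_tree_space)"
proof -
  have "(\<lambda>e. distr (quenched_law \<eta> e) (seq_space \<Theta> \<Otimes>\<^sub>M marked_tree_space) (Pair e))
      \<in> seq_space \<Theta> \<rightarrow>\<^sub>M subprob_algebra (seq_space \<Theta> \<Otimes>\<^sub>M marked_tree_space)"
    by (rule measurable_distr2[OF _ measurable_quenched_law_subprob]) simp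
  then show ?thesis unfolding joint_kernel_def Q_def by simp
qed

lemma space_Q: "space Q = space (seq_space \<Theta>)"
  by (simp add: Q_def)

lemma measurable_Pair_quenched:
  assumes "e \<in> space (seq_space \<Theta>)"
  shows "Pair e \<in> quenched_law \<eta> e \<rightarrow>\<^sub>M seq_space \<Theta> \<Otimes>\<^sub>M marked_tree_space"
  unfolding measurable_cong_sets[OF sets_quenched_law[OF assms] refl] using assms by (rule measurable_Pair1')

lemma emeasure_joint_kernel:
  assumes e: "e \<in> space (seq_space \<Theta>)" and A: "A \<in> sets (seq_space \<Theta>)" and B: "B \<in> sets marked_tree_space"
  shows "emeasure (joint_kernel e) (A \<times> B) = indicator A e * emeasure (quenched_law \<eta> e) B"
proof -
  have sp: "space (quenched_law \<eta> e) = space marked_tree_space"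
    by (rule sets_eq_imp_space_eq[OF sets_quenched_law[OF e]])
  have "emeasure (joint_kernel e) (A \<times> B) = emeasure (quenched_law \<eta> e) (Pair e -` (A \<times> B) \<inter> space marked_tree_space)"
    unfolding joint_kernel_def using A B by (subst emeasure_distr[OF measurable_Pair_quenched[OF e]]) (simp_all add: sp)
  also have "Pair e -` (A \<times> B) \<inter> space marked_tree_space = (if e \<in> A then B else {})"
    using sets.sets_into_space[OF B] by auto
  finally show ?thesis by simp
qed

text \<open>The locale assumption \<open>annealed\<close> is the equality of both measures on
  rectangles. Rectangles are stable under intersection and generate the product sigma-algebra, so
  the equality extends to all joint events.\<close>

lemma joint_law: "distr M (seq_space \<Theta> \<Otimes>\<^sub>M marked_tree_space) (\<lambda>\<omega>. (environment \<omega>, tree \<omega>)) = Q \<bind> joint_kernel"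
proof (rule measure_eqI_generator_eq[OF Int_stable_pair_measure_generator])
  let ?G = "{a \<times> b | a b. a \<in> sets (seq_space \<Theta>) \<and> b \<in> sets marked_tree_space}"
  have ne: "space Q \<noteq> {}"
    using prob_space.not_empty[OF prob_space_distr[OF measurable_environment]] unfolding Q_def .
  show "?G \<subseteq> Pow (space (seq_space \<Theta>) \<times> space marked_tree_space)"
    by (rule pair_measure_closed)
  show "sets (distr M (seq_space \<Theta> \<Otimes>\<^sub>M marked_tree_space) (\<lambda>\<omega>. (environment \<omega>, tree \<omega>))) =
      sigma_sets (space (seq_space \<Theta>) \<times> space marked_tree_space) ?G"
    by (simp only: sets_distr sets_pair_measure)
  show "sets (Q \<bind> joint_kernel) = sigma_sets (space (seq_space \<Theta>) \<times> space marked_tree_space) ?G"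
    using sets_bind[OF sets_kernel[OF measurable_joint_kernel] ne] by (simp only: sets_pair_measure)
  show "range (\<lambda>_::nat. space (seq_space \<Theta>) \<times> space marked_tree_space) \<subseteq> ?G"
    by (rule image_subsetI, rule CollectI, rule exI[of _ "space (seq_space \<Theta>)"],
      rule exI[of _ "space marked_tree_space"], intro conjI refl sets.top)
  show "(\<Union>i::nat. space (seq_space \<Theta>) \<times> space marked_tree_space) = space (seq_space \<Theta>) \<times> space marked_tree_space" by simp
  interpret J: prob_space "distr M (seq_space \<Theta> \<Otimes>\<^sub>M marked_tree_space) (\<lambda>\<omega>. (environment \<omega>, tree \<omega>))"
    by (rule prob_space_distr[OF measurable_environment_tree])
  show "emeasure (distr M (seq_space \<Theta> \<Otimes>\<^sub>M marked_tree_space) (\<lambda>\<omega>. (environment \<omega>, tree \<omega>)))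
      (space (seq_space \<Theta>) \<times> space marked_tree_space) \<noteq> \<infinity>"
    by (simp add: J.emeasure_finite)
  fix Y assume "Y \<in> ?G"
  then obtain A B where Y: "Y = A \<times> B" and A: "A \<in> sets (seq_space \<Theta>)" and B: "B \<in> sets marked_tree_space" by blast
  have meas: "(\<lambda>e. indicator A e * emeasure (quenched_law \<eta> e) B) \<in> borel_measurable (seq_space \<Theta>)"
    by (intro borel_measurable_times_ennreal borel_measurable_indicator A
        measurable_compose[OF measurable_quenched_law_subprob measurable_emeasure_subprob_algebra[OF B]])
  have "emeasure (distr M (seq_space \<Theta> \<Otimes>\<^sub>M marked_tree_space) (\<lambda>\<omega>. (environment \<omega>, tree \<omega>))) Y =
      emeasure M {\<omega>\<in>space M. environment \<omega> \<in> A \<and> tree \<omega> \<in> B}"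
    unfolding Y using A B
    by (subst emeasure_distr[OF measurable_environment_tree]) (auto intro!: arg_cong[where f = "emeasure M"])
  also have "\<dots> = (\<integral>\<^sup>+\<omega>. indicator A (environment \<omega>) * emeasure (quenched_law \<eta> (environment \<omega>)) B \<partial>M)"
    by (rule annealed[OF A B])
  also have "\<dots> = (\<integral>\<^sup>+e. indicator A e * emeasure (quenched_law \<eta> e) B \<partial>Q)"
    unfolding Q_def by (rule nn_integral_distr'[OF measurable_environment meas, symmetric])
  also have "\<dots> = (\<integral>\<^sup>+e. emeasure (joint_kernel e) Y \<partial>Q)"
    unfolding Y by (rule nn_integral_cong) (simp only: space_Q emeasure_joint_kernel[OF _ A B])
  also have "\<dots> = emeasure (Q \<bind> joint_kernel) Y"
    unfolding Y by (rule emeasure_bind[OF ne measurable_joint_kernel, symmetric]) (intro pair_measureI A B)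
  finally show "emeasure (distr M (seq_space \<Theta> \<Otimes>\<^sub>M marked_tree_space) (\<lambda>\<omega>. (environment \<omega>, tree \<omega>))) Y =
      emeasure (Q \<bind> joint_kernel) Y" .
qed

text \<open>The bridge from quenched to annealed statements: for a measurable property of
  environment and tree, almost sure truth in almost every environment becomes almost sure truth
  under \<open>M\<close>.\<close>

lemma AE_annealed:
  assumes P: "Measurable.pred (seq_space \<Theta> \<Otimes>\<^sub>M marked_tree_space) P"
    and AE: "AE e in Q. AE x in quenched_law \<eta> e. P (e, x)"
  shows "AE \<omega> in M. P (environment \<omega>, tree \<omega>)"
proof (rule AE_distrD[OF measurable_environment_tree])
  have "AE e in Q. AE p in joint_kernel e. P p"
    using AE AE_space
  proof eventually_elim
    case (elim e)
    then have e: "e \<in> space (seq_space \<Theta>)" by (simp add: space_Q)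
    have "{p \<in> space (seq_space \<Theta> \<Otimes>\<^sub>M marked_tree_space). P p} \<in> sets (seq_space \<Theta> \<Otimes>\<^sub>M marked_tree_space)"
      using P by (simp add: pred_def)
    from AE_distr_iff[OF measurable_Pair_quenched[OF e] this] elim(1) show ?case
      unfolding joint_kernel_def by blast
  qed
  then show "AE p in distr M (seq_space \<Theta> \<Otimes>\<^sub>M marked_tree_space) (\<lambda>\<omega>. (environment \<omega>, tree \<omega>)). P p"
    unfolding joint_law AE_bind[OF measurable_joint_kernel P] .
qed

lemma nn_integral_annealed:
  assumes f: "f \<in> borel_measurable (seq_space \<Theta> \<Otimes>\<^sub>M marked_tree_space)"
  shows "(\<integral>\<^sup>+\<omega>. f (environment \<omega>, tree \<omega>) \<partial>M) = (\<integral>\<^sup>+e. \<integral>\<^sup>+x. f (e, x) \<partial>quenched_law \<eta> e \<partial>Q)"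
proof -
  have "(\<integral>\<^sup>+\<omega>. f (environment \<omega>, tree \<omega>) \<partial>M) = (\<integral>\<^sup>+p. f p \<partial>(Q \<bind> joint_kernel))"
    unfolding joint_law[symmetric] by (rule nn_integral_distr'[OF measurable_environment_tree f, symmetric])
  also have "\<dots> = (\<integral>\<^sup>+e. \<integral>\<^sup>+p. f p \<partial>joint_kernel e \<partial>Q)"
    by (rule nn_integral_bind[OF f measurable_joint_kernel])
  also have "\<dots> = (\<integral>\<^sup>+e. \<integral>\<^sup>+x. f (e, x) \<partial>quenched_law \<eta> e \<partial>Q)"
  proof (rule nn_integral_cong)
    fix e assume "e \<in> space Q"
    then have e: "e \<in> space (seq_space \<Theta>)" by (simp add: space_Q)
    show "(\<integral>\<^sup>+p. f p \<partial>joint_kernel e) = (\<integral>\<^sup>+x. f (e, x) \<partial>quenched_law \<eta> e)"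
      unfolding joint_kernel_def by (rule nn_integral_distr'[OF measurable_Pair_quenched[OF e] f])
  qed
  finally show ?thesis .
qed

lemma nn_integral_root:
  assumes f: "(\<lambda>p. f (fst p) (snd p)) \<in> borel_measurable (\<Theta> \<Otimes>\<^sub>M offspring_space)"
  shows "(\<integral>\<^sup>+\<omega>. f (\<xi> 0 \<omega>) (X [] \<omega>) \<partial>M) = (\<integral>\<^sup>+e. \<integral>\<^sup>+y. f (e 0) y \<partial>\<eta> (e 0) \<partial>Q)"
proof -
  have "(\<lambda>p. (fst p 0, snd p [])) \<in> seq_space \<Theta> \<Otimes>\<^sub>M marked_tree_space \<rightarrow>\<^sub>M \<Theta> \<Otimes>\<^sub>M offspring_space"
    by (intro measurable_Pair measurable_compose[OF measurable_fst measurable_component_singleton]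
        measurable_compose[OF measurable_snd measurable_component_singleton]) simp_all
  from nn_integral_annealed[OF measurable_compose[OF this f]]
  have "(\<integral>\<^sup>+\<omega>. f (\<xi> 0 \<omega>) (X [] \<omega>) \<partial>M) = (\<integral>\<^sup>+e. \<integral>\<^sup>+x. f (e 0) (x []) \<partial>quenched_law \<eta> e \<partial>Q)" by simp
  also have "\<dots> = (\<integral>\<^sup>+e. \<integral>\<^sup>+y. f (e 0) y \<partial>\<eta> (e 0) \<partial>Q)"
  proof (rule nn_integral_cong)
    fix e assume "e \<in> space Q"
    then have e: "e \<in> space (seq_space \<Theta>)" by (simp add: space_Q)
    then have e': "e n \<in> space \<Theta>" for n by (simp add: space_PiM PiE_iff)
    have "(\<lambda>y. (e 0, y)) \<in> offspring_space \<rightarrow>\<^sub>M \<Theta> \<Otimes>\<^sub>M offspring_space" using e' by (rule measurable_Pair1')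
    from measurable_compose[OF this f] have fm: "f (e 0) \<in> borel_measurable offspring_space" by simp
    have c: "(\<lambda>x. x []) \<in> quenched_law \<eta> e \<rightarrow>\<^sub>M offspring_space"
      unfolding measurable_cong_sets[OF sets_quenched_law[OF e] refl] by (rule measurable_component_singleton) simp
    have "(\<integral>\<^sup>+x. f (e 0) (x []) \<partial>quenched_law \<eta> e) = (\<integral>\<^sup>+y. f (e 0) y \<partial>distr (quenched_law \<eta> e) offspring_space (\<lambda>x. x []))"
      by (rule nn_integral_distr'[OF c fm, symmetric])
    also have "distr (quenched_law \<eta> e) offspring_space (\<lambda>x. x []) = \<eta> (e 0)"
      using distr_quenched_law[OF kernel e', where u = "[]"] by simp
    finally show "(\<integral>\<^sup>+x. f (e 0) (x []) \<partial>quenched_law \<eta> e) = (\<integral>\<^sup>+y. f (e 0) y \<partial>\<eta> (e 0))" .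
  qed
  finally show ?thesis .
qed

lemma ergodic_shift_Q: "ergodic_shift Q \<Theta>"
proof (intro ergodic_shift.intro ergodic_shift_axioms.intro)
  show "prob_space Q" unfolding Q_def by (rule prob_space_distr[OF measurable_environment])
  show "sets Q = sets (seq_space \<Theta>)" by (simp add: Q_def)
  have "distr Q (seq_space \<Theta>) shift_seq = distr M (seq_space \<Theta>) (shift_seq \<circ> environment)"
    unfolding Q_def by (rule distr_distr[OF measurable_shift_seq measurable_environment])
  also have "shift_seq \<circ> environment = (\<lambda>\<omega> n. \<xi> (Suc n) \<omega>)" by (simp add: fun_eq_iff shift_seq_def)
  also have "distr M (seq_space \<Theta>) \<dots> = Q"
    using stationary by (simp add: Q_def stationary_sequence_def)
  finally show "distr Q (seq_space \<Theta>) shift_seq = Q" .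
  fix A assume A: "A \<in> sets Q" and inv: "shift_seq -` A \<inter> space Q = A"
  have A': "A \<in> sets (seq_space \<Theta>)" using A by (simp add: Q_def)
  have shift: "shift_seq = (\<lambda>e n. e (Suc n))" by (simp add: shift_seq_def fun_eq_iff)
  have "(\<lambda>e n. e (Suc n)) -` A \<inter> space (seq_space \<Theta>) = A" using inv unfolding space_Q shift .
  with A' ergodic have "measure M {\<omega>\<in>space M. environment \<omega> \<in> A} \<in> {0, 1}"
    unfolding ergodic_sequence_def by blast
  moreover have "measure Q A = measure M {\<omega>\<in>space M. environment \<omega> \<in> A}"
    unfolding Q_def using A' by (subst measure_distr[OF measurable_environment]) (auto intro!: arg_cong[where f = "measure M"])
  ultimately show "measure Q A \<in> {0, 1}" by simp
qed

lemma AE_Q_iff: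
  assumes "Measurable.pred \<Theta> P"
  shows "(AE e in Q. P (e 0)) \<longleftrightarrow> (AE \<omega> in M. P (\<xi> 0 \<omega>))"
proof -
  have "Measurable.pred (seq_space \<Theta>) (\<lambda>e. P (e 0))"
    by (rule measurable_coordinate_compose[OF assms])
  then have "{e\<in>space (seq_space \<Theta>). P (e 0)} \<in> sets (seq_space \<Theta>)" by (simp add: pred_def)
  from AE_distr_iff[OF measurable_environment this] show ?thesis unfolding Q_def .
qed

lemma nn_integral_Q:
  assumes "f \<in> borel_measurable \<Theta>"
  shows "(\<integral>\<^sup>+e. f (e 0) \<partial>Q) = (\<integral>\<^sup>+\<omega>. f (\<xi> 0 \<omega>) \<partial>M)"
  unfolding Q_def
  by (rule nn_integral_distr'[OF measurable_environment measurable_coordinate_compose[OF assms]])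

lemma ergodic_environment_Q:
  assumes mean: "AE \<omega> in M. 0 < mean_offspring (\<eta> (\<xi> 0 \<omega>)) \<and> mean_offspring (\<eta> (\<xi> 0 \<omega>)) < \<infinity>"
    and log: "integrable M (\<lambda>\<omega>. ln (enn2real (mean_offspring (\<eta> (\<xi> 0 \<omega>)))))"
      "0 < (\<integral>\<omega>. ln (enn2real (mean_offspring (\<eta> (\<xi> 0 \<omega>)))) \<partial>M)"
    and nl: "AE \<omega> in M. non_lattice (displacement_law (\<eta> (\<xi> 0 \<omega>)))"
    and var: "0 < (\<integral>\<^sup>+\<omega>. displacement_variance (\<eta> (\<xi> 0 \<omega>)) \<partial>M)"
      "(\<integral>\<^sup>+\<omega>. displacement_variance (\<eta> (\<xi> 0 \<omega>)) \<partial>M) < \<infinity>"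
    and \<beta>: "\<beta> > 3 / 2"
    and moment: "(\<integral>\<^sup>+\<omega>. ennreal (real (fst (X [] \<omega>)) / enn2real (mean_offspring (\<eta> (\<xi> 0 \<omega>)))
           * log_plus (real (fst (X [] \<omega>))) powr \<beta>) \<partial>M) < \<infinity>"
  shows "ergodic_environment Q \<Theta> \<eta> \<beta>"
proof (intro ergodic_environment.intro ergodic_shift_Q offspring_kernel_axioms ergodic_environment_axioms.intro \<beta>)
  have logm: "(\<lambda>e. ln (enn2real (mean_offspring (\<eta> (e 0))))) \<in> borel_measurable (seq_space \<Theta>)"
    by (rule measurable_coordinate_compose[of "\<lambda>\<theta>. ln (enn2real (mean_offspring (\<eta> \<theta>)))"]) simp
  have mean_pred: "Measurable.pred \<Theta> (\<lambda>\<theta>. 0 < mean_offspring (\<eta> \<theta>) \<and> mean_offspring (\<eta> \<theta>) < \<infinity>)"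
    by measurable
  show "AE e in Q. 0 < mean_offspring (\<eta> (e 0)) \<and> mean_offspring (\<eta> (e 0)) < \<infinity>"
    using mean unfolding AE_Q_iff[OF mean_pred] .
  show "integrable Q (\<lambda>e. ln (enn2real (mean_offspring (\<eta> (e 0)))))"
    unfolding Q_def using log(1) by (subst integrable_distr_eq[OF measurable_environment logm])
  show "0 < (\<integral>e. ln (enn2real (mean_offspring (\<eta> (e 0)))) \<partial>Q)"
    unfolding Q_def using log(2) by (subst integral_distr[OF measurable_environment logm])
  show "0 < (\<integral>\<^sup>+e. displacement_variance (\<eta> (e 0)) \<partial>Q)" "(\<integral>\<^sup>+e. displacement_variance (\<eta> (e 0)) \<partial>Q) < \<infinity>"
    using var unfolding nn_integral_Q[OF measurable_displacement_variance] .
  have m: "(\<lambda>p. ennreal (real (fst (snd p)) / enn2real (mean_offspring (\<eta> (fst p))) * log_plus (real (fst (snd p))) powr \<beta>))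
      \<in> borel_measurable (\<Theta> \<Otimes>\<^sub>M offspring_space)"
    by (rule measurable_log_weight)
  show "(\<integral>\<^sup>+e. \<integral>\<^sup>+y. ennreal (real (fst y) / enn2real (mean_offspring (\<eta> (e 0))) *
      log_plus (real (fst y)) powr \<beta>) \<partial>\<eta> (e 0) \<partial>Q) < \<infinity>"
    using moment nn_integral_root[OF m] by simp
  fix K
  have decay_pred: "Measurable.pred \<Theta> (\<lambda>\<theta>. \<exists>m. \<theta> \<in> decay_set K m)"
    by measurable
  have v: "AE \<omega> in M. displacement_variance (\<eta> (\<xi> 0 \<omega>)) \<noteq> \<infinity>"
    using var(2) by (intro nn_integral_PInf_AE measurable_compose[OF random_variable_environment]) simp_all
  have "AE \<omega> in M. \<exists>m. \<xi> 0 \<omega> \<in> decay_set K m"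
    using mean nl v AE_space
  proof eventually_elim
    case (elim \<omega>)
    show ?case
      by (rule in_decay_set[OF measurable_space[OF random_variable_environment elim(4)] _ _ _ elim(2)])
        (use elim(1,3) in \<open>simp_all add: less_top\<close>)
  qed
  then show "AE e in Q. \<exists>m. e 0 \<in> decay_set K m"
    unfolding AE_Q_iff[OF decay_pred] .
qed

end

theorem theorem10p4:
  fixes M :: "'w measure" and \<Theta> :: "'e measure"
    and \<eta> :: "'e \<Rightarrow> offspring measure"
    and \<xi> :: "nat \<Rightarrow> 'w \<Rightarrow> 'e" and X :: "nat list \<Rightarrow> 'w \<Rightarrow> offspring"
    and \<epsilon> \<beta> h :: real
  assumes "branching_random_walk_random_environment M \<Theta> \<eta> \<xi> X"
    \<comment> \<open>\<open>E log m\<^sub>0 \<in> (0, \<infinity>)\<close>; in particular \<open>m\<^sub>0 \<in> (0, \<infinity>)\<close> a.s.\<close>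
    and "AE \<omega> in M. 0 < mean_offspring (\<eta> (\<xi> 0 \<omega>)) \<and> mean_offspring (\<eta> (\<xi> 0 \<omega>)) < \<infinity>"
    and "integrable M (\<lambda>\<omega>. ln (enn2real (mean_offspring (\<eta> (\<xi> 0 \<omega>)))))"
    and "0 < (\<integral>\<omega>. ln (enn2real (mean_offspring (\<eta> (\<xi> 0 \<omega>)))) \<partial>M)"
    and "(\<integral>\<^sup>+\<omega>. ennreal (real (fst (X [] \<omega>)) / enn2real (mean_offspring (\<eta> (\<xi> 0 \<omega>)))
           * log_plus (real (fst (X [] \<omega>)))) \<partial>M) < \<infinity>"
    and "AE \<omega> in M. non_lattice (displacement_law (\<eta> (\<xi> 0 \<omega>)))"
    and "\<epsilon> > 0"
    and "(\<integral>\<^sup>+\<omega>. ennreal (\<bar>displacement_mean (\<eta> (\<xi> 0 \<omega>))\<bar> powr \<epsilon>) \<partial>M) < \<infinity>"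
    and "0 < (\<integral>\<^sup>+\<omega>. displacement_variance (\<eta> (\<xi> 0 \<omega>)) \<partial>M)"
    and "(\<integral>\<^sup>+\<omega>. displacement_variance (\<eta> (\<xi> 0 \<omega>)) \<partial>M) < \<infinity>"
    and "\<beta> > 3 / 2"
    and "(\<integral>\<^sup>+\<omega>. ennreal (real (fst (X [] \<omega>)) / enn2real (mean_offspring (\<eta> (\<xi> 0 \<omega>)))
           * log_plus (real (fst (X [] \<omega>))) powr \<beta>) \<partial>M) < \<infinity>"
    and "h > 0"
  shows "AE \<omega> in M.
    filterlim (\<lambda>n. num_particles (\<lambda>u. X u \<omega>) n UNIV) at_top sequentially \<longrightarrow>
    (\<lambda>n. SUP x::real.
       \<bar>scaling \<eta> (\<lambda>i. \<xi> i \<omega>) n *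
          (real (num_particles (\<lambda>u. X u \<omega>) n {x<..<x + h}) / real (num_particles (\<lambda>u. X u \<omega>) n UNIV))
        - h * std_normal_density
            ((x - centering \<eta> (\<lambda>i. \<xi> i \<omega>) n) / scaling \<eta> (\<lambda>i. \<xi> i \<omega>) n)\<bar>)
      \<longlonglongrightarrow> 0"
proof -
  interpret B: branching_random_walk_random_environment M \<Theta> \<eta> \<xi> X by (rule assms(1))
  interpret E: ergodic_environment B.Q \<Theta> \<eta> \<beta>
    by (rule B.ergodic_environment_Q[OF assms(2,3,4,6,9,10,11,12)])
  \<comment> \<open>The last use of the law of the tree: from here on a realization
    \<open>\<omega>\<close> is fixed and the argument concerns its finite point
    configurations.\<close>
  have fourier: "AE \<omega> in M. filterlim (\<lambda>n. card (particles (\<lambda>u. X u \<omega>) n)) at_top sequentially \<longrightarrow>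
      (\<forall>K::nat. (\<lambda>n. fourier_error \<eta> (real K) n (\<lambda>i. \<xi> i \<omega>) (\<lambda>u. X u \<omega>)) \<longlonglongrightarrow> 0)"
    using B.AE_annealed[OF B.pred_fourier_convergence] E.fourier_error_AE by simp
  have scaling: "AE \<omega> in M. filterlim (scaling \<eta> (\<lambda>i. \<xi> i \<omega>)) at_top sequentially"
    using AE_distrD[OF B.measurable_environment E.scaling_at_top_AE[unfolded B.Q_def]] .
  from fourier scaling show ?thesis
  proof eventually_elim
    case (elim \<omega>)
    show ?case
    proof
      assume "filterlim (\<lambda>n. num_particles (\<lambda>u. X u \<omega>) n UNIV) at_top sequentially"
      then have top: "filterlim (\<lambda>n. card (particles (\<lambda>u. X u \<omega>) n)) at_top sequentially"
        by (simp add: num_particles_def)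
      interpret P: positions_sequence "\<lambda>n. particles (\<lambda>u. X u \<omega>) n" "\<lambda>n u. position (\<lambda>u. X u \<omega>) u"
        "scaling \<eta> (\<lambda>i. \<xi> i \<omega>)" "centering \<eta> (\<lambda>i. \<xi> i \<omega>)"
      proof (rule positions_sequence.intro)
        show "finite (particles (\<lambda>u. X u \<omega>) n)" for n by (rule finite_particles)
        show "0 \<le> scaling \<eta> (\<lambda>i. \<xi> i \<omega>) n" for n by (simp add: scaling_def sum_nonneg)
        show "filterlim (scaling \<eta> (\<lambda>i. \<xi> i \<omega>)) at_top sequentially" by (rule elim(2))
        fix K :: real
        \<comment> \<open>The Fourier error is monotone in the frequency bound, so the countably
          many integer bounds cover every real one.\<close>
        obtain L :: nat where L: "K \<le> real L" using real_arch_simple by blast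
        have lim: "(\<lambda>n. fourier_error \<eta> (real L) n (\<lambda>i. \<xi> i \<omega>) (\<lambda>u. X u \<omega>)) \<longlonglongrightarrow> 0"
          using elim(1) top by blast
        have le: "fourier_error \<eta> K n (\<lambda>i. \<xi> i \<omega>) (\<lambda>u. X u \<omega>) \<le> fourier_error \<eta> (real L) n (\<lambda>i. \<xi> i \<omega>) (\<lambda>u. X u \<omega>)" for n
          unfolding fourier_error_def
          by (intro mult_left_mono nn_integral_mono) (use L in \<open>auto simp: indicator_def\<close>)
        have "(\<lambda>n. fourier_error \<eta> K n (\<lambda>i. \<xi> i \<omega>) (\<lambda>u. X u \<omega>)) \<longlonglongrightarrow> 0"
          by (rule tendsto_sandwich[OF always_eventually always_eventually tendsto_const lim]) (simp_all add: le)
        then show "(\<lambda>n. ennreal (scaling \<eta> (\<lambda>i. \<xi> i \<omega>) n) * (\<integral>\<^sup>+t. ennreal (cmod (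
            (\<Sum>u\<in>particles (\<lambda>u. X u \<omega>) n. iexp (t * position (\<lambda>u. X u \<omega>) u)) / of_nat (card (particles (\<lambda>u. X u \<omega>) n)) -
            iexp (t * centering \<eta> (\<lambda>i. \<xi> i \<omega>) n) * of_real (exp (- (scaling \<eta> (\<lambda>i. \<xi> i \<omega>) n)\<^sup>2 * t\<^sup>2 / 2)))) *
            indicator {-K..K} t \<partial>lborel)) \<longlonglongrightarrow> 0"
          unfolding fourier_error_def .
      qed
      show "(\<lambda>n. SUP x::real.
          \<bar>scaling \<eta> (\<lambda>i. \<xi> i \<omega>) n *
            (real (num_particles (\<lambda>u. X u \<omega>) n {x<..<x + h}) / real (num_particles (\<lambda>u. X u \<omega>) n UNIV))
          - h * std_normal_density
            ((x - centering \<eta> (\<lambda>i. \<xi> i \<omega>) n) / scaling \<eta> (\<lambda>i. \<xi> i \<omega>) n)\<bar>)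
        \<longlonglongrightarrow> 0"
        using P.interval_limit[OF assms(13)] unfolding num_particles_def by simp
    qed
  qed
qed

end
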